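(* Let $\Omega\subset\mathbb R^n$ be a bounded domain with $C^{m+2,\alpha}$ boundary, $m\in\mathbb N_0$, $0<\alpha<1$, and let $a_1,a_2\in C^{2m+1,\alpha}(\overline\Omega\times\mathbb R\times\mathbb R^n)$ be positive. Let $\phi\in C^{m+2,\alpha}(\partial\Omega)$ and let $\Phi\in C^{m+2,\alpha}(\overline\Omega)$ be strictly convex, with $D^2\Phi\ge c_0I_n$ in $\overline\Omega$ for some $c_0>0$, and such that for both $j=1,2$ $$\det D^2\Phi=a_j(x,\Phi,\nabla\Phi)\ \text{ in }\Omega,\qquad\Phi=\phi\ \text{ on }\partial\Omega.$$ Assume $a_1(x,\phi,\nabla\Phi)=a_2(x,\phi,\nabla\Phi)$ for all $x\in\partial\Omega$. Let $$L^j_\Phi v=\operatorname{div}(\mathcal C_\Phi\nabla v)-b^j_\Phi\cdot\nabla v-q^j_\Phi v,\qquad j=1,2,$$ where $\mathcal C_\Phi=\operatorname{cof}D^2\Phi$, $b^j_\Phi=\nabla_pa_j(x,\Phi,\nabla\Phi)$, $q^j_\Phi=\partial_za_j(x,\Phi,\nabla\Phi)$, and assume $q^j_\Phi\ge0$. Assume that the fixed-principal-part linear inverse problem is uniquely solvable for the lower-order coefficients in the following sense: if $$\int_\Omega(b^1_\Phi-b^2_\Phi)\cdot\nabla v\,w\,dx+\int_\Omega(q^1_\Phi-q^2_\Phi)vw\,dx=0$$ for all weak solutions $v,w\in H^1(\Omega)$ of $L^1_\Phi v=0$ and $(L^2_\Phi)^*w=0$ in $\Omega$, then $b^1_\Phi=b^2_\Phi$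 and $q^1_\Phi=q^2_\Phi$ in $\Omega$. If $$\mathscr C_{a_1}^{(\phi,\partial_\nu\Phi|_{\partial\Omega})}=\mathscr C_{a_2}^{(\phi,\partial_\nu\Phi|_{\partial\Omega})},$$ then $$\nabla_pa_1(x,\Phi,\nabla\Phi)=\nabla_pa_2(x,\Phi,\nabla\Phi)\quad\text{and}\quad\partial_za_1(x,\Phi,\nabla\Phi)=\partial_za_2(x,\Phi,\nabla\Phi)\quad\text{in }\Omega.$$
   Context: Nonlinearities are written $a=a(x,z,p)$, $x\in\overline\Omega$, $z\in\mathbb R$, $p\in\mathbb R^n$. $\operatorname{cof}D^2\Phi$ is the cofactor matrix of the Hessian. $C^{k,\alpha}(\overline\Omega)$ is the usual Hölder space (norms required finite on unbounded sets); $C^{k,\alpha}(\partial\Omega)$ carries the quotient norm over extensions. $\nu$ is the exterior unit normal and $\partial_\nu$ the normal derivative. Dropping indices, $v\in H^1(\Omega)$ is a weak solution of $Lv=0$ if $\int_\Omega(\mathcal C\nabla v\cdot\nabla\chi+b\cdot\nabla v\,\chi+qv\chi)\,dx=0$ for all $\chi\in H^1_0(\Omega)$; $L^*$ is the $L^2$-adjoint, and $w\in H^1(\Omega)$ is a weak solution of $L^*w=0$ if $\int_\Omega(\mathcal C\nabla w\cdot\nabla\chi+w\,b\cdot\nabla\chi+qw\chi)\,dx=0$ for all $\chi\in H^1_0(\Omega)$. Nonlinear Cauchy data set: for $a=a_j$, local well-posedness provides $\delta>0$ and a neighbourhood $V$ of $\Phi$ in $C^{m+2,\alpha}(\overline\Omega)$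 such that for every $\eta\in C^{m+2,\alpha}(\partial\Omega)$ with $\|\eta-\phi\|_{C^{m+2,\alpha}(\partial\Omega)}<\delta$ the problem $\det D^2u=a(x,u,\nabla u)$ in $\Omega$, $u=\eta$ on $\partial\Omega$ has a unique solution $u_\eta\in V$, and $\mathcal S:\eta\mapsto u_\eta$ is of class $C^{m+1}$ (Fréchet) near $\phi$ with $\mathcal S(\phi)=\Phi$. Then $$\mathscr C_a^{(\phi,\partial_\nu\Phi|_{\partial\Omega})}=\{(\eta,\partial_\nu u_\eta|_{\partial\Omega}):\ \|\eta-\phi\|_{C^{m+2,\alpha}(\partial\Omega)}<\delta\}\subset C^{m+2,\alpha}(\partial\Omega)\times C^{m+1,\alpha}(\partial\Omega).$$ *)

theory Defs
  imports "HOL-Analysis.Analysis"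
begin

section \<open>Classical derivatives and Hoelder spaces\<close>

text \<open>
  The list \<open>bs\<close> of basis vectors plays the role of a multi-index; on \<open>C\<^sup>k\<close> functions the order of
  differentiation is immaterial.
\<close>

primrec pderivs :: "'a::euclidean_space list \<Rightarrow> ('a \<Rightarrow> real) \<Rightarrow> 'a \<Rightarrow> real" where
  "pderivs [] f = f"
| "pderivs (b # bs) f = (\<lambda>x. frechet_derivative (pderivs bs f) (at x) b)"

definition multi_indices :: "nat \<Rightarrow> 'a::euclidean_space list set" where
  "multi_indices j = {bs. set bs \<subseteq> Basis \<and> length bs = j}"

definition Ck_on :: "nat \<Rightarrow> 'a::euclidean_space set \<Rightarrow> ('a \<Rightarrow> real) \<Rightarrow> bool" where
  "Ck_on k U f \<longleftrightarrow>
     (\<forall>j<k. \<forall>bs\<in>multi_indices j. \<forall>x\<in>U. pderivs bs f differentiable (at x)) \<and>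
     (\<forall>j\<le>k. \<forall>bs\<in>multi_indices j. continuous_on U (pderivs bs f))"

text \<open>
  \<open>holder_space k \<alpha> U\<close> is \<open>C\<^sup>k\<^sup>,\<^sup>\<alpha>\<close> of the closure of the open set \<open>U\<close>: only the values of \<open>f\<close> on
  \<open>closure U\<close> matter, the derivatives of order at most \<open>k\<close> extend continuously to the closure and
  are bounded on \<open>U\<close>, and those of order \<open>k\<close> are uniformly \<open>\<alpha>\<close>-Hoelder on \<open>U\<close>.
\<close>

definition holder_space :: "nat \<Rightarrow> real \<Rightarrow> 'a::euclidean_space set \<Rightarrow> ('a \<Rightarrow> real) set" where
  "holder_space k \<alpha> U = {f.
     Ck_on k U f \<and>
     continuous_on (closure U) f \<and>
     (\<forall>j\<le>k. \<forall>bs\<in>multi_indices j.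
        (\<exists>g. continuous_on (closure U) g \<and> (\<forall>x\<in>U. g x = pderivs bs f x)) \<and>
        (\<exists>K. \<forall>x\<in>U. \<bar>pderivs bs f x\<bar> \<le> K)) \<and>
     (\<forall>bs\<in>multi_indices k. \<exists>K. \<forall>x\<in>U. \<forall>y\<in>U.
        \<bar>pderivs bs f x - pderivs bs f y\<bar> \<le> K * norm (x - y) powr \<alpha>)}"

definition holder_norm :: "nat \<Rightarrow> real \<Rightarrow> 'a::euclidean_space set \<Rightarrow> ('a \<Rightarrow> real) \<Rightarrow> real" where
  "holder_norm k \<alpha> U f =
     (\<Sum>j\<le>k. Sup {\<bar>pderivs bs f x\<bar> | bs x. bs \<in> multi_indices j \<and> x \<in> U}) +
     Sup {\<bar>pderivs bs f x - pderivs bs f y\<bar> / norm (x - y) powr \<alpha> | bs x y.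
            bs \<in> multi_indices k \<and> x \<in> U \<and> y \<in> U \<and> x \<noteq> y}"

text \<open>
  Functions on the boundary are represented by functions on the whole space of which only the
  values on \<open>frontier U\<close> are relevant.
\<close>

definition bdry_holder_space :: "nat \<Rightarrow> real \<Rightarrow> 'a::euclidean_space set \<Rightarrow> ('a \<Rightarrow> real) set" where
  "bdry_holder_space k \<alpha> U = {\<eta>. \<exists>f\<in>holder_space k \<alpha> U. \<forall>x\<in>frontier U. f x = \<eta> x}"

definition bdry_holder_norm :: "nat \<Rightarrow> real \<Rightarrow> 'a::euclidean_space set \<Rightarrow> ('a \<Rightarrow> real) \<Rightarrow> real" where
  "bdry_holder_norm k \<alpha> U \<eta> =
     Inf {holder_norm k \<alpha> U f | f. f \<in> holder_space k \<alpha> U \<and> (\<forall>x\<in>frontier U. f x = \<eta> x)}"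

definition grad :: "(real ^ 'n \<Rightarrow> real) \<Rightarrow> real ^ 'n \<Rightarrow> real ^ 'n" where
  "grad f x = (\<chi> i. pderivs [axis i 1] f x)"

definition hess :: "(real ^ 'n \<Rightarrow> real) \<Rightarrow> real ^ 'n \<Rightarrow> real ^ 'n ^ 'n" where
  "hess f x = (\<chi> i j. pderivs [axis i 1, axis j 1] f x)"

text \<open>The \<open>(i, j)\<close> cofactor is the determinant after replacing row \<open>i\<close> by the \<open>j\<close>-th unit vector.\<close>

definition cof :: "real ^ 'n ^ 'n \<Rightarrow> real ^ 'n ^ 'n" where
  "cof A = (\<chi> i j. det (\<chi> k. if k = i then axis j 1 else A $ k))"

text \<open>Extension by continuity from the open set \<open>\<Omega>\<close> to its closure.\<close>

definition cl_ext :: "'a::topological_space set \<Rightarrow> ('a \<Rightarrow> 'b::t2_space) \<Rightarrow> 'a \<Rightarrow> 'b" where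
  "cl_ext \<Omega> g x = (if x \<in> \<Omega> then g x else Lim (at x within \<Omega>) g)"

text \<open>\<open>\<Omega>\<close> need not be convex, so convexity is tested on the segments contained in \<open>\<Omega>\<close>.\<close>

definition strictly_convex_in :: "'a::real_normed_vector set \<Rightarrow> ('a \<Rightarrow> real) \<Rightarrow> bool" where
  "strictly_convex_in \<Omega> f \<longleftrightarrow>
     (\<forall>x y. x \<noteq> y \<longrightarrow> closed_segment x y \<subseteq> \<Omega> \<longrightarrow>
       (\<forall>t\<in>{0<..<1}. f ((1 - t) *\<^sub>R x + t *\<^sub>R y) < (1 - t) * f x + t * f y))"


section \<open>Domains and normal derivatives\<close>

text \<open>
  Near \<open>x0\<close>, \<open>\<Omega>\<close> lies strictly above the graph, in the direction \<open>e\<close>, of a function \<open>\<gamma>\<close> of the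
  variables orthogonal to \<open>e\<close>.
\<close>

definition graph_chart ::
  "'a::euclidean_space set \<Rightarrow> 'a \<Rightarrow> real \<Rightarrow> 'a \<Rightarrow> ('a \<Rightarrow> real) \<Rightarrow> bool" where
  "graph_chart \<Omega> x0 r e \<gamma> \<longleftrightarrow>
     0 < r \<and> norm e = 1 \<and> (\<forall>x t. \<gamma> (x + t *\<^sub>R e) = \<gamma> x) \<and>
     \<Omega> \<inter> ball x0 r = {x \<in> ball x0 r. \<gamma> x < x \<bullet> e}"

definition bounded_holder_domain :: "nat \<Rightarrow> real \<Rightarrow> 'a::euclidean_space set \<Rightarrow> bool" where
  "bounded_holder_domain k \<alpha> \<Omega> \<longleftrightarrow>
     open \<Omega> \<and> connected \<Omega> \<and> \<Omega> \<noteq> {} \<and> bounded \<Omega> \<and>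
     (\<forall>x0\<in>frontier \<Omega>. \<exists>r e \<gamma>. graph_chart \<Omega> x0 r e \<gamma> \<and> \<gamma> \<in> holder_space k \<alpha> (ball x0 r))"

text \<open>
  Locally \<open>\<Omega>\<close> is the set where \<open>\<gamma> x - x \<bullet> e < 0\<close>, so the normalised gradient of this function points
  outwards; it does not depend on the chart.
\<close>

definition unit_normal :: "(real ^ 'n) set \<Rightarrow> real ^ 'n \<Rightarrow> real ^ 'n" where
  "unit_normal \<Omega> x = (THE \<nu>. \<exists>r e \<gamma>. graph_chart \<Omega> x r e \<gamma> \<and> \<gamma> differentiable (at x) \<and>
     \<nu> = (grad \<gamma> x - e) /\<^sub>R norm (grad \<gamma> x - e))"

definition normal_deriv :: "(real ^ 'n) set \<Rightarrow> (real ^ 'n \<Rightarrow> real) \<Rightarrow> real ^ 'n \<Rightarrow> real" where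
  "normal_deriv \<Omega> u x = cl_ext \<Omega> (grad u) x \<bullet> unit_normal \<Omega> x"


section \<open>Sobolev spaces and weak solutions\<close>

definition test_functions :: "(real ^ 'n) set \<Rightarrow> (real ^ 'n \<Rightarrow> real) set" where
  "test_functions \<Omega> = {\<psi>. (\<forall>k. Ck_on k UNIV \<psi>) \<and>
     compact (closure {x. \<psi> x \<noteq> 0}) \<and> closure {x. \<psi> x \<noteq> 0} \<subseteq> \<Omega>}"

definition L2_on :: "(real ^ 'n) set \<Rightarrow> (real ^ 'n \<Rightarrow> 'b::real_normed_vector) \<Rightarrow> bool" where
  "L2_on \<Omega> v \<longleftrightarrow> v \<in> borel_measurable (lebesgue_on \<Omega>) \<and>
     integrable (lebesgue_on \<Omega>) (\<lambda>x. (norm (v x))\<^sup>2)"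

definition is_weak_grad ::
  "(real ^ 'n) set \<Rightarrow> (real ^ 'n \<Rightarrow> real) \<Rightarrow> (real ^ 'n \<Rightarrow> real ^ 'n) \<Rightarrow> bool" where
  "is_weak_grad \<Omega> v G \<longleftrightarrow> L2_on \<Omega> G \<and>
     (\<forall>\<psi>\<in>test_functions \<Omega>. \<forall>i.
        (LINT x|lebesgue_on \<Omega>. v x * grad \<psi> x $ i) = - (LINT x|lebesgue_on \<Omega>. G x $ i * \<psi> x))"

definition H1 :: "(real ^ 'n) set \<Rightarrow> (real ^ 'n \<Rightarrow> real) set" where
  "H1 \<Omega> = {v. L2_on \<Omega> v \<and> (\<exists>G. is_weak_grad \<Omega> v G)}"

text \<open>Weak gradients are unique up to null sets, so integrals do not depend on the choice.\<close>

definition wgrad :: "(real ^ 'n) set \<Rightarrow> (real ^ 'n \<Rightarrow> real) \<Rightarrow> real ^ 'n \<Rightarrow> real ^ 'n" where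
  "wgrad \<Omega> v = (SOME G. is_weak_grad \<Omega> v G)"

definition H1_norm :: "(real ^ 'n) set \<Rightarrow> (real ^ 'n \<Rightarrow> real) \<Rightarrow> real" where
  "H1_norm \<Omega> v = sqrt ((LINT x|lebesgue_on \<Omega>. (v x)\<^sup>2) +
                       (LINT x|lebesgue_on \<Omega>. (norm (wgrad \<Omega> v x))\<^sup>2))"

definition H10 :: "(real ^ 'n) set \<Rightarrow> (real ^ 'n \<Rightarrow> real) set" where
  "H10 \<Omega> = {\<theta> \<in> H1 \<Omega>. \<exists>\<psi>. (\<forall>k::nat. \<psi> k \<in> test_functions \<Omega>) \<and>
     (\<lambda>k. H1_norm \<Omega> (\<lambda>x. \<theta> x - \<psi> k x)) \<longlonglongrightarrow> 0}"

text \<open>Weak \<open>H\<^sup>1\<close> solutions of \<open>Lv = div (C \<nabla>v) - b \<cdot> \<nabla>v - q v = 0\<close> and of the adjoint equation.\<close>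

definition weak_solution ::
  "(real ^ 'n) set \<Rightarrow> (real ^ 'n \<Rightarrow> real ^ 'n ^ 'n) \<Rightarrow> (real ^ 'n \<Rightarrow> real ^ 'n) \<Rightarrow> (real ^ 'n \<Rightarrow> real)
    \<Rightarrow> (real ^ 'n \<Rightarrow> real) \<Rightarrow> bool" where
  "weak_solution \<Omega> C b q v \<longleftrightarrow> v \<in> H1 \<Omega> \<and>
     (\<forall>\<theta>\<in>H10 \<Omega>. (LINT x|lebesgue_on \<Omega>.
        (C x *v wgrad \<Omega> v x) \<bullet> wgrad \<Omega> \<theta> x + (b x \<bullet> wgrad \<Omega> v x) * \<theta> x + q x * v x * \<theta> x) = 0)"

definition adjoint_weak_solution ::
  "(real ^ 'n) set \<Rightarrow> (real ^ 'n \<Rightarrow> real ^ 'n ^ 'n) \<Rightarrow> (real ^ 'n \<Rightarrow> real ^ 'n) \<Rightarrow> (real ^ 'n \<Rightarrow> real)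
    \<Rightarrow> (real ^ 'n \<Rightarrow> real) \<Rightarrow> bool" where
  "adjoint_weak_solution \<Omega> C b q w \<longleftrightarrow> w \<in> H1 \<Omega> \<and>
     (\<forall>\<theta>\<in>H10 \<Omega>. (LINT x|lebesgue_on \<Omega>.
        (C x *v wgrad \<Omega> w x) \<bullet> wgrad \<Omega> \<theta> x + w x * (b x \<bullet> wgrad \<Omega> \<theta> x) + q x * w x * \<theta> x) = 0)"


section \<open>Maps of class \<open>C\<^sup>k\<close> between normed spaces of functions\<close>

text \<open>
  The spaces are given by a carrier and a norm. Elements are function representatives, and two
  representatives at distance \<open>0\<close> stand for the same element, which is why multilinearity is
  stated with norms.
\<close>

definition bounded_multilinear ::
  "('p \<Rightarrow> real) set \<Rightarrow> (('p \<Rightarrow> real) \<Rightarrow> real) \<Rightarrow> ('q \<Rightarrow> real) set \<Rightarrow> (('q \<Rightarrow> real) \<Rightarrow> real)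
    \<Rightarrow> nat \<Rightarrow> (('p \<Rightarrow> real) list \<Rightarrow> 'q \<Rightarrow> real) \<Rightarrow> bool" where
  "bounded_multilinear X NX Y NY j T \<longleftrightarrow>
     (\<forall>hs. set hs \<subseteq> X \<and> length hs = j \<longrightarrow> T hs \<in> Y) \<and>
     (\<forall>hs. set hs \<subseteq> X \<and> length hs = j \<longrightarrow>
        (\<forall>i<j. \<forall>h\<in>X. \<forall>h'\<in>X. \<forall>c.
          NY (\<lambda>y. T (hs[i := (\<lambda>x. c * h x + h' x)]) y
                   - (c * T (hs[i := h]) y + T (hs[i := h']) y)) = 0)) \<and>
     (\<exists>K. \<forall>hs. set hs \<subseteq> X \<and> length hs = j \<longrightarrow> NY (T hs) \<le> K * (\<Prod>h\<leftarrow>hs. NX h))"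

text \<open>
  \<open>D j \<eta>\<close> is the \<open>j\<close>-th Frechet derivative at \<open>\<eta>\<close>, as a \<open>j\<close>-linear map; \<open>B\<close> is an open subset of \<open>X\<close>.
  Differentiability of \<open>D j\<close> and continuity of \<open>D k\<close> refer to the operator norm of multilinear maps.
\<close>

definition frechet_Ck_on ::
  "('p \<Rightarrow> real) set \<Rightarrow> (('p \<Rightarrow> real) \<Rightarrow> real) \<Rightarrow> ('q \<Rightarrow> real) set \<Rightarrow> (('q \<Rightarrow> real) \<Rightarrow> real)
    \<Rightarrow> nat \<Rightarrow> ('p \<Rightarrow> real) set \<Rightarrow> (('p \<Rightarrow> real) \<Rightarrow> ('q \<Rightarrow> real)) \<Rightarrow> bool" where
  "frechet_Ck_on X NX Y NY k B S \<longleftrightarrow>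
     (\<exists>D :: nat \<Rightarrow> ('p \<Rightarrow> real) \<Rightarrow> ('p \<Rightarrow> real) list \<Rightarrow> 'q \<Rightarrow> real.
        (\<forall>\<eta>\<in>B. D 0 \<eta> [] = S \<eta>) \<and>
        (\<forall>j\<le>k. \<forall>\<eta>\<in>B. bounded_multilinear X NX Y NY j (D j \<eta>)) \<and>
        (\<forall>j<k. \<forall>\<eta>\<in>B. \<forall>\<epsilon>>0. \<exists>r>0. \<forall>h\<in>X. NX h < r \<and> (\<lambda>x. \<eta> x + h x) \<in> B \<longrightarrow>
           (\<forall>hs. set hs \<subseteq> X \<and> length hs = j \<longrightarrow>
              NY (\<lambda>y. D j (\<lambda>x. \<eta> x + h x) hs y - D j \<eta> hs y - D (Suc j) \<eta> (h # hs) y)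
                \<le> \<epsilon> * NX h * (\<Prod>h'\<leftarrow>hs. NX h'))) \<and>
        (\<forall>\<eta>\<in>B. \<forall>\<epsilon>>0. \<exists>r>0. \<forall>\<zeta>\<in>B. NX (\<lambda>x. \<zeta> x - \<eta> x) < r \<longrightarrow>
           (\<forall>hs. set hs \<subseteq> X \<and> length hs = k \<longrightarrow>
              NY (\<lambda>y. D k \<zeta> hs y - D k \<eta> hs y) \<le> \<epsilon> * (\<Prod>h'\<leftarrow>hs. NX h'))))"


section \<open>The nonlinear problem and its Cauchy data\<close>

text \<open>The nonlinearity \<open>a\<close> takes the triple \<open>(x, z, p)\<close>.\<close>

definition dz :: "((real ^ 'n) \<times> real \<times> (real ^ 'n) \<Rightarrow> real) \<Rightarrow> real ^ 'n \<Rightarrow> real \<Rightarrow> real ^ 'n \<Rightarrow> real" where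
  "dz a x z p = deriv (\<lambda>s. a (x, s, p)) z"

definition dp ::
  "((real ^ 'n) \<times> real \<times> (real ^ 'n) \<Rightarrow> real) \<Rightarrow> real ^ 'n \<Rightarrow> real \<Rightarrow> real ^ 'n \<Rightarrow> real ^ 'n" where
  "dp a x z p = grad (\<lambda>p'. a (x, z, p')) p"

text \<open>Coefficients of the linearised operator \<open>div (C \<nabla>v) - b \<cdot> \<nabla>v - q v\<close> at \<open>\<Phi>\<close>.\<close>

definition lin_C :: "(real ^ 'n \<Rightarrow> real) \<Rightarrow> real ^ 'n \<Rightarrow> real ^ 'n ^ 'n" where
  "lin_C \<Phi> x = cof (hess \<Phi> x)"

definition lin_b ::
  "((real ^ 'n) \<times> real \<times> (real ^ 'n) \<Rightarrow> real) \<Rightarrow> (real ^ 'n \<Rightarrow> real) \<Rightarrow> real ^ 'n \<Rightarrow> real ^ 'n" where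
  "lin_b a \<Phi> x = dp a x (\<Phi> x) (grad \<Phi> x)"

definition lin_q ::
  "((real ^ 'n) \<times> real \<times> (real ^ 'n) \<Rightarrow> real) \<Rightarrow> (real ^ 'n \<Rightarrow> real) \<Rightarrow> real ^ 'n \<Rightarrow> real" where
  "lin_q a \<Phi> x = dz a x (\<Phi> x) (grad \<Phi> x)"

definition MA_solution ::
  "(real ^ 'n) set \<Rightarrow> ((real ^ 'n) \<times> real \<times> (real ^ 'n) \<Rightarrow> real) \<Rightarrow> (real ^ 'n \<Rightarrow> real)
    \<Rightarrow> (real ^ 'n \<Rightarrow> real) \<Rightarrow> bool" where
  "MA_solution \<Omega> a \<eta> u \<longleftrightarrow>
     (\<forall>x\<in>\<Omega>. det (hess u x) = a (x, u x, grad u x)) \<and> (\<forall>x\<in>frontier \<Omega>. u x = \<eta> x)"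

definition bdry_ball ::
  "nat \<Rightarrow> real \<Rightarrow> (real ^ 'n) set \<Rightarrow> (real ^ 'n \<Rightarrow> real) \<Rightarrow> real \<Rightarrow> (real ^ 'n \<Rightarrow> real) set" where
  "bdry_ball k \<alpha> \<Omega> \<phi> \<delta> =
     {\<eta> \<in> bdry_holder_space k \<alpha> \<Omega>. bdry_holder_norm k \<alpha> \<Omega> (\<lambda>x. \<eta> x - \<phi> x) < \<delta>}"

text \<open>
  The solution of the Dirichlet problem lying in \<open>V\<close>; under \<open>local_well_posedness\<close> below its values on
  \<open>closure \<Omega>\<close> are determined.
\<close>

definition solution_map ::
  "(real ^ 'n) set \<Rightarrow> ((real ^ 'n) \<times> real \<times> (real ^ 'n) \<Rightarrow> real) \<Rightarrow> (real ^ 'n \<Rightarrow> real) set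
    \<Rightarrow> (real ^ 'n \<Rightarrow> real) \<Rightarrow> real ^ 'n \<Rightarrow> real" where
  "solution_map \<Omega> a V \<eta> = (SOME u. u \<in> V \<and> MA_solution \<Omega> a \<eta> u)"

definition local_well_posedness ::
  "(real ^ 'n) set \<Rightarrow> nat \<Rightarrow> real \<Rightarrow> ((real ^ 'n) \<times> real \<times> (real ^ 'n) \<Rightarrow> real)
    \<Rightarrow> (real ^ 'n \<Rightarrow> real) \<Rightarrow> (real ^ 'n \<Rightarrow> real) \<Rightarrow> real \<Rightarrow> (real ^ 'n \<Rightarrow> real) set \<Rightarrow> bool" where
  "local_well_posedness \<Omega> m \<alpha> a \<phi> \<Phi> \<delta> V \<longleftrightarrow>
     0 < \<delta> \<and>
     V \<subseteq> holder_space (m + 2) \<alpha> \<Omega> \<and>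
     (\<exists>r>0. \<forall>u\<in>holder_space (m + 2) \<alpha> \<Omega>.
        holder_norm (m + 2) \<alpha> \<Omega> (\<lambda>x. u x - \<Phi> x) < r \<longrightarrow> u \<in> V) \<and>
     (\<forall>\<eta>\<in>bdry_ball (m + 2) \<alpha> \<Omega> \<phi> \<delta>.
        \<exists>u\<in>V. MA_solution \<Omega> a \<eta> u \<and>
          (\<forall>w\<in>V. MA_solution \<Omega> a \<eta> w \<longrightarrow> (\<forall>x\<in>closure \<Omega>. w x = u x))) \<and>
     (\<exists>\<rho>>0. \<rho> \<le> \<delta> \<and>
        frechet_Ck_on
          (bdry_holder_space (m + 2) \<alpha> \<Omega>) (bdry_holder_norm (m + 2) \<alpha> \<Omega>)
          (holder_space (m + 2) \<alpha> \<Omega>) (holder_norm (m + 2) \<alpha> \<Omega>)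
          (m + 1) (bdry_ball (m + 2) \<alpha> \<Omega> \<phi> \<rho>) (solution_map \<Omega> a V)) \<and>
     (\<forall>x\<in>closure \<Omega>. solution_map \<Omega> a V \<phi> x = \<Phi> x)"

text \<open>Pairs of functions on \<open>frontier \<Omega>\<close>, normalised by \<open>restrict\<close> so that equality is equality there.\<close>

definition cauchy_data ::
  "(real ^ 'n) set \<Rightarrow> nat \<Rightarrow> real \<Rightarrow> ((real ^ 'n) \<times> real \<times> (real ^ 'n) \<Rightarrow> real)
    \<Rightarrow> (real ^ 'n \<Rightarrow> real) \<Rightarrow> real \<Rightarrow> (real ^ 'n \<Rightarrow> real) set
    \<Rightarrow> ((real ^ 'n \<Rightarrow> real) \<times> (real ^ 'n \<Rightarrow> real)) set" where
  "cauchy_data \<Omega> m \<alpha> a \<phi> \<delta> V =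
     {(restrict \<eta> (frontier \<Omega>), restrict (normal_deriv \<Omega> (solution_map \<Omega> a V \<eta>)) (frontier \<Omega>)) | \<eta>.
        \<eta> \<in> bdry_ball (m + 2) \<alpha> \<Omega> \<phi> \<delta>}"

end

theory Submission
  imports Defs "HOL-Computational_Algebra.Polynomial"
begin

text \<open>
  Differentiating the solution map along \<open>\<phi> + t F\<close> gives, for every smooth \<open>F\<close>, solutions \<open>v\<^sub>1, v\<^sub>2\<close> of the two
  linearised equations with boundary values \<open>F\<close>; equality of the Cauchy data gives them the same normal derivative.
  The Hessian of \<open>\<Phi>\<close> has a cofactor matrix with divergence free rows, so the difference \<open>v\<^sub>1 - v\<^sub>2\<close>, whose Cauchy data
  vanish, may be tested against an arbitrary \<open>H\<^sup>1\<close> function without boundary terms. Testing it with an adjoint solution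
  \<open>w\<close> of the second equation yields the integral identity of the hypothesis for the pair \<open>v\<^sub>1, w\<close>.

  It extends to all weak solutions \<open>v\<close> because the classical ones are dense: take \<open>F\<close> smooth and close to \<open>v\<close> in \<open>H\<^sup>1\<close>;
  then \<open>v\<^sub>1 - F\<close> vanishes on the boundary and almost solves the same problem as \<open>v - F\<close>. This requires the stability of
  the Dirichlet problem in \<open>H\<^sup>1\<^sub>0\<close>, which is not coercive because of the drift \<open>b\<close>. An \<open>L\<^sup>1\<close> bound for the adjoint problem
  (from the sign of \<open>q\<close> and an exponential supersolution), an interpolation inequality between \<open>L\<^sup>1\<close> and \<open>H\<^sup>1\<close>, and the
  method of continuity replace the Fredholm alternative.
\<close>

section \<open>Functions of class $C^k$\<close>

text \<open>Stability is wanted for the first argument of the bilinear form, the unknown of the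
  equation with drift. The sign of \<open>q\<close> acts most directly on the second argument, the
  adjoint unknown: the supersolution times a regularised sign of that unknown is an admissible test
  function and yields an \<open>L1\<close> bound. Duality carries the bound back to the first
  argument, and this is what solvability is needed for. Solvability up to a small residual is
  enough, so one can stay in the incomplete space of \<open>C^1\<close> functions with compact
  support. The deformation adds \<tau> times the mass form, with \<tau> between the Garding constant
  \<open>sig\<close> and 0. Along it the zeroth order coefficient \<open>q + \<tau>\<close> stays
  nonnegative, so one supersolution serves every \<tau> and the a priori constant \<open>K4\<close>
  is uniform, as the method of continuity requires. The other constraint is regularity: for
  \<open>m = 0\<close> the cofactor matrix of the Hessian of \<Phi> is only Hoelder continuous and
  has no classical divergence. That its rows are divergence free is therefore used in integrated
  form, proved for smooth functions and carried over to \<Phi> by mollification.\<close>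

lemma frechet_derivative_cong_open:
 assumes "open U" "x \<in> U" "!!y. y \<in> U ==> f y = g y"
 shows "frechet_derivative f (at x) = frechet_derivative g (at x)"
proof -
 \<comment> \<open>\<open>frechet_derivative\<close> chooses from the set of derivatives, so
   equality of these sets suffices, also where they are empty.\<close>
 have "(f has_derivative f') (at x) \<longleftrightarrow> (g has_derivative f') (at x)" for f'
  using assms has_derivative_transform_within_open[of f f' x UNIV U g]
   has_derivative_transform_within_open[of g f' x UNIV U f] by auto
 then show ?thesis by (simp add: frechet_derivative_def)
qed

lemma pderivs_cong:
 assumes "open U" "!!y. y \<in> U ==> f y = g y"
 shows "x \<in> U ==> pderivs bs f x = pderivs bs g x"
proof (induction bs arbitrary: x)
 case (Cons b bs)
 then show ?case
  using frechet_derivative_cong_open[OF assms(1), of x "pderivs bs f" "pderivs bs g"] by simp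
qed (use assms in auto)

lemma pderivs_snoc: "pderivs (bs @ [b]) f = pderivs bs (pderivs [b] f)"
 by (induction bs) auto

lemma multi_indices_0 [simp]: "multi_indices 0 = {[]}"
 by (auto simp: multi_indices_def)

lemma multi_indices_Suc:
 "bs \<in> multi_indices (Suc j) \<longleftrightarrow> (\<exists>b cs. b \<in> Basis \<and> cs \<in> multi_indices j \<and> bs = b # cs)"
 by (cases bs) (auto simp: multi_indices_def)

lemma multi_indices_Suc_snoc:
 "bs \<in> multi_indices (Suc j) \<longleftrightarrow> (\<exists>b cs. b \<in> Basis \<and> cs \<in> multi_indices j \<and> bs = cs @ [b])"
 by (cases bs rule: rev_cases) (auto simp: multi_indices_def)

lemma Ck_on_0 [simp]: "Ck_on 0 U f \<longleftrightarrow> continuous_on U f"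
 by (simp add: Ck_on_def)

text \<open>\<open>pderivs\<close> applies the last list element first, so splitting a multi-index
  at its end makes \<open>pderivs [b] f\<close> the new function. The closure properties below
  thereby become inductions on \<open>k\<close> over arbitrary functions.\<close>

lemma Ck_on_Suc:
 fixes f :: "'a::euclidean_space => real"
 shows "Ck_on (Suc k) U f \<longleftrightarrow> (\<forall>x\<in>U. f differentiable at x) \<and> (\<forall>b\<in>Basis. Ck_on k U (pderivs [b] f))"
 (is "?L \<longleftrightarrow> ?R")
proof
 assume L: ?L
 show ?R
  unfolding Ck_on_def
 proof (intro conjI ballI allI impI)
  show "f differentiable at x" if "x \<in> U" for x
   using L that unfolding Ck_on_def by (metis multi_indices_0 pderivs.simps(1) singletonI zero_less_Suc)
 next
  fix b :: 'a and j and bs :: "'a list" and x assume "b \<in> Basis" "j < k" "bs \<in> multi_indices j" "x \<in> U"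
  then have "bs @ [b] \<in> multi_indices (Suc j)" "Suc j < Suc k"
   by (auto simp: multi_indices_Suc_snoc)
  then show "pderivs bs (pderivs [b] f) differentiable at x"
   using L \<open>x \<in> U\<close> unfolding Ck_on_def pderivs_snoc[symmetric] by blast
 next
  fix b :: 'a and j and bs :: "'a list" assume "b \<in> Basis" "j <= k" "bs \<in> multi_indices j"
  then have "bs @ [b] \<in> multi_indices (Suc j)" "Suc j <= Suc k"
   by (auto simp: multi_indices_Suc_snoc)
  then show "continuous_on U (pderivs bs (pderivs [b] f))"
   using L unfolding Ck_on_def pderivs_snoc[symmetric] by blast
 qed
next
 assume R: ?R
 then have cont: "continuous_on U f"
  using differentiable_imp_continuous_within continuous_at_imp_continuous_on by blast
 show ?L
  unfolding Ck_on_def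
 proof (intro conjI ballI allI impI)
  fix j and bs :: "'a list" and x assume *: "j < Suc k" "bs \<in> multi_indices j" "x \<in> U"
  show "pderivs bs f differentiable at x"
  proof (cases j)
   case (Suc i)
   then obtain b cs where "b \<in> Basis" "cs \<in> multi_indices i" "i < k" and bs: "bs = cs @ [b]"
    using * by (auto simp: multi_indices_Suc_snoc)
   moreover from this have "Ck_on k U (pderivs [b] f)" using R by blast
   ultimately show ?thesis unfolding bs pderivs_snoc using * by (simp add: Ck_on_def)
  qed (use * R in auto)
 next
  fix j and bs :: "'a list" assume *: "j <= Suc k" "bs \<in> multi_indices j"
  show "continuous_on U (pderivs bs f)"
  proof (cases j)
   case (Suc i)
   then obtain b cs where "b \<in> Basis" "cs \<in> multi_indices i" "i <= k" and bs: "bs = cs @ [b]"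
    using * by (auto simp: multi_indices_Suc_snoc)
   moreover from this have "Ck_on k U (pderivs [b] f)" using R by blast
   ultimately show ?thesis unfolding bs pderivs_snoc by (simp add: Ck_on_def)
  qed (use * cont in auto)
 qed
qed

lemma Ck_on_imp_continuous_on: "Ck_on k U f ==> continuous_on U f"
 unfolding Ck_on_def by (metis le0 multi_indices_0 pderivs.simps(1) singletonI)

lemma Ck_on_cong:
 fixes f g :: "'a::euclidean_space => real"
 assumes "open U" "!!y. y \<in> U ==> f y = g y"
 shows "Ck_on k U f \<longleftrightarrow> Ck_on k U g"
proof -
 have "Ck_on k U g" if "Ck_on k U f" "!!y. y \<in> U ==> f y = g y" for f g :: "'a => real"
  unfolding Ck_on_def
 proof (intro conjI ballI allI impI)
  fix j and bs :: "'a list" and x assume *: "j < k" "bs \<in> multi_indices j" "x \<in> U"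
  then have "pderivs bs f differentiable at x" using that(1) by (simp add: Ck_on_def)
  then obtain D where "(pderivs bs f has_derivative D) (at x)"
   by (auto simp: differentiable_def)
  then have "(pderivs bs g has_derivative D) (at x)"
   by (rule has_derivative_transform_within_open[OF _ assms(1) \<open>x \<in> U\<close>])
    (use pderivs_cong[OF assms(1), of f g] that(2) in auto)
  then show "pderivs bs g differentiable at x" by (auto simp: differentiable_def)
 next
  fix j and bs :: "'a list" assume "j <= k" "bs \<in> multi_indices j"
  then have "continuous_on U (pderivs bs f)" using that(1) by (simp add: Ck_on_def)
  then show "continuous_on U (pderivs bs g)"
   by (rule continuous_on_eq) (use pderivs_cong[OF assms(1), of f g] that(2) in auto)
 qed
 from this[of f g] this[of g f] show ?thesis using assms(2) by auto
qed

lemma Ck_on_le: "Ck_on k U f ==> j <= k ==> Ck_on j U f"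
 by (auto simp: Ck_on_def intro: less_le_trans le_trans)

lemma Ck_on_subset: "Ck_on k U f ==> V \<subseteq> U ==> Ck_on k V f"
 unfolding Ck_on_def using continuous_on_subset by (metis (no_types, lifting) subsetD)

lemma pderivs_single:
 assumes "(f has_derivative f') (at x)"
 shows "pderivs [b] f x = f' b"
 using frechet_derivative_at[OF assms] by simp

lemma has_derivative_pderivs:
 "f differentiable at x ==> (f has_derivative (%h. pderivs [h] f x)) (at x)"
 by (simp add: frechet_derivative_works)

lemma Ck_on_const [simp]: "Ck_on k U (%x. c)"
proof (induction k arbitrary: c)
 case (Suc k)
 have "pderivs [b] (%x. c) = (%x. 0)" for b :: 'a by simp
 then show ?case by (auto simp: Ck_on_Suc Suc simp del: pderivs.simps)
qed simp

lemma Ck_on_bounded_linear: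
 assumes "bounded_linear f" shows "Ck_on k U f"
proof (cases k)
 case (Suc k)
 have "pderivs [b] f = (%x. f b)" for b
  using bounded_linear_imp_has_derivative[OF assms] pderivs_single by blast
 then show ?thesis
  by (auto simp: Ck_on_Suc Suc bounded_linear_imp_differentiable assms simp del: pderivs.simps)
qed (use assms linear_continuous_on in auto)

lemma Ck_on_add:
 assumes "open U"
 shows "Ck_on k U f ==> Ck_on k U g ==> Ck_on k U (%x. f x + g x)"
proof (induction k arbitrary: f g)
 case (Suc k)
 have "pderivs [b] (%x. f x + g x) x = pderivs [b] f x + pderivs [b] g x" if "x \<in> U" for b x
  using Suc.prems that by (intro pderivs_single derivative_eq_intros) (auto simp: Ck_on_Suc frechet_derivative_works)
 then have "Ck_on k U (pderivs [b] (%x. f x + g x))" if "b \<in> Basis" for b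
  using Suc that
   Ck_on_cong[OF assms, of "pderivs [b] (%x. f x + g x)" "%x. pderivs [b] f x + pderivs [b] g x" k]
  by (auto simp: Ck_on_Suc simp del: pderivs.simps)
 then show ?case using Suc.prems by (auto simp: Ck_on_Suc simp del: pderivs.simps)
qed (auto intro: continuous_intros)

lemma Ck_on_mult:
 assumes "open U"
 shows "Ck_on k U f ==> Ck_on k U g ==> Ck_on k U (%x. f x*g x)"
proof (induction k arbitrary: f g)
 case (Suc k)
 have "pderivs [b] (%x. f x*g x) x = f x*pderivs [b] g x + pderivs [b] f x*g x" if "x \<in> U" for b x
  using Suc.prems that by (intro pderivs_single derivative_eq_intros) (auto simp: Ck_on_Suc frechet_derivative_works)
 then have "Ck_on k U (pderivs [b] (%x. f x*g x))" if "b \<in> Basis" for b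
  using Suc that Ck_on_le[of "Suc k" U f k] Ck_on_le[of "Suc k" U g k] 
   Ck_on_cong[OF assms, of "pderivs [b] (%x. f x*g x)" "%x. f x*pderivs [b] g x + pderivs [b] f x*g x" k]
  by (auto intro!: Ck_on_add[OF assms] simp: Ck_on_Suc simp del: pderivs.simps)
 then show ?case using Suc.prems by (auto simp: Ck_on_Suc simp del: pderivs.simps)
qed (auto intro: continuous_intros)

lemma Ck_on_diff:
 assumes "open U" "Ck_on k U f" "Ck_on k U g"
 shows "Ck_on k U (%x. f x - g x)"
 using Ck_on_add[OF assms(1,2) Ck_on_mult[OF assms(1) Ck_on_const[of _ _ "-1"] assms(3)]] by simp

lemma Ck_on_sum:
 assumes "open U" "!!i. i \<in> I ==> Ck_on k U (f i)"
 shows "Ck_on k U (%x. \<Sum>i\<in>I. f i x)"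
 using assms(2) by (induction I rule: infinite_finite_induct) (auto intro: Ck_on_add[OF assms(1)])

lemma Ck_on_prod:
 assumes "open U" "!!i. i \<in> I ==> Ck_on k U (f i)"
 shows "Ck_on k U (%x. \<Prod>i\<in>I. f i x)"
 using assms(2) by (induction I rule: infinite_finite_induct) (auto intro: Ck_on_mult[OF assms(1)])

lemma frechet_derivative_shift:
 fixes f :: "'a::euclidean_space => real"
 shows "frechet_derivative (%x. f (x - a)) (at x) = frechet_derivative f (at (x - a))"
proof -
 have 1: "((%x. f (x - a)) has_derivative D) (at x)" if "(f has_derivative D) (at (x - a))" for f :: "'a => real" and D x a
  using has_derivative_compose[of "%x. x - a" "%h. h" x UNIV f D] that
   has_derivative_diff[OF has_derivative_ident has_derivative_const, of a] by simp
 have "((%x. f (x - a)) has_derivative D) (at x) \<longleftrightarrow> (f has_derivative D) (at (x - a))" for D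
  using 1[of f D x a] 1[of "%x. f (x - a)" D "x - a" "- a"] by auto
 then show ?thesis by (simp add: frechet_derivative_def)
qed

lemma pderivs_shift:
 fixes f :: "'a::euclidean_space => real"
 shows "pderivs bs (%x. f (x - a)) x = pderivs bs f (x - a)"
proof (induction bs arbitrary: x)
 case (Cons b bs)
 then have "pderivs bs (%x. f (x - a)) = (%x. pderivs bs f (x - a))" by auto
 then show ?case by (simp add: frechet_derivative_shift)
qed simp

lemma Ck_on_shift:
 fixes f :: "'a::euclidean_space => real"
 shows "Ck_on k UNIV f ==> Ck_on k UNIV (%x. f (x - a))"
proof (induction k arbitrary: f)
 case 0
 then show ?case by (auto intro!: continuous_on_compose2[of UNIV f] continuous_intros)
next
 case (Suc k)
 have d: "(%x. f (x - a)) differentiable at x" for x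
  using Suc.prems by (intro differentiable_chain_at[of "%x. x - a" x f, unfolded o_def])
   (auto simp: Ck_on_Suc)
 have "pderivs [b] (%x. f (x - a)) = (%x. pderivs [b] f (x - a))" for b
  using pderivs_shift by blast
 then show ?case using Suc d by (auto simp: Ck_on_Suc simp del: pderivs.simps)
qed

section \<open>Smooth bump functions\<close>

text \<open>The polynomial factor makes the family closed under differentiation: with X for 1/t, the
  derivative replaces P by X^2 (P - P').\<close>

definition expinv :: "real poly => real => real" where
 "expinv P t = (if 0 < t then poly P (1/t)*exp (- (1/t)) else 0)"

lemma expinv_tendsto_0: "(expinv P \<longlongrightarrow> 0) (at 0)"
proof -
 have "((%x. poly P x*exp (- x)) \<longlongrightarrow> 0) at_top"
 proof (induction P)
  case (pCons a P)
  have "((%x. coeff P i*(x^Suc i/exp x)) \<longlongrightarrow> coeff P i*0) at_top" for i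
   by (intro tendsto_intros tendsto_power_div_exp_0)
  then have "((%x. \<Sum>i\<le>degree P. coeff P i*(x^Suc i/exp x)) \<longlongrightarrow> (\<Sum>i\<le>degree P. coeff P i*0)) at_top"
   by (intro tendsto_sum) auto
  moreover have "((%x. a*(x^0/exp x)) \<longlongrightarrow> a*0) at_top"
   by (intro tendsto_intros tendsto_power_div_exp_0)
  ultimately have "((%x. a*(x^0/exp x) + (\<Sum>i\<le>degree P. coeff P i*(x^Suc i/exp x))) \<longlongrightarrow> 0) at_top"
   using tendsto_add by fastforce
  moreover have "poly (pCons a P) x*exp (- x) = a*(x^0/exp x) + (\<Sum>i\<le>degree P. coeff P i*(x^Suc i/exp x))" for x
   unfolding poly_pCons poly_altdef[of P]
   by (simp add: exp_minus divide_inverse distrib_right sum_distrib_left sum_distrib_right algebra_simps)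
  ultimately show ?case by simp
 qed simp
 then have "((%t. poly P (1/t)*exp (- (1/t))) \<longlongrightarrow> 0) (at_right 0)"
  using filterlim_compose[OF _ filterlim_inverse_at_top_right] by (simp add: inverse_eq_divide)
 then have "(expinv P \<longlongrightarrow> 0) (at_right 0)"
  by (rule Lim_transform_eventually) (auto simp: expinv_def eventually_at_filter)
 moreover have "(expinv P \<longlongrightarrow> 0) (at_left 0)"
  by (rule Lim_transform_eventually[OF tendsto_const]) (auto simp: expinv_def eventually_at_filter)
 ultimately show ?thesis by (simp add: filterlim_split_at)
qed

lemma expinv_has_real_derivative:
 "(expinv P has_real_derivative expinv (pCons 0 (pCons 0 (P - pderiv P))) t) (at t)"
proof -
 consider "t > 0" | "t < 0" | "t = 0" by linarith
 then show ?thesis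
 proof cases
  case 1
  have "((%t. poly P (1/t)*exp (- (1/t))) has_real_derivative
    expinv (pCons 0 (pCons 0 (P - pderiv P))) t) (at t)"
   using 1 by (auto intro!: derivative_eq_intros DERIV_chain2[OF poly_DERIV]
     simp: expinv_def field_simps power2_eq_square)
  then show ?thesis
   by (rule has_field_derivative_transform_within_open[of _ _ _ "{0<..}"]) (use 1 in \<open>auto simp: expinv_def\<close>)
 next
  case 2
  have "((%t. 0) has_real_derivative expinv (pCons 0 (pCons 0 (P - pderiv P))) t) (at t)"
   using 2 by (simp add: expinv_def)
  then show ?thesis
   by (rule has_field_derivative_transform_within_open[of _ _ _ "{..<0}"]) (use 2 in \<open>auto simp: expinv_def\<close>)
 next
  case 3
  \<comment> \<open>The difference quotient at 0 stays in the family, so its limit is again given by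
    \<open>expinv_tendsto_0\<close>.\<close>
  have "expinv P t/t = expinv (pCons 0 P) t" for t
   by (simp add: expinv_def)
  moreover have "expinv Q 0 = 0" for Q by (simp add: expinv_def)
  ultimately show ?thesis using 3 expinv_tendsto_0[of "pCons 0 P"]
   by (simp add: has_field_derivative_iff)
 qed
qed

lemma Ck_on_expinv:
 assumes "open U"
 shows "(!!j. Ck_on j U g) ==> Ck_on k U (%x. expinv P (g x))"
proof (induction k arbitrary: P)
 case 0
 have "continuous_on UNIV (expinv P)"
  by (intro continuous_at_imp_continuous_on ballI DERIV_isCont[OF expinv_has_real_derivative])
 from continuous_on_compose2[OF this, of U g] show ?case using 0[of 0] by simp
next
 case (Suc k)
 let ?Q = "pCons 0 (pCons 0 (P - pderiv P))"
 have d: "((%x. expinv P (g x)) has_derivative (%h. pderivs [h] g x*expinv ?Q (g x))) (at x)" if "x \<in> U" for x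
  using Suc.prems[of "Suc 0"] that
  by (intro DERIV_compose_FDERIV[OF expinv_has_real_derivative] has_derivative_pderivs)
   (auto simp: Ck_on_Suc)
 have "Ck_on k U (%x. pderivs [b] g x*expinv ?Q (g x))" if "b \<in> Basis" for b
  using Suc.IH[OF Suc.prems] Suc.prems[of "Suc k"] that by (intro Ck_on_mult[OF assms]) (auto simp: Ck_on_Suc)
 moreover have "pderivs [b] (%x. expinv P (g x)) x = pderivs [b] g x*expinv ?Q (g x)" if "x \<in> U" for b x
  using pderivs_single[OF d[OF that]] by simp
 ultimately have "Ck_on k U (pderivs [b] (%x. expinv P (g x)))" if "b \<in> Basis" for b
  using that Ck_on_cong[OF assms, of "pderivs [b] (%x. expinv P (g x))"
    "%x. pderivs [b] g x*expinv ?Q (g x)" k] by simp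
 then show ?case using d by (auto simp: Ck_on_Suc differentiable_def simp del: pderivs.simps)
qed

section \<open>Translations in $L^2$\<close>

lemma lborel_distr_plus_right: "distr lborel borel (%x. x + z) = (lborel :: 'a::euclidean_space measure)"
proof -
 have "(+) z = (%x. x + z)" by (auto simp: add.commute)
 then show ?thesis using lborel_distr_plus[of z] by simp
qed

lemma lborel_integral_translate:
 fixes f :: "'a::euclidean_space => 'b::{banach, second_countable_topology}"
 assumes [measurable]: "f \<in> borel_measurable borel"
 shows "(LBINT x. f (x + z)) = (LBINT x. f x)"
  and "integrable lborel (%x. f (x + z)) \<longleftrightarrow> integrable lborel f"
 using integral_distr[of "%x. x + z" lborel borel f] integrable_distr_eq[of "%x. x + z" lborel borel f]
 by (simp_all add: lborel_distr_plus_right)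

lemma lborel_nn_integral_translate:
 fixes f :: "'a::euclidean_space => ennreal"
 assumes [measurable]: "f \<in> borel_measurable borel"
 shows "(\<integral>\<^sup>+x. f (x + z) \<partial>lborel) = (\<integral>\<^sup>+x. f x \<partial>lborel)"
 using nn_integral_distr[of "%x. x + z" lborel borel f] by (simp add: lborel_distr_plus_right)

lemma power2_sum2_le: "(a + b)^2 <= 2*a^2 + 2*(b::real)^2"
 using zero_le_power2[of "a - b"] by (simp add: power2_eq_square algebra_simps)

text \<open>Measurable functions are limits of continuous ones, which only have to be truncated.\<close>

lemma L2_continuous_approx:
 fixes w :: "'a::euclidean_space => real"
 assumes w[measurable]: "w \<in> borel_measurable borel" and w2: "integrable lborel (%x. (w x)^2)" and e: "0 < e"
 shows "\<exists>g R. continuous_on UNIV g \<and> (\<forall>x. \<bar>g x\<bar> <= R) \<and> (\<forall>x. R < norm x --> g x = 0) \<and>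
  integrable lborel (%x. (w x - g x)^2) \<and> (LBINT x. (w x - g x)^2) < e"
proof -
 have "w measurable_on UNIV" using measurable_completion[of w lborel borel]
  by (intro lebesgue_measurable_imp_measurable_on) auto
 then obtain N g where N: "negligible N" and g: "!!n. continuous_on UNIV (g n)"
  and lim: "!!x. x \<notin> N ==> (%n. g n x) \<longlonglongrightarrow> w x" by (auto simp: measurable_on_def)
 have AEN: "AE x in lborel. x \<notin> N"
  using N AE_not_in[of N lebesgue] AE_completion_iff[of "%x. x \<notin> N" lborel] by (simp add: negligible_iff_null_sets)
 note [measurable] = borel_measurable_continuous_onI[OF g]
 \<comment> \<open>Clips values to the interval from - M to M and switches off between the radii M
   and M + 1. It is continuous in both arguments, so it turns continuous approximants into bounded
   ones with bounded support.\<close>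
 define t where "t M x y = max 0 (min 1 (real M + 1 - norm x))*max (- real M) (min (real M) y)" for M and x :: 'a and y
 have tM: "\<bar>t M x y\<bar> <= real M" "real M + 1 < norm x ==> t M x y = 0" "\<bar>y - t M x y\<bar> <= \<bar>y\<bar>" for M x y
 proof -
  define c where "c = max 0 (min 1 (real M + 1 - norm x))"
  have c: "0 <= c" "c <= 1" by (auto simp: c_def)
  have d: "\<bar>max (- real M) (min (real M) y)\<bar> <= real M" "\<bar>max (- real M) (min (real M) y)\<bar> <= \<bar>y\<bar>"
   "0 <= y ==> 0 <= max (- real M) (min (real M) y)" "y <= 0 ==> max (- real M) (min (real M) y) <= 0" by auto
  show "\<bar>t M x y\<bar> <= real M" using mult_mono[OF c(2) d(1)] c by (simp add: t_def c_def[symmetric] abs_mult)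
  show "real M + 1 < norm x ==> t M x y = 0" by (simp add: t_def)
  have "\<bar>t M x y\<bar> <= \<bar>y\<bar>" using mult_mono[OF c(2) d(2)] c by (simp add: t_def c_def[symmetric] abs_mult)
  moreover have "0 <= y ==> 0 <= t M x y" "y <= 0 ==> t M x y <= 0"
   using c d(3,4) by (auto simp: t_def c_def[symmetric] mult_nonneg_nonpos)
  ultimately show "\<bar>y - t M x y\<bar> <= \<bar>y\<bar>" by linarith
 qed
 have tc: "continuous_on UNIV (%x. t M x (f x))" if "continuous_on UNIV f" for f M
  unfolding t_def by (intro continuous_intros that)
 have [measurable]: "(%x. t M x (f x)) \<in> borel_measurable borel" if "f \<in> borel_measurable borel" for f M
  using that unfolding t_def by measurable
 have wt: "integrable lborel (%x. (w x - t M x (w x))^2)" for M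
  by (rule Bochner_Integration.integrable_bound[OF w2]) (use tM(3) in \<open>auto simp: abs_le_square_iff\<close>)
 have "(%M. \<integral>x. (w x - t M x (w x))^2 \<partial>lborel) \<longlonglongrightarrow> (\<integral>x. 0 \<partial>(lborel::'a measure))"
 proof (rule integral_dominated_convergence[where w = "%x. (w x)^2"])
  show "AE x in lborel. (%M. (w x - t M x (w x))^2) \<longlonglongrightarrow> 0"
  proof (rule AE_I2)
   fix x
   obtain n :: nat where n: "max (norm x) \<bar>w x\<bar> <= n" using real_arch_simple by blast
   have "\<forall>\<^sub>F M in sequentially. 0 = (w x - t M x (w x))^2"
    using eventually_ge_at_top[of n] by eventually_elim (use n in \<open>auto simp: t_def\<close>)
   then show "(%M. (w x - t M x (w x))^2) \<longlonglongrightarrow> 0" by (rule Lim_transform_eventually[OF tendsto_const])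
  qed
 qed (use w2 tM(3) in \<open>auto simp: abs_le_square_iff\<close>)
 from order_tendstoD(2)[OF this, of "e/4"] e obtain M where M: "(LBINT x. (w x - t M x (w x))^2) < e/4"
  by (auto simp: eventually_sequentially)
 let ?I = "%x. (2*real M)^2*indicat_real (cball (0::'a) (real M + 1)) x"
 have I: "integrable lborel ?I" using emeasure_bounded_finite[of "cball (0::'a) (real M + 1)"] by (auto intro!: integrable_real_indicator)
 have le: "(t M x y - t M x z)^2 <= ?I x" for x y z
 proof (cases "norm x <= real M + 1")
  case True
  have "\<bar>t M x y - t M x z\<bar> <= 2*real M" using tM(1)[of M x y] tM(1)[of M x z] by linarith
  from power_mono[OF this, of 2] show ?thesis using True by simp
 qed (simp add: tM(2))
 have "(%n. \<integral>x. (t M x (w x) - t M x (g n x))^2 \<partial>lborel) \<longlonglongrightarrow> (\<integral>x. 0 \<partial>(lborel::'a measure))"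
 proof (rule integral_dominated_convergence[where w = ?I])
  show "AE x in lborel. (%n. (t M x (w x) - t M x (g n x))^2) \<longlonglongrightarrow> 0"
   using AEN
  proof eventually_elim
   case (elim x)
   have "(%n. (t M x (w x) - t M x (g n x))^2) \<longlonglongrightarrow> (t M x (w x) - t M x (w x))^2"
    unfolding t_def by (intro tendsto_intros lim[OF elim])
   then show ?case by simp
  qed
 qed (use I le in auto)
 from order_tendstoD(2)[OF this, of "e/4"] e obtain n where n: "(LBINT x. (t M x (w x) - t M x (g n x))^2) < e/4"
  by (auto simp: eventually_sequentially)
 have i: "integrable lborel (%x. (t M x (w x) - t M x (g n x))^2)"
  by (rule Bochner_Integration.integrable_bound[OF I]) (use le in auto)
 have sq: "(w x - t M x (g n x))^2 <= 2*(w x - t M x (w x))^2 + 2*(t M x (w x) - t M x (g n x))^2" for x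
  using power2_sum2_le[of "w x - t M x (w x)" "t M x (w x) - t M x (g n x)"] by simp
 have ii: "integrable lborel (%x. (w x - t M x (g n x))^2)"
  by (rule Bochner_Integration.integrable_bound[of _ "%x. 2*(w x - t M x (w x))^2 + 2*(t M x (w x) - t M x (g n x))^2"])
   (use wt i sq in auto)
 have "(LBINT x. (w x - t M x (g n x))^2) <= (LBINT x. 2*(w x - t M x (w x))^2 + 2*(t M x (w x) - t M x (g n x))^2)"
  by (rule integral_mono) (use wt i ii sq in auto)
 also have "\<dots> < e" using wt i M n by simp
 finally have "(LBINT x. (w x - t M x (g n x))^2) < e" .
 then show ?thesis
  using ii tc[OF g] tM(1,2)[of M _ "g n _"] order_trans[OF tM(1)[of M _ "g n _"], of "real M + 1"]
  by (intro exI[of _ "%x. t M x (g n x)"] exI[of _ "real M + 1"]) auto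
qed

text \<open>Translations are isometries of \<open>L2\<close>, so the claim passes to
  \<open>w\<close> from a continuous approximant with bounded support. For the approximant it is
  dominated convergence along a sequence of shifts that would contradict the claim.\<close>

lemma L2_translation:
 fixes w :: "'a::euclidean_space => real"
 assumes w[measurable]: "w \<in> borel_measurable borel" and w2: "integrable lborel (%x. (w x)^2)" and e: "0 < e"
 obtains d where "0 < d" "!!z. norm z < d ==> (LBINT x. (w (x + z) - w x)^2) < e"
proof (rule ccontr)
 assume "\<not> thesis"
 then have "\<exists>z. norm z < 1/real (Suc n) \<and> \<not> (LBINT x. (w (x + z) - w x)^2) < e" for n
  using that[of "1/real (Suc n)"] by auto
 then obtain z where z: "!!n. norm (z n) < 1/real (Suc n)" "!!n. \<not> (LBINT x. (w (x + z n) - w x)^2) < e"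
  by metis
 have z0: "z \<longlonglongrightarrow> 0"
  by (rule tendsto_norm_zero_cancel, rule tendsto_sandwich[OF _ _ tendsto_const LIMSEQ_inverse_real_of_nat])
   (use z(1) in \<open>auto simp: inverse_eq_divide intro!: always_eventually less_imp_le\<close>)
 have z1: "norm (z n) <= 1" for n using less_le_trans[OF z(1)[of n], of 1] by simp
 \<comment> \<open>With the weights 4, 2, 4 of the final estimate the total is 4 e/24 + 2 e/4 + 4
   e/24 < e.\<close>
 have "0 < e/24" using e by simp
 from L2_continuous_approx[OF w w2 this] obtain g R where g: "continuous_on UNIV g" "!!x. \<bar>g x\<bar> <= R" "!!x. R < norm x ==> g x = 0"
  and wg: "integrable lborel (%x. (w x - g x)^2)" "(LBINT x. (w x - g x)^2) < e/24" by blast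
 note [measurable] = borel_measurable_continuous_onI[OF g(1)]
 let ?I = "%x. (2*R)^2*indicat_real (cball (0::'a) (R + 1)) x"
 have I: "integrable lborel ?I" using emeasure_bounded_finite[of "cball (0::'a) (R + 1)"] by (auto intro!: integrable_real_indicator)
 have le: "(g (x + z n) - g x)^2 <= ?I x" for x n
 proof (cases "norm x <= R + 1")
  case True
  have "\<bar>g (x + z n) - g x\<bar> <= 2*R" using g(2)[of x] g(2)[of "x + z n"] by linarith
  from power_mono[OF this, of 2] show ?thesis using True by simp
 next
  case False
  then have "R < norm x" "R < norm (x + z n)" using norm_diff_ineq[of x "z n"] z1[of n] by linarith+
  then show ?thesis using False g(3) by simp
 qed
 have "(%n. \<integral>x. (g (x + z n) - g x)^2 \<partial>lborel) \<longlonglongrightarrow> (\<integral>x. 0 \<partial>(lborel::'a measure))"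
 proof (rule integral_dominated_convergence[where w = ?I])
  show "AE x in lborel. (%n. (g (x + z n) - g x)^2) \<longlonglongrightarrow> 0"
  proof (rule AE_I2)
   fix x
   have "(%n. x + z n) \<longlonglongrightarrow> x + 0" by (intro tendsto_intros z0)
   then have "(%n. g (x + z n)) \<longlonglongrightarrow> g (x + 0)"
    using g(1) by (intro continuous_on_tendsto_compose[of UNIV g]) auto
   then have "(%n. (g (x + z n) - g x)^2) \<longlonglongrightarrow> (g (x + 0) - g x)^2" by (intro tendsto_intros)
   then show "(%n. (g (x + z n) - g x)^2) \<longlonglongrightarrow> 0" by simp
  qed
 qed (use I le in auto)
 from order_tendstoD(2)[OF this, of "e/4"] e obtain n where n: "(LBINT x. (g (x + z n) - g x)^2) < e/4"
  by (auto simp: eventually_sequentially)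
 have i1: "integrable lborel (%x. (w (x + z n) - g (x + z n))^2)" "(LBINT x. (w (x + z n) - g (x + z n))^2) < e/24"
  using lborel_integral_translate[of "%x. (w x - g x)^2" "z n"] wg by simp_all
 have i2: "integrable lborel (%x. (g (x + z n) - g x)^2)"
  by (rule Bochner_Integration.integrable_bound[OF I]) (use le in auto)
 have "(LBINT x. (w (x + z n) - w x)^2) \<le>
   (LBINT x. 4*(w (x + z n) - g (x + z n))^2 + 2*(g (x + z n) - g x)^2 + 4*(w x - g x)^2)"
 proof (rule Bochner_Integration.integral_mono')
  fix x
  show "(w (x + z n) - w x)^2 <= 4*(w (x + z n) - g (x + z n))^2 + 2*(g (x + z n) - g x)^2 + 4*(w x - g x)^2"
   using power2_sum2_le[of "(w (x + z n) - g (x + z n)) + (g x - w x)" "g (x + z n) - g x"]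
    power2_sum2_le[of "w (x + z n) - g (x + z n)" "g x - w x"] by (simp add: power2_commute[of "g x" "w x"])
 qed (use i1 i2 wg in auto)
 also have "\<dots> < e" using i1 i2 wg n e by simp
 finally show False using z(2) by simp
qed

text \<open>The kernel enters as \<open>k (y - x)\<close>, not \<open>k (x - y)\<close>: a kernel
  supported near \<open>s\<close> averages \<open>w\<close> near \<open>x + s\<close>, and
  differentiating in \<open>x\<close> puts a minus sign on the gradient of the kernel.\<close>

definition conv :: "('a::euclidean_space => real) => ('a => real) => 'a => real" where
 "conv w k x = (LBINT y. w y*k (y - x))"

lemma conv_alt:
 assumes [measurable]: "w \<in> borel_measurable borel" "k \<in> borel_measurable borel"
 shows "conv w k x = (LBINT z. w (x + z)*k z)"
 using lborel_integral_translate(1)[of "%y. w y*k (y - x)" x] by (simp add: conv_def add.commute)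

lemma integrable_mult_bounded:
 fixes w :: "'a => real"
 assumes "integrable M w" "k \<in> borel_measurable M" "!!x. x \<in> space M ==> \<bar>k x\<bar> <= B"
 shows "integrable M (%x. w x*k x)"
proof (rule Bochner_Integration.integrable_bound)
 show "integrable M (%x. B*\<bar>w x\<bar>)" using assms by simp
 show "AE x in M. norm (w x*k x) <= norm (B*\<bar>w x\<bar>)"
 proof (rule AE_I2)
  fix x assume "x \<in> space M"
  from assms(3)[OF this] show "norm (w x*k x) <= norm (B*\<bar>w x\<bar>)"
   using mult_left_mono[of "\<bar>k x\<bar>" "\<bar>B\<bar>" "\<bar>w x\<bar>"] by (simp add: abs_mult mult_ac)
 qed
qed (use assms in \<open>auto intro!: borel_measurable_times borel_measurable_integrable\<close>)

text \<open>Jensen's inequality for the square, from the nonnegativity of the variance. In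
  \<open>ennreal\<close> it also covers an infinite right side, so Tonelli can be applied to it
  directly.\<close>

lemma weighted_mean_square_le:
 fixes d k :: "'a => real"
 assumes [measurable]: "d \<in> borel_measurable M" "k \<in> borel_measurable M"
  and k: "!!x. 0 <= k x" "integrable M k" "(\<integral>x. k x \<partial>M) = 1" and dk: "integrable M (%x. d x*k x)"
 shows "ennreal ((\<integral>x. d x*k x \<partial>M)^2) <= (\<integral>\<^sup>+x. ennreal ((d x)^2*k x) \<partial>M)"
proof (cases "integrable M (%x. (d x)^2*k x)")
 case True
 define m where "m = (\<integral>x. d x*k x \<partial>M)"
 have "0 <= (\<integral>x. (d x - m)^2*k x \<partial>M)" using k by (intro integral_nonneg_AE) auto
 also have "\<dots> = (\<integral>x. (d x)^2*k x - 2*m*(d x*k x) + m^2*k x \<partial>M)"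
  by (simp add: power2_eq_square algebra_simps)
 also have "\<dots> = (\<integral>x. (d x)^2*k x \<partial>M) - 2*m*m + m^2"
  using True k dk by (simp add: m_def)
 finally have "m^2 <= (\<integral>x. (d x)^2*k x \<partial>M)" by (simp add: power2_eq_square)
 then show ?thesis using True k unfolding m_def
  by (subst nn_integral_eq_integral) (auto intro!: ennreal_leI)
next
 case False
 have "(\<integral>\<^sup>+x. ennreal ((d x)^2*k x) \<partial>M) = \<infinity>"
 proof (rule ccontr)
  assume "(\<integral>\<^sup>+x. ennreal ((d x)^2*k x) \<partial>M) ~= \<infinity>"
  then have "integrable M (%x. (d x)^2*k x)"
   using k by (intro integrableI_nonneg) (auto simp: less_top)
  then show False using False by simp
 qed
 then show ?thesis by simp
qed

text \<open>By Jensen the squared error at a point is at most the \<open>k\<close>-average of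
  squared translation differences. Exchanging the integrals leaves a \<open>k\<close>-average of
  quantities bounded by \<open>e\<close>.\<close>

lemma conv_L2_close:
 fixes w k :: "'a::euclidean_space => real"
 assumes [measurable]: "w \<in> borel_measurable borel" "k \<in> borel_measurable borel"
  and w1: "integrable lborel w" and w2: "integrable lborel (%x. (w x)^2)"
  and k: "!!x. 0 <= k x" "!!x. k x <= B" "integrable lborel k" "(LBINT x. k x) = 1"
   "!!z. r < norm z ==> k z = 0"
  and e: "!!z. norm z <= r ==> (LBINT x. (w (x + z) - w x)^2) <= e"
 shows "integrable lborel (%x. (conv w k x - w x)^2)" "(LBINT x. (conv w k x - w x)^2) <= e"
proof -
 have "conv w k = (%x. \<integral>z. w (x + z)*k z \<partial>lborel)" by (intro ext conv_alt) measurable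
 then have [measurable]: "conv w k \<in> borel_measurable borel" by simp
 have int2: "integrable lborel (%x. (w (x + z) - w x)^2)" for z
 proof (rule Bochner_Integration.integrable_bound)
  show "integrable lborel (%x. 2*(w (x + z))^2 + 2*(w x)^2)"
   using w2 lborel_integral_translate(2)[of "%x. (w x)^2"] by simp
  show "AE x in lborel. norm ((w (x + z) - w x)^2) <= norm (2*(w (x + z))^2 + 2*(w x)^2)"
   using power2_sum2_le[of "w (x + z)" "- w x" for x] by (auto intro!: AE_I2 simp: abs_of_nonneg)
 qed simp
 have "r >= 0"
 proof (rule ccontr)
  assume "\<not> 0 <= r"
  then have "k z = 0" for z using k(5) norm_ge_zero[of z] by (metis less_le_trans not_le)
  then show False using k(4) by simp
 qed
 then have e0: "0 <= e" using e[of 0] by simp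
 have "(\<integral>\<^sup>+x. ennreal ((conv w k x - w x)^2) \<partial>lborel)
   <= (\<integral>\<^sup>+x. \<integral>\<^sup>+z. ennreal ((w (x + z) - w x)^2*k z) \<partial>lborel \<partial>lborel)"
 proof (rule nn_integral_mono)
  fix x
  have i: "integrable lborel (%z. w (x + z)*k z)"
   using k lborel_integral_translate(2)[of w x] w1
   by (intro integrable_mult_bounded[where B = B]) (auto simp: add.commute)
  have i': "integrable lborel (%z. (w (x + z) - w x)*k z)"
   using Bochner_Integration.integrable_diff[OF i, of "%z. w x*k z"] k by (simp add: left_diff_distrib)
  have "(LBINT z. (w (x + z) - w x)*k z) = (LBINT z. w (x + z)*k z - w x*k z)"
   by (simp add: left_diff_distrib)
  also have "\<dots> = conv w k x - w x"
   using i k by (simp add: conv_alt)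
  finally show "ennreal ((conv w k x - w x)^2) <= (\<integral>\<^sup>+z. ennreal ((w (x + z) - w x)^2*k z) \<partial>lborel)"
   using weighted_mean_square_le[of "%z. w (x + z) - w x" lborel k] k i' by simp
 qed
 also have "\<dots> = (\<integral>\<^sup>+z. \<integral>\<^sup>+x. ennreal ((w (x + z) - w x)^2*k z) \<partial>lborel \<partial>lborel)"
  by (rule lborel_pair.Fubini') measurable
 also have "\<dots> <= (\<integral>\<^sup>+z. ennreal (e*k z) \<partial>lborel)"
 proof (rule nn_integral_mono)
  fix z
  have "(\<integral>\<^sup>+x. ennreal ((w (x + z) - w x)^2*k z) \<partial>lborel) = ennreal ((LBINT x. (w (x + z) - w x)^2)*k z)"
   using int2[of z] k by (subst nn_integral_eq_integral) auto
  also have "\<dots> <= ennreal (e*k z)"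
  proof (cases "norm z <= r")
   case True
   then show ?thesis using e k by (intro ennreal_leI mult_right_mono) auto
  qed (use k in auto)
  finally show "(\<integral>\<^sup>+x. ennreal ((w (x + z) - w x)^2*k z) \<partial>lborel) <= ennreal (e*k z)" .
 qed
 also have "\<dots> = ennreal e"
  using k e0 by (subst nn_integral_eq_integral) auto
 finally have *: "(\<integral>\<^sup>+x. ennreal ((conv w k x - w x)^2) \<partial>lborel) <= ennreal e" .
 then show i: "integrable lborel (%x. (conv w k x - w x)^2)"
  by (intro integrableI_nonneg) (auto simp: top_unique intro: le_less_trans[OF _ ennreal_less_top])
 from * show "(LBINT x. (conv w k x - w x)^2) <= e"
  using e0 by (subst (asm) nn_integral_eq_integral[OF i]) (auto simp: ennreal_le_iff)
qed

section \<open>Gradients and compactly supported functions\<close>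

lemma grad_nth: "grad f x$i = pderivs [axis i 1] f x"
 by (simp add: grad_def)

lemma grad_eqI:
 assumes "(f has_derivative (%h. G \<bullet> h)) (at x)"
 shows "grad f x = G"
 using pderivs_single[OF assms] by (simp add: vec_eq_iff inner_axis grad_nth del: pderivs.simps)

lemma has_derivative_grad:
 assumes "f differentiable at x"
 shows "(f has_derivative (%h. grad f x \<bullet> h)) (at x)"
proof -
 obtain D where D: "(f has_derivative D) (at x)" using assms by (auto simp: differentiable_def)
 then interpret D: bounded_linear D by (rule has_derivative_bounded_linear)
 have "D h = grad f x \<bullet> h" for h
 proof -
  have "D h = D (\<Sum>i\<in>UNIV. h$i *\<^sub>R axis i 1)" by (simp add: basis_expansion scalar_mult_eq_scaleR[symmetric])
  also have "\<dots> = (\<Sum>i\<in>UNIV. h$i*D (axis i 1))" by (simp add: D.sum D.scaleR)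
  finally show ?thesis
   using pderivs_single[OF D] by (simp add: inner_vec_def mult.commute grad_nth del: pderivs.simps)
 qed
 then show ?thesis using D by (metis (no_types, lifting) ext)
qed

lemma grad_cong_open:
 assumes "open U" "x \<in> U" "!!y. y \<in> U ==> f y = g y"
 shows "grad f x = grad g x"
 using pderivs_cong[OF assms(1,3,2)] by (simp add: vec_eq_iff grad_nth del: pderivs.simps)

lemma Basis_vec_axis: "b \<in> (Basis :: (real^'n) set) \<longleftrightarrow> (\<exists>i. b = axis i 1)"
 by (auto simp: Basis_vec_def)

lemma Ck_on_Suc_grad:
 fixes f :: "real^'n => real"
 shows "Ck_on (Suc k) U f \<longleftrightarrow> (\<forall>x\<in>U. f differentiable at x) \<and> (\<forall>i. Ck_on k U (%x. grad f x$i))"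
proof -
 have "(\<forall>b\<in>Basis. P b) \<longleftrightarrow> (\<forall>i. P (axis i 1))" for P :: "real^'n => bool"
  using Basis_vec_axis by metis
 then show ?thesis by (simp add: Ck_on_Suc grad_nth del: pderivs.simps)
qed

lemma Ck_on_1:
 fixes f :: "real^'n => real"
 shows "Ck_on (Suc 0) U f \<longleftrightarrow> (\<forall>x\<in>U. f differentiable at x) \<and> continuous_on U (grad f)"
proof -
 have "continuous_on U (grad f)" if "!!i. continuous_on U (%x. grad f x$i)"
  using continuous_on_vec_lambda[of U "%i x. grad f x$i"] that by (simp)
 moreover have "continuous_on U (%x. grad f x$i)" if "continuous_on U (grad f)" for i
  using that by (intro continuous_intros)
 ultimately show ?thesis by (auto simp: Ck_on_Suc_grad)
qed

text \<open>One derivative only, so that the class is stable under products with \<open>C^1\<close>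
  functions and under composition with \<open>C^1\<close> functions vanishing at 0; the solutions
  and the regularised signs used below are no smoother in general.\<close>

definition C1c :: "(real^'n) set => (real^'n => real) set" where
 "C1c Om = {\<xi>. Ck_on (Suc 0) UNIV \<xi> \<and> compact (closure {x. \<xi> x ~= 0}) \<and> closure {x. \<xi> x ~= 0} \<subseteq> Om}"

lemma C1c_differentiable: "\<xi> \<in> C1c Om ==> \<xi> differentiable at x"
 by (simp add: C1c_def Ck_on_1)

lemma C1c_has_derivative: "\<xi> \<in> C1c Om ==> (\<xi> has_derivative (%h. grad \<xi> x \<bullet> h)) (at x)"
 by (intro has_derivative_grad C1c_differentiable)

lemma C1c_continuous: "\<xi> \<in> C1c Om ==> continuous_on S \<xi>"
 by (auto simp: C1c_def intro: Ck_on_imp_continuous_on continuous_on_subset[of UNIV])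

lemma C1c_continuous_grad: "\<xi> \<in> C1c Om ==> continuous_on S (grad \<xi>)"
 by (auto simp: C1c_def Ck_on_1 intro: continuous_on_subset[of UNIV])

lemma test_functions_C1c: "\<psi> \<in> test_functions Om ==> \<psi> \<in> C1c Om"
 by (auto simp: C1c_def test_functions_def)

lemma grad_zero_outside:
 assumes "x \<notin> closure {x. f x ~= 0}"
 shows "f x = 0" "grad f x = 0"
proof -
 show "f x = 0" using assms closure_subset[of "{x. f x ~= 0}"] by blast
 have "grad f x = grad (%x. 0) x"
  using assms closure_subset[of "{x. f x ~= 0}"] by (intro grad_cong_open[of "- closure {x. f x ~= 0}"]) auto
 also have "\<dots> = 0" by (rule grad_eqI) simp
 finally show "grad f x = 0" .
qed

lemma C1c_zero_outside:
 assumes "\<xi> \<in> C1c Om" "x \<notin> Om"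
 shows "\<xi> x = 0" "grad \<xi> x = 0"
 using grad_zero_outside[of x \<xi>] assms by (auto simp: C1c_def)

lemma compact_support_bounded:
 fixes f :: "'a::euclidean_space => 'b::real_normed_vector"
 assumes "continuous_on UNIV f" "compact K" "!!x. x \<notin> K ==> f x = 0"
 obtains B where "0 < B" "!!x. norm (f x) <= B"
proof -
 have "bounded (f ` K)"
  using assms by (meson compact_continuous_image compact_imp_bounded continuous_on_subset subset_UNIV)
 then obtain B where "0 < B" "!!x. x \<in> K ==> norm (f x) <= B" by (auto simp: bounded_pos)
 then show thesis using that[of B] assms(3) by (metis norm_zero less_imp_le)
qed

lemma compact_support_uniformly_continuous:
 fixes f :: "'a::euclidean_space => 'b::real_normed_vector"
 assumes f: "continuous_on UNIV f" and K: "compact K" "!!x. x \<notin> K ==> f x = 0"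
 shows "uniformly_continuous_on UNIV f"
proof -
 obtain r where r: "K \<subseteq> ball 0 r" using K(1) by (metis bounded_subset_ballD compact_imp_bounded)
 have "uniformly_continuous_on (cball 0 (r + 1)) f"
  using f by (intro compact_uniformly_continuous continuous_on_subset[OF f]) auto
 show ?thesis
  unfolding uniformly_continuous_on_def
 proof (intro allI impI)
  fix e :: real assume "0 < e"
  with \<open>uniformly_continuous_on (cball 0 (r + 1)) f\<close> obtain d where d: "d > 0"
   "!!x x'. x \<in> cball 0 (r + 1) ==> x' \<in> cball 0 (r + 1) ==> dist x' x < d ==> dist (f x') (f x) < e"
   unfolding uniformly_continuous_on_def by metis
  show "\<exists>d>0. \<forall>x\<in>UNIV. \<forall>x'\<in>UNIV. dist x' x < d --> dist (f x') (f x) < e"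
  proof (intro exI[of _ "min d 1"] conjI ballI impI)
   fix x x' :: 'a assume *: "dist x' x < min d 1"
   show "dist (f x') (f x) < e"
   proof (cases "x \<in> cball 0 (r + 1) \<and> x' \<in> cball 0 (r + 1)")
    case False
    have "norm x' <= norm x + dist x' x" "norm x <= norm x' + dist x' x"
     using norm_triangle_sub[of x' x] norm_triangle_sub[of x x'] by (auto simp: dist_norm norm_minus_commute)
    then have "x \<notin> ball 0 r" "x' \<notin> ball 0 r" using False * by auto
    then have "x \<notin> K" "x' \<notin> K" using r by blast+
    then have "f x = 0" "f x' = 0" using K(2) by auto
    then show ?thesis using \<open>0 < e\<close> by simp
   qed (use d * in auto)
  qed (use d in auto)
 qed
qed

lemma compact_support_integrable:
 fixes f :: "'a::euclidean_space => real"
 assumes "continuous_on UNIV f" "compact K" "!!x. x \<notin> K ==> f x = 0"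
 shows "integrable lborel f"
proof -
 have "integrable lborel (%x. indicator K x *\<^sub>R f x)"
  using assms by (intro borel_integrable_compact) (auto intro: continuous_on_subset)
 moreover have "(%x. indicator K x *\<^sub>R f x) = f" using assms(3) by (auto split: split_indicator)
 ultimately show ?thesis by simp
qed

lemma C1c_bounded:
 assumes "\<xi> \<in> C1c Om"
 obtains B where "0 < B" "!!x. \<bar>\<xi> x\<bar> <= B" "!!x. norm (grad \<xi> x) <= B"
proof -
 have K: "compact (closure {x. \<xi> x ~= 0})" using assms by (simp add: C1c_def)
 obtain B1 where "0 < B1" "!!x. norm (\<xi> x) <= B1"
  using compact_support_bounded[OF C1c_continuous[OF assms] K] grad_zero_outside(1)[of _ \<xi>] by metis
 moreover obtain B2 where "0 < B2" "!!x. norm (grad \<xi> x) <= B2"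
  using compact_support_bounded[OF C1c_continuous_grad[OF assms] K] grad_zero_outside(2)[of _ \<xi>] by metis
 ultimately show thesis using that[of "max B1 B2"] by (simp add: le_max_iff_disj)
qed

lemma continuous_on_grad_nth: "continuous_on S (grad f) ==> continuous_on S (%x. grad f x$i)"
 by (intro continuous_intros)

lemma C1c_borel [measurable (raw)]:
 assumes "\<xi> \<in> C1c Om"
 shows "\<xi> \<in> borel_measurable borel" "grad \<xi> \<in> borel_measurable borel"
 using C1c_continuous[OF assms] C1c_continuous_grad[OF assms] borel_measurable_continuous_onI by blast+

lemma C1c_integrable:
 assumes "\<xi> \<in> C1c Om"
 shows "integrable lborel \<xi>" "integrable lborel (%x. grad \<xi> x$i)"
proof -
 have K: "compact (closure {x. \<xi> x ~= 0})" using assms by (simp add: C1c_def)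
 show "integrable lborel \<xi>"
  by (rule compact_support_integrable[OF C1c_continuous[OF assms] K]) (rule grad_zero_outside)
 show "integrable lborel (%x. grad \<xi> x$i)"
  by (rule compact_support_integrable[OF continuous_on_grad_nth[OF C1c_continuous_grad[OF assms]] K])
   (simp add: grad_zero_outside(2))
qed

lemma test_functions_grad:
 assumes "\<psi> \<in> test_functions Om"
 shows "(%x. grad \<psi> x$i) \<in> test_functions Om"
proof -
 have "x \<in> closure {x. \<psi> x ~= 0}" if "grad \<psi> x$i ~= 0" for x
  using grad_zero_outside(2)[of x \<psi>] that by (cases "x \<in> closure {x. \<psi> x ~= 0}") auto
 then have sub: "closure {x. grad \<psi> x$i ~= 0} \<subseteq> closure {x. \<psi> x ~= 0}"
  by (intro closure_minimal) auto
 moreover have "Ck_on k UNIV (%x. grad \<psi> x$i)" for k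
  using assms Ck_on_Suc_grad[of k UNIV \<psi>] by (auto simp: test_functions_def)
 moreover have "bounded {x. grad \<psi> x$i ~= 0}"
 proof (rule bounded_subset)
  have "compact (closure {x. \<psi> x ~= 0})" using assms by (simp add: test_functions_def)
  then show "bounded (closure {x. \<psi> x ~= 0})" by (rule compact_imp_bounded)
  show "{x. grad \<psi> x$i ~= 0} \<subseteq> closure {x. \<psi> x ~= 0}"
   by (rule order_trans[OF closure_subset sub])
 qed
 ultimately show ?thesis using assms by (auto simp: test_functions_def)
qed

text \<open>The gradient is uniformly continuous because of the compact support. Uniformity in
  \<open>z\<close> is what allows differentiation under the integral sign of a convolution.\<close>

lemma C1c_uniform_linearization:
 assumes k: "k \<in> C1c Om" and e: "0 < e"
 obtains d where "0 < d" "!!z h. norm h < d ==> \<bar>k (z - h) - k z + grad k z \<bullet> h\<bar> <= e*norm h"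
proof -
 have K: "compact (closure {x. k x ~= 0})" using k by (simp add: C1c_def)
 have "uniformly_continuous_on UNIV (grad k)"
  by (rule compact_support_uniformly_continuous[OF C1c_continuous_grad[OF k] K]) (rule grad_zero_outside)
 then obtain d where d: "d > 0" "!!x x'. dist x' x < d ==> dist (grad k x') (grad k x) < e"
  unfolding uniformly_continuous_on_def using e by blast
 have "\<bar>k (z - h) - k z + grad k z \<bullet> h\<bar> <= e*norm h" if "norm h < d" for z h
 proof -
  have "norm (k (z - h) - k z - grad k z \<bullet> ((z - h) - z)) <= norm ((z - h) - z)*e"
  proof (rule differentiable_bound_linearization[where S = "ball z d" and f' = "%x h. grad k x \<bullet> h"])
   fix t :: real assume t: "t \<in> {0..1}"
   have "\<bar>t\<bar>*norm h <= 1*norm h" using t by (intro mult_right_mono) auto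
   then show "z + t *\<^sub>R (z - h - z) \<in> ball z d" using that by (simp add: dist_norm)
  next
   fix x assume "x \<in> ball z d"
   then have "norm (grad k x - grad k z) <= e"
    using d(2)[of x z] by (simp add: dist_norm norm_minus_commute)
   then have "norm ((grad k x - grad k z) \<bullet> h) <= e*norm h" for h
    using Cauchy_Schwarz_ineq2[of "grad k x - grad k z" h] mult_right_mono[of _ e "norm h"]
    by (metis norm_ge_zero order_trans real_norm_def)
   then show "onorm ((%h. grad k x \<bullet> h) - (%h. grad k z \<bullet> h)) <= e"
    by (intro onorm_le) (simp add: inner_diff_left)
  qed (use d k in \<open>auto intro: has_derivative_at_withinI C1c_has_derivative\<close>)
  then show ?thesis by (simp add: mult.commute inner_minus_right)
 qed
 then show thesis using that d(1) by blast
qed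

section \<open>Convolution with smooth kernels\<close>

lemma integrable_conv:
 fixes w k :: "'a::euclidean_space => real"
 assumes "integrable lborel w" "k \<in> borel_measurable borel" "!!z. \<bar>k z\<bar> <= B"
 shows "integrable lborel (%y. w y*k (y - x))"
 using assms by (intro integrable_mult_bounded[where B = B]) auto

lemma has_derivative_conv:
 assumes w: "integrable lborel w" and k: "k \<in> C1c Om"
 shows "(conv w k has_derivative (%h. (\<chi> i. - conv w (%z. grad k z$i) x) \<bullet> h)) (at x)"
 unfolding has_derivative_at_alt
proof (intro conjI allI impI)
 show "bounded_linear ((\<bullet>) (\<chi> i. - conv w (%z. grad k z$i) x))" by (rule bounded_linear_inner_right)
 fix e :: real assume "0 < e"
 obtain B where B: "0 < B" "!!x. \<bar>k x\<bar> <= B" "!!x. norm (grad k x) <= B"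
  using C1c_bounded[OF k] by metis
 have Bi: "\<bar>grad k x$i\<bar> <= B" for x i using B(3)[of x] component_le_norm_cart[of "grad k x" i] by linarith
 \<comment> \<open>The accuracy is divided by \<open>W + 1\<close> below because \<open>W\<close>
   itself may vanish.\<close>
 define W where "W = (LBINT y. \<bar>w y\<bar>)"
 have "W >= 0" by (simp add: W_def integral_nonneg_AE)
 have [measurable]: "k \<in> borel_measurable borel" "grad k \<in> borel_measurable borel" using k by (auto intro: C1c_borel)
 have [measurable]: "(%z. grad k z$i) \<in> borel_measurable borel" for i
  using borel_measurable_continuous_onI[OF continuous_on_grad_nth[OF C1c_continuous_grad[OF k]]] by simp
 obtain d where d: "0 < d" "!!z h. norm h < d ==> \<bar>k (z - h) - k z + grad k z \<bullet> h\<bar> <= e/(W + 1)*norm h"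
  using C1c_uniform_linearization[OF k, of "e/(W + 1)"] \<open>0 < e\<close> \<open>W >= 0\<close> by (metis add_nonneg_pos divide_pos_pos zero_less_one)
 show "\<exists>d>0. \<forall>y. norm (y - x) < d -->
   norm (conv w k y - conv w k x - (\<chi> i. - conv w (%z. grad k z$i) x) \<bullet> (y - x)) <= e*norm (y - x)"
 proof (intro exI[of _ d] conjI allI impI)
  fix x' assume x': "norm (x' - x) < d"
  define h where "h = x' - x"
  have ik: "integrable lborel (%y. w y*k (y - x))" for x
   using B by (intro integrable_conv[OF w, where B = B]) auto
  have ig: "integrable lborel (%y. w y*grad k (y - x)$i)" for i x
   using Bi by (intro integrable_conv[OF w, where B = B]) auto
  have gi: "w y*(grad k (y - x) \<bullet> h) = (\<Sum>i\<in>UNIV. h$i*(w y*grad k (y - x)$i))" for y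
   by (simp add: inner_vec_def sum_distrib_left mult_ac)
  have igh: "integrable lborel (%y. w y*(grad k (y - x) \<bullet> h))"
   unfolding gi using ig by (intro Bochner_Integration.integrable_sum integrable_mult_right) auto
  have "(LBINT y. w y*(grad k (y - x) \<bullet> h)) = (\<Sum>i\<in>UNIV. h$i*conv w (%z. grad k z$i) x)"
   unfolding gi conv_def using ig
   by (subst Bochner_Integration.integral_sum) auto
  then have D: "(\<chi> i. - conv w (%z. grad k z$i) x) \<bullet> h = - (LBINT y. w y*(grad k (y - x) \<bullet> h))"
   by (simp add: inner_vec_def sum_negf mult.commute)
  have eq: "conv w k x' = (LBINT y. w y*k ((y - x) - h))" by (simp add: conv_def h_def)
  have ik': "integrable lborel (%y. w y*k ((y - x) - h))" using ik[of x'] by (simp add: h_def)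
  have "conv w k x' - conv w k x - (\<chi> i. - conv w (%z. grad k z$i) x) \<bullet> h =
    (LBINT y. w y*(k ((y - x) - h) - k (y - x) + grad k (y - x) \<bullet> h))"
   unfolding D eq using ik' ik[of x] igh by (simp add: conv_def distrib_left right_diff_distrib)
  also have "norm \<dots> <= (LBINT y. \<bar>w y\<bar>*(e/(W + 1)*norm h))"
  proof (rule order_trans[OF integral_norm_bound integral_mono])
   show "integrable lborel (%y. norm (w y*(k ((y - x) - h) - k (y - x) + grad k (y - x) \<bullet> h)))"
    using ik' ik[of x] igh by (simp add: distrib_left right_diff_distrib)
   show "norm (w y*(k ((y - x) - h) - k (y - x) + grad k (y - x) \<bullet> h)) <= \<bar>w y\<bar>*(e/(W + 1)*norm h)" for y
    unfolding real_norm_def abs_mult using x' by (intro mult_left_mono d) (auto simp: h_def)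
  qed (use w in auto)
  also have "\<dots> = W/(W + 1)*e*norm h" by (simp add: W_def)
  also have "\<dots> <= 1*e*norm h" using \<open>W >= 0\<close> \<open>0 < e\<close> by (intro mult_right_mono) auto
  finally show "norm (conv w k x' - conv w k x - (\<chi> i. - conv w (%z. grad k z$i) x) \<bullet> (x' - x)) <= e*norm (x' - x)"
   by (simp add: h_def)
 qed (use d in auto)
qed

lemma grad_conv:
 assumes "integrable lborel w" "k \<in> C1c Om"
 shows "grad (conv w k) x$i = - conv w (%z. grad k z$i) x"
 using grad_eqI[OF has_derivative_conv[OF assms]] by (simp)

lemma Ck_on_conv:
 assumes "integrable lborel w"
 shows "\<psi> \<in> test_functions Om ==> Ck_on k UNIV (conv w \<psi>)"
proof (induction k arbitrary: \<psi>)
 case 0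
 have "conv w \<psi> differentiable at x" for x
  using has_derivative_conv[OF assms test_functions_C1c[OF 0]] by (auto simp: differentiable_def)
 then show ?case by (auto intro!: continuous_at_imp_continuous_on differentiable_imp_continuous_within)
next
 case (Suc k)
 note D = has_derivative_conv[OF assms test_functions_C1c[OF Suc.prems]]
 have "Ck_on k UNIV (%x. grad (conv w \<psi>) x$i)" for i
  using Ck_on_mult[OF open_UNIV Ck_on_const[of k UNIV "-1"] Suc.IH[OF test_functions_grad[OF Suc.prems]]]
  by (simp add: grad_conv[OF assms test_functions_C1c[OF Suc.prems]])
 moreover have "conv w \<psi> differentiable at x" for x using D by (auto simp: differentiable_def)
 ultimately show ?case by (simp add: Ck_on_Suc_grad)
qed

text \<open>The centre \<open>s\<close> is arbitrary: near the boundary the averages must be taken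
  over balls pushed into the domain.\<close>

definition mollifier :: "real^'n => real => (real^'n => real) => bool" where
 "mollifier s r k \<longleftrightarrow> k \<in> test_functions UNIV \<and> (\<forall>z. 0 <= k z) \<and> (LBINT z. k z) = 1 \<and>
   (\<forall>z. k z ~= 0 --> z \<in> ball s r)"

lemma mollifier_exists:
 fixes s :: "real^'n"
 assumes "0 < r"
 obtains k where "mollifier s r k"
proof -
 define f where "f z = expinv 1 (r^2 - (z - s) \<bullet> (z - s))" for z :: "real^'n"
 have pos: "0 < r^2 - (z - s) \<bullet> (z - s) \<longleftrightarrow> z \<in> ball s r" for z
  using assms power_mono_iff[of r "norm (z - s)" 2]
  by (simp add: dot_square_norm dist_norm norm_minus_commute not_le[symmetric])
 then have f0: "f z ~= 0 \<longleftrightarrow> z \<in> ball s r" and f_nonneg: "0 <= f z" for z by (auto simp: f_def expinv_def)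
 have "Ck_on j UNIV (%z. z \<bullet> b)" for b :: "real^'n" and j
  by (rule Ck_on_bounded_linear) (rule bounded_linear_inner_left)
 from Ck_on_shift[OF this] have "Ck_on j UNIV (%z. (z - s) \<bullet> b)" for b :: "real^'n" and j .
 then have "Ck_on j UNIV (%z. \<Sum>b\<in>Basis. ((z - s) \<bullet> b)*((z - s) \<bullet> b))" for j
  by (intro Ck_on_sum Ck_on_mult) auto
 then have "Ck_on j UNIV (%z. (z - s) \<bullet> (z - s))" for j
  by (subst euclidean_inner) simp
 then have Ck: "Ck_on j UNIV f" for j
  unfolding f_def by (intro Ck_on_expinv Ck_on_diff) auto
 have K: "compact (closure {x. f x ~= 0})" by (simp add: f0 del: mem_ball)
 then have f: "f \<in> test_functions UNIV" using Ck by (simp add: test_functions_def)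
 define c where "c = (LBINT z. f z)"
 have i: "integrable lborel f" using C1c_integrable test_functions_C1c[OF f] by blast
 have "c ~= 0"
 proof
  assume "c = 0"
  then have "AE z in lborel. f z = 0"
   using i f_nonneg unfolding c_def by (subst (asm) integral_nonneg_eq_0_iff_AE) auto
  then have "AE z in lborel. z \<notin> ball s r" by (rule eventually_mono) (use f0 in blast)
  then have "ball s r \<in> null_sets lborel" by (subst AE_iff_null_sets) auto
  then show False using assms content_ball_pos[of r s] by (auto simp: null_sets_def measure_def)
 qed
 moreover have "c >= 0" unfolding c_def using f_nonneg by (intro integral_nonneg_AE) auto
 ultimately have "c > 0" by simp
 have "(%z. 1/c*f z) \<in> test_functions UNIV"
  using Ck_on_mult[OF open_UNIV Ck_on_const[of _ UNIV "1/c"] Ck] K \<open>c > 0\<close>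
  by (simp add: test_functions_def)
 then have "mollifier s r (%z. 1/c*f z)"
  using \<open>c > 0\<close> f_nonneg i by (auto simp: mollifier_def f0 c_def[symmetric])
 then show thesis using that by blast
qed

lemma mollifier_L2:
 fixes w :: "real^'n => real"
 assumes w: "w \<in> borel_measurable borel" "integrable lborel w" "integrable lborel (%x. (w x)^2)"
  and e: "0 < e"
 obtains d where "0 < d"
  "!!s r k. mollifier s r k ==> norm s + r <= d ==> integrable lborel (%x. (conv w k x - w x)^2)"
  "!!s r k. mollifier s r k ==> norm s + r <= d ==> (LBINT x. (conv w k x - w x)^2) <= e"
proof -
 obtain d where d: "0 < d" "!!z. norm z < d ==> (LBINT x. (w (x + z) - w x)^2) < e"
  using L2_translation[OF w(1,3) e] by blast
 have *: "integrable lborel (%x. (conv w k x - w x)^2) \<and> (LBINT x. (conv w k x - w x)^2) <= e"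
  if k: "mollifier s r k" and le: "norm s + r <= d/2" for s r k
 proof -
  have kC: "k \<in> C1c UNIV" using k by (simp add: mollifier_def test_functions_C1c)
  obtain B where B: "!!x. \<bar>k x\<bar> <= B" using C1c_bounded[OF kC] by metis
  have z: "k z = 0" if "d/2 < norm z" for z
  proof -
   have "norm z <= norm s + dist s z" using norm_triangle_sub[of z s] by (simp add: dist_norm norm_minus_commute)
   then show ?thesis using k le that unfolding mollifier_def by force
  qed
  have "(LBINT x. (w (x + z) - w x)^2) <= e" if "norm z <= d/2" for z
   using d(2)[of z] that d(1) by simp
  with conv_L2_close[OF w(1) _ w(2,3), of k B "d/2" e] k kC B z C1c_integrable(1)[OF kC] C1c_borel(1)[OF kC]
  show ?thesis by (auto simp: mollifier_def abs_le_iff)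
 qed
 show thesis by (rule that[of "d/2"]) (use d * in auto)
qed

section \<open>Square integrable functions\<close>

definition L2sq :: "(real^'n) set => (real^'n => 'b::real_normed_vector) => real" where
 "L2sq Om P = (LINT x|lebesgue_on Om. (norm (P x))^2)"

text \<open>Value and gradient in one vector: the squared \<open>H1\<close> norm is
  \<open>L2sq\<close> of the jet, and the weak formulation of a second order equation is the
  integral of a single inner product of jets.\<close>

definition jet :: "(real^'n => real) => real^'n => real \<times> (real^'n)" where
 "jet f x = (f x, grad f x)"

lemma L2sq_nonneg [simp]: "0 <= L2sq Om P"
 by (simp add: L2sq_def integral_nonneg_AE)

lemma norm_add_power2_le:
 fixes a b :: "'b::real_normed_vector"
 shows "(norm (a + b))^2 <= 2*(norm a)^2 + 2*(norm b)^2"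
 using power2_sum2_le[of "norm a" "norm b"] norm_triangle_ineq[of a b]
  power_mono[OF norm_triangle_ineq norm_ge_zero, of a b 2] by linarith

lemma L2_on_add:
 fixes P Q :: "real^'n => 'b::euclidean_space"
 assumes "L2_on Om P" "L2_on Om Q"
 shows "L2_on Om (%x. P x + Q x)" "L2sq Om (%x. P x + Q x) <= 2*L2sq Om P + 2*L2sq Om Q"
proof -
 have [measurable]: "P \<in> borel_measurable (lebesgue_on Om)" "Q \<in> borel_measurable (lebesgue_on Om)"
  using assms by (auto simp: L2_on_def)
 have i: "integrable (lebesgue_on Om) (%x. 2*(norm (P x))^2 + 2*(norm (Q x))^2)"
  using assms by (simp add: L2_on_def)
 show L: "L2_on Om (%x. P x + Q x)"
  unfolding L2_on_def by (intro conjI Bochner_Integration.integrable_bound[OF i])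
   (auto intro!: AE_I2 norm_add_power2_le)
 have "L2sq Om (%x. P x + Q x) <= (LINT x|lebesgue_on Om. 2*(norm (P x))^2 + 2*(norm (Q x))^2)"
  unfolding L2sq_def using L i by (intro integral_mono norm_add_power2_le) (auto simp: L2_on_def)
 also have "\<dots> = 2*L2sq Om P + 2*L2sq Om Q"
  using assms by (simp add: L2_on_def L2sq_def)
 finally show "L2sq Om (%x. P x + Q x) <= 2*L2sq Om P + 2*L2sq Om Q" .
qed

lemma L2_on_scaleR:
 fixes P :: "real^'n => 'b::euclidean_space"
 assumes "L2_on Om P"
 shows "L2_on Om (%x. c *\<^sub>R P x)" "L2sq Om (%x. c *\<^sub>R P x) = c^2*L2sq Om P"
 using assms by (auto simp: L2_on_def L2sq_def power_mult_distrib)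

lemma L2_on_diff:
 fixes P Q :: "real^'n => 'b::euclidean_space"
 assumes "L2_on Om P" "L2_on Om Q"
 shows "L2_on Om (%x. P x - Q x)" "L2sq Om (%x. P x - Q x) <= 2*L2sq Om P + 2*L2sq Om Q"
 using L2_on_add[OF assms(1) L2_on_scaleR(1)[OF assms(2), of "-1"]] L2_on_scaleR(2)[OF assms(2), of "-1"]
 by simp_all

lemma L2_on_inner_integrable:
 fixes P Q :: "real^'n => 'b::euclidean_space"
 assumes "L2_on Om P" "L2_on Om Q"
 shows "integrable (lebesgue_on Om) (%x. P x \<bullet> Q x)"
proof (rule Bochner_Integration.integrable_bound)
 show "integrable (lebesgue_on Om) (%x. (norm (P x))^2 + (norm (Q x))^2)"
  using assms by (simp add: L2_on_def)
 show "(%x. P x \<bullet> Q x) \<in> borel_measurable (lebesgue_on Om)"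
  using assms by (auto simp: L2_on_def)
 show "AE x in lebesgue_on Om. norm (P x \<bullet> Q x) <= norm ((norm (P x))^2 + (norm (Q x))^2)"
 proof (rule AE_I2)
  fix x
  have "\<bar>P x \<bullet> Q x\<bar> <= norm (P x)*norm (Q x)" by (rule Cauchy_Schwarz_ineq2)
  also have "\<dots> <= (norm (P x))^2 + (norm (Q x))^2"
   using sum_squares_bound[of "norm (P x)" "norm (Q x)"] mult_nonneg_nonneg[OF norm_ge_zero norm_ge_zero, of "P x" "Q x"] by linarith
  finally show "norm (P x \<bullet> Q x) <= norm ((norm (P x))^2 + (norm (Q x))^2)" by simp
 qed
qed

text \<open>The common core of the Cauchy-Schwarz inequalities below, including forms that are only
  semidefinite; hence the separate case of a vanishing leading coefficient.\<close>

lemma quadratic_nonneg_discriminant: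
 fixes a b c :: real
 assumes "!!t. 0 <= a + 2*t*b + t^2*c" "0 <= a" "0 <= c"
 shows "\<bar>b\<bar> <= sqrt a * sqrt c"
proof -
 have "b^2 <= a*c"
 proof (cases "c = 0")
  case True
  have "b = 0"
  proof (rule ccontr)
   assume "b ~= 0"
   \<comment> \<open>At this \<open>t\<close> the affine function takes the value - 1.\<close>
   have "0 <= a + 2*(- (a + 1)/(2*b))*b" using assms(1)[of "- (a + 1)/(2*b)"] True by simp
   then show False using \<open>b ~= 0\<close> by (simp add: field_simps)
  qed
  then show ?thesis using True by simp
 next
  case False
  then have c: "c > 0" using assms by simp
  have "0 <= c*(a + 2*(- b/c)*b + (- b/c)^2*c)" using assms(1)[of "- b/c"] c by simp
  also have "\<dots> = a*c - b^2" using c by (simp add: field_simps power2_eq_square)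
  finally show ?thesis by simp
 qed
 then have "sqrt (b^2) <= sqrt (a*c)" by (rule real_sqrt_le_mono)
 then show ?thesis by (simp add: real_sqrt_mult)
qed

lemma L2_Cauchy_Schwarz:
 fixes P Q :: "real^'n => 'b::euclidean_space"
 assumes "L2_on Om P" "L2_on Om Q"
 shows "\<bar>LINT x|lebesgue_on Om. P x \<bullet> Q x\<bar> <= sqrt (L2sq Om P) * sqrt (L2sq Om Q)"
proof (rule quadratic_nonneg_discriminant)
 fix t :: real
 have "0 <= L2sq Om (%x. P x + t *\<^sub>R Q x)" by simp
 also have "\<dots> = (LINT x|lebesgue_on Om. (norm (P x))^2 + 2*t*(P x \<bullet> Q x) + t^2*(norm (Q x))^2)"
  unfolding L2sq_def power2_norm_eq_inner
  by (simp add: inner_add_left inner_add_right inner_commute power2_eq_square algebra_simps)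
 also have "\<dots> = L2sq Om P + 2*t*(LINT x|lebesgue_on Om. P x \<bullet> Q x) + t^2*L2sq Om Q"
  using assms L2_on_inner_integrable[OF assms] by (simp add: L2_on_def L2sq_def)
 finally show "0 <= L2sq Om P + 2*t*(LINT x|lebesgue_on Om. P x \<bullet> Q x) + t^2*L2sq Om Q" .
qed auto

lemma open_bounded_lmeasurable: "open Om ==> bounded Om ==> Om \<in> lmeasurable"
 by (simp add: lmeasurable_open)

lemma integrable_lebesgue_on_const:
 assumes "open Om" "bounded Om"
 shows "integrable (lebesgue_on Om) (%x. c)"
proof -
 have "emeasure (lebesgue_on Om) (space (lebesgue_on Om)) < \<infinity>"
  using open_bounded_lmeasurable[OF assms]
  by (simp add: emeasure_restrict_space space_restrict_space fmeasurable_def del: emeasure_completion)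
 then interpret finite_measure "lebesgue_on Om" by (intro finite_measureI) auto
 show ?thesis by simp
qed

lemma integrable_lebesgue_on_bounded:
 fixes f :: "real^'n => 'b::euclidean_space"
 assumes "open Om" "bounded Om" "f \<in> borel_measurable (lebesgue_on Om)" "!!x. x \<in> Om ==> norm (f x) <= B"
 shows "integrable (lebesgue_on Om) f"
 by (rule Bochner_Integration.integrable_bound[OF integrable_lebesgue_on_const[OF assms(1,2), of B] assms(3)])
  (use assms in \<open>auto intro!: AE_I2 order_trans[OF _ abs_ge_self]\<close>)

lemma measurable_lebesgue_on_continuous:
 fixes f :: "real^'n => 'b::euclidean_space"
 shows "open Om ==> continuous_on Om f ==> f \<in> borel_measurable (lebesgue_on Om)"
 by (intro continuous_imp_measurable_on_sets_lebesgue) auto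

lemma L2_on_bounded:
 fixes f :: "real^'n => 'b::euclidean_space"
 assumes "open Om" "bounded Om" "f \<in> borel_measurable (lebesgue_on Om)" "!!x. x \<in> Om ==> norm (f x) <= B"
 shows "L2_on Om f"
 unfolding L2_on_def using assms
 by (intro conjI integrable_lebesgue_on_bounded[where B = "B^2"]) (auto intro!: power_mono)

lemma L2_on_jet_iff:
 fixes v :: "real^'n => real"
 shows "L2_on Om (%x. (v x, G x)) \<longleftrightarrow> L2_on Om v \<and> L2_on Om (G :: real^'n => real^'n)"
  and "L2_on Om v ==> L2_on Om G ==> L2sq Om (%x. (v x, G x)) = L2sq Om v + L2sq Om G"
proof -
 have n: "(norm (a, b))^2 = (norm a)^2 + (norm b)^2" for a :: real and b :: "real^'n"
  by (simp add: norm_Pair)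
 show "L2_on Om (%x. (v x, G x)) \<longleftrightarrow> L2_on Om v \<and> L2_on Om G"
 proof
  assume L: "L2_on Om (%x. (v x, G x))"
  then have m: "(%x. (v x, G x)) \<in> borel_measurable (lebesgue_on Om)"
   and i: "integrable (lebesgue_on Om) (%x. (norm (v x))^2 + (norm (G x))^2)"
   by (auto simp: L2_on_def n)
  have "v \<in> borel_measurable (lebesgue_on Om)" "G \<in> borel_measurable (lebesgue_on Om)"
   using measurable_compose[OF m borel_measurable_continuous_onI[of fst]]
    measurable_compose[OF m borel_measurable_continuous_onI[of snd]]
   by (simp_all add: continuous_on_fst continuous_on_snd)
  then show "L2_on Om v \<and> L2_on Om G"
   unfolding L2_on_def by (auto intro!: Bochner_Integration.integrable_bound[OF i])
 next
  assume "L2_on Om v \<and> L2_on Om G"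
  then show "L2_on Om (%x. (v x, G x))" by (auto simp: L2_on_def n)
 qed
 show "L2_on Om v ==> L2_on Om G ==> L2sq Om (%x. (v x, G x)) = L2sq Om v + L2sq Om G"
  by (simp add: L2_on_def L2sq_def n)
qed

lemma L2_on_fst_snd:
 fixes P :: "real^'n => real \<times> (real^'n)"
 assumes "L2_on Om P"
 shows "L2_on Om (%x. fst (P x))" "L2_on Om (%x. snd (P x))"
 using assms L2_on_jet_iff(1)[of Om "%x. fst (P x)" "%x. snd (P x)"] by auto

section \<open>Borel representatives\<close>

lemma lebesgue_on_borel:
 fixes f :: "real^'n => 'b::{banach, second_countable_topology}"
 assumes "open Om" "f \<in> borel_measurable borel" "!!x. x \<notin> Om ==> f x = 0"
 shows "(LINT x|lebesgue_on Om. f x) = (LBINT x. f x)"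
  and "integrable (lebesgue_on Om) f \<longleftrightarrow> integrable lborel f"
proof -
 have Om: "Om \<inter> space lebesgue \<in> sets lebesgue" using assms(1) by auto
 have eq: "(%x. indicator Om x *\<^sub>R f x) = f" using assms(3) by (auto split: split_indicator)
 show "(LINT x|lebesgue_on Om. f x) = (LBINT x. f x)"
  unfolding integral_restrict_space[OF Om] eq using assms(2) by (simp add: integral_completion)
 show "integrable (lebesgue_on Om) f \<longleftrightarrow> integrable lborel f"
  unfolding integrable_restrict_space[OF Om] eq using assms(2) by (simp add: integrable_completion)
qed

text \<open>Elements of \<open>H1\<close> are Lebesgue measurable on \<open>Om\<close> only. A Borel
  version, zero outside \<open>Om\<close>, can be translated, convolved and integrated over the
  whole space.\<close>

definition borel_rep :: "(real^'n) set => (real^'n => real) => (real^'n => real) => bool" where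
 "borel_rep Om f f' \<longleftrightarrow> f' \<in> borel_measurable borel \<and> (\<forall>x. x \<notin> Om --> f' x = 0) \<and>
   (AE x in lebesgue_on Om. f' x = f x)"

lemma borel_rep_exists:
 assumes Om: "open Om" and f: "f \<in> borel_measurable (lebesgue_on Om)"
 obtains f' where "borel_rep Om f f'"
proof -
 have S: "Om \<in> sets lebesgue" using Om by auto
 have "(%x. if x \<in> Om then f x else 0) \<in> borel_measurable lebesgue"
  using borel_measurable_if[OF S] f by blast
 then obtain g where g: "g \<in> borel_measurable lborel" "AE x in lborel. (if x \<in> Om then f x else 0) = g x"
  using completion_ex_borel_measurable_real by blast
 have [measurable]: "Om \<in> sets borel" "g \<in> borel_measurable borel" using Om g by auto
 have "AE x in lebesgue. (if x \<in> Om then f x else 0) = g x" using g(2) by (rule AE_completion)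
 then have "AE x in lebesgue_on Om. indicator Om x*g x = f x"
  using S by (subst AE_restrict_space_iff) (auto elim: eventually_mono)
 then have "borel_rep Om f (%x. indicator Om x*g x)"
  by (auto simp: borel_rep_def)
 then show thesis using that by blast
qed

lemma borel_rep_integral:
 assumes "open Om" "f \<in> borel_measurable (lebesgue_on Om)" "borel_rep Om f f'" "g \<in> borel_measurable borel"
 shows "(LINT x|lebesgue_on Om. f x*g x) = (LBINT x. f' x*g x)"
  and "integrable (lebesgue_on Om) (%x. f x*g x) \<longleftrightarrow> integrable lborel (%x. f' x*g x)"
proof -
 have f'[measurable]: "f' \<in> borel_measurable borel" and [measurable]: "g \<in> borel_measurable borel"
  using assms by (auto simp: borel_rep_def)
 have g': "g \<in> borel_measurable (lebesgue_on Om)" "f' \<in> borel_measurable (lebesgue_on Om)"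
  by (intro measurable_restrict_space1 measurable_completion, simp)+
 have ae: "AE x in lebesgue_on Om. f x*g x = f' x*g x"
  using assms(3) unfolding borel_rep_def by (auto elim: eventually_mono)
 show "(LINT x|lebesgue_on Om. f x*g x) = (LBINT x. f' x*g x)"
  using lebesgue_on_borel(1)[OF assms(1), of "%x. f' x*g x"] assms(3)
   integral_cong_AE[OF _ _ ae] assms(2) g' by (auto simp: borel_rep_def)
 show "integrable (lebesgue_on Om) (%x. f x*g x) \<longleftrightarrow> integrable lborel (%x. f' x*g x)"
  using lebesgue_on_borel(2)[OF assms(1), of "%x. f' x*g x"] assms(3)
   integrable_cong_AE[OF _ _ ae] assms(2) g' by (auto simp: borel_rep_def)
qed

lemma borel_rep_L2:
 assumes Om: "open Om" "bounded Om" and f: "L2_on Om f" "borel_rep Om f f'"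
 shows "integrable lborel f'" "integrable lborel (%x. (f' x)^2)"
proof -
 have m: "f \<in> borel_measurable (lebesgue_on Om)" "f' \<in> borel_measurable borel" using f by (auto simp: L2_on_def borel_rep_def)
 have m': "f' \<in> borel_measurable (lebesgue_on Om)"
  using m(2) by (intro measurable_restrict_space1 measurable_completion) simp
 have "AE x in lebesgue_on Om. (norm (f x))^2 = (f' x)^2"
  using f(2) unfolding borel_rep_def by (auto elim: eventually_mono)
 from integrable_cong_AE[OF _ _ this] have "integrable (lebesgue_on Om) (%x. (f' x)^2)"
  using f(1) m m' by (simp add: L2_on_def)
 then show i2: "integrable lborel (%x. (f' x)^2)"
  using lebesgue_on_borel(2)[OF Om(1), of "%x. (f' x)^2"] f(2) m by (simp add: borel_rep_def)
 \<comment> \<open>On \<open>Om\<close> the modulus of \<open>f'\<close> is at most its square plus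
   1, and \<open>Om\<close> has finite measure.\<close>
 have "integrable lborel (%x. (f' x)^2 + indicator Om x)"
  using i2 Om emeasure_bounded_finite[OF Om(2)] by (intro Bochner_Integration.integrable_add) auto
 then show "integrable lborel f'"
 proof (rule Bochner_Integration.integrable_bound)
  show "AE x in lborel. norm (f' x) <= norm ((f' x)^2 + indicator Om x)"
  proof (rule AE_I2)
   fix x
   show "norm (f' x) <= norm ((f' x)^2 + indicator Om x)"
   proof (cases "x \<in> Om")
    case True
    have "0 <= (\<bar>f' x\<bar> - 1)^2" by simp
    then have "2*\<bar>f' x\<bar> <= (f' x)^2 + 1" by (simp add: power2_diff)
    then show ?thesis using True by simp
   qed (use f in \<open>auto simp: borel_rep_def\<close>)
  qed
 qed (use m in auto)
qed

section \<open>Weak gradients\<close>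

lemma Ck_on_Un:
 assumes "open U" "open V" "Ck_on k U f" "Ck_on k V f"
 shows "Ck_on k (U \<union> V) f"
 using assms unfolding Ck_on_def by (auto intro: continuous_on_open_Un)

text \<open>The product is \<open>C^1\<close> on \<open>Om\<close> and zero on the complement of the
  support of \<psi>; these two open sets cover the space.\<close>

lemma C1c_mult:
 assumes Om: "open Om" and \<psi>: "\<psi> \<in> C1c Om" and v: "Ck_on (Suc 0) Om v"
 shows "(%x. \<psi> x * v x) \<in> C1c Om"
  and "x \<in> Om ==> grad (%x. \<psi> x * v x) x = \<psi> x *\<^sub>R grad v x + v x *\<^sub>R grad \<psi> x"
proof -
 define S where "S = closure {x. \<psi> x ~= 0}"
 have S: "S \<subseteq> Om" "compact S" using \<psi> by (auto simp: C1c_def S_def)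
 have z: "\<psi> x = 0" if "x \<notin> S" for x
  using that unfolding S_def by (rule grad_zero_outside)
 have Scl: "closed S" by (simp add: S_def)
 have "Ck_on (Suc 0) Om (%x. \<psi> x * v x)"
  using \<psi> v by (intro Ck_on_mult[OF Om]) (auto simp: C1c_def intro: Ck_on_subset)
 moreover have "Ck_on (Suc 0) (- S) (%x. \<psi> x * v x)"
  using Ck_on_cong[of "- S" "%x. \<psi> x * v x" "%x. 0" "Suc 0"] z Scl by (simp add: open_Compl)
 ultimately have "Ck_on (Suc 0) (Om \<union> - S) (%x. \<psi> x * v x)"
  using Scl by (intro Ck_on_Un Om) auto
 moreover have "Om \<union> - S = UNIV" using S by auto
 moreover have sub: "{x. \<psi> x * v x ~= 0} \<subseteq> S" using z by force
 then have "closure {x. \<psi> x * v x ~= 0} \<subseteq> S" using Scl by (rule closure_minimal)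
 moreover have "bounded {x. \<psi> x * v x ~= 0}"
  using bounded_subset[OF compact_imp_bounded[OF S(2)] sub] .
 ultimately show "(%x. \<psi> x * v x) \<in> C1c Om" using S by (auto simp: C1c_def)
 assume "x \<in> Om"
 then have "(v has_derivative (%h. grad v x \<bullet> h)) (at x)" using v by (intro has_derivative_grad) (simp add: Ck_on_1)
 then show "grad (%x. \<psi> x * v x) x = \<psi> x *\<^sub>R grad v x + v x *\<^sub>R grad \<psi> x"
  by (intro grad_eqI) (auto intro!: derivative_eq_intros C1c_has_derivative[OF \<psi>] simp: inner_add_left)
qed

text \<open>The convolution of \<open>f\<close> with the indicator of a large ball equals the
  integral of \<open>f\<close> near the origin, hence is constant there. Its partial derivative at 0
  is minus the integral in question.\<close>

lemma integral_grad_C1c: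
 assumes f: "f \<in> C1c Om"
 shows "(LBINT x. grad f x$i) = 0"
proof -
 define S where "S = closure {x. f x ~= 0}"
 have "bounded S" using f by (auto simp: C1c_def S_def intro: compact_imp_bounded)
 then obtain r where r: "S \<subseteq> ball 0 r" by (metis bounded_subset_ballD)
 define w where "w = indicat_real (ball (0 :: real^'a) (r + 1))"
 have w: "integrable lborel w"
  unfolding w_def using emeasure_bounded_finite[of "ball (0 :: real^'a) (r + 1)"] by (auto intro!: integrable_real_indicator)
 have [measurable]: "f \<in> borel_measurable borel" using C1c_borel[OF f] by simp
 have "conv w f x = (LBINT z. f z)" if "x \<in> ball 0 1" for x
 proof -
  have "conv w f x = (LBINT z. w (x + z)*f z)" by (rule conv_alt) (auto simp: w_def intro!: borel_measurable_indicator)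
  also have "\<dots> = (LBINT z. f z)"
  proof (rule Bochner_Integration.integral_cong)
   fix z
   show "w (x + z)*f z = f z"
   proof (cases "z \<in> S")
    case True
    then have "norm (x + z) < r + 1" using r that norm_triangle_ineq[of x z] by fastforce
    then show ?thesis by (simp add: w_def)
   qed (use grad_zero_outside(1)[of z f] in \<open>simp add: S_def\<close>)
  qed simp
  finally show ?thesis .
 qed
 then have "grad (conv w f) 0 = grad (%x. \<integral>z. f z \<partial>lborel) (0 :: real^'a)"
  by (intro grad_cong_open[of "ball 0 1"]) auto
 also have "\<dots> = 0" by (rule grad_eqI) simp
 finally have "conv w (%z. grad f z$i) 0 = 0"
  using grad_conv[OF w f, of 0 i] by simp
 moreover have "conv w (%z. grad f z$i) 0 = (LBINT z. grad f z$i)"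
  unfolding conv_def
 proof (rule Bochner_Integration.integral_cong)
  fix z
  show "w z*grad f (z - 0)$i = grad f z$i"
  proof (cases "z \<in> S")
   case True
   then show ?thesis using r by (auto simp: w_def)
  qed (use grad_zero_outside(2)[of z f] in \<open>simp add: S_def\<close>)
 qed simp
 ultimately show ?thesis by simp
qed

lemma integral_grad_C1c_lebesgue_on:
 assumes "open Om" "f \<in> C1c Om"
 shows "(LINT x|lebesgue_on Om. grad f x$i) = 0"
 using lebesgue_on_borel(1)[OF assms(1) borel_measurable_integrable[OF C1c_integrable(2)[OF assms(2), of i], simplified]]
  integral_grad_C1c[OF assms(2), of i] C1c_zero_outside(2)[OF assms(2)] by simp

lemma C1_bounded_L2:
 assumes Om: "open Om" "bounded Om" and v: "Ck_on (Suc 0) Om v"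
  and B: "!!x. x \<in> Om ==> \<bar>v x\<bar> <= B" "!!x. x \<in> Om ==> norm (grad v x) <= B"
 shows "L2_on Om v" "L2_on Om (grad v)" "L2_on Om (jet v)"
proof -
 show "L2_on Om v"
  using v B by (intro L2_on_bounded[OF Om, where B = B] measurable_lebesgue_on_continuous[OF Om(1)])
   (auto intro: Ck_on_imp_continuous_on)
 moreover show "L2_on Om (grad v)"
  using v B by (intro L2_on_bounded[OF Om, where B = B] measurable_lebesgue_on_continuous[OF Om(1)])
   (auto simp: Ck_on_1)
 ultimately show "L2_on Om (jet v)" using L2_on_jet_iff(1)[of Om v "grad v"] by (simp add: jet_def[abs_def])
qed

lemma C1c_L2:
 assumes Om: "open Om" "bounded Om" and v: "v \<in> C1c Om'"
 shows "L2_on Om v" "L2_on Om (grad v)" "L2_on Om (jet v)"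
proof -
 obtain B where "!!x. \<bar>v x\<bar> <= B" "!!x. norm (grad v x) <= B" using C1c_bounded[OF v] by metis
 then show "L2_on Om v" "L2_on Om (grad v)" "L2_on Om (jet v)"
  using C1_bounded_L2[OF Om, of v B] v Ck_on_subset[of _ UNIV v Om] by (auto simp: C1c_def)
qed

lemma L2_on_nth:
 fixes G :: "real^'n => real^'m"
 assumes L: "L2_on Om G"
 shows "L2_on Om (%x. G x$i)"
 unfolding L2_on_def
proof
 show m: "(%x. G x$i) \<in> borel_measurable (lebesgue_on Om)"
  using L measurable_compose[OF _ borel_measurable_continuous_onI[OF continuous_on_component[OF continuous_on_id]], of G]
  by (auto simp: L2_on_def)
 have "integrable (lebesgue_on Om) (%x. (norm (G x))^2)" using L by (simp add: L2_on_def)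
 then show "integrable (lebesgue_on Om) (%x. (norm (G x$i))^2)"
 proof (rule Bochner_Integration.integrable_bound)
  show "AE x in lebesgue_on Om. norm ((norm (G x$i))^2) <= norm ((norm (G x))^2)"
   using component_le_norm_cart[of "G _" i] by (auto intro!: AE_I2 simp: abs_le_square_iff[symmetric])
 qed (use m in measurable)
qed

lemma L2_on_mult_integrable:
 fixes f g :: "real^'n => real"
 shows "L2_on Om f ==> L2_on Om g ==> integrable (lebesgue_on Om) (%x. f x*g x)"
 using L2_on_inner_integrable[of Om f g] by simp

lemma C1_bounded_weak_grad:
 assumes Om: "open Om" "bounded Om" and v: "Ck_on (Suc 0) Om v"
  and B: "!!x. x \<in> Om ==> \<bar>v x\<bar> <= B" "!!x. x \<in> Om ==> norm (grad v x) <= B"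
 shows "is_weak_grad Om v (grad v)"
 unfolding is_weak_grad_def
proof (intro conjI ballI allI)
 note L = C1_bounded_L2[OF Om v B]
 show "L2_on Om (grad v)" by (rule L)
 fix \<psi> i assume "\<psi> \<in> test_functions Om"
 then have \<psi>: "\<psi> \<in> C1c Om" by (rule test_functions_C1c)
 note L\<psi> = C1c_L2[OF Om \<psi>]
 have "0 = (LINT x|lebesgue_on Om. grad (%x. \<psi> x * v x) x$i)"
  using integral_grad_C1c_lebesgue_on[OF Om(1) C1c_mult(1)[OF Om(1) \<psi> v]] by simp
 also have "\<dots> = (LINT x|lebesgue_on Om. v x*grad \<psi> x$i + grad v x$i*\<psi> x)"
  by (rule Bochner_Integration.integral_cong) (auto simp: C1c_mult(2)[OF Om(1) \<psi> v])
 also have "\<dots> = (LINT x|lebesgue_on Om. v x*grad \<psi> x$i) + (LINT x|lebesgue_on Om. grad v x$i*\<psi> x)"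
  using L L\<psi> by (intro Bochner_Integration.integral_add L2_on_mult_integrable L2_on_nth) auto
 finally show "(LINT x|lebesgue_on Om. v x*grad \<psi> x$i) = - (LINT x|lebesgue_on Om. grad v x$i*\<psi> x)"
  by simp
qed

lemma is_weak_grad_diff:
 assumes Om: "open Om" "bounded Om" and "L2_on Om v" "L2_on Om w" "is_weak_grad Om v G" "is_weak_grad Om w H"
 shows "is_weak_grad Om (%x. v x - w x) (%x. G x - H x)"
 unfolding is_weak_grad_def
proof (intro conjI ballI allI)
 have G: "L2_on Om G" "L2_on Om H" using assms by (auto simp: is_weak_grad_def)
 then show "L2_on Om (%x. G x - H x)" by (rule L2_on_diff)
 fix \<psi> i assume \<psi>: "\<psi> \<in> test_functions Om"
 note L = C1c_L2[OF Om test_functions_C1c[OF \<psi>]]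
 show "(LINT x|lebesgue_on Om. (v x - w x)*grad \<psi> x$i) = - (LINT x|lebesgue_on Om. (G x - H x)$i*\<psi> x)"
  using assms \<psi> L G L2_on_nth[OF L(2)] L2_on_nth[OF G(1)] L2_on_nth[OF G(2)]
  by (simp add: is_weak_grad_def left_diff_distrib Bochner_Integration.integral_diff L2_on_mult_integrable)
qed

lemma mollifier_shift_test:
 assumes k: "mollifier s r k" and "cball (x + s) r \<subseteq> Om"
 shows "(%y. k (y - x)) \<in> test_functions Om"
proof -
 have sub: "{y. k (y - x) ~= 0} \<subseteq> cball (x + s) r"
 proof
  fix y assume "y \<in> {y. k (y - x) ~= 0}"
  then have "y - x \<in> ball s r" using k by (auto simp: mollifier_def)
  then show "y \<in> cball (x + s) r" by (simp add: dist_norm algebra_simps)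
 qed
 then have "closure {y. k (y - x) ~= 0} \<subseteq> cball (x + s) r" by (intro closure_minimal) auto
 moreover have "bounded {y. k (y - x) ~= 0}" by (rule bounded_subset[OF bounded_cball sub])
 moreover have "Ck_on j UNIV (%y. k (y - x))" for j
  using k by (intro Ck_on_shift) (auto simp: mollifier_def test_functions_def)
 ultimately show ?thesis using assms(2) by (auto simp: test_functions_def)
qed

text \<open>At distance more than \<open>r0\<close> from the complement, the translates of a kernel
  of small radius are test functions, so the mollifications of \<open>f\<close> vanish there. They
  are \<open>L2\<close>-close to \<open>f\<close>, so \<open>f\<close> vanishes there too, and
  \<open>r0\<close> runs through a null sequence.\<close>

lemma fundamental_lemma:
 fixes f :: "real^'n => real"
 assumes Om: "open Om" "bounded Om" and f: "L2_on Om f"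
  and 0: "!!\<psi>. \<psi> \<in> test_functions Om ==> (LINT x|lebesgue_on Om. f x*\<psi> x) = 0"
 shows "AE x in lebesgue_on Om. f x = 0"
proof -
 have fm: "f \<in> borel_measurable (lebesgue_on Om)" using f by (simp add: L2_on_def)
 then obtain g where g: "borel_rep Om f g" using borel_rep_exists[OF Om(1)] by blast
 then have gm[measurable]: "g \<in> borel_measurable borel" by (simp add: borel_rep_def)
 note gi = borel_rep_L2[OF Om f g]
 define d where "d x = infdist x (- Om)" for x
 have ne: "- Om ~= {}" using Om(2) by (metis Compl_empty_eq not_bounded_UNIV double_complement)
 have [measurable]: "{x. r < d x} \<in> sets borel" for r
  unfolding d_def by (intro borel_open open_Collect_less continuous_intros)
 have ball: "cball x r \<subseteq> Om" if "r < d x" for x r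
 proof
  fix y assume "y \<in> cball x r"
  then show "y \<in> Om" using infdist_le[of y "- Om" x] that by (force simp: d_def)
 qed
 have g0: "AE x in lborel. d x > r0 --> g x = 0" if "0 < r0" for r0
 proof -
  let ?h = "%x. indicator {x. r0 < d x} x*(g x)^2"
  have i: "integrable lborel ?h"
   by (rule Bochner_Integration.integrable_bound[OF gi(2)]) (auto split: split_indicator)
  have "(LBINT x. ?h x) <= e" if "0 < e" for e
  proof -
   obtain r where r: "0 < r"
    "!!s r' (k :: real^'n => real). mollifier s r' k ==> norm s + r' <= r ==> integrable lborel (%x. (conv g k x - g x)^2)"
    "!!s r' (k :: real^'n => real). mollifier s r' k ==> norm s + r' <= r ==> (LBINT x. (conv g k x - g x)^2) <= e"
    using mollifier_L2[OF gm gi \<open>0 < e\<close>] by blast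
   obtain k where k: "mollifier (0 :: real^'n) (min r r0) k" using mollifier_exists[of "min r r0"] r \<open>0 < r0\<close> by auto
   have "conv g k x = 0" if "r0 < d x" for x
   proof -
    have "(%y. k (y - x)) \<in> test_functions Om"
     using ball[of "min r r0" x] that by (intro mollifier_shift_test[OF k]) auto
    from 0[OF this] C1c_borel(1)[OF test_functions_C1c[OF this]] show ?thesis
     using borel_rep_integral(1)[OF Om(1) fm g] by (simp add: conv_def)
   qed
   then have "?h x <= (conv g k x - g x)^2" for x by (auto split: split_indicator)
   then have "(LBINT x. ?h x) <= (LBINT x. (conv g k x - g x)^2)"
    using i r(2)[OF k] by (intro integral_mono) auto
   also have "\<dots> <= e" using r(3)[OF k] by simp
   finally show ?thesis .
  qed
  then have "(LBINT x. ?h x) <= 0" by (meson dense_ge)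
  then have "(LBINT x. ?h x) = 0" by (intro antisym integral_nonneg_AE) auto
  then have "AE x in lborel. ?h x = 0"
   using i by (subst (asm) integral_nonneg_eq_0_iff_AE) auto
  then show ?thesis by (rule eventually_mono) (auto split: split_indicator_asm)
 qed
 then have "AE x in lborel. \<forall>n. d x > 1/real (Suc n) --> g x = 0"
  unfolding AE_all_countable by (intro allI g0) simp
 then have "AE x in lborel. g x = 0"
 proof (rule eventually_mono)
  fix x assume *: "\<forall>n. d x > 1/real (Suc n) --> g x = 0"
  show "g x = 0"
  proof (cases "x \<in> Om")
   case True
   then have "d x > 0" unfolding d_def using Om(1) ne by (intro infdist_pos_not_in_closed) auto
   then obtain n where "1/real (Suc n) < d x" using nat_approx_posE by blast
   then show ?thesis using * by blast
  qed (use g in \<open>auto simp: borel_rep_def\<close>)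
 qed
 then have "AE x in lebesgue. g x = 0" by (rule AE_completion)
 then have "AE x in lebesgue_on Om. g x = 0"
  using Om(1) by (subst AE_restrict_space_iff) (auto elim: eventually_mono)
 then show ?thesis using g unfolding borel_rep_def by (auto elim: eventually_elim2)
qed

lemma weak_grad_unique:
 assumes Om: "open Om" "bounded Om" and "is_weak_grad Om v G" "is_weak_grad Om v H"
 shows "AE x in lebesgue_on Om. G x = H x"
proof -
 have G: "L2_on Om G" "L2_on Om H" using assms by (auto simp: is_weak_grad_def)
 have "AE x in lebesgue_on Om. G x$i - H x$i = 0" for i
 proof (rule fundamental_lemma[OF Om])
  show "L2_on Om (%x. G x$i - H x$i)" using G by (intro L2_on_diff L2_on_nth)
  fix \<psi> assume \<psi>: "\<psi> \<in> test_functions Om"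
  note L = C1c_L2(1)[OF Om test_functions_C1c[OF \<psi>]]
  show "(LINT x|lebesgue_on Om. (G x$i - H x$i)*\<psi> x) = 0"
   using assms \<psi> L L2_on_nth[OF G(1)] L2_on_nth[OF G(2)]
   by (simp add: is_weak_grad_def left_diff_distrib Bochner_Integration.integral_diff L2_on_mult_integrable)
 qed
 then have "AE x in lebesgue_on Om. \<forall>i\<in>UNIV. G x$i - H x$i = 0"
  by (subst AE_finite_all) auto
 then show ?thesis by (rule eventually_mono) (simp add: vec_eq_iff)
qed

lemma wgrad_is_weak_grad: "v \<in> H1 Om ==> is_weak_grad Om v (wgrad Om v)"
 unfolding H1_def wgrad_def using someI[of "is_weak_grad Om v"] by blast

lemma wgrad_AE:
 assumes "open Om" "bounded Om" "is_weak_grad Om v G"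
 shows "AE x in lebesgue_on Om. wgrad Om v x = G x"
 using weak_grad_unique[OF assms(1,2) _ assms(3)] someI[of "is_weak_grad Om v", OF assms(3)]
 by (simp add: wgrad_def)

section \<open>Functions vanishing on the boundary\<close>

lemma bounded_Compl_nonempty:
 fixes Om :: "(real^'n) set"
 shows "bounded Om ==> - Om ~= {}"
 by (metis Compl_empty_eq not_bounded_UNIV double_complement)

lemma infdist_Compl_pos_iff:
 fixes Om :: "(real^'n) set"
 assumes "open Om" "bounded Om"
 shows "0 < infdist x (- Om) \<longleftrightarrow> x \<in> Om"
proof -
 have "infdist x (- Om) = 0 \<longleftrightarrow> x \<in> - Om"
  using assms bounded_Compl_nonempty by (intro in_closed_iff_infdist_zero[symmetric]) auto
 then show ?thesis using infdist_nonneg[of x "- Om"] by auto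
qed

lemma ball_infdist_Compl_subset: "ball x (infdist x (- Om)) \<subseteq> Om"
proof
 fix y assume y: "y \<in> ball x (infdist x (- Om))"
 show "y \<in> Om"
 proof (rule ccontr)
  assume "y \<notin> Om"
  then have "infdist x (- Om) <= dist x y" by (intro infdist_le) auto
  then show False using y by simp
 qed
qed

text \<open>The open ball of radius \<open>infdist x (- Om)\<close> lies in \<open>Om\<close>, and
  its closure contains a boundary point nearest to \<open>x\<close>. The mean value inequality on
  this ball extends to that point, where \<open>f\<close> is 0; the regularity of the boundary does
  not enter.\<close>

lemma zero_boundary_bound:
 assumes Om: "open Om" "bounded Om" and f: "!!x. x \<in> Om ==> f differentiable at x"
  and K: "!!x. x \<in> Om ==> norm (grad f x) <= K"
  and cont: "continuous_on (closure Om) f" and 0: "!!x. x \<in> frontier Om ==> f x = 0"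
  and x: "x \<in> Om"
 shows "\<bar>f x\<bar> <= K*infdist x (- Om)"
proof -
 define d where "d = infdist x (- Om)"
 have d: "0 < d" using infdist_Compl_pos_iff[OF Om, of x] x by (simp add: d_def)
 have sub: "ball x d \<subseteq> Om" unfolding d_def by (rule ball_infdist_Compl_subset)
 obtain y where y: "y \<in> - Om" "d = dist x y"
  using infdist_attains_inf[of "- Om" x] Om(1) bounded_Compl_nonempty[OF Om(2)] by (auto simp: d_def)
 have cl: "closure (ball x d) = cball x d" using d by simp
 have "cball x d \<subseteq> closure Om" using closure_mono[OF sub] by (simp add: cl)
 moreover have "y \<in> cball x d" using y by simp
 ultimately have "y \<in> frontier Om" using y Om by (auto simp: frontier_def interior_open)
 have "norm (f z - f x) <= K*d" if "z \<in> ball x d" for z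
 proof -
  have "norm (f z - f x) <= K*norm (z - x)"
  proof (rule differentiable_bound[of "ball x d" f "%x h. grad f x \<bullet> h"])
   fix u assume "u \<in> ball x d"
   then have u: "u \<in> Om" using sub by blast
   show "(f has_derivative (%h. grad f u \<bullet> h)) (at u within ball x d)"
    by (rule has_derivative_at_withinI[OF has_derivative_grad[OF f[OF u]]])
   have "norm (grad f u \<bullet> h) <= K*norm h" for h
    using Cauchy_Schwarz_ineq2[of "grad f u" h] mult_right_mono[OF K[OF u] norm_ge_zero[of h]] by simp
   then show "onorm (%h. grad f u \<bullet> h) <= K" by (intro onorm_le)
  qed (use that d in auto)
  moreover have "0 <= K" using K[OF x] norm_ge_zero[of "grad f x"] by linarith
  moreover have "norm (z - x) <= d" using that by (simp add: dist_norm norm_minus_commute)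
  ultimately show ?thesis using mult_left_mono[of "norm (z - x)" d K] by linarith
 qed
 moreover have "continuous_on (closure (ball x d)) (%z. f z - f x)"
  unfolding cl using continuous_on_subset[OF cont \<open>cball x d \<subseteq> closure Om\<close>] by (intro continuous_intros)
 moreover have "y \<in> closure (ball x d)" unfolding cl by fact
 ultimately have "norm (f y - f x) <= K*d"
  using continuous_on_closure_norm_le[of "ball x d" "%z. f z - f x" "K*d" y] by blast
 then show ?thesis using 0[OF \<open>y \<in> frontier Om\<close>] by (simp add: d_def)
qed

lemma Lipschitz_norm_grad_le:
 fixes f :: "real^'n => real"
 assumes f: "f differentiable at x" and L: "!!y. \<bar>f y - f x\<bar> <= L*norm (y - x)"
 shows "norm (grad f x) <= L"
proof (cases "grad f x = 0")
 case True
 have "0 <= L*norm (axis undefined 1 :: real^'n)" using L[of "x + axis undefined 1"] by (smt (verit) add_diff_cancel_left')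
 then show ?thesis using True by simp
next
 case False
 define h where "h = grad f x"
 have n: "norm h > 0" using False by (simp add: h_def)
 have "((%t. f (x + t *\<^sub>R h)) has_derivative (%t. grad f x \<bullet> (t *\<^sub>R h))) (at 0)"
  by (rule has_derivative_compose[where f = "%t. x + t *\<^sub>R h" and g = f])
   (auto intro!: derivative_eq_intros has_derivative_grad f)
 then have "((%t. f (x + t *\<^sub>R h)) has_real_derivative (h \<bullet> h)) (at 0)"
  by (simp add: has_field_derivative_def h_def mult.commute[of _ "grad f x \<bullet> grad f x"])
 then have "((%t. norm ((f (x + t *\<^sub>R h) - f x)/t)) \<longlongrightarrow> norm (h \<bullet> h)) (at 0)"
  by (intro tendsto_norm) (simp add: has_field_derivative_iff)
 moreover have "\<forall>\<^sub>F t in at (0::real). norm ((f (x + t *\<^sub>R h) - f x)/t) <= L*norm h"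
  unfolding eventually_at_filter
 proof (intro always_eventually allI impI)
  fix t :: real assume "t ~= 0"
  then show "norm ((f (x + t *\<^sub>R h) - f x)/t) <= L*norm h"
   using L[of "x + t *\<^sub>R h"] by (simp add: field_simps)
 qed
 ultimately have "norm (h \<bullet> h) <= L*norm h" by (intro tendsto_upperbound) auto
 then show ?thesis using n by (simp add: dot_square_norm power2_eq_square h_def)
qed

lemma conv_eq_const:
 assumes "mollifier s r k" "w \<in> borel_measurable borel" "!!y. y \<in> ball (x + s) r ==> w y = c"
 shows "conv w k x = c"
proof -
 have k: "k \<in> C1c UNIV" using assms by (simp add: mollifier_def test_functions_C1c)
 have "conv w k x = (LBINT z. w (x + z)*k z)" by (rule conv_alt[OF assms(2) C1c_borel(1)[OF k]])
 also have "\<dots> = (LBINT z. c*k z)"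
 proof (rule Bochner_Integration.integral_cong)
  fix z
  show "w (x + z)*k z = c*k z"
  proof (cases "k z = 0")
   case False
   then have "z \<in> ball s r" using assms(1) by (auto simp: mollifier_def)
   then show ?thesis using assms(3)[of "x + z"] by (simp add: dist_norm)
  qed simp
 qed simp
 also have "\<dots> = c" using assms(1) by (simp add: mollifier_def)
 finally show ?thesis .
qed

lemma conv_Lipschitz:
 assumes k: "mollifier s r k" and w: "w \<in> borel_measurable borel" "integrable lborel w"
  and L: "!!x y. \<bar>w x - w y\<bar> <= L*norm (x - y)"
 shows "\<bar>conv w k x - conv w k y\<bar> <= L*norm (x - y)"
proof -
 have kC: "k \<in> C1c UNIV" using k by (simp add: mollifier_def test_functions_C1c)
 note [measurable] = C1c_borel(1)[OF kC] w(1)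
 obtain B where B: "!!x. \<bar>k x\<bar> <= B" using C1c_bounded[OF kC] by metis
 have i: "integrable lborel (%z. w (x + z)*k z)" for x
  using lborel_integral_translate(2)[OF w(1), of x] w B
  by (intro integrable_mult_bounded[where B = B]) (auto simp: add.commute)
 have "conv w k x - conv w k y = (LBINT z. (w (x + z) - w (y + z))*k z)"
  using i by (simp add: conv_alt left_diff_distrib)
 also have "norm \<dots> <= (LBINT z. norm ((w (x + z) - w (y + z))*k z))" by (rule integral_norm_bound)
 also have "\<dots> <= (LBINT z. L*norm (x - y)*k z)"
 proof (rule integral_mono)
  show "integrable lborel (%z. norm ((w (x + z) - w (y + z))*k z))"
   using i by (simp add: left_diff_distrib)
  show "integrable lborel (%z. L*norm (x - y)*k z)"
   using C1c_integrable(1)[OF kC] by simp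
  fix z
  have "\<bar>w (x + z) - w (y + z)\<bar>*k z <= L*norm (x - y)*k z"
   using L[of "x + z" "y + z"] k by (intro mult_right_mono) (auto simp: mollifier_def)
  then show "norm ((w (x + z) - w (y + z))*k z) <= L*norm (x - y)*k z"
   using k by (simp add: abs_mult mollifier_def)
 qed
 also have "\<dots> = L*norm (x - y)" using k by (simp add: mollifier_def)
 finally show ?thesis by simp
qed

lemma mollifier_test: "mollifier s r k ==> k \<in> test_functions UNIV"
 by (simp add: mollifier_def)

text \<open>A piecewise linear function of the distance to the complement, 0 up to e and 1 from 2 e,
  is mollified at scale e/2. Averaging preserves the Lipschitz constant 1/e and moves the two
  thresholds to e/2 and 5/2 e. The value 3 e exceeds the latter, so the gradient vanishes there as
  well.\<close>

lemma boundary_cutoff: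
 fixes Om :: "(real^'n) set"
 assumes Om: "open Om" "bounded Om" and e: "0 < e"
 obtains \<eta> where "\<eta> \<in> test_functions Om" "!!x. 0 <= \<eta> x" "!!x. \<eta> x <= 1" "!!x. norm (grad \<eta> x) <= 1/e"
  "!!x. 3*e < infdist x (- Om) ==> \<eta> x = 1" "!!x. 3*e < infdist x (- Om) ==> grad \<eta> x = 0"
proof -
 define d where "d x = infdist x (- Om)" for x
 have dL: "\<bar>d x - d y\<bar> <= norm (x - y)" for x y
  using infdist_triangle_abs[of x "- Om" y] by (simp add: d_def dist_norm)
 have dc: "continuous_on UNIV d" unfolding d_def by (intro continuous_intros)
 define g where "g x = max 0 (min 1 (d x/e - 1))" for x
 have g01: "0 <= g x" "g x <= 1" for x by (auto simp: g_def)
 have g0: "g x = 0" if "d x <= e" for x using that e by (auto simp: g_def field_simps)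
 have g1: "g x = 1" if "2*e <= d x" for x using that e by (auto simp: g_def field_simps)
 have gL: "\<bar>g x - g y\<bar> <= 1/e*norm (x - y)" for x y
 proof -
  have "\<bar>g x - g y\<bar> <= \<bar>d x/e - d y/e\<bar>" unfolding g_def by (auto simp: max_def min_def)
  also have "\<dots> = 1/e*\<bar>d x - d y\<bar>" using e by (simp add: diff_divide_distrib[symmetric] abs_divide)
  also have "\<dots> <= 1/e*norm (x - y)" using dL e by (intro mult_left_mono) auto
  finally show ?thesis .
 qed
 have gm: "g \<in> borel_measurable borel"
  unfolding g_def by (intro borel_measurable_continuous_onI continuous_intros dc) (use e in auto)
 have Omi: "integrable lborel (indicat_real Om)" using Om emeasure_bounded_finite[OF Om(2)] by auto
 have gi: "integrable lborel g"
 proof (rule Bochner_Integration.integrable_bound[OF Omi _ AE_I2])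
  fix x
  show "norm (g x) <= norm (indicat_real Om x)"
  proof (cases "x \<in> Om")
   case False
   then have "d x = 0" unfolding d_def by (intro infdist_zero) auto
   then show ?thesis using g0[of x] e by simp
  qed (use g01[of x] in simp)
 qed (use gm in simp)
 obtain k :: "real^'n => real" where k: "mollifier 0 (e/2) k" using mollifier_exists[of "e/2"] e by auto
 define \<eta> where "\<eta> = conv g k"
 have dball: "\<bar>d y - d x\<bar> < e/2" if "y \<in> ball (x + 0) (e/2)" for x y
  using that dL[of y x] by (simp add: dist_norm norm_minus_commute)
 have \<eta>0: "\<eta> x = 0" if "d x <= e/2" for x
  unfolding \<eta>_def
 proof (rule conv_eq_const[OF k gm])
  fix y assume "y \<in> ball (x + 0) (e/2)"
  from dball[OF this] that show "g y = 0" by (intro g0) linarith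
 qed
 have \<eta>1: "\<eta> x = 1" if "5/2*e <= d x" for x
  unfolding \<eta>_def
 proof (rule conv_eq_const[OF k gm])
  fix y assume "y \<in> ball (x + 0) (e/2)"
  from dball[OF this] that show "g y = 1" by (intro g1) linarith
 qed
 have Ck: "Ck_on j UNIV \<eta>" for j unfolding \<eta>_def by (rule Ck_on_conv[OF gi mollifier_test[OF k]])
 have sub: "{x. \<eta> x ~= 0} \<subseteq> {x. e/2 <= d x}" 
 proof (intro subsetI CollectI)
  fix x assume "x \<in> {x. \<eta> x ~= 0}"
  then show "e/2 <= d x" using \<eta>0[of x] by (cases "d x <= e/2") auto
 qed
 have subO: "{x. e/2 <= d x} \<subseteq> Om"
 proof
  fix x assume "x \<in> {x. e/2 <= d x}"
  then show "x \<in> Om" using infdist_Compl_pos_iff[OF Om, of x] e by (simp add: d_def)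
 qed
 have "closed {x. e/2 <= d x}" by (intro closed_Collect_le continuous_intros dc)
 then have cl: "closure {x. \<eta> x ~= 0} \<subseteq> {x. e/2 <= d x}" using sub by (intro closure_minimal)
 have "bounded {x. \<eta> x ~= 0}" by (rule bounded_subset[OF Om(2)]) (use sub subO in blast)
 then have t: "\<eta> \<in> test_functions Om" using Ck cl subO by (auto simp: test_functions_def)
 have kC: "k \<in> C1c UNIV" using k by (simp add: mollifier_def test_functions_C1c)
 note [measurable] = C1c_borel(1)[OF kC] gm
 have conv01: "0 <= \<eta> x" "\<eta> x <= 1" for x
 proof -
  have i: "integrable lborel (%z. g (x + z)*k z)"
  proof (rule Bochner_Integration.integrable_bound[OF C1c_integrable(1)[OF kC] _ AE_I2])
   show "norm (g (x + z)*k z) <= norm (k z)" for z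
    using g01[of "x + z"] mult_right_mono[of "g (x + z)" 1 "\<bar>k z\<bar>"] by (simp add: abs_mult)
  qed simp
  have eq: "\<eta> x = (LBINT z. g (x + z)*k z)" unfolding \<eta>_def by (rule conv_alt) measurable
  show "0 <= \<eta> x" unfolding eq using g01 k by (intro integral_nonneg_AE AE_I2) (simp add: mollifier_def)
  have "\<eta> x <= (LBINT z. k z)" unfolding eq
   using i C1c_integrable(1)[OF kC] g01 k mult_right_mono[of "g _" 1 "k _"]
   by (intro integral_mono) (auto simp: mollifier_def mult_left_le_one_le)
  then show "\<eta> x <= 1" using k by (simp add: mollifier_def)
 qed
 have grad1: "norm (grad \<eta> x) <= 1/e" for x
 proof (rule Lipschitz_norm_grad_le)
  show "\<eta> differentiable at x" using Ck[of "Suc 0"] by (simp add: Ck_on_1)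
  show "\<bar>\<eta> y - \<eta> x\<bar> <= 1/e*norm (y - x)" for y
   unfolding \<eta>_def by (rule conv_Lipschitz[OF k gm gi gL])
 qed
 have grad0: "grad \<eta> x = 0" if "3*e < d x" for x
 proof -
  have "grad \<eta> x = grad (%_. 1) x"
  proof (rule grad_cong_open)
   show "open {x. 3*e < d x}" by (intro open_Collect_less continuous_intros dc)
  qed (use that e in \<open>auto intro!: \<eta>1\<close>)
  also have "\<dots> = 0" by (rule grad_eqI) simp
  finally show ?thesis .
 qed
 show thesis
  by (rule that[OF t conv01 grad1]) (use grad0 e in \<open>auto simp: d_def[symmetric] intro!: \<eta>1\<close>)
qed

text \<open>Multiply \<open>f\<close> by cutoffs. Their gradients are of size 1/e, but only where
  the distance to the complement is at most 3 e, and there \<open>f\<close> is at most 3 e B. The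
  products are thus bounded by 3 B uniformly in e, which gives the 4 B, and at each point the
  sequence is eventually constant.\<close>

lemma zero_boundary_approx:
 assumes Om: "open Om" "bounded Om" and f: "Ck_on (Suc 0) Om f"
  and B: "!!x. x \<in> Om ==> \<bar>f x\<bar> <= B" "!!x. x \<in> Om ==> norm (grad f x) <= B"
  and cont: "continuous_on (closure Om) f" and 0: "!!x. x \<in> frontier Om ==> f x = 0"
 obtains F where "!!n. F n \<in> C1c Om"
  "!!n x. x \<in> Om ==> \<bar>F n x\<bar> <= 4*B" "!!n x. x \<in> Om ==> norm (grad (F n) x) <= 4*B"
  "!!x. x \<in> Om ==> (%n. F n x) \<longlonglongrightarrow> f x" "!!x. x \<in> Om ==> (%n. grad (F n) x) \<longlonglongrightarrow> grad f x"
proof -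
 define e where "e n = 1/real (Suc n)" for n
 have e: "e n > 0" for n by (simp add: e_def)
 have "\<exists>\<eta>. \<eta> \<in> test_functions Om \<and> (\<forall>x. 0 <= \<eta> x) \<and> (\<forall>x. \<eta> x <= 1) \<and> (\<forall>x. norm (grad \<eta> x) <= 1/e n) \<and>
  (\<forall>x. 3*e n < infdist x (- Om) --> \<eta> x = 1) \<and> (\<forall>x. 3*e n < infdist x (- Om) --> grad \<eta> x = 0)" for n
  using boundary_cutoff[OF Om e[of n]] by metis
 then obtain \<eta> where \<eta>: "!!n. \<eta> n \<in> test_functions Om" "!!n x. 0 <= \<eta> n x" "!!n x. \<eta> n x <= 1"
  "!!n x. norm (grad (\<eta> n) x) <= 1/e n"
  "!!n x. 3*e n < infdist x (- Om) ==> \<eta> n x = 1" "!!n x. 3*e n < infdist x (- Om) ==> grad (\<eta> n) x = 0"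
  by metis
 note \<eta>C = test_functions_C1c[OF \<eta>(1)]
 define F where "F n x = \<eta> n x*f x" for n x
 have FC: "F n \<in> C1c Om" for n unfolding F_def by (rule C1c_mult(1)[OF Om(1) \<eta>C f])
 have Fg: "grad (F n) x = \<eta> n x *\<^sub>R grad f x + f x *\<^sub>R grad (\<eta> n) x" if "x \<in> Om" for n x
  unfolding F_def by (rule C1c_mult(2)[OF Om(1) \<eta>C f that])
 have fd: "\<bar>f x\<bar> <= B*infdist x (- Om)" if "x \<in> Om" for x
  by (rule zero_boundary_bound[OF Om _ B(2) cont 0 that]) (use f in \<open>auto simp: Ck_on_1\<close>)
 have F1: "\<bar>F n x\<bar> <= 4*B" if "x \<in> Om" for n x
 proof -
  have "\<bar>F n x\<bar> <= 1*\<bar>f x\<bar>" unfolding F_def abs_mult using \<eta>(2,3)[of n x] by (intro mult_right_mono) auto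
  then show ?thesis using B(1)[OF that] by linarith
 qed
 have F2: "norm (grad (F n) x) <= 4*B" if "x \<in> Om" for n x
 proof -
  have "norm (\<eta> n x *\<^sub>R grad f x) <= 1*B"
   unfolding norm_scaleR using \<eta>(2,3)[of n x] B(2)[OF that] by (intro mult_mono) auto
  moreover have "norm (f x *\<^sub>R grad (\<eta> n) x) <= 3*B"
  proof (cases "3*e n < infdist x (- Om)")
   case True
   then show ?thesis using \<eta>(6)[OF True] B(1)[OF that] by simp
  next
   case False
   have B0: "0 <= B" using B(1)[OF that] by linarith
   have "\<bar>f x\<bar> <= B*(3*e n)" using fd[OF that] mult_left_mono[of "infdist x (- Om)" "3*e n" B] False B0 by linarith
   then have "norm (f x *\<^sub>R grad (\<eta> n) x) <= (B*(3*e n))*(1/e n)"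
    unfolding norm_scaleR using \<eta>(4)[of n x] by (intro mult_mono) auto
   then show ?thesis using e[of n] by simp
  qed
  ultimately show ?thesis unfolding Fg[OF that] by (intro order_trans[OF norm_triangle_ineq]) simp
 qed
 have ev: "\<forall>\<^sub>F n in sequentially. F n x = f x \<and> grad (F n) x = grad f x" if "x \<in> Om" for x
 proof -
  have pos: "0 < infdist x (- Om)" using infdist_Compl_pos_iff[OF Om] that by blast
  have "(%n. 3*e n) \<longlonglongrightarrow> 3*0"
   unfolding e_def using LIMSEQ_inverse_real_of_nat by (intro tendsto_intros) (simp add: inverse_eq_divide)
  from order_tendstoD(2)[OF this, of "infdist x (- Om)"] pos
  have "\<forall>\<^sub>F n in sequentially. 3*e n < infdist x (- Om)" by simp
  then show ?thesis
   by (rule eventually_mono) (auto simp: Fg[OF that] \<eta>(5,6), simp add: F_def \<eta>(5))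
 qed
 show thesis
 proof (rule that[OF FC F1 F2])
  show "(%n. F n x) \<longlonglongrightarrow> f x" if "x \<in> Om" for x
   by (rule tendsto_eventually) (use ev[OF that] in \<open>auto elim: eventually_mono\<close>)
  show "(%n. grad (F n) x) \<longlonglongrightarrow> grad f x" if "x \<in> Om" for x
   by (rule tendsto_eventually) (use ev[OF that] in \<open>auto elim: eventually_mono\<close>)
 qed
qed

lemma zero_boundary_jet_approx:
 assumes Om: "open Om" "bounded Om" and f: "Ck_on (Suc 0) Om f"
  and B: "!!x. x \<in> Om ==> \<bar>f x\<bar> <= B" "!!x. x \<in> Om ==> norm (grad f x) <= B"
  and cont: "continuous_on (closure Om) f" and 0: "!!x. x \<in> frontier Om ==> f x = 0"
  and e: "0 < e"
 obtains \<xi> where "\<xi> \<in> C1c Om" "L2sq Om (%x. jet f x - jet \<xi> x) < e"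
proof -
 obtain F where F: "!!n. F n \<in> C1c Om"
  "!!n x. x \<in> Om ==> \<bar>F n x\<bar> <= 4*B" "!!n x. x \<in> Om ==> norm (grad (F n) x) <= 4*B"
  "!!x. x \<in> Om ==> (%n. F n x) \<longlonglongrightarrow> f x" "!!x. x \<in> Om ==> (%n. grad (F n) x) \<longlonglongrightarrow> grad f x"
  using zero_boundary_approx[OF Om f B cont 0] by blast
 note Lf = C1_bounded_L2[OF Om f B]
 have "(%n. L2sq Om (%x. jet f x - jet (F n) x)) \<longlonglongrightarrow> (LINT x|lebesgue_on Om. 0)"
  unfolding L2sq_def
 \<comment> \<open>The jet of \<open>f\<close> contributes 2 B and that of \<open>F n\<close>
   contributes 8 B.\<close>
 proof (rule integral_dominated_convergence[where w = "%x. (10*B)^2"])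
  have "L2_on Om (%x. jet f x - jet (F n) x)" for n
   using Lf(3) C1c_L2(3)[OF Om F(1)] by (intro L2_on_diff)
  then show "(%x. (norm (jet f x - jet (F n) x))^2) \<in> borel_measurable (lebesgue_on Om)" for n
   by (simp add: L2_on_def borel_measurable_integrable)
  show "integrable (lebesgue_on Om) (%x. (10*B)^2)" by (rule integrable_lebesgue_on_const[OF Om])
  show "AE x in lebesgue_on Om. (%n. (norm (jet f x - jet (F n) x))^2) \<longlonglongrightarrow> 0"
  proof (rule AE_I2)
   fix x assume "x \<in> space (lebesgue_on Om)"
   then have "x \<in> Om" by simp
   then have "(%n. (norm (jet f x - jet (F n) x))^2) \<longlonglongrightarrow> (norm (jet f x - jet f x))^2"
    unfolding jet_def by (intro tendsto_intros F)
   then show "(%n. (norm (jet f x - jet (F n) x))^2) \<longlonglongrightarrow> 0" by simp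
  qed
  show "AE x in lebesgue_on Om. norm ((norm (jet f x - jet (F n) x))^2) <= (10*B)^2" for n
  proof (rule AE_I2)
   fix x assume "x \<in> space (lebesgue_on Om)"
   then have x: "x \<in> Om" by simp
   have "norm (jet f x) <= norm (f x) + norm (grad f x)" "norm (jet (F n) x) <= norm (F n x) + norm (grad (F n) x)"
    unfolding jet_def by (rule norm_Pair_le)+
   then have "norm (jet f x - jet (F n) x) <= 10*B"
    using norm_triangle_ineq4[of "jet f x" "jet (F n) x"] B(1,2)[OF x] F(2,3)[OF x, of n] by simp
   then have "(norm (jet f x - jet (F n) x))^2 <= (10*B)^2" by (rule power_mono) simp
   then show "norm ((norm (jet f x - jet (F n) x))^2) <= (10*B)^2" by simp
  qed
 qed simp
 then have "\<forall>\<^sub>F n in sequentially. L2sq Om (%x. jet f x - jet (F n) x) < e"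
  using e by (intro order_tendstoD(2)[of _ 0]) auto
 then obtain n where "L2sq Om (%x. jet f x - jet (F n) x) < e" by (auto simp: eventually_sequentially)
 then show thesis using that F(1) by blast
qed

section \<open>Smooth approximation\<close>

lemma grad_shift:
 shows "grad (%x. f (x - a)) x = grad f (x - a)"
 using pderivs_shift[of "[_]" f a x] by (simp add: vec_eq_iff grad_nth del: pderivs.simps)

text \<open>When the ball lies in \<open>Om\<close>, the shifted kernel is a test function of the
  integration variable, and the definition of the weak gradient moves the derivative from the kernel
  to \<open>v\<close>. The minus signs of \<open>grad_conv\<close> and of the weak gradient
  cancel.\<close>

lemma grad_conv_weak:
 assumes Om: "open Om" "bounded Om" and v: "L2_on Om v" "is_weak_grad Om v G"
  and v': "borel_rep Om v v'" and G': "borel_rep Om (%x. G x$i) G'"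
  and k: "mollifier s r k" and sub: "cball (x + s) r \<subseteq> Om"
 shows "grad (conv v' k) x$i = conv G' k x"
proof -
 have kC: "k \<in> C1c UNIV" by (intro test_functions_C1c mollifier_test[OF k])
 have \<psi>: "(%y. k (y - x)) \<in> test_functions Om" by (rule mollifier_shift_test[OF k sub])
 have GL: "L2_on Om (%x. G x$i)" using v(2) by (intro L2_on_nth) (simp add: is_weak_grad_def)
 have m: "v \<in> borel_measurable (lebesgue_on Om)" "(%x. G x$i) \<in> borel_measurable (lebesgue_on Om)"
  using v(1) GL by (auto simp: L2_on_def)
 have "(%y. grad k (y - x)$i) \<in> borel_measurable borel"
  using C1c_integrable(2)[OF test_functions_C1c[OF \<psi>], of i]
  by (auto dest: borel_measurable_integrable simp: grad_shift)
 then have "- conv v' (%z. grad k z$i) x = - (LINT y|lebesgue_on Om. v y*grad (%y. k (y - x)) y$i)"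
  by (simp add: conv_def grad_shift borel_rep_integral(1)[OF Om(1) m(1) v'])
 also have "\<dots> = (LINT y|lebesgue_on Om. G y$i*k (y - x))"
  using v(2) \<psi> by (simp add: is_weak_grad_def)
 also have "\<dots> = conv G' k x"
  using borel_rep_integral(1)[OF Om(1) m(2) G' C1c_borel(1)[OF test_functions_C1c[OF \<psi>]]] by (simp add: conv_def)
 finally show ?thesis using grad_conv[OF borel_rep_L2(1)[OF Om v(1) v'] kC, of x i] by simp
qed

lemma mollifier_L2_ex:
 assumes "w \<in> borel_measurable borel" "integrable lborel w" "integrable lborel (%x. (w x)^2)" "0 < e"
 shows "\<exists>d>0. \<forall>s r k. mollifier s r k --> norm s + r <= d -->
  integrable lborel (%x. (conv w k x - w x)^2) \<and> (LBINT x. (conv w k x - w x)^2) <= e"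
 by (rule mollifier_L2[OF assms]) auto

text \<open>The error is dominated by an integrable \<open>E\<close> instead of being estimated in
  norm, because the gradient identity holds only at points whose shifted ball stays in
  \<open>Om\<close>. Which points these are is decided by the use: near a compact support, or in one
  patch of a cover.\<close>

lemma H1_mollify:
 fixes v :: "real^'n => real"
 assumes Om: "open Om" "bounded Om" and v: "L2_on Om v" "is_weak_grad Om v G"
  and v': "borel_rep Om v v'" and e: "0 < e"
 obtains d where "0 < d" "!!s r k. mollifier s r k ==> norm s + r <= d ==>
  \<exists>E. integrable (lebesgue_on Om) E \<and> (\<forall>x. 0 <= E x) \<and> (LINT x|lebesgue_on Om. E x) <= e \<and>
   (AE x in lebesgue_on Om. cball (x + s) r \<subseteq> Om --> (norm (jet (conv v' k) x - (v x, G x)))^2 <= E x)"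
proof -
 have GL: "L2_on Om (%x. G x$i)" for i using v(2) by (intro L2_on_nth) (simp add: is_weak_grad_def)
 have "\<exists>G'. borel_rep Om (%x. G x$i) G'" for i
  using GL[of i] borel_rep_exists[OF Om(1)] by (auto simp: L2_on_def)
 then obtain G' where G': "!!i. borel_rep Om (%x. G x$i) (G' i)" by metis
 note iv = borel_rep_L2[OF Om v(1) v'] and iG = borel_rep_L2[OF Om GL G']
 have bm[measurable]: "v' \<in> borel_measurable borel" "G' i \<in> borel_measurable borel" for i
  using v' G' by (auto simp: borel_rep_def)
 \<comment> \<open>One share for the function and one for each of its partial derivatives.\<close>
 define e' where "e' = e/(real CARD('n) + 1)"
 have e': "0 < e'" using e by (simp add: e'_def)
 obtain d0 where d0p: "0 < d0" and d0': "\<forall>s r k. mollifier s r k --> norm s + r <= d0 -->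
   integrable lborel (%x. (conv v' k x - v' x)^2) \<and> (LBINT x. (conv v' k x - v' x)^2) <= e'"
  using mollifier_L2_ex[OF bm(1) iv e'] by auto
 have "\<forall>i. \<exists>d>0. \<forall>s r k. mollifier s r k --> norm s + r <= d -->
   integrable lborel (%x. (conv (G' i) k x - G' i x)^2) \<and> (LBINT x. (conv (G' i) k x - G' i x)^2) <= e'"
  by (intro allI mollifier_L2_ex bm iG e')
 from choice[OF this] obtain d1 where d1': "\<forall>i. 0 < d1 i \<and> (\<forall>s r k. mollifier s r k --> norm s + r <= d1 i -->
   integrable lborel (%x. (conv (G' i) k x - G' i x)^2) \<and> (LBINT x. (conv (G' i) k x - G' i x)^2) <= e')"
  by auto
 define d where "d = min d0 (Min (range d1))"
 have d: "0 < d" "d <= d0" "!!i. d <= d1 i"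
  using d0p d1' by (auto simp: d_def min_le_iff_disj)
 show thesis
 proof (rule that[OF d(1)])
  fix s r and k :: "real^'n => real"
  assume k: "mollifier s r k" and le: "norm s + r <= d"
  have le0: "norm s + r <= d0" and le1: "!!i. norm s + r <= d1 i" using le d(2) d(3) by (auto intro: order_trans)
  from d0' k le0 have d0: "integrable lborel (%x. (conv v' k x - v' x)^2)" "(LBINT x. (conv v' k x - v' x)^2) <= e'"
   by auto
  from d1' k le1 have d1: "integrable lborel (%x. (conv (G' i) k x - G' i x)^2)"
   "(LBINT x. (conv (G' i) k x - G' i x)^2) <= e'" for i by auto
  define E0 where "E0 x = (conv v' k x - v' x)^2 + (\<Sum>i\<in>UNIV. (conv (G' i) k x - G' i x)^2)" for x
  define E where "E x = indicator Om x*E0 x" for x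
  have E0: "integrable lborel E0" "0 <= E0 x" for x
   unfolding E0_def using d0(1) d1(1)
   by (auto intro!: Bochner_Integration.integrable_add Bochner_Integration.integrable_sum add_nonneg_nonneg sum_nonneg)
  have [measurable]: "Om \<in> sets borel" "E0 \<in> borel_measurable borel"
   using Om(1) borel_measurable_integrable[OF E0(1)] by auto
  have Eb: "E \<in> borel_measurable borel" "E x = 0" if "x \<notin> Om" for x unfolding E_def using that by auto
  then have Em: "E \<in> borel_measurable borel" unfolding E_def by measurable
  have Ei: "integrable lborel E"
   by (rule Bochner_Integration.integrable_bound[OF E0(1)]) (auto simp: E_def E0 Em split: split_indicator)
  have Ez: "E x = 0" if "x \<notin> Om" for x using that by (simp add: E_def)
  have "integrable (lebesgue_on Om) E" using lebesgue_on_borel(2)[OF Om(1) Em Ez] Ei by simp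
  moreover have "(LINT x|lebesgue_on Om. E x) <= e"
  proof -
   have "(LINT x|lebesgue_on Om. E x) = (LBINT x. E x)" by (rule lebesgue_on_borel(1)[OF Om(1) Em Ez])
   also have "\<dots> <= (LBINT x. E0 x)"
   proof (rule integral_mono[OF Ei E0(1)])
    show "E x <= E0 x" for x using E0(2)[of x] by (simp add: E_def split: split_indicator)
   qed
   also have "\<dots> = (LBINT x. (conv v' k x - v' x)^2) + (\<Sum>i\<in>UNIV. \<integral>x. (conv (G' i) k x - G' i x)^2 \<partial>lborel)"
    unfolding E0_def using d0(1) d1(1)
    by (subst Bochner_Integration.integral_add, simp_all)
   also have "\<dots> <= e' + (\<Sum>i\<in>(UNIV :: 'n set). e')"
    using d0(2) d1(2) by (intro add_mono sum_mono) auto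
   also have "\<dots> = (real CARD('n) + 1)*e'" by (simp add: algebra_simps)
   also have "\<dots> = e" using add_nonneg_pos[of "real CARD('n)" 1] by (simp add: e'_def)
   finally show ?thesis .
  qed
  moreover have "0 <= E x" for x by (simp add: E_def E0)
  moreover have "AE x in lebesgue_on Om. cball (x + s) r \<subseteq> Om --> (norm (jet (conv v' k) x - (v x, G x)))^2 <= E x"
  proof -
   have "AE x in lebesgue_on Om. \<forall>i\<in>UNIV. G' i x = G x$i"
    using G' by (subst AE_finite_all) (auto simp: borel_rep_def)
   moreover have "AE x in lebesgue_on Om. v' x = v x" using v' by (simp add: borel_rep_def)
   moreover have "AE x in lebesgue_on Om. x \<in> Om" by (rule AE_I2) simp
   ultimately show ?thesis
   proof eventually_elim
    case (elim x)
    show ?case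
    proof
     assume sub: "cball (x + s) r \<subseteq> Om"
     have "(norm (grad (conv v' k) x - G x))^2 = (\<Sum>i\<in>UNIV. (conv (G' i) k x - G' i x)^2)"
      unfolding power2_norm_eq_inner inner_vec_def
      using elim(1) by (simp add: power2_eq_square grad_conv_weak[OF Om v v' G' k sub])
     then show "(norm (jet (conv v' k) x - (v x, G x)))^2 <= E x"
      using elim by (simp add: jet_def norm_Pair E_def E0_def add_nonneg_nonneg sum_nonneg)
    qed
   qed
  qed
  ultimately show "\<exists>E. integrable (lebesgue_on Om) E \<and> (\<forall>x. 0 <= E x) \<and> (LINT x|lebesgue_on Om. E x) <= e \<and>
   (AE x in lebesgue_on Om. cball (x + s) r \<subseteq> Om --> (norm (jet (conv v' k) x - (v x, G x)))^2 <= E x)"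
   by blast
 qed
qed

lemma L2sq_le_integral:
 assumes "integrable (lebesgue_on Om) E" "AE x in lebesgue_on Om. (norm (P x))^2 <= E x"
  "AE x in lebesgue_on Om. 0 <= E x"
 shows "L2sq Om P <= (LINT x|lebesgue_on Om. E x)"
 unfolding L2sq_def using assms by (intro integral_mono_AE') (auto elim: eventually_mono)

lemma C1c_approx_test:
 fixes \<xi> :: "real^'n => real"
 assumes Om: "open Om" "bounded Om" and \<xi>: "\<xi> \<in> C1c Om" and e: "0 < e"
 obtains \<psi> where "\<psi> \<in> test_functions Om" "L2sq Om (%x. jet \<xi> x - jet \<psi> x) <= e"
proof -
 define S where "S = closure {x. \<xi> x ~= 0}"
 have S: "compact S" "S \<subseteq> Om" using \<xi> by (auto simp: C1c_def S_def)
 obtain r0 where r0: "0 < r0" "(\<Union>x\<in>S. ball x r0) \<subseteq> Om"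
  using compact_subset_open_imp_ball_epsilon_subset[OF S(1) Om(1) S(2)] by blast
 obtain B where B: "!!x. \<bar>\<xi> x\<bar> <= B" "!!x. norm (grad \<xi> x) <= B" using C1c_bounded[OF \<xi>] by metis
 note L = C1c_L2[OF Om \<xi>]
 have "Ck_on (Suc 0) Om \<xi>" using \<xi> by (auto simp: C1c_def intro: Ck_on_subset)
 then have wg: "is_weak_grad Om \<xi> (grad \<xi>)" using C1_bounded_weak_grad[OF Om _ B] by blast
 have rep: "borel_rep Om \<xi> \<xi>" using C1c_borel(1)[OF \<xi>] C1c_zero_outside(1)[OF \<xi>] by (auto simp: borel_rep_def)
 obtain d where d: "0 < d" "!!s r k. mollifier s r k ==> norm s + r <= d ==>
  \<exists>E. integrable (lebesgue_on Om) E \<and> (\<forall>x. 0 <= E x) \<and> (LINT x|lebesgue_on Om. E x) <= e \<and>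
   (AE x in lebesgue_on Om. cball (x + s) r \<subseteq> Om --> (norm (jet (conv \<xi> k) x - (\<xi> x, grad \<xi> x)))^2 <= E x)"
  using H1_mollify[OF Om L(1) wg rep e] by blast
 \<comment> \<open>The mollified function lives within \<open>r\<close> of the support of \<xi>, and
   balls of radius \<open>r\<close> around such points stay within 2 r < r0 of it, hence in
   \<open>Om\<close>.\<close>
 define r where "r = min d (r0/3)"
 have r: "0 < r" "r <= d" "3*r <= r0" using d(1) r0(1) by (auto simp: r_def)
 obtain k :: "real^'n => real" where k: "mollifier 0 r k" using mollifier_exists[OF r(1)] by blast
 obtain E where E: "integrable (lebesgue_on Om) E" "!!x. 0 <= E x" "(LINT x|lebesgue_on Om. E x) <= e"
  "AE x in lebesgue_on Om. cball (x + 0) r \<subseteq> Om --> (norm (jet (conv \<xi> k) x - (\<xi> x, grad \<xi> x)))^2 <= E x"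
  using d(2)[OF k] r(2) by auto
 define T where "T = (\<Union>x\<in>S. \<Union>y\<in>cball 0 r. {x + y})"
 have T: "compact T" unfolding T_def by (rule compact_sums'[OF S(1) compact_cball])
 have Tball: "cball x r \<subseteq> Om" if x: "x \<in> T" for x
 proof -
  obtain a b where ab: "x = a + b" "a \<in> S" "b \<in> cball 0 r" using x by (auto simp: T_def)
  have "cball x r \<subseteq> ball a r0"
  proof
   fix y assume "y \<in> cball x r"
   moreover have "dist a y <= dist a x + dist x y" by (rule dist_triangle)
   ultimately show "y \<in> ball a r0" using ab r by (simp add: dist_norm)
  qed
  then show ?thesis using r0(2) ab(2) by blast
 qed
 have z: "conv \<xi> k x = 0" if "x \<notin> T" for x
 proof (rule conv_eq_const[OF k C1c_borel(1)[OF \<xi>]])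
  fix y assume y: "y \<in> ball (x + 0) r"
  show "\<xi> y = 0"
  proof (rule ccontr)
   assume "\<xi> y ~= 0"
   then have "y \<in> S" unfolding S_def using closure_subset[of "{x. \<xi> x ~= 0}"] by blast
   moreover have "x - y \<in> cball 0 r" using y by (simp add: dist_norm less_imp_le norm_minus_commute)
   ultimately have "y + (x - y) \<in> T" unfolding T_def by blast
   then show False using that by simp
  qed
 qed
 have Tz: "conv \<xi> k x = 0" "grad (conv \<xi> k) x = 0" "\<xi> x = 0" "grad \<xi> x = 0" if "x \<notin> T" for x
 proof -
  have "open (- T)" using T by (simp add: compact_imp_closed open_Compl)
  then have "grad (conv \<xi> k) x = grad (%_. 0) x" using z that by (intro grad_cong_open) auto
  also have "\<dots> = 0" by (rule grad_eqI) simp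
  finally show "grad (conv \<xi> k) x = 0" .
  show "conv \<xi> k x = 0" using z that by blast
  have "x \<notin> S"
  proof
   assume "x \<in> S"
   moreover have "0 \<in> cball (0 :: real^'n) r" using r by simp
   ultimately have "x + 0 \<in> T" unfolding T_def by blast
   then show False using that by simp
  qed
  then show "\<xi> x = 0" "grad \<xi> x = 0" unfolding S_def by (rule grad_zero_outside)+
 qed
 have "T \<subseteq> Om" using Tball r(1) by fastforce
 moreover have sub: "{x. conv \<xi> k x ~= 0} \<subseteq> T" using z by blast
 moreover have "closure {x. conv \<xi> k x ~= 0} \<subseteq> T" using sub compact_imp_closed[OF T] by (rule closure_minimal)
 moreover have "bounded {x. conv \<xi> k x ~= 0}" using bounded_subset[OF compact_imp_bounded[OF T] sub] .
 ultimately have t: "conv \<xi> k \<in> test_functions Om"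
  using Ck_on_conv[OF C1c_integrable(1)[OF \<xi>] mollifier_test[OF k]] by (auto simp: test_functions_def)
 have "L2sq Om (%x. jet \<xi> x - jet (conv \<xi> k) x) <= (LINT x|lebesgue_on Om. E x)"
 proof (rule L2sq_le_integral[OF E(1)])
  show "AE x in lebesgue_on Om. (norm (jet \<xi> x - jet (conv \<xi> k) x))^2 <= E x"
   using E(4)
  proof eventually_elim
   case (elim x)
   show ?case
   proof (cases "x \<in> T")
    case True
    then show ?thesis using Tball[OF True] elim norm_minus_commute[of "jet \<xi> x" "jet (conv \<xi> k) x"] by (simp add: jet_def)
   qed (use Tz[of x] E(2)[of x] in \<open>simp add: jet_def\<close>)
  qed
 qed (use E in auto)
 then show thesis using that[OF t] E(3) by simp
qed

text \<open>\<open>H10\<close> asks for smooth test functions and measures gradients by the chosen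
  \<open>wgrad\<close>. Any weak gradient agrees with \<open>wgrad\<close> almost everywhere, and
  mollification replaces \<open>C1c\<close> functions by smooth ones.\<close>

lemma H10I:
 assumes Om: "open Om" "bounded Om" and \<theta>: "L2_on Om \<theta>" "is_weak_grad Om \<theta> G"
  and approx: "!!e. 0 < e ==> \<exists>\<xi>\<in>C1c Om. L2sq Om (%x. (\<theta> x, G x) - jet \<xi> x) < e"
 shows "\<theta> \<in> H10 Om"
proof -
 have L: "L2_on Om (%x. (\<theta> x, G x))"
  using \<theta> L2_on_jet_iff(1)[of Om \<theta> G] by (simp add: is_weak_grad_def)
 have "\<exists>\<psi>\<in>test_functions Om. L2sq Om (%x. (\<theta> x, G x) - jet \<psi> x) <= 1/real (Suc n)" for n
 proof -
  define e where "e = 1/real (Suc n)/4"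
  have "0 < e" by (simp add: e_def)
  obtain \<xi> where \<xi>: "\<xi> \<in> C1c Om" "L2sq Om (%x. (\<theta> x, G x) - jet \<xi> x) < e" using approx[OF \<open>0 < e\<close>] by blast
  obtain \<psi> where \<psi>: "\<psi> \<in> test_functions Om" "L2sq Om (%x. jet \<xi> x - jet \<psi> x) <= e"
   using C1c_approx_test[OF Om \<xi>(1) \<open>0 < e\<close>] by blast
  note J = C1c_L2(3)[OF Om \<xi>(1)] C1c_L2(3)[OF Om test_functions_C1c[OF \<psi>(1)]]
  have "L2sq Om (%x. ((\<theta> x, G x) - jet \<xi> x) + (jet \<xi> x - jet \<psi> x)) <= 2*e + 2*e"
   using L2_on_add(2)[OF L2_on_diff(1)[OF L J(1)] L2_on_diff(1)[OF J]] \<xi>(2) \<psi>(2) by linarith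
  moreover have "2*e + 2*e = 1/real (Suc n)" unfolding e_def by linarith
  ultimately show ?thesis using \<psi>(1) by (intro bexI[of _ \<psi>]) auto
 qed
 then obtain \<psi> where \<psi>: "!!n. \<psi> n \<in> test_functions Om"
  "!!n. L2sq Om (%x. (\<theta> x, G x) - jet (\<psi> n) x) <= 1/real (Suc n)" by metis
 have H: "H1_norm Om (%x. \<theta> x - \<psi> n x) = sqrt (L2sq Om (%x. (\<theta> x, G x) - jet (\<psi> n) x))" for n
 proof -
  have \<psi>C: "\<psi> n \<in> C1c Om" using \<psi>(1) by (rule test_functions_C1c)
  note L\<psi> = C1c_L2[OF Om \<psi>C]
  obtain B where B: "!!x. \<bar>\<psi> n x\<bar> <= B" "!!x. norm (grad (\<psi> n) x) <= B" using C1c_bounded[OF \<psi>C] by metis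
  have "Ck_on (Suc 0) Om (\<psi> n)" using \<psi>C by (auto simp: C1c_def intro: Ck_on_subset)
  then have "is_weak_grad Om (\<psi> n) (grad (\<psi> n))" using C1_bounded_weak_grad[OF Om _ B] by blast
  then have wg: "is_weak_grad Om (%x. \<theta> x - \<psi> n x) (%x. G x - grad (\<psi> n) x)"
   using \<theta> L\<psi> by (intro is_weak_grad_diff[OF Om])
  have GL: "L2_on Om G" using \<theta>(2) by (simp add: is_weak_grad_def)
  have ae: "AE x in lebesgue_on Om. (norm (wgrad Om (%x. \<theta> x - \<psi> n x) x))^2 = (norm (G x - grad (\<psi> n) x))^2"
   using wgrad_AE[OF Om wg] by (auto elim: eventually_mono)
  have "L2_on Om (%x. \<theta> x - \<psi> n x)" using \<theta>(1) L\<psi>(1) by (rule L2_on_diff)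
  then have "(%x. \<theta> x - \<psi> n x) \<in> H1 Om" using wg by (auto simp: H1_def)
  then have "L2_on Om (wgrad Om (%x. \<theta> x - \<psi> n x))"
   using wgrad_is_weak_grad by (auto simp: is_weak_grad_def)
  then have "(LINT x|lebesgue_on Om. (norm (wgrad Om (%x. \<theta> x - \<psi> n x) x))^2) = L2sq Om (%x. G x - grad (\<psi> n) x)"
   unfolding L2sq_def using ae L2_on_diff(1)[OF GL L\<psi>(2)]
   by (intro integral_cong_AE) (auto simp: L2_on_def borel_measurable_integrable)
  moreover have "L2sq Om (%x. (\<theta> x - \<psi> n x, G x - grad (\<psi> n) x)) = L2sq Om (%x. \<theta> x - \<psi> n x) + L2sq Om (%x. G x - grad (\<psi> n) x)"
   using \<theta>(1) L\<psi> GL by (intro L2_on_jet_iff(2) L2_on_diff(1))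
  ultimately show ?thesis by (simp add: H1_norm_def jet_def L2sq_def)
 qed
 have "(%n. H1_norm Om (%x. \<theta> x - \<psi> n x)) \<longlonglongrightarrow> sqrt 0"
  unfolding H
 proof (rule tendsto_real_sqrt, rule tendsto_sandwich[of "%_. 0" _ _ "%n. 1/real (Suc n)"])
  show "(%n. 1/real (Suc n)) \<longlonglongrightarrow> 0" using LIMSEQ_inverse_real_of_nat by (simp add: inverse_eq_divide)
  show "\<forall>\<^sub>F n in sequentially. L2sq Om (%x. (\<theta> x, G x) - jet (\<psi> n) x) <= 1/real (Suc n)"
   by (intro always_eventually allI \<psi>(2))
  show "\<forall>\<^sub>F n in sequentially. 0 <= L2sq Om (%x. (\<theta> x, G x) - jet (\<psi> n) x)" by simp
 qed simp
 then show ?thesis using \<theta> \<psi>(1) by (auto simp: H10_def H1_def)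
qed

lemma zero_boundary_H10:
 assumes Om: "open Om" "bounded Om" and f: "Ck_on (Suc 0) Om f"
  and B: "!!x. x \<in> Om ==> \<bar>f x\<bar> <= B" "!!x. x \<in> Om ==> norm (grad f x) <= B"
  and cont: "continuous_on (closure Om) f" and 0: "!!x. x \<in> frontier Om ==> f x = 0"
 shows "f \<in> H10 Om"
proof (rule H10I[OF Om])
 show "\<exists>\<xi>\<in>C1c Om. L2sq Om (%x. (f x, grad f x) - jet \<xi> x) < e" if "0 < e" for e
  using zero_boundary_jet_approx[OF Om f B cont 0 that] by (metis (no_types, lifting) jet_def ext)
qed (use C1_bounded_L2[OF Om f B] C1_bounded_weak_grad[OF Om f B] in auto)

lemma C1c_H10:
 assumes Om: "open Om" "bounded Om" and \<xi>: "\<xi> \<in> C1c Om"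
 shows "\<xi> \<in> H10 Om" "is_weak_grad Om \<xi> (grad \<xi>)"
proof -
 obtain B where B: "!!x. \<bar>\<xi> x\<bar> <= B" "!!x. norm (grad \<xi> x) <= B" using C1c_bounded[OF \<xi>] by metis
 have "Ck_on (Suc 0) Om \<xi>" using \<xi> by (auto simp: C1c_def intro: Ck_on_subset)
 then show wg: "is_weak_grad Om \<xi> (grad \<xi>)" using C1_bounded_weak_grad[OF Om _ B] by blast
 show "\<xi> \<in> H10 Om"
  by (rule H10I[OF Om _ wg]) (use C1c_L2[OF Om \<xi>] \<xi> in \<open>auto simp: jet_def L2sq_def intro!: bexI[of _ \<xi>]\<close>)
qed

section \<open>Density of smooth functions in $H^1$\<close>

text \<open>The indicator of the ball of radius 11/16 r, mollified at scale r/8: indeed 11/16 - 1/8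
  > 1/2 and 11/16 + 1/8 < 7/8. A support strictly inside the ball of radius \<open>r\<close> makes
  the gradient vanish outside it too.\<close>

lemma ball_cutoff:
 fixes c :: "real^'n"
 assumes r: "0 < r"
 shows "\<exists>\<zeta>\<in>test_functions UNIV. (\<forall>x\<in>ball c (r/2). \<zeta> x = 1) \<and> (\<forall>x. x \<notin> cball c (7/8*r) --> \<zeta> x = 0)"
proof -
 define w where "w = indicat_real (ball c (11/16*r))"
 have wm: "w \<in> borel_measurable borel" by (simp add: w_def borel_measurable_indicator)
 have wi: "integrable lborel w"
  unfolding w_def using emeasure_bounded_finite[of "ball c (11/16*r)"] by (auto intro!: integrable_real_indicator)
 obtain k :: "real^'n => real" where k: "mollifier 0 (r/8) k" using mollifier_exists[of "r/8"] r by auto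
 have tri: "dist c y <= dist c x + dist x y" "dist c x <= dist c y + dist x y" for x y
  using dist_triangle[of c y x] dist_triangle[of c x y] by (simp_all add: dist_commute)
 have 1: "conv w k x = 1" if "x \<in> ball c (r/2)" for x
 proof (rule conv_eq_const[OF k wm])
  fix y assume "y \<in> ball (x + 0) (r/8)"
  then have "dist c y < 11/16*r" using that tri(1)[of y x] r by simp
  then show "w y = 1" by (simp add: w_def)
 qed
 have 0: "conv w k x = 0" if "x \<notin> cball c (7/8*r)" for x
 proof (rule conv_eq_const[OF k wm])
  fix y assume "y \<in> ball (x + 0) (r/8)"
  then have "\<not> dist c y < 11/16*r" using that tri(2)[of x y] r by simp
  then show "w y = 0" by (simp add: w_def)
 qed
 have "{x. conv w k x ~= 0} \<subseteq> cball c (7/8*r)" using 0 by blast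
 then have "bounded {x. conv w k x ~= 0}" by (rule bounded_subset[OF bounded_cball])
 then have "conv w k \<in> test_functions UNIV"
  using Ck_on_conv[OF wi mollifier_test[OF k]] by (simp add: test_functions_def)
 then show ?thesis using 1 0 by (intro bexI[of _ "conv w k"]) auto
qed

lemma test_functions_mult:
 assumes "\<psi> \<in> test_functions UNIV" "!!k. Ck_on k UNIV f"
 shows "(%x. \<psi> x*f x) \<in> test_functions UNIV"
proof -
 have "bounded (closure {x. \<psi> x ~= 0})" using assms(1) unfolding test_functions_def by (intro compact_imp_bounded) simp
 then have "bounded {x. \<psi> x*f x ~= 0}"
  by (rule bounded_subset) (use closure_subset[of "{x. \<psi> x ~= 0}"] in auto)
 then show ?thesis using assms by (auto simp: test_functions_def intro!: Ck_on_mult)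
qed

text \<open>Each new cutoff \<chi> is multiplied by 1 - S, where S is the sum of the earlier
  functions. The new sum S + \<chi> (1 - S) is 1 wherever S or \<chi> is.\<close>

lemma smooth_partition_of_unity:
 fixes r :: "real^'n => real"
 assumes "finite C" "!!c. c \<in> C ==> 0 < r c"
 shows "\<exists>\<zeta>. (\<forall>c\<in>C. \<zeta> c \<in> test_functions UNIV \<and> (\<forall>x. x \<notin> cball c (7/8*r c) --> \<zeta> c x = 0)) \<and>
  (\<forall>x\<in>(\<Union>c\<in>C. ball c (r c/2)). (\<Sum>c\<in>C. \<zeta> c x) = 1)"
 using assms
proof (induction C rule: finite_induct)
 case (insert c C)
 have "\<exists>\<zeta>. (\<forall>c\<in>C. \<zeta> c \<in> test_functions UNIV \<and> (\<forall>x. x \<notin> cball c (7/8*r c) --> \<zeta> c x = 0)) \<and>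
  (\<forall>x\<in>(\<Union>c\<in>C. ball c (r c/2)). (\<Sum>c\<in>C. \<zeta> c x) = 1)"
  by (rule insert.IH) (use insert.prems in simp)
 then obtain \<zeta> where
  IH: "(\<forall>c\<in>C. \<zeta> c \<in> test_functions UNIV \<and> (\<forall>x. x \<notin> cball c (7/8*r c) --> \<zeta> c x = 0)) \<and>
  (\<forall>x\<in>(\<Union>c\<in>C. ball c (r c/2)). (\<Sum>c\<in>C. \<zeta> c x) = 1)" by (elim exE)
 then have \<zeta>: "!!c. c \<in> C ==> \<zeta> c \<in> test_functions UNIV"
  "!!c x. c \<in> C ==> x \<notin> cball c (7/8*r c) ==> \<zeta> c x = 0"
  "!!x. x \<in> (\<Union>c\<in>C. ball c (r c/2)) ==> (\<Sum>c\<in>C. \<zeta> c x) = 1"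
  by (simp_all only: simp_thms)
 obtain \<chi>' where \<chi>': "\<chi>' \<in> test_functions UNIV" "!!x. x \<in> ball c (r c/2) ==> \<chi>' x = 1"
  "!!x. x \<notin> cball c (7/8*r c) ==> \<chi>' x = 0"
  using ball_cutoff[OF insert.prems[OF insertI1]] by blast
 define \<zeta>' where "\<zeta>' = \<zeta>(c := %x. \<chi>' x*(1 - (\<Sum>c\<in>C. \<zeta> c x)))"
 have "Ck_on k UNIV (%x. 1 - (\<Sum>c\<in>C. \<zeta> c x))" for k
  using \<zeta>(1) by (intro Ck_on_diff Ck_on_sum) (auto simp: test_functions_def)
 then have "(%x. \<chi>' x*(1 - (\<Sum>c\<in>C. \<zeta> c x))) \<in> test_functions UNIV"
  by (rule test_functions_mult[OF \<chi>'(1)])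
 then have 1: "\<zeta>' c' \<in> test_functions UNIV" if "c' \<in> insert c C" for c'
  using that \<zeta>(1) by (auto simp: \<zeta>'_def)
 have 2: "\<zeta>' c' x = 0" if "c' \<in> insert c C" "x \<notin> cball c' (7/8*r c')" for c' x
  using that \<zeta>(2)[of c' x] \<chi>'(3)[of x] by (auto simp: \<zeta>'_def)
 have "(\<Sum>c'\<in>insert c C. \<zeta>' c' x) = \<chi>' x*(1 - (\<Sum>c\<in>C. \<zeta> c x)) + (\<Sum>c\<in>C. \<zeta> c x)" for x
 proof -
  have "(\<Sum>c'\<in>C. \<zeta>' c' x) = (\<Sum>c\<in>C. \<zeta> c x)"
   using insert.hyps by (intro sum.cong) (auto simp: \<zeta>'_def)
  then show ?thesis using insert.hyps by (simp add: \<zeta>'_def)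
 qed
 note eq = this
 have 3: "(\<Sum>c'\<in>insert c C. \<zeta>' c' x) = 1" if "x \<in> (\<Union>c'\<in>insert c C. ball c' (r c'/2))" for x
 proof (cases "x \<in> ball c (r c/2)")
  case True
  then show ?thesis unfolding eq using \<chi>'(2) by simp
 next
  case False
  then have "x \<in> (\<Union>c\<in>C. ball c (r c/2))" using that by blast
  then show ?thesis unfolding eq using \<zeta>(3) by simp
 qed
 show ?case using 1 2 3 by (intro exI[of _ \<zeta>']) blast
qed simp

text \<open>A local interior cone condition: near \<open>c\<close>, small shifts along
  \<open>s\<close> carry points of the domain inside it together with balls of proportional radius.
  At interior points \<open>s\<close> may be 0.\<close>

definition shiftable :: "(real^'n) set => real^'n => real => real^'n => real => real => bool" where
 "shiftable Om c r s \<kappa> \<epsilon>\<^sub>0 \<longleftrightarrow> 0 < r \<and> 0 < \<kappa> \<and> 0 < \<epsilon>\<^sub>0 \<and>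
   (\<forall>x\<in>Om \<inter> ball c r. \<forall>\<epsilon>\<in>{0<..<\<epsilon>\<^sub>0}. cball (x + \<epsilon> *\<^sub>R s) (\<epsilon>*\<kappa>) \<subseteq> Om)"

text \<open>On each patch of a finite cover, \<open>v\<close> is mollified with a kernel centred at
  a small multiple of the local direction \<open>s\<close>, so that only values inside
  \<open>Om\<close> are averaged. A partition of unity glues the pieces to a function that is smooth
  on the whole space.\<close>

lemma smooth_dense_H1:
 fixes Om :: "(real^'n) set"
 assumes Om: "open Om" "bounded Om" and sh: "!!c. c \<in> closure Om ==> \<exists>r s \<kappa> \<epsilon>\<^sub>0. shiftable Om c r s \<kappa> \<epsilon>\<^sub>0"
  and v: "L2_on Om v" "is_weak_grad Om v G" and e: "0 < e"
 obtains F where "!!k. Ck_on k UNIV F" "L2sq Om (%x. jet F x - (v x, G x)) <= e"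
proof -
 have "\<forall>c\<in>closure Om. \<exists>q. case q of (r, s, \<kappa>, \<epsilon>\<^sub>0) => shiftable Om c r s \<kappa> \<epsilon>\<^sub>0" using sh by auto
 from bchoice[OF this] obtain q where q: "\<forall>c\<in>closure Om. case q c of (r, s, \<kappa>, \<epsilon>\<^sub>0) => shiftable Om c r s \<kappa> \<epsilon>\<^sub>0"
  by (elim exE)
 define r where "r c = fst (q c)" for c
 define s where "s c = fst (snd (q c))" for c
 define \<kappa> where "\<kappa> c = fst (snd (snd (q c)))" for c
 define \<epsilon>\<^sub>0 where "\<epsilon>\<^sub>0 c = snd (snd (snd (q c)))" for c
 have qs: "shiftable Om c (r c) (s c) (\<kappa> c) (\<epsilon>\<^sub>0 c)" if "c \<in> closure Om" for c
  using bspec[OF q that] by (simp add: r_def s_def \<kappa>_def \<epsilon>\<^sub>0_def split_def)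
 have rpos: "0 < r c" if "c \<in> closure Om" for c using qs[OF that] by (simp add: shiftable_def)
 have cpt: "compact (closure Om)" using Om by simp
 have cov: "closure Om \<subseteq> (\<Union>c\<in>closure Om. ball c (r c/2))" using rpos by fastforce
 obtain C where C: "C \<subseteq> closure Om" "finite C" "closure Om \<subseteq> (\<Union>c\<in>C. ball c (r c/2))"
  using compactE_image[OF cpt, of "closure Om" "%c. ball c (r c/2)", OF open_ball cov] by blast
 obtain \<zeta> where \<zeta>': "\<forall>c\<in>C. \<zeta> c \<in> test_functions UNIV \<and> (\<forall>x. x \<notin> cball c (7/8*r c) --> \<zeta> c x = 0)"
  "\<forall>x\<in>(\<Union>c\<in>C. ball c (r c/2)). (\<Sum>c\<in>C. \<zeta> c x) = 1"
  using smooth_partition_of_unity[OF C(2), of r] rpos C(1) by blast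
 have \<zeta>t: "\<zeta> c \<in> test_functions UNIV" if "c \<in> C" for c using \<zeta>'(1) that by blast
 have \<zeta>0: "\<zeta> c x = 0" "grad (\<zeta> c) x = 0" if "c \<in> C" "x \<notin> ball c (r c)" for c x
 proof -
  have rc: "0 < r c" using rpos C(1) that(1) by blast
  have *: "x \<notin> cball c (7/8*r c)" using that(2) rc by (simp add: not_less)
  then show "\<zeta> c x = 0" using \<zeta>'(1) that(1) by blast
  have "grad (\<zeta> c) x = grad (%_. 0) x"
   by (rule grad_cong_open[of "- cball c (7/8*r c)"]) (use * \<zeta>'(1) that(1) in auto)
  also have "\<dots> = 0" by (rule grad_eqI) simp
  finally show "grad (\<zeta> c) x = 0" .
 qed
 have \<zeta>sum: "(\<Sum>c\<in>C. \<zeta> c x) = 1" if "x \<in> Om" for x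
  using \<zeta>'(2) C(3) closure_subset[of Om] that by blast
 have \<zeta>D: "(\<zeta> c has_derivative (%h. grad (\<zeta> c) x \<bullet> h)) (at x)" if "c \<in> C" for c x
  by (rule C1c_has_derivative[OF test_functions_C1c[OF \<zeta>t[OF that]]])
 have \<zeta>gsum: "(\<Sum>c\<in>C. grad (\<zeta> c) x) = 0" if "x \<in> Om" for x
 proof -
  have "((%x. \<Sum>c\<in>C. \<zeta> c x) has_derivative (%h. \<Sum>c\<in>C. grad (\<zeta> c) x \<bullet> h)) (at x)"
   by (intro has_derivative_sum \<zeta>D)
  then have "grad (%x. \<Sum>c\<in>C. \<zeta> c x) x = (\<Sum>c\<in>C. grad (\<zeta> c) x)"
   by (intro grad_eqI) (simp add: inner_sum_left)
  moreover have "grad (%x. \<Sum>c\<in>C. \<zeta> c x) x = grad (%_. 1) x"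
   by (rule grad_cong_open[OF Om(1) that]) (rule \<zeta>sum)
  moreover have "grad (%_. 1 :: real) x = 0" by (rule grad_eqI) simp
  ultimately show ?thesis by simp
 qed
 have "\<forall>c\<in>C. \<exists>B. (\<forall>x. \<bar>\<zeta> c x\<bar> <= B) \<and> (\<forall>x. norm (grad (\<zeta> c) x) <= B)"
 proof
  fix c assume "c \<in> C"
  show "\<exists>B. (\<forall>x. \<bar>\<zeta> c x\<bar> <= B) \<and> (\<forall>x. norm (grad (\<zeta> c) x) <= B)"
   by (rule C1c_bounded[OF test_functions_C1c[OF \<zeta>t[OF \<open>c \<in> C\<close>]]]) blast
 qed
 from bchoice[OF this] obtain Bc where Bc: "\<forall>c\<in>C. (\<forall>x. \<bar>\<zeta> c x\<bar> <= Bc c) \<and> (\<forall>x. norm (grad (\<zeta> c) x) <= Bc c)"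
  by (elim exE)
 define B where "B = (\<Sum>c\<in>C. \<bar>Bc c\<bar>)"
 have BcB: "Bc c <= B" if "c \<in> C" for c
  unfolding B_def using member_le_sum[OF that, of "%c. \<bar>Bc c\<bar>"] C(2) by simp
 then have B: "\<bar>\<zeta> c x\<bar> <= B" "norm (grad (\<zeta> c) x) <= B" if "c \<in> C" for c x
  using order_trans[of "\<bar>\<zeta> c x\<bar>" "Bc c" B] order_trans[of "norm (grad (\<zeta> c) x)" "Bc c" B] Bc that BcB[OF that] by auto
 have "0 <= B" by (simp add: B_def sum_nonneg)
 \<comment> \<open>Each patch contributes at most 3 B times its local error, for the value, the
   gradient and the gradient of the cutoff. One factor \<open>card C\<close> comes from squaring the
   sum, the other from adding up the patches; the 1 makes \<open>M\<close> positive.\<close>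
 define M where "M = (3*B)^2*real (card C)*real (card C) + 1"
 have M: "0 < M" unfolding M_def by (intro add_nonneg_pos) auto
 define e' where "e' = e/M"
 have e': "0 < e'" using e M by (simp add: e'_def)
 obtain v' where v': "borel_rep Om v v'" using borel_rep_exists[OF Om(1)] v(1) by (auto simp: L2_on_def)
 note v'i = borel_rep_L2(1)[OF Om v(1) v']
 obtain d where d: "0 < d" "!!s r k. mollifier s r k ==> norm s + r <= d ==>
  \<exists>E. integrable (lebesgue_on Om) E \<and> (\<forall>x. 0 <= E x) \<and> (LINT x|lebesgue_on Om. E x) <= e' \<and>
   (AE x in lebesgue_on Om. cball (x + s) r \<subseteq> Om --> (norm (jet (conv v' k) x - (v x, G x)))^2 <= E x)"
  using H1_mollify[OF Om v v' e'] by blast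
 have "\<forall>c\<in>C. \<exists>q. case q of (k, E) => k \<in> test_functions UNIV \<and> integrable (lebesgue_on Om) E \<and> (\<forall>x. 0 <= E x) \<and>
  (LINT x|lebesgue_on Om. E x) <= e' \<and>
  (AE x in lebesgue_on Om. x \<in> ball c (r c) --> (norm (jet (conv v' k) x - (v x, G x)))^2 <= E x)"
 proof
  fix c assume "c \<in> C"
  then have S: "shiftable Om c (r c) (s c) (\<kappa> c) (\<epsilon>\<^sub>0 c)" using qs C(1) by blast
  define \<epsilon> where "\<epsilon> = min (\<epsilon>\<^sub>0 c/2) (d/(norm (s c) + \<kappa> c))"
  have \<kappa>: "0 < \<kappa> c" "0 < \<epsilon>\<^sub>0 c" using S by (auto simp: shiftable_def)
  then have n: "0 < norm (s c) + \<kappa> c" by (simp add: add_nonneg_pos)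
  then have \<epsilon>: "0 < \<epsilon>" "\<epsilon> < \<epsilon>\<^sub>0 c" using \<kappa> d(1) by (auto simp: \<epsilon>_def)
  have "\<epsilon>*(norm (s c) + \<kappa> c) <= d/(norm (s c) + \<kappa> c)*(norm (s c) + \<kappa> c)"
   using n by (intro mult_right_mono) (auto simp: \<epsilon>_def)
  also have "\<dots> = d" using n by simp
  finally have le: "norm (\<epsilon> *\<^sub>R s c) + \<epsilon>*\<kappa> c <= d" using \<epsilon> by (simp add: distrib_left)
  obtain k :: "real^'n => real" where k: "mollifier (\<epsilon> *\<^sub>R s c) (\<epsilon>*\<kappa> c) k"
   using mollifier_exists[of "\<epsilon>*\<kappa> c"] \<epsilon> \<kappa> by auto
  from d(2)[OF k le] obtain E where E: "integrable (lebesgue_on Om) E" "\<forall>x. 0 <= E x" "(LINT x|lebesgue_on Om. E x) <= e'"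
   "AE x in lebesgue_on Om. cball (x + \<epsilon> *\<^sub>R s c) (\<epsilon>*\<kappa> c) \<subseteq> Om --> (norm (jet (conv v' k) x - (v x, G x)))^2 <= E x"
   by blast
  have "AE x in lebesgue_on Om. x \<in> Om" by (rule AE_I2) simp
  with E(4) have "AE x in lebesgue_on Om. x \<in> ball c (r c) --> (norm (jet (conv v' k) x - (v x, G x)))^2 <= E x"
  proof eventually_elim
   case (elim x)
   show ?case
   proof
    assume "x \<in> ball c (r c)"
    then have "cball (x + \<epsilon> *\<^sub>R s c) (\<epsilon>*\<kappa> c) \<subseteq> Om" using S elim(2) \<epsilon> by (auto simp: shiftable_def)
    then show "(norm (jet (conv v' k) x - (v x, G x)))^2 <= E x" using elim(1) by blast
   qed
  qed
  then show "\<exists>q. case q of (k, E) => k \<in> test_functions UNIV \<and> integrable (lebesgue_on Om) E \<and> (\<forall>x. 0 <= E x) \<and>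
   (LINT x|lebesgue_on Om. E x) <= e' \<and>
   (AE x in lebesgue_on Om. x \<in> ball c (r c) --> (norm (jet (conv v' k) x - (v x, G x)))^2 <= E x)"
   using E mollifier_test[OF k] by (intro exI[of _ "(k, E)"]) simp
 qed
 from bchoice[OF this] obtain p where p: "\<forall>c\<in>C. case p c of (k, E) =>
  k \<in> test_functions UNIV \<and> integrable (lebesgue_on Om) E \<and> (\<forall>x. 0 <= E x) \<and>
  (LINT x|lebesgue_on Om. E x) <= e' \<and>
  (AE x in lebesgue_on Om. x \<in> ball c (r c) --> (norm (jet (conv v' k) x - (v x, G x)))^2 <= E x)"
  by (elim exE)
 define k where "k c = fst (p c)" for c
 define E where "E c = snd (p c)" for c
 have kE: "k c \<in> test_functions UNIV" "integrable (lebesgue_on Om) (E c)" "!!x. 0 <= E c x"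
  "(LINT x|lebesgue_on Om. E c x) <= e'"
  "AE x in lebesgue_on Om. x \<in> ball c (r c) --> (norm (jet (conv v' (k c)) x - (v x, G x)))^2 <= E c x" if "c \<in> C" for c
  using bspec[OF p that] by (auto simp: k_def E_def split_def)
 define F where "F x = (\<Sum>c\<in>C. \<zeta> c x*conv v' (k c) x)" for x
 have FCk: "Ck_on j UNIV F" for j
  unfolding F_def using \<zeta>t Ck_on_conv[OF v'i kE(1)] by (intro Ck_on_sum Ck_on_mult) (auto simp: test_functions_def)
 have cD: "(conv v' (k c) has_derivative (%h. grad (conv v' (k c)) x \<bullet> h)) (at x)" if "c \<in> C" for c x
  using Ck_on_conv[OF v'i kE(1)[OF that], of "Suc 0"] by (intro has_derivative_grad) (simp add: Ck_on_1)
 have Fg: "grad F x = (\<Sum>c\<in>C. \<zeta> c x *\<^sub>R grad (conv v' (k c)) x + conv v' (k c) x *\<^sub>R grad (\<zeta> c) x)" for x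
 proof (rule grad_eqI)
  have "(F has_derivative (%h. \<Sum>c\<in>C. \<zeta> c x*(grad (conv v' (k c)) x \<bullet> h) + (grad (\<zeta> c) x \<bullet> h)*conv v' (k c) x)) (at x)"
   unfolding F_def by (intro has_derivative_sum has_derivative_mult \<zeta>D cD)
  then show "(F has_derivative (%h. (\<Sum>c\<in>C. \<zeta> c x *\<^sub>R grad (conv v' (k c)) x + conv v' (k c) x *\<^sub>R grad (\<zeta> c) x) \<bullet> h)) (at x)"
   by (simp add: inner_sum_left inner_add_left mult.commute)
 qed
 define N where "N c x = (if x \<in> ball c (r c) then norm (jet (conv v' (k c)) x - (v x, G x)) else 0)" for c x
 have "L2sq Om (%x. jet F x - (v x, G x)) <= (LINT x|lebesgue_on Om. (3*B)^2*real (card C)*(\<Sum>c\<in>C. E c x))"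
 proof (rule L2sq_le_integral)
  show "integrable (lebesgue_on Om) (%x. (3*B)^2*real (card C)*(\<Sum>c\<in>C. E c x))"
   using kE(2) by (intro integrable_mult_right Bochner_Integration.integrable_sum) auto
  show "AE x in lebesgue_on Om. 0 <= (3*B)^2*real (card C)*(\<Sum>c\<in>C. E c x)"
   using kE(3) by (intro AE_I2 mult_nonneg_nonneg sum_nonneg) auto
  have "AE x in lebesgue_on Om. \<forall>c\<in>C. x \<in> ball c (r c) --> (norm (jet (conv v' (k c)) x - (v x, G x)))^2 <= E c x"
   using kE(5) C(2) by (subst AE_finite_all) auto
  moreover have "AE x in lebesgue_on Om. x \<in> Om" by (rule AE_I2) simp
  ultimately show "AE x in lebesgue_on Om. (norm (jet F x - (v x, G x)))^2 <= (3*B)^2*real (card C)*(\<Sum>c\<in>C. E c x)"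
  proof eventually_elim
   case (elim x)
   let ?a = "%c. conv v' (k c) x - v x" and ?b = "%c. grad (conv v' (k c)) x - G x"
   have "F x - v x = F x - (\<Sum>c\<in>C. \<zeta> c x) * v x" using \<zeta>sum[OF elim(2)] by simp
   also have "\<dots> = (\<Sum>c\<in>C. \<zeta> c x*?a c)"
    by (simp add: F_def right_diff_distrib sum_subtractf sum_distrib_right)
   finally have 1: "F x - v x = (\<Sum>c\<in>C. \<zeta> c x*?a c)" .
   \<comment> \<open>The gradients of the partition sum to 0, so \<open>v x\<close> times their sum
     can be subtracted; this turns the terms with derivatives of the cutoffs into local
     errors.\<close>
   have "grad F x - G x = grad F x - (\<Sum>c\<in>C. \<zeta> c x) *\<^sub>R G x - v x *\<^sub>R (\<Sum>c\<in>C. grad (\<zeta> c) x)"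
    using \<zeta>sum[OF elim(2)] \<zeta>gsum[OF elim(2)] by simp
   also have "\<dots> = (\<Sum>c\<in>C. \<zeta> c x *\<^sub>R ?b c + ?a c *\<^sub>R grad (\<zeta> c) x)"
    by (simp add: Fg scaleR_right_diff_distrib scaleR_left_diff_distrib sum.distrib sum_subtractf
      scaleR_sum_right scaleR_sum_left)
   finally have 2: "grad F x - G x = (\<Sum>c\<in>C. \<zeta> c x *\<^sub>R ?b c + ?a c *\<^sub>R grad (\<zeta> c) x)" .
   have 3: "jet F x - (v x, G x) = (\<Sum>c\<in>C. (\<zeta> c x*?a c, \<zeta> c x *\<^sub>R ?b c + ?a c *\<^sub>R grad (\<zeta> c) x))"
    by (simp add: jet_def 1 2 sum_prod[symmetric] prod_eq_iff fst_sum snd_sum)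
   have "norm (jet F x - (v x, G x)) <= (\<Sum>c\<in>C. 3*B*N c x)"
    unfolding 3
   proof (rule sum_norm_le)
    fix c assume c: "c \<in> C"
    show "norm (\<zeta> c x*?a c, \<zeta> c x *\<^sub>R ?b c + ?a c *\<^sub>R grad (\<zeta> c) x) <= 3*B*N c x"
    proof (cases "x \<in> ball c (r c)")
     case True
     have n: "\<bar>?a c\<bar> <= N c x" "norm (?b c) <= N c x"
      using True norm_fst_le[of "?a c" "?b c"] norm_snd_le[of "?b c" "?a c"] by (auto simp: N_def jet_def)
     have "norm (\<zeta> c x*?a c, \<zeta> c x *\<^sub>R ?b c + ?a c *\<^sub>R grad (\<zeta> c) x)
       <= norm (\<zeta> c x*?a c) + (norm (\<zeta> c x *\<^sub>R ?b c) + norm (?a c *\<^sub>R grad (\<zeta> c) x))"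
      by (intro order_trans[OF norm_Pair_le] add_left_mono norm_triangle_ineq)
     also have "\<dots> <= B*N c x + (B*N c x + N c x*B)"
      unfolding norm_scaleR real_norm_def abs_mult using B[OF c, of x] n \<open>0 <= B\<close>
      by (intro add_mono mult_mono) auto
     finally show ?thesis by (simp add: algebra_simps)
    next
     case False
     then have "(\<zeta> c x*?a c, \<zeta> c x *\<^sub>R ?b c + ?a c *\<^sub>R grad (\<zeta> c) x) = 0"
      using \<zeta>0[OF c False] by (simp add: zero_prod_def)
     then show ?thesis using False by (simp add: N_def)
    qed
   qed
   then have "(norm (jet F x - (v x, G x)))^2 <= (\<Sum>c\<in>C. 3*B*N c x)^2" by (rule power_mono) simp
   also have "\<dots> = (3*B)^2*(\<Sum>c\<in>C. N c x)^2" by (simp add: sum_distrib_left[symmetric] power_mult_distrib)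
   also have "\<dots> <= (3*B)^2*((\<Sum>c\<in>C. (N c x)^2)*card C)"
    by (intro mult_left_mono sum_squared_le_sum_of_squares) (use C(2) in auto)
   also have "\<dots> <= (3*B)^2*((\<Sum>c\<in>C. E c x)*card C)"
    using elim(1) kE(3) by (intro mult_left_mono mult_right_mono sum_mono) (auto simp: N_def)
   finally show ?case by (simp add: mult_ac)
  qed
 qed
 also have "\<dots> = (3*B)^2*real (card C)*(\<Sum>c\<in>C. LINT x|lebesgue_on Om. E c x)"
  using kE(2) by (simp add: Bochner_Integration.integral_sum)
 also have "\<dots> <= (3*B)^2*real (card C)*(real (card C)*e')"
  using kE(4) by (intro mult_left_mono sum_bounded_above) auto
 also have "\<dots> <= M*e'" unfolding M_def using e' by (simp add: algebra_simps)
 also have "\<dots> = e" using M by (simp add: e'_def)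
 finally show thesis using that FCk by blast
qed

section \<open>Hoelder functions\<close>

lemma finite_multi_indices: "finite (multi_indices j :: 'a::euclidean_space list set)"
 unfolding multi_indices_def by (rule finite_lists_length_eq) simp

lemma multi_indices_nonempty: "multi_indices j ~= ({} :: 'a::euclidean_space list set)"
proof -
 obtain b :: 'a where "b \<in> Basis" using nonempty_Basis by blast
 then have "replicate j b \<in> multi_indices j" by (auto simp: multi_indices_def)
 then show ?thesis by blast
qed

lemma holder_space_Ck: "f \<in> holder_space k \<alpha> U ==> j <= k ==> Ck_on j U f"
 by (auto simp: holder_space_def intro: Ck_on_le)

lemma holder_space_bound:
 fixes f :: "'a::euclidean_space => real"
 assumes "f \<in> holder_space k \<alpha> U" "j <= k"
 shows "\<exists>K. \<forall>bs\<in>multi_indices j. \<forall>x\<in>U. \<bar>pderivs bs f x\<bar> <= K"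
proof -
 have "\<forall>bs\<in>multi_indices j. \<exists>K. \<forall>x\<in>U. \<bar>pderivs bs f x\<bar> <= K"
  using assms by (simp add: holder_space_def)
 from bchoice[OF this] obtain K where K: "\<forall>bs\<in>multi_indices j. \<forall>x\<in>U. \<bar>pderivs bs f x\<bar> <= K bs" by (elim exE)
 have "\<bar>pderivs bs f x\<bar> <= (\<Sum>bs\<in>(multi_indices j :: 'a list set). \<bar>K bs\<bar>)" if "bs \<in> multi_indices j" "x \<in> U" for bs x
 proof -
  have "\<bar>pderivs bs f x\<bar> <= K bs" using K that by blast
  also have "\<dots> <= \<bar>K bs\<bar>" by simp
  also have "\<dots> <= (\<Sum>bs\<in>(multi_indices j :: 'a list set). \<bar>K bs\<bar>)"
   by (rule member_le_sum[OF that(1) _ finite_multi_indices]) simp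
  finally show ?thesis .
 qed
 then show ?thesis by blast
qed

lemma holder_space_quotient_bound:
 fixes f :: "'a::euclidean_space => real"
 assumes "f \<in> holder_space k \<alpha> U"
 shows "\<exists>K. \<forall>bs\<in>multi_indices k. \<forall>x\<in>U. \<forall>y\<in>U. x ~= y --> \<bar>pderivs bs f x - pderivs bs f y\<bar>/norm (x - y) powr \<alpha> <= K"
proof -
 have "\<forall>bs\<in>multi_indices k. \<exists>K. \<forall>x\<in>U. \<forall>y\<in>U. \<bar>pderivs bs f x - pderivs bs f y\<bar> <= K*norm (x - y) powr \<alpha>"
  using assms by (simp add: holder_space_def)
 from bchoice[OF this] obtain K where
  K: "\<forall>bs\<in>multi_indices k. \<forall>x\<in>U. \<forall>y\<in>U. \<bar>pderivs bs f x - pderivs bs f y\<bar> <= K bs*norm (x - y) powr \<alpha>" by (elim exE)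
 have "\<bar>pderivs bs f x - pderivs bs f y\<bar>/norm (x - y) powr \<alpha> <= (\<Sum>bs\<in>(multi_indices k :: 'a list set). \<bar>K bs\<bar>)"
  if "bs \<in> multi_indices k" "x \<in> U" "y \<in> U" "x ~= y" for bs x y
 proof -
  have "\<bar>pderivs bs f x - pderivs bs f y\<bar> <= K bs*norm (x - y) powr \<alpha>" using K that by blast
  then have "\<bar>pderivs bs f x - pderivs bs f y\<bar>/norm (x - y) powr \<alpha> <= K bs"
   using that(4) by (simp add: pos_divide_le_eq)
  also have "\<dots> <= \<bar>K bs\<bar>" by simp
  also have "\<dots> <= (\<Sum>bs\<in>(multi_indices k :: 'a list set). \<bar>K bs\<bar>)"
   by (rule member_le_sum[OF that(1) _ finite_multi_indices]) simp
  finally show ?thesis .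
 qed
 then show ?thesis by blast
qed

text \<open>\<open>Sup\<close> is informative only on nonempty bounded sets. Membership in the space
  gives the bounds, and openness of \<open>U\<close> supplies a second point for the Hoelder
  quotient, whose supremum must be shown nonnegative.\<close>

lemma holder_norm_ge_pderivs:
 fixes f :: "'a::euclidean_space => real"
 assumes U: "open U" "U ~= {}" and f: "f \<in> holder_space k \<alpha> U" and "j <= k" "bs \<in> multi_indices j" "x \<in> U"
 shows "\<bar>pderivs bs f x\<bar> <= holder_norm k \<alpha> U f"
proof -
 define S where "S j = {\<bar>pderivs bs f x\<bar> | bs x. bs \<in> multi_indices j \<and> x \<in> U}" for j
 define Q where "Q = {\<bar>pderivs bs f x - pderivs bs f y\<bar>/norm (x - y) powr \<alpha> | bs x y.
      bs \<in> multi_indices k \<and> x \<in> U \<and> y \<in> U \<and> x ~= y}"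
 have bdd: "bdd_above (S j)" if jk: "j <= k" for j
 proof -
  obtain K where "\<forall>bs\<in>multi_indices j. \<forall>x\<in>U. \<bar>pderivs bs f x\<bar> <= K" using holder_space_bound[OF f jk] by blast
  then show ?thesis unfolding S_def by (intro bdd_aboveI[of _ K]) auto
 qed
 have S0: "0 <= Sup (S j)" if jk: "j <= k" for j
 proof -
  obtain bs :: "'a list" where "bs \<in> multi_indices j" using multi_indices_nonempty by blast
  then have "\<bar>pderivs bs f x\<bar> \<in> S j" using \<open>x \<in> U\<close> by (auto simp: S_def)
  from cSup_upper[OF this bdd[OF jk]] show ?thesis by linarith
 qed
 have "0 <= Sup Q"
 proof -
  obtain bs :: "'a list" where bs: "bs \<in> multi_indices k" using multi_indices_nonempty by blast
  obtain e where e: "0 < e" "ball x e \<subseteq> U" using U(1) \<open>x \<in> U\<close> by (auto simp: open_contains_ball)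
  obtain b :: 'a where b: "b \<in> Basis" using nonempty_Basis by blast
  define y where "y = x + (e/2) *\<^sub>R b"
  have "y \<in> U" "x ~= y" using e b by (auto simp: y_def dist_norm nonzero_Basis intro!: subsetD[OF e(2)])
  then have "\<bar>pderivs bs f x - pderivs bs f y\<bar>/norm (x - y) powr \<alpha> \<in> Q" using bs \<open>x \<in> U\<close> unfolding Q_def by blast
  moreover obtain K where "\<forall>bs\<in>multi_indices k. \<forall>x\<in>U. \<forall>y\<in>U. x ~= y --> \<bar>pderivs bs f x - pderivs bs f y\<bar>/norm (x - y) powr \<alpha> <= K"
   using holder_space_quotient_bound[OF f] by blast
  then have "bdd_above Q" unfolding Q_def by (intro bdd_aboveI[of _ K]) auto
  ultimately have "\<bar>pderivs bs f x - pderivs bs f y\<bar>/norm (x - y) powr \<alpha> <= Sup Q" by (rule cSup_upper)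
  moreover have "0 <= \<bar>pderivs bs f x - pderivs bs f y\<bar>/norm (x - y) powr \<alpha>" by simp
  ultimately show ?thesis by linarith
 qed
 have "\<bar>pderivs bs f x\<bar> <= Sup (S j)"
  using assms by (intro cSup_upper bdd) (auto simp: S_def)
 also have "\<dots> <= (\<Sum>j\<le>k. Sup (S j))"
  using S0 \<open>j <= k\<close> by (intro member_le_sum) auto
 also have "\<dots> <= holder_norm k \<alpha> U f"
  using \<open>0 <= Sup Q\<close> unfolding holder_norm_def S_def Q_def by simp
 finally show ?thesis .
qed

lemma convex_grad_Lipschitz:
 assumes S: "convex S" "!!x. x \<in> S ==> f differentiable at x" and L: "!!x. x \<in> S ==> norm (grad f x) <= L"
  and xy: "x \<in> S" "y \<in> S"
 shows "\<bar>f x - f y\<bar> <= L*norm (x - y)"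
proof -
 have "norm (f x - f y) <= L*norm (x - y)"
 proof (rule differentiable_bound[of S f "%x h. grad f x \<bullet> h"])
  fix u assume u: "u \<in> S"
  show "(f has_derivative (%h. grad f u \<bullet> h)) (at u within S)"
   by (rule has_derivative_at_withinI[OF has_derivative_grad[OF S(2)[OF u]]])
  have "norm (grad f u \<bullet> h) <= L*norm h" for h
   using Cauchy_Schwarz_ineq2[of "grad f u" h] mult_right_mono[OF L[OF u] norm_ge_zero[of h]] by simp
  then show "onorm (%h. grad f u \<bullet> h) <= L" by (intro onorm_le)
 qed (use S xy in auto)
 then show ?thesis by simp
qed

text \<open>The mean value inequality is applied in a ball containing \<open>Om\<close>, since
  \<open>Om\<close> need not be convex. There |x - y| is at most (2 R)^(1 - \<alpha>) |x -
  y|^\<alpha>.\<close>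

lemma smooth_in_holder_space:
 fixes F :: "real^'n => real"
 assumes F: "!!k. Ck_on k UNIV F" and Om: "bounded Om" and \<alpha>: "0 < \<alpha>" "\<alpha> < 1"
 shows "F \<in> holder_space k \<alpha> Om"
proof -
 have c: "continuous_on S (pderivs bs F)" if "bs \<in> multi_indices j" for S bs j
 proof -
  have "continuous_on UNIV (pderivs bs F)" using F[of j] that unfolding Ck_on_def by blast
  then show ?thesis by (rule continuous_on_subset) simp
 qed
 have bdd: "\<exists>K. \<forall>x\<in>S. \<bar>pderivs bs F x\<bar> <= K" if "bs \<in> multi_indices j" "compact S" for S bs j
 proof -
  have "bounded (pderivs bs F ` S)" by (rule compact_imp_bounded[OF compact_continuous_image[OF c[OF that(1)] that(2)]])
  then show ?thesis by (auto simp: bounded_iff)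
 qed
 have hold: "\<exists>K. \<forall>x\<in>Om. \<forall>y\<in>Om. \<bar>pderivs bs F x - pderivs bs F y\<bar> <= K*norm (x - y) powr \<alpha>" if bs: "bs \<in> multi_indices k" for bs
 proof -
  obtain R where R: "0 < R" "Om \<subseteq> ball 0 R" using Om bounded_subset_ballD[of Om 0] by blast
  have d: "pderivs bs F differentiable at x" for x using F[of "Suc k"] bs lessI[of k] unfolding Ck_on_def by blast
  have "\<forall>i. \<exists>K. \<forall>x\<in>cball 0 R. \<bar>pderivs (axis i 1 # bs) F x\<bar> <= K"
   using bs by (intro allI bdd[of _ "Suc k"]) (auto simp: multi_indices_Suc Basis_vec_axis)
  from choice[OF this] obtain K where K: "\<forall>i. \<forall>x\<in>cball 0 R. \<bar>pderivs (axis i 1 # bs) F x\<bar> <= K i" by (elim exE)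
  define L where "L = (\<Sum>i\<in>UNIV. K i)"
  have g: "norm (grad (pderivs bs F) x) <= L" if "x \<in> cball 0 R" for x
  proof -
   have "norm (grad (pderivs bs F) x) <= (\<Sum>i\<in>UNIV. \<bar>grad (pderivs bs F) x$i\<bar>)" by (rule norm_le_l1_cart)
   also have "\<dots> <= L" unfolding L_def using K that by (intro sum_mono) (simp add: grad_nth)
   finally show ?thesis .
  qed
  have L0: "0 <= L" using g[of 0] R(1) norm_ge_zero[of "grad (pderivs bs F) 0"] by (simp del: norm_ge_zero)
  have "\<bar>pderivs bs F x - pderivs bs F y\<bar> <= (L*(2*R) powr (1 - \<alpha>))*norm (x - y) powr \<alpha>" if xy: "x \<in> Om" "y \<in> Om" for x y
  proof (cases "x = y")
   case False
   have n: "norm (x - y) <= 2*R"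
   proof -
    have "x \<in> ball 0 R" "y \<in> ball 0 R" using R(2) xy by auto
    then show ?thesis using norm_triangle_ineq4[of x y] by simp
   qed
   have "\<bar>pderivs bs F x - pderivs bs F y\<bar> <= L*norm (x - y)"
    using R(2) xy by (intro convex_grad_Lipschitz[OF convex_cball[of 0 R] d g]) auto
   also have "norm (x - y) = norm (x - y) powr (1 - \<alpha>)*norm (x - y) powr \<alpha>"
    using False by (simp add: powr_add[symmetric])
   also have "L*\<dots> <= L*((2*R) powr (1 - \<alpha>)*norm (x - y) powr \<alpha>)"
    using n \<alpha> L0 by (intro mult_left_mono mult_right_mono powr_mono2) auto
   finally show ?thesis by (simp add: mult.assoc)
  qed (use L0 in simp)
  then show ?thesis by blast
 qed
 have "Ck_on k Om F" using F by (rule Ck_on_subset) simp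
 moreover have "continuous_on (closure Om) F" using c[of "[]" 0] by simp
 moreover have "\<exists>K. \<forall>x\<in>Om. \<bar>pderivs bs F x\<bar> <= K" if "bs \<in> multi_indices j" for j bs
  using bdd[OF that, of "closure Om"] Om closure_subset[of Om] by (meson compact_closure subsetD)
 moreover have "\<exists>g. continuous_on (closure Om) g \<and> (\<forall>x\<in>Om. g x = pderivs bs F x)" if "bs \<in> multi_indices j" for j bs
  using c[OF that] by blast
 ultimately show ?thesis using hold by (simp add: holder_space_def)
qed

section \<open>Boundary charts\<close>

lemma holder_space_grad_bound:
 fixes f :: "real^'n => real"
 assumes "f \<in> holder_space (Suc k) \<alpha> U"
 shows "\<exists>K\<ge>0. \<forall>x\<in>U. norm (grad f x) <= K"
proof -
 obtain K where K: "\<forall>bs\<in>multi_indices 1. \<forall>x\<in>U. \<bar>pderivs bs f x\<bar> <= K"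
  using holder_space_bound[OF assms, of 1] by auto
 have "norm (grad f x) <= \<bar>real CARD('n)*K\<bar>" if "x \<in> U" for x
 proof -
  have "\<bar>grad f x$i\<bar> <= K" for i
   unfolding grad_nth using that by (intro bspec[OF bspec[OF K]]) (auto simp: multi_indices_def Basis_vec_axis)
  then have "(\<Sum>i\<in>UNIV. \<bar>grad f x$i\<bar>) <= (\<Sum>i\<in>(UNIV :: 'n set). K)" by (rule sum_mono)
  then show ?thesis using norm_le_l1_cart[of "grad f x"] by simp
 qed
 then show ?thesis by (intro exI[of _ "\<bar>real CARD('n)*K\<bar>"]) auto
qed

lemma holder_space_differentiable:
 "f \<in> holder_space (Suc k) \<alpha> U ==> x \<in> U ==> f differentiable at x"
 by (auto simp: holder_space_def Ck_on_Suc)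

text \<open>At a boundary point the direction is the chart direction \<open>e\<close>. If M bounds
  the gradient of \<gamma>, moving up by \<epsilon> compensates both the change of \<gamma>, at most
  M \<epsilon> \<kappa>, and the loss of height, at most \<epsilon> \<kappa>, provided \<kappa> (M +
  1) = 1.\<close>

lemma shiftable_holder_domain:
 assumes dom: "bounded_holder_domain (Suc k) \<alpha> Om" and c: "c \<in> closure Om"
 shows "\<exists>r s \<kappa> \<epsilon>\<^sub>0. shiftable Om c r s \<kappa> \<epsilon>\<^sub>0"
proof (cases "c \<in> Om")
 case True
 have "open Om" using dom by (simp add: bounded_holder_domain_def)
 then obtain r where r: "0 < r" "ball c r \<subseteq> Om" using True by (auto simp: open_contains_ball)
 have "shiftable Om c (r/2) 0 1 (r/2)"
  unfolding shiftable_def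
 proof (intro conjI ballI)
  fix x \<epsilon> assume "x \<in> Om \<inter> ball c (r/2)" "\<epsilon> \<in> {0<..<r/2}"
  then have "cball x \<epsilon> \<subseteq> ball c r" by (intro cball_subset_ball_iff[THEN iffD2]) (auto simp: dist_commute)
  then show "cball (x + \<epsilon> *\<^sub>R 0) (\<epsilon>*1) \<subseteq> Om" using r(2) by simp
 qed (use r in auto)
 then show ?thesis by blast
next
 case False
 have "open Om" using dom by (simp add: bounded_holder_domain_def)
 then have "c \<in> frontier Om" using c False by (simp add: frontier_def interior_open)
 then obtain r e \<gamma> where ch: "graph_chart Om c r e \<gamma>" and \<gamma>: "\<gamma> \<in> holder_space (Suc k) \<alpha> (ball c r)"
  using dom unfolding bounded_holder_domain_def by blast
 have r: "0 < r" and e: "norm e = 1" and inv: "!!x t. \<gamma> (x + t *\<^sub>R e) = \<gamma> x"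
  and Omr: "Om \<inter> ball c r = {x \<in> ball c r. \<gamma> x < x \<bullet> e}"
  using ch by (auto simp: graph_chart_def)
 obtain M where M: "0 <= M" "\<forall>x\<in>ball c r. norm (grad \<gamma> x) <= M" using holder_space_grad_bound[OF \<gamma>] by blast
 define \<kappa> where "\<kappa> = 1/(M + 1)"
 have \<kappa>: "0 < \<kappa>" "\<kappa> <= 1" "\<kappa>*(M + 1) = 1" using M(1) by (auto simp: \<kappa>_def)
 \<comment> \<open>Starting within r/2 of the centre, a perturbation and a shift of less than r/4
   each stay in the chart.\<close>
 have "shiftable Om c (r/2) e \<kappa> (r/4)"
  unfolding shiftable_def
 proof (intro conjI ballI subsetI)
  fix x \<epsilon> y assume "x \<in> Om \<inter> ball c (r/2)" and \<epsilon>: "\<epsilon> \<in> {0<..<r/4}" and y: "y \<in> cball (x + \<epsilon> *\<^sub>R e) (\<epsilon>*\<kappa>)"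
  then have x: "x \<in> Om" "dist c x < r/2" by auto
  have \<epsilon>': "0 < \<epsilon>" "\<epsilon> < r/4" using \<epsilon> by auto
  define z where "z = y - \<epsilon> *\<^sub>R e"
  have zx: "norm (z - x) <= \<epsilon>*\<kappa>" using y by (simp add: z_def dist_norm norm_minus_commute algebra_simps)
  have \<epsilon>\<kappa>: "\<epsilon>*\<kappa> <= \<epsilon>" using \<epsilon> \<kappa> by (simp add: mult_left_le)
  have "dist c z <= dist c x + norm (z - x)" using dist_triangle[of c z x] by (simp add: dist_norm norm_minus_commute)
  then have "dist c z < 3/4*r" using x(2) zx \<epsilon>\<kappa> \<epsilon>' by linarith
  then have zb: "z \<in> ball c r" using r by simp
  have "norm (y - z) = \<epsilon>" using e \<epsilon> by (simp add: z_def)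
  then have "dist c y <= dist c z + \<epsilon>" using dist_triangle[of c y z] by (simp add: dist_norm norm_minus_commute)
  then have "dist c y < r" using \<open>dist c z < 3 / 4 * r\<close> \<epsilon>' by linarith
  then have yb: "y \<in> ball c r" by simp
  have xb: "x \<in> ball c r" using x r by simp
  have "\<bar>\<gamma> z - \<gamma> x\<bar> <= M*norm (z - x)"
   using M(2) zb xb by (intro convex_grad_Lipschitz[OF convex_ball holder_space_differentiable[OF \<gamma>]]) auto
  also have "\<dots> <= M*(\<epsilon>*\<kappa>)" using M(1) zx by (rule mult_left_mono[rotated])
  finally have \<gamma>z: "\<gamma> z <= \<gamma> x + M*(\<epsilon>*\<kappa>)" by linarith
  have "\<gamma> y = \<gamma> z" using inv[of z \<epsilon>] by (simp add: z_def)
  moreover have "\<gamma> x < x \<bullet> e" using Omr x(1) xb by blast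
  moreover have "y \<bullet> e = x \<bullet> e + (z - x) \<bullet> e + \<epsilon>"
   using e by (simp add: z_def inner_diff_left dot_square_norm)
  moreover have "\<bar>(z - x) \<bullet> e\<bar> <= \<epsilon>*\<kappa>" using Cauchy_Schwarz_ineq2[of "z - x" e] e zx by simp
  moreover have "M*(\<epsilon>*\<kappa>) + \<epsilon>*\<kappa> = \<epsilon>"
   using \<kappa>(3) by (metis (no_types, opaque_lifting) distrib_left mult.assoc mult.commute mult.right_neutral)
  ultimately have "\<gamma> y < y \<bullet> e" using \<gamma>z by linarith
  then show "y \<in> Om" using Omr yb by blast
 qed (use r \<kappa> in auto)
 then show ?thesis by blast
qed

text \<open>A boundary point is outside \<open>Om\<close> but a limit of points of
  \<open>Om\<close>, so it lies on the graph. Since \<gamma> is constant along \<open>e\<close>, its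
  gradient is orthogonal to \<open>e\<close>, and the outward field
  \<open>grad \<gamma> x0 - e\<close> cannot vanish.\<close>

lemma graph_chart_height:
 assumes Om: "open Om" and x0: "x0 \<in> frontier Om" and ch: "graph_chart Om x0 r e \<gamma>" and \<gamma>: "\<gamma> differentiable at x0"
 shows "\<gamma> x0 = x0 \<bullet> e" "(grad \<gamma> x0 - e) \<bullet> e = - 1"
  and "((%s. \<gamma> (x0 + s *\<^sub>R d) - (x0 + s *\<^sub>R d) \<bullet> e) has_real_derivative (grad \<gamma> x0 - e) \<bullet> d) (at 0)"
proof -
 have r: "0 < r" and e: "norm e = 1" and inv: "!!x t. \<gamma> (x + t *\<^sub>R e) = \<gamma> x"
  and Omr: "Om \<inter> ball x0 r = {x \<in> ball x0 r. \<gamma> x < x \<bullet> e}"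
  using ch by (auto simp: graph_chart_def)
 have x0': "x0 \<notin> Om" "x0 \<in> closure Om" using x0 Om by (auto simp: frontier_def interior_open)
 have x0b: "x0 \<in> ball x0 r" using r by simp
 have ge: "x0 \<bullet> e <= \<gamma> x0" using Omr x0'(1) x0b by force
 show "\<gamma> x0 = x0 \<bullet> e"
 proof (rule ccontr)
  assume "\<gamma> x0 ~= x0 \<bullet> e"
  then have "0 < \<gamma> x0 - x0 \<bullet> e" using ge by simp
  moreover have "((%x. \<gamma> x - x \<bullet> e) \<longlongrightarrow> \<gamma> x0 - x0 \<bullet> e) (at x0)"
   using \<gamma> by (intro tendsto_intros) (simp add: differentiable_imp_continuous_within continuous_within[symmetric])
  ultimately have "\<forall>\<^sub>F x in at x0. 0 < \<gamma> x - x \<bullet> e" using order_tendstoD(1) by blast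
  then obtain d where d: "d > 0" "!!x. x ~= x0 ==> dist x x0 < d ==> 0 < \<gamma> x - x \<bullet> e"
   by (auto simp: eventually_at)
  obtain y where y: "y \<in> Om" "dist y x0 < min d r" using x0'(2) d(1) r unfolding closure_approachable by (meson min_less_iff_conj)
  then have "y ~= x0" using x0'(1) by blast
  then have "0 < \<gamma> y - y \<bullet> e" using d(2) y by simp
  moreover have "y \<in> ball x0 r" using y by (simp add: dist_commute)
  then have "\<gamma> y < y \<bullet> e" using Omr y(1) by blast
  ultimately show False by simp
 qed
 have D: "((%s. \<gamma> (x0 + s *\<^sub>R d)) has_derivative (%s. grad \<gamma> x0 \<bullet> (s *\<^sub>R d))) (at 0)" for d
  by (rule has_derivative_compose[where f = "%s. x0 + s *\<^sub>R d" and g = \<gamma>])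
   (auto intro!: derivative_eq_intros has_derivative_grad \<gamma>)
 then have D: "((%s. \<gamma> (x0 + s *\<^sub>R d)) has_real_derivative grad \<gamma> x0 \<bullet> d) (at 0)" for d
  unfolding has_field_derivative_def by (simp add: mult.commute[of _ "grad \<gamma> x0 \<bullet> _"])
 show "((%s. \<gamma> (x0 + s *\<^sub>R d) - (x0 + s *\<^sub>R d) \<bullet> e) has_real_derivative (grad \<gamma> x0 - e) \<bullet> d) (at 0)"
 proof -
  have "((%s. (x0 + s *\<^sub>R d) \<bullet> e) has_real_derivative d \<bullet> e) (at 0)"
   unfolding inner_add_left inner_scaleR_left by (auto intro!: derivative_eq_intros)
  from DERIV_diff[OF D[of d] this] show ?thesis by (simp add: inner_diff_left inner_commute[of d e])
 qed
 have "((%s. \<gamma> x0) has_real_derivative grad \<gamma> x0 \<bullet> e) (at 0)" using D[of e] by (simp add: inv)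
 then have "grad \<gamma> x0 \<bullet> e = 0" using DERIV_unique[OF _ DERIV_const] by blast
 then show "(grad \<gamma> x0 - e) \<bullet> e = - 1" using e by (simp add: inner_diff_left dot_square_norm)
qed

text \<open>The function \<gamma> x - x . e vanishes at \<open>x0\<close> and is negative exactly on
  the domain, so the sign of its derivative along \<open>d\<close> decides whether \<open>d\<close>
  enters or leaves. This relates the normal of a chart to \<open>Om\<close> alone.\<close>

lemma graph_chart_directions:
 assumes Om: "open Om" and x0: "x0 \<in> frontier Om" and ch: "graph_chart Om x0 r e \<gamma>" and \<gamma>: "\<gamma> differentiable at x0"
 shows "(grad \<gamma> x0 - e) \<bullet> d < 0 ==> \<exists>s0>0. \<forall>s\<in>{0<..<s0}. x0 + s *\<^sub>R d \<in> Om"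
  and "0 < (grad \<gamma> x0 - e) \<bullet> d ==> \<exists>s0>0. \<forall>s\<in>{0<..<s0}. x0 + s *\<^sub>R d \<notin> Om"
proof -
 have r: "0 < r" and Omr: "Om \<inter> ball x0 r = {x \<in> ball x0 r. \<gamma> x < x \<bullet> e}"
  using ch by (auto simp: graph_chart_def)
 note h = graph_chart_height[OF Om x0 ch \<gamma>]
 have n: "0 < norm d + 1" by (simp add: add_nonneg_pos)
 have b: "x0 + s *\<^sub>R d \<in> ball x0 r" if "0 < s" "s < r/(norm d + 1)" for s
 proof -
  have "s*norm d <= s*(norm d + 1)" using that by (intro mult_left_mono) auto
  also have "\<dots> < r" using that n by (simp add: pos_less_divide_eq)
  finally show ?thesis using that by (simp add: dist_norm)
 qed
 {
  assume "(grad \<gamma> x0 - e) \<bullet> d < 0"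
  from has_real_derivative_neg_dec_right[OF h(3) this] obtain s1 where
   s1: "s1 > 0" "!!s. 0 < s ==> s < s1 ==> \<gamma> (x0 + s *\<^sub>R d) - (x0 + s *\<^sub>R d) \<bullet> e < 0"
   using h(1) by auto
  have "x0 + s *\<^sub>R d \<in> Om" if "s \<in> {0<..<min s1 (r/(norm d + 1))}" for s
   using s1(2)[of s] b[of s] that Omr by auto
  then show "\<exists>s0>0. \<forall>s\<in>{0<..<s0}. x0 + s *\<^sub>R d \<in> Om"
   using s1(1) r n by (intro exI[of _ "min s1 (r/(norm d + 1))"]) auto
 }
 {
  assume "0 < (grad \<gamma> x0 - e) \<bullet> d"
  from has_real_derivative_pos_inc_right[OF h(3) this] obtain s1 where
   s1: "s1 > 0" "!!s. 0 < s ==> s < s1 ==> 0 < \<gamma> (x0 + s *\<^sub>R d) - (x0 + s *\<^sub>R d) \<bullet> e"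
   using h(1) by auto
  have "x0 + s *\<^sub>R d \<notin> Om" if "s \<in> {0<..<min s1 (r/(norm d + 1))}" for s
  proof
   assume "x0 + s *\<^sub>R d \<in> Om"
   moreover have "x0 + s *\<^sub>R d \<in> ball x0 r" using b[of s] that by auto
   ultimately have "\<gamma> (x0 + s *\<^sub>R d) < (x0 + s *\<^sub>R d) \<bullet> e" using Omr by blast
   then show False using s1(2)[of s] that by auto
  qed
  then show "\<exists>s0>0. \<forall>s\<in>{0<..<s0}. x0 + s *\<^sub>R d \<notin> Om"
   using s1(1) r n by (intro exI[of _ "min s1 (r/(norm d + 1))"]) auto
 }
qed

text \<open>The choice of chart does not matter: if two charts gave different unit normals N and
  \<nu>, the direction \<nu> - N would enter \<open>Om\<close> by the first chart and leave it by
  the second.\<close>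

lemma unit_normal_eq:
 assumes Om: "open Om" and x0: "x0 \<in> frontier Om" and ch: "graph_chart Om x0 r e \<gamma>" and \<gamma>: "\<gamma> differentiable at x0"
 shows "unit_normal Om x0 = (grad \<gamma> x0 - e) /\<^sub>R norm (grad \<gamma> x0 - e)"
 unfolding unit_normal_def
proof (rule the_equality)
 define N where "N = (grad \<gamma> x0 - e) /\<^sub>R norm (grad \<gamma> x0 - e)"
 show "\<exists>r' e' \<gamma>'. graph_chart Om x0 r' e' \<gamma>' \<and> \<gamma>' differentiable at x0 \<and>
   (grad \<gamma> x0 - e) /\<^sub>R norm (grad \<gamma> x0 - e) = (grad \<gamma>' x0 - e') /\<^sub>R norm (grad \<gamma>' x0 - e')"
  using ch \<gamma> by blast
 fix \<nu> assume "\<exists>r' e' \<gamma>'. graph_chart Om x0 r' e' \<gamma>' \<and> \<gamma>' differentiable at x0 \<and> \<nu> = (grad \<gamma>' x0 - e') /\<^sub>R norm (grad \<gamma>' x0 - e')"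
 then obtain r' e' \<gamma>' where ch': "graph_chart Om x0 r' e' \<gamma>'" and \<gamma>': "\<gamma>' differentiable at x0"
  and \<nu>: "\<nu> = (grad \<gamma>' x0 - e') /\<^sub>R norm (grad \<gamma>' x0 - e')" by blast
 have "grad \<gamma> x0 - e ~= 0" "grad \<gamma>' x0 - e' ~= 0"
  using graph_chart_height(2)[OF Om x0 ch \<gamma>] graph_chart_height(2)[OF Om x0 ch' \<gamma>'] by auto
 then have p: "0 < norm (grad \<gamma> x0 - e)" "0 < norm (grad \<gamma>' x0 - e')"
  and n: "norm N = 1" "norm \<nu> = 1" by (auto simp: N_def \<nu>)
 have "\<nu> = N"
 proof (rule ccontr)
  assume "\<nu> ~= N"
  have "0 < (norm (\<nu> - N))^2" using \<open>\<nu> ~= N\<close> by simp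
  also have "(norm (\<nu> - N))^2 = 2 - 2*(\<nu> \<bullet> N)"
   using n by (simp add: power2_norm_eq_inner inner_diff_left inner_diff_right inner_commute norm_eq_1)
  finally have lt: "\<nu> \<bullet> N < 1" by simp
  have "N \<bullet> (\<nu> - N) < 0" "0 < \<nu> \<bullet> (\<nu> - N)"
   using lt n by (auto simp: inner_diff_right inner_commute norm_eq_1)
  then have "(grad \<gamma> x0 - e) \<bullet> (\<nu> - N) < 0" "0 < (grad \<gamma>' x0 - e') \<bullet> (\<nu> - N)"
   using p unfolding N_def[symmetric] \<nu>[symmetric]
   by (auto simp: N_def \<nu> mult_less_0_iff zero_less_mult_iff zero_less_divide_iff divide_less_0_iff)
  from graph_chart_directions(1)[OF Om x0 ch \<gamma> this(1)] graph_chart_directions(2)[OF Om x0 ch' \<gamma>' this(2)]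
  obtain s1 s2 where s: "0 < s1" "0 < s2" "\<forall>s\<in>{0<..<s1}. x0 + s *\<^sub>R (\<nu> - N) \<in> Om" "\<forall>s\<in>{0<..<s2}. x0 + s *\<^sub>R (\<nu> - N) \<notin> Om" by auto
  define s where "s = min s1 s2/2"
  have "s \<in> {0<..<s1}" "s \<in> {0<..<s2}" using s(1,2) by (auto simp: s_def min_def)
  then show False using s(3,4) by blast
 qed
 then show "\<nu> = (grad \<gamma> x0 - e) /\<^sub>R norm (grad \<gamma> x0 - e)" by (simp add: N_def)
qed

section \<open>Vanishing Cauchy data\<close>

lemma frontier_at_within_nontrivial:
 fixes Om :: "(real^'n) set"
 assumes "open Om" "x0 \<in> frontier Om"
 shows "at x0 within Om ~= bot" "x0 \<notin> Om"
proof -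
 show n: "x0 \<notin> Om" using assms by (simp add: frontier_def interior_open)
 have "x0 \<in> closure Om" using assms by (simp add: frontier_def)
 then have "x0 islimpt Om" using n by (simp add: closure_def)
 then show "at x0 within Om ~= bot" by (simp add: trivial_limit_within)
qed

lemma cl_ext_frontier:
 fixes g :: "real^'n => 'b::t2_space"
 assumes "open Om" "x0 \<in> frontier Om" "(g \<longlongrightarrow> l) (at x0 within Om)"
 shows "cl_ext Om g x0 = l"
 using frontier_at_within_nontrivial[OF assms(1,2)] assms(3) by (simp add: cl_ext_def tendsto_Lim)

lemma holder_grad_tendsto:
 fixes u :: "real^'n => real"
 assumes Om: "open Om" and u: "u \<in> holder_space (Suc k) \<alpha> Om" and x0: "x0 \<in> closure Om"
 shows "\<exists>G. (grad u \<longlongrightarrow> G) (at x0 within Om)"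
proof -
 have "\<forall>i. \<exists>g. continuous_on (closure Om) g \<and> (\<forall>x\<in>Om. g x = pderivs [axis i 1] u x)"
 proof
  fix i :: 'n
  have "[axis i 1 :: real^'n] \<in> multi_indices 1" by (auto simp: multi_indices_def Basis_vec_axis)
  then show "\<exists>g. continuous_on (closure Om) g \<and> (\<forall>x\<in>Om. g x = pderivs [axis i 1] u x)"
   using u unfolding holder_space_def by (auto simp del: pderivs.simps)
 qed
 from choice[OF this] obtain g where
  g: "\<forall>i. continuous_on (closure Om) (g i) \<and> (\<forall>x\<in>Om. g i x = pderivs [axis i 1] u x)" by (elim exE)
 have "((%x. grad u x$i) \<longlongrightarrow> g i x0) (at x0 within Om)" for i
 proof (rule Lim_transform_eventually)
  have "(g i \<longlongrightarrow> g i x0) (at x0 within closure Om)"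
   using g x0 by (simp add: continuous_on_def)
  then show "(g i \<longlongrightarrow> g i x0) (at x0 within Om)" by (rule tendsto_within_subset) (rule closure_subset)
  show "\<forall>\<^sub>F x in at x0 within Om. g i x = grad u x$i"
   using g by (auto simp: eventually_at_filter grad_nth simp del: pderivs.simps)
 qed
 then have "(grad u \<longlongrightarrow> (\<chi> i. g i x0)) (at x0 within Om)" by (intro vec_tendstoI) simp
 then show ?thesis by blast
qed

lemma cl_ext_grad_tendsto:
 assumes Om: "open Om" and u: "u \<in> holder_space (Suc k) \<alpha> Om" and x0: "x0 \<in> frontier Om"
 shows "(grad u \<longlongrightarrow> cl_ext Om (grad u) x0) (at x0 within Om)"
proof -
 have "x0 \<in> closure Om" using x0 by (simp add: frontier_def)
 then obtain G where "(grad u \<longlongrightarrow> G) (at x0 within Om)" using holder_grad_tendsto[OF Om u] by blast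
 then show ?thesis using cl_ext_frontier[OF Om x0] by metis
qed

text \<open>
  A point at distance \<open>s\<close> from \<open>x0\<close> in an inward direction \<open>d\<close> lies at height about
  \<open>- s * (N \<bullet> d)\<close> above the boundary, where \<open>u\<close> vanishes. Letting \<open>d\<close> tend to a tangential
  direction shows that tangential derivatives vanish, without differentiating along the boundary.
\<close>

lemma zero_Cauchy_data:
 assumes dom: "bounded_holder_domain (Suc k) \<alpha> Om" and u: "u \<in> holder_space (Suc k) \<alpha> Om"
  and u0: "!!x. x \<in> frontier Om ==> u x = 0" and x0: "x0 \<in> frontier Om" and nd: "normal_deriv Om u x0 = 0"
 shows "cl_ext Om (grad u) x0 = 0"
proof -
 have Om: "open Om" "bounded Om" using dom by (auto simp: bounded_holder_domain_def)
 obtain r e \<gamma> where ch: "graph_chart Om x0 r e \<gamma>" and \<gamma>h: "\<gamma> \<in> holder_space (Suc k) \<alpha> (ball x0 r)"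
  using dom x0 unfolding bounded_holder_domain_def by blast
 have r: "0 < r" and e: "norm e = 1" and inv: "!!x t. \<gamma> (x + t *\<^sub>R e) = \<gamma> x"
  and Omr: "Om \<inter> ball x0 r = {x \<in> ball x0 r. \<gamma> x < x \<bullet> e}"
  using ch by (auto simp: graph_chart_def)
 have \<gamma>: "\<gamma> differentiable at x0" using holder_space_differentiable[OF \<gamma>h, of x0] r by simp
 define N where "N = grad \<gamma> x0 - e"
 define G where "G = cl_ext Om (grad u) x0"
 note height = graph_chart_height[OF Om(1) x0 ch \<gamma>, folded N_def]
 have N0: "N ~= 0" using height(2) by auto
 have GN: "G \<bullet> N = 0"
  using nd N0 unfolding normal_deriv_def unit_normal_eq[OF Om(1) x0 ch \<gamma>] N_def[symmetric] G_def[symmetric] by simp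
 have Glim: "(grad u \<longlongrightarrow> G) (at x0 within Om)" unfolding G_def by (rule cl_ext_grad_tendsto[OF Om(1) u x0])
 obtain K where K: "0 <= K" "\<forall>x\<in>Om. norm (grad u x) <= K" using holder_space_grad_bound[OF u] by blast
 have ucont: "continuous_on (closure Om) u" using u by (simp add: holder_space_def)
 have udiff: "u differentiable at x" if "x \<in> Om" for x by (rule holder_space_differentiable[OF u that])
 have ubd: "\<bar>u x\<bar> <= K*infdist x (- Om)" if "x \<in> Om" for x
  by (rule zero_boundary_bound[OF Om udiff _ ucont u0 that]) (use K in auto)
 have x0c: "x0 \<in> closure Om" using x0 by (simp add: frontier_def)
 have key: "\<bar>G \<bullet> d\<bar> <= K*(- (N \<bullet> d))" if d: "N \<bullet> d < 0" for d
 proof -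
  obtain s0 where s0: "0 < s0" "\<forall>s\<in>{0<..<s0}. x0 + s *\<^sub>R d \<in> Om"
   using graph_chart_directions(1)[OF Om(1) x0 ch \<gamma>] d unfolding N_def by blast
  define \<phi> where "\<phi> s = \<gamma> (x0 + s *\<^sub>R d) - (x0 + s *\<^sub>R d) \<bullet> e" for s
  have D: "(\<phi> has_real_derivative N \<bullet> d) (at 0)" unfolding \<phi>_def by (rule height(3))
  have \<phi>0: "\<phi> 0 = 0" using height(1) by (simp add: \<phi>_def)
  have "((%s. \<phi> s/s) \<longlongrightarrow> N \<bullet> d) (at 0)" using D \<phi>0 by (simp add: has_field_derivative_iff)
  then have lim2: "((%s. K*(- (\<phi> s/s))) \<longlongrightarrow> K*(- (N \<bullet> d))) (at_right 0)"
   by (intro tendsto_intros) (rule filterlim_mono[OF _ order_refl at_le], auto)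
  have "(\<phi> \<longlongrightarrow> 0) (at 0)" using DERIV_isCont[OF D] \<phi>0 by (simp add: isCont_def)
  then have \<phi>lim: "(\<phi> \<longlongrightarrow> 0) (at_right 0)" by (rule filterlim_mono[OF _ order_refl at_le]) auto
  \<comment> \<open>Since \<open>u\<close> vanishes at \<open>x0\<close>, its value at distance
    parameter \<open>s\<close> is \<open>s\<close> times a directional derivative at an intermediate
    interior point; as \<open>s\<close> tends to 0 the gradient there tends to
    \<open>G\<close>.\<close>
  have mvt': "\<exists>\<sigma>. 0 < \<sigma> \<and> \<sigma> < s \<and> u (x0 + s *\<^sub>R d) = s*(grad u (x0 + \<sigma> *\<^sub>R d) \<bullet> d)" if s: "0 < s" "s < s0" for s
  proof -
   have cl: "x0 + t *\<^sub>R d \<in> closure Om" if "t \<in> {0..s}" for t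
    using s0(2) s that x0c closure_subset[of Om] by (cases "t = 0") auto
   have "continuous_on {0..s} (%t. u (x0 + t *\<^sub>R d))"
    by (rule continuous_on_compose2[OF ucont]) (use cl in \<open>auto intro!: continuous_intros\<close>)
   moreover have "((%t. u (x0 + t *\<^sub>R d)) has_derivative (%h. grad u (x0 + t *\<^sub>R d) \<bullet> (h *\<^sub>R d))) (at t)"
    if "0 < t" "t < s" for t
   proof -
    have "x0 + t *\<^sub>R d \<in> Om" using s0(2) that s by auto
    then show ?thesis
     by (intro has_derivative_compose[where f = "%t. x0 + t *\<^sub>R d" and g = u])
      (auto intro!: derivative_eq_intros has_derivative_grad udiff)
   qed
   ultimately obtain \<sigma> where \<sigma>: "\<sigma> \<in> {0<..<s}" "u (x0 + s *\<^sub>R d) - u (x0 + 0 *\<^sub>R d) = grad u (x0 + \<sigma> *\<^sub>R d) \<bullet> ((s - 0) *\<^sub>R d)"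
    using mvt[OF s(1), of "%t. u (x0 + t *\<^sub>R d)" "%t h. grad u (x0 + t *\<^sub>R d) \<bullet> (h *\<^sub>R d)"] by auto
   then show ?thesis using u0[OF x0] by (intro exI[of _ \<sigma>]) auto
  qed
  then have "\<forall>s. \<exists>\<sigma>. s \<in> {0<..<s0} --> 0 < \<sigma> \<and> \<sigma> < s \<and> u (x0 + s *\<^sub>R d) = s*(grad u (x0 + \<sigma> *\<^sub>R d) \<bullet> d)" by auto
  from choice[OF this] obtain \<sigma> where
   \<sigma>: "\<forall>s. s \<in> {0<..<s0} --> 0 < \<sigma> s \<and> \<sigma> s < s \<and> u (x0 + s *\<^sub>R d) = s*(grad u (x0 + \<sigma> s *\<^sub>R d) \<bullet> d)" by (elim exE)
  have evs: "\<forall>\<^sub>F s in at_right 0. s \<in> {0<..<s0}" using s0(1) by (auto simp: eventually_at_right_field)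
  have "(\<sigma> \<longlongrightarrow> 0) (at_right 0)"
  proof (rule tendsto_sandwich)
   show "\<forall>\<^sub>F s in at_right 0. 0 <= \<sigma> s" using evs by eventually_elim (use \<sigma> in force)
   show "\<forall>\<^sub>F s in at_right 0. \<sigma> s <= s" using evs by eventually_elim (use \<sigma> in force)
  qed (auto intro: tendsto_ident_at)
  then have "((%s. x0 + \<sigma> s *\<^sub>R d) \<longlongrightarrow> x0 + 0 *\<^sub>R d) (at_right 0)" by (intro tendsto_intros)
  moreover have "\<forall>\<^sub>F s in at_right 0. x0 + \<sigma> s *\<^sub>R d \<in> Om \<and> x0 + \<sigma> s *\<^sub>R d ~= x0"
   using evs
  proof eventually_elim
   case (elim s)
   then have "\<sigma> s \<in> {0<..<s0}" using \<sigma> by force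
   then have "x0 + \<sigma> s *\<^sub>R d \<in> Om" using s0(2) by blast
   then show ?case using frontier_at_within_nontrivial(2)[OF Om(1) x0] by metis
  qed
  ultimately have "filterlim (%s. x0 + \<sigma> s *\<^sub>R d) (at x0 within Om) (at_right 0)"
   unfolding filterlim_at by simp
  from filterlim_compose[OF Glim this] have lim1: "((%s. \<bar>grad u (x0 + \<sigma> s *\<^sub>R d) \<bullet> d\<bar>) \<longlongrightarrow> \<bar>G \<bullet> d\<bar>) (at_right 0)"
   by (intro tendsto_intros)
  have ev\<phi>: "\<forall>\<^sub>F s in at_right 0. \<bar>\<phi> s\<bar> < r/2"
   using tendsto_rabs[OF \<phi>lim] r by (intro order_tendstoD(2)[of _ "\<bar>0\<bar>"]) auto
  have evd: "\<forall>\<^sub>F s in at_right 0. s*norm d < r/2"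
   by (intro order_tendstoD(2)[of _ "0*norm d"] tendsto_intros) (use r in auto)
  have le: "\<forall>\<^sub>F s in at_right 0. \<bar>grad u (x0 + \<sigma> s *\<^sub>R d) \<bullet> d\<bar> <= K*(- (\<phi> s/s))"
   using evs ev\<phi> evd
  proof eventually_elim
   case (elim s)
   then have s: "0 < s" by simp
   define x where "x = x0 + s *\<^sub>R d"
   have x: "x \<in> Om" unfolding x_def using s0(2) elim(1) by blast
   have "dist x0 x = s*norm d" using s by (simp add: x_def dist_norm)
   then have xb: "dist x0 x < r/2" using elim(3) by simp
   then have "x \<in> ball x0 r" using r by simp
   then have "\<gamma> x < x \<bullet> e" using Omr x by blast
   then have h: "0 < - \<phi> s" by (simp add: \<phi>_def x_def)
   \<comment> \<open>As \<phi> s is minus the height of \<open>x\<close> above the graph,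
     \<open>y\<close> is the point of the graph below \<open>x\<close>. Hence the distance from
     \<open>x\<close> to the complement is at most - \<phi> s.\<close>
   define y where "y = x + \<phi> s *\<^sub>R e"
   have dxy: "dist x y = - \<phi> s" using e h by (simp add: y_def dist_norm)
   have yb: "y \<in> ball x0 r" using dist_triangle[of x0 y x] dxy xb elim(2) h by simp
   have "\<gamma> y = \<gamma> x" unfolding y_def by (rule inv)
   moreover have "y \<bullet> e = \<gamma> x" using e by (simp add: y_def \<phi>_def x_def inner_add_left dot_square_norm algebra_simps)
   ultimately have "y \<notin> Om" using Omr yb by force
   then have "infdist x (- Om) <= dist x y" by (intro infdist_le) auto
   then have "\<bar>u x\<bar> <= K*(- \<phi> s)" using ubd[OF x] K(1) dxy by (metis mult_left_mono order_trans)
   moreover have "u x = s*(grad u (x0 + \<sigma> s *\<^sub>R d) \<bullet> d)" unfolding x_def using \<sigma> elim(1) by blast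
   ultimately have "s*\<bar>grad u (x0 + \<sigma> s *\<^sub>R d) \<bullet> d\<bar> <= K*(- \<phi> s)" using s by (simp add: abs_mult)
   then show ?case using s by (simp add: field_simps)
  qed
  show ?thesis by (rule tendsto_le[OF _ lim2 lim1 le]) simp
 qed
 have "\<bar>G \<bullet> G\<bar> <= 0"
 proof (rule field_le_epsilon)
  fix \<epsilon> :: real assume \<epsilon>: "0 < \<epsilon>"
  \<comment> \<open>Since \<open>G\<close> is orthogonal to \<open>N\<close>, the direction G -
    \<mu> N satisfies N . d = - \<mu> |N|^2 < 0 while G . d is still |G|^2; \<open>key\<close> then
    bounds |G|^2 by K \<mu> |N|^2.\<close>
  define \<mu> where "\<mu> = \<epsilon>/(K*(N \<bullet> N) + 1)"
  have p: "0 < K*(N \<bullet> N) + 1" using K(1) by (intro add_nonneg_pos) auto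
  have \<mu>: "0 < \<mu>" using \<epsilon> p by (simp add: \<mu>_def)
  have "N \<bullet> (G - \<mu> *\<^sub>R N) < 0" using GN N0 \<mu> by (simp add: inner_diff_right inner_commute)
  from key[OF this] have "\<bar>G \<bullet> G\<bar> <= K*(\<mu>*(N \<bullet> N))"
   using GN by (simp add: inner_diff_right inner_commute)
  also have "\<dots> <= \<mu>*(K*(N \<bullet> N) + 1)" using \<mu> by (simp add: algebra_simps)
  also have "\<dots> = \<epsilon>" using p by (simp add: \<mu>_def)
  finally show "\<bar>G \<bullet> G\<bar> <= 0 + \<epsilon>" by simp
 qed
 then have "G = 0" using inner_ge_zero[of G] by (metis abs_le_zero_iff inner_eq_zero_iff)
 then show ?thesis by (simp add: G_def)
qed

section \<open>Symmetry of second derivatives\<close>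

text \<open>The mean value theorem is used twice: for the increment of \<open>f\<close> over
  \<open>s b\<close> as a function along \<open>a\<close>, then for the derivative along
  \<open>a\<close> as a function along \<open>b\<close>.\<close>

lemma second_difference_mvt:
 fixes f :: "'a::euclidean_space => real"
 assumes f: "!!y. y \<in> ball x r ==> f differentiable at y" "!!y. y \<in> ball x r ==> pderivs [a] f differentiable at y"
  and s: "0 < s" "s*(norm a + norm b) < r"
 shows "\<exists>t\<in>{0<..<s}. \<exists>t'\<in>{0<..<s}. f (x + s *\<^sub>R a + s *\<^sub>R b) - f (x + s *\<^sub>R a) - f (x + s *\<^sub>R b) + f x
  = s * s*pderivs [b, a] f (x + t *\<^sub>R a + t' *\<^sub>R b)"
proof -
 have mem: "x + t *\<^sub>R a + t' *\<^sub>R b \<in> ball x r" if "0 <= t" "t <= s" "0 <= t'" "t' <= s" for t t'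
 proof -
  have "norm (t *\<^sub>R a + t' *\<^sub>R b) <= t*norm a + t'*norm b"
   using norm_triangle_ineq[of "t *\<^sub>R a" "t' *\<^sub>R b"] that by simp
  also have "\<dots> <= s*norm a + s*norm b" using that by (intro add_mono mult_right_mono) auto
  also have "\<dots> < r" using s(2) by (simp add: distrib_left)
  finally have "norm (t *\<^sub>R a + t' *\<^sub>R b) < r" .
  moreover have "x - (x + t *\<^sub>R a + t' *\<^sub>R b) = - (t *\<^sub>R a + t' *\<^sub>R b)" by simp
  ultimately show ?thesis by (simp only: mem_ball dist_norm norm_minus_cancel)
 qed
 have D: "((%t. g (c + t *\<^sub>R v)) has_real_derivative pderivs [v] g (c + t *\<^sub>R v)) (at t)"
  if "g differentiable at (c + t *\<^sub>R v)" for g :: "'a => real" and c v t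
 proof -
  have "((%t. g (c + t *\<^sub>R v)) has_derivative (%h. frechet_derivative g (at (c + t *\<^sub>R v)) (h *\<^sub>R v))) (at t)"
   using that by (intro has_derivative_compose[where f = "%t. c + t *\<^sub>R v" and g = g])
    (auto intro!: derivative_eq_intros simp: frechet_derivative_works)
  moreover have "frechet_derivative g (at (c + t *\<^sub>R v)) (h *\<^sub>R v) = h*pderivs [v] g (c + t *\<^sub>R v)" for h
   using linear_frechet_derivative[OF that] by (simp add: linear_scale)
  ultimately show ?thesis by (simp add: has_field_derivative_def mult.commute[of _ "pderivs _ _ _"] del: pderivs.simps)
 qed
 define g where "g t = f (x + s *\<^sub>R b + t *\<^sub>R a) - f (x + t *\<^sub>R a)" for t
 have "\<exists>t. 0 < t \<and> t < s \<and> g s - g 0 = (s - 0)*(pderivs [a] f (x + s *\<^sub>R b + t *\<^sub>R a) - pderivs [a] f (x + t *\<^sub>R a))"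
 proof (rule MVT2[OF s(1)])
  fix t assume t: "0 <= t" "t <= s"
  have "x + s *\<^sub>R b + t *\<^sub>R a \<in> ball x r" "x + t *\<^sub>R a \<in> ball x r"
   using mem[of t s] mem[of t 0] t s(1) by (simp_all add: add_ac)
  then show "(g has_real_derivative pderivs [a] f (x + s *\<^sub>R b + t *\<^sub>R a) - pderivs [a] f (x + t *\<^sub>R a)) (at t)"
   unfolding g_def by (intro DERIV_diff D f)
 qed
 then obtain t where t: "0 < t" "t < s"
  "g s - g 0 = s*(pderivs [a] f (x + t *\<^sub>R a + s *\<^sub>R b) - pderivs [a] f (x + t *\<^sub>R a + 0 *\<^sub>R b))"
  by (auto simp: add_ac simp del: pderivs.simps)
 have "\<exists>t'. 0 < t' \<and> t' < s \<and> pderivs [a] f (x + t *\<^sub>R a + s *\<^sub>R b) - pderivs [a] f (x + t *\<^sub>R a + 0 *\<^sub>R b)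
   = (s - 0)*pderivs [b] (pderivs [a] f) (x + t *\<^sub>R a + t' *\<^sub>R b)"
  by (rule MVT2[OF s(1)], rule D, rule f, rule mem) (use t in auto)
 then obtain t' where t': "0 < t'" "t' < s" "pderivs [a] f (x + t *\<^sub>R a + s *\<^sub>R b) - pderivs [a] f (x + t *\<^sub>R a + 0 *\<^sub>R b)
   = s*pderivs [b, a] f (x + t *\<^sub>R a + t' *\<^sub>R b)" by auto
 have "f (x + s *\<^sub>R a + s *\<^sub>R b) - f (x + s *\<^sub>R a) - f (x + s *\<^sub>R b) + f x = g s - g 0"
  by (simp add: g_def add_ac)
 then show ?thesis using t t' by (intro bexI[of _ t] bexI[of _ t']) (auto simp del: pderivs.simps)
qed

text \<open>The second difference is symmetric in \<open>a\<close> and \<open>b\<close>, and its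
  quotient by s^2 tends to the mixed derivative taken in either order.\<close>

lemma pderivs_commute:
 fixes f :: "'a::euclidean_space => real"
 assumes U: "open U" "x \<in> U" and f: "Ck_on (Suc (Suc 0)) U f" and ab: "a \<in> Basis" "b \<in> Basis"
 shows "pderivs [a, b] f x = pderivs [b, a] f x"
proof -
 obtain r where r: "0 < r" "ball x r \<subseteq> U" using U by (auto simp: open_contains_ball)
 define \<Delta> where "\<Delta> s = f (x + s *\<^sub>R a + s *\<^sub>R b) - f (x + s *\<^sub>R a) - f (x + s *\<^sub>R b) + f x" for s
 have lim: "((%s. \<Delta> s/(s * s)) \<longlongrightarrow> pderivs [b, a] f x) (at_right 0)"
  if ab: "a \<in> Basis" "b \<in> Basis" and \<Delta>: "!!s. \<Delta> s = f (x + s *\<^sub>R a + s *\<^sub>R b) - f (x + s *\<^sub>R a) - f (x + s *\<^sub>R b) + f x" for a b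
 proof -
  have d: "f differentiable at y" "pderivs [a] f differentiable at y" if "y \<in> ball x r" for y
   using f that r(2) ab by (auto simp: Ck_on_Suc simp del: pderivs.simps)
  have n: "norm a = 1" "norm b = 1" using ab by auto
  have "\<forall>s. \<exists>t t'. s \<in> {0<..<r/2} --> t \<in> {0<..<s} \<and> t' \<in> {0<..<s} \<and> \<Delta> s = s * s*pderivs [b, a] f (x + t *\<^sub>R a + t' *\<^sub>R b)"
  proof
   fix s
   show "\<exists>t t'. s \<in> {0<..<r/2} --> t \<in> {0<..<s} \<and> t' \<in> {0<..<s} \<and> \<Delta> s = s * s*pderivs [b, a] f (x + t *\<^sub>R a + t' *\<^sub>R b)"
   proof (cases "s \<in> {0<..<r/2}")
    case True
    then have "0 < s" "s*(norm a + norm b) < r" using n by auto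
    from second_difference_mvt[of x r f a s b, OF d this] show ?thesis unfolding \<Delta> by blast
   qed blast
  qed
  from choice[OF this] obtain t where "\<forall>s. \<exists>t'. s \<in> {0<..<r/2} --> t s \<in> {0<..<s} \<and> t' \<in> {0<..<s} \<and>
   \<Delta> s = s * s*pderivs [b, a] f (x + t s *\<^sub>R a + t' *\<^sub>R b)" by (elim exE)
  from choice[OF this] obtain t' where t: "\<forall>s. s \<in> {0<..<r/2} --> t s \<in> {0<..<s} \<and> t' s \<in> {0<..<s} \<and>
   \<Delta> s = s * s*pderivs [b, a] f (x + t s *\<^sub>R a + t' s *\<^sub>R b)" by (elim exE)
  have ev: "\<forall>\<^sub>F s in at_right 0. s \<in> {0<..<r/2}" using r(1) by (auto simp: eventually_at_right_field intro!: exI[of _ "r/2"])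
  have t0: "(t \<longlongrightarrow> 0) (at_right 0)" "(t' \<longlongrightarrow> 0) (at_right 0)"
  proof -
   have e: "\<forall>\<^sub>F s in at_right 0. 0 <= t s \<and> t s <= s \<and> 0 <= t' s \<and> t' s <= s"
    using ev by eventually_elim (use t in force)
   show "(t \<longlongrightarrow> 0) (at_right 0)" "(t' \<longlongrightarrow> 0) (at_right 0)"
    by (rule tendsto_sandwich[of "%_. 0" _ _ "%s. s"]; use e in \<open>auto elim: eventually_mono intro: tendsto_ident_at\<close>)+
  qed
  have "continuous_on U (pderivs [b, a] f)"
   using f ab by (auto simp: Ck_on_Suc)
  then have "isCont (pderivs [b, a] f) x" using U continuous_on_eq_continuous_at by blast
  moreover have "((%s. x + t s *\<^sub>R a + t' s *\<^sub>R b) \<longlongrightarrow> x + 0 *\<^sub>R a + 0 *\<^sub>R b) (at_right 0)"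
   by (intro tendsto_intros t0)
  ultimately have "((%s. pderivs [b, a] f (x + t s *\<^sub>R a + t' s *\<^sub>R b)) \<longlongrightarrow> pderivs [b, a] f x) (at_right 0)"
   using isCont_tendsto_compose[of x "pderivs [b, a] f"] by (simp del: pderivs.simps)
  then show ?thesis
  proof (rule Lim_transform_eventually)
   show "\<forall>\<^sub>F s in at_right 0. pderivs [b, a] f (x + t s *\<^sub>R a + t' s *\<^sub>R b) = \<Delta> s/(s * s)"
    using ev
   proof eventually_elim
    case (elim s)
    then have "\<Delta> s = s * s*pderivs [b, a] f (x + t s *\<^sub>R a + t' s *\<^sub>R b)" using t by blast
    then show ?case using elim by (simp del: pderivs.simps)
   qed
  qed
 qed
 have "((%s. \<Delta> s/(s * s)) \<longlongrightarrow> pderivs [b, a] f x) (at_right 0)" by (rule lim[OF ab]) (simp add: \<Delta>_def)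
 moreover have "((%s. \<Delta> s/(s * s)) \<longlongrightarrow> pderivs [a, b] f x) (at_right 0)" by (rule lim[OF ab(2,1)]) (simp add: \<Delta>_def add_ac)
 ultimately show ?thesis using tendsto_unique[OF trivial_limit_at_right_real] by blast
qed

section \<open>Cofactors\<close>

abbreviation perms :: "('n::finite => 'n) set" where
 "perms \<equiv> {p. p permutes UNIV}"

lemma det_row_replace:
 fixes A :: "real^'n^'n"
 shows "det (\<chi> k. if k = i then a else A$k) =
  (\<Sum>p\<in>perms. of_int (sign p)*(a$p i*(\<Prod>k\<in>UNIV - {i}. A$k$p k)))"
 unfolding det_def
proof (rule sum.cong[OF refl])
 fix p :: "'n => 'n"
 have "(\<Prod>k\<in>UNIV. (\<chi> k. if k = i then a else A$k)$k$p k)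
   = (\<chi> k. if k = i then a else A$k)$i$p i*(\<Prod>k\<in>UNIV - {i}. (\<chi> k. if k = i then a else A$k)$k$p k)"
  by (rule prod.remove) auto
 also have "\<dots> = a$p i*(\<Prod>k\<in>UNIV - {i}. A$k$p k)"
  by (intro arg_cong2[where f = "(*)"] prod.cong) auto
 finally show "of_int (sign p)*(\<Prod>k\<in>UNIV. (\<chi> k. if k = i then a else A$k)$k$p k) =
   of_int (sign p)*(a$p i*(\<Prod>k\<in>UNIV - {i}. A$k$p k))" by simp
qed

lemma cof_nth:
 "cof A$i$j = (\<Sum>p\<in>perms. of_int (sign p)*((if p i = j then 1 else 0)*(\<Prod>k\<in>UNIV - {i}. A$k$p k)))"
proof -
 have "axis j 1$p i = (if p i = j then 1 else (0::real))" for p :: "'a => 'a" by (simp add: axis_def)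
 then show ?thesis unfolding cof_def by (simp add: det_row_replace)
qed

lemma sum_cof_row: "(\<Sum>j\<in>UNIV. a$j*cof A$i$j) = det (\<chi> k. if k = i then a else A$k)"
proof -
 have "(\<Sum>j\<in>UNIV. a$j*cof A$i$j) =
  (\<Sum>j\<in>UNIV. \<Sum>p\<in>perms. (if p i = j then a$j*(of_int (sign p)*(\<Prod>k\<in>UNIV - {i}. A$k$p k)) else 0))"
  unfolding cof_nth sum_distrib_left by (intro sum.cong refl) auto
 also have "\<dots> = (\<Sum>p\<in>perms. \<Sum>j\<in>UNIV. (if p i = j then a$j*(of_int (sign p)*(\<Prod>k\<in>UNIV - {i}. A$k$p k)) else 0))"
  by (rule sum.swap)
 also have "\<dots> = det (\<chi> k. if k = i then a else A$k)"
  by (simp add: det_row_replace mult_ac)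
 finally show ?thesis .
qed

text \<open>Off the diagonal the entry is the expansion of a determinant with two equal
  rows.\<close>

lemma matrix_mult_cof: "A ** transpose (cof A) = det A *\<^sub>R mat 1"
proof -
 have "(\<Sum>j\<in>UNIV. A$k$j*cof A$i$j) = (if k = i then det A else 0)" for i k
 proof (cases "k = i")
  case True
  have "(\<chi> l. if l = i then A$i else A$l) = A" by (simp add: vec_eq_iff)
  then show ?thesis using sum_cof_row[of "A$i" A i] True by simp
 next
  case False
  have "det (\<chi> l. if l = i then A$k else A$l) = 0"
   by (rule det_identical_rows[OF False]) (use False in \<open>simp add: row_def vec_eq_iff\<close>)
  then show ?thesis using False sum_cof_row[of "A$k" A i] by simp
 qed
 then show ?thesis by (simp add: vec_eq_iff matrix_matrix_mult_def transpose_def mat_def)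
qed

text \<open>Reindex the sum by inverse permutations: the sign is unchanged and the condition p i = j
  becomes its mirror image.\<close>

lemma cof_transpose: "cof (transpose A)$i$j = cof A$j$i"
proof -
 have "cof (transpose A)$i$j =
  (\<Sum>p\<in>perms. of_int (sign p)*((if p i = j then 1 else 0)*(\<Prod>k\<in>UNIV - {i}. A$p k$k)))"
  by (simp add: cof_nth transpose_def)
 also have "\<dots> = (\<Sum>p\<in>perms. of_int (sign (Hilbert_Choice.inv p))*((if Hilbert_Choice.inv p i = j then 1 else 0) *
   (\<Prod>k\<in>UNIV - {i}. A$Hilbert_Choice.inv p k$k)))"
  by (rule sum_permutations_inverse)
 also have "\<dots> = (\<Sum>p\<in>perms. of_int (sign p)*((if p j = i then 1 else 0)*(\<Prod>k\<in>UNIV - {j}. A$k$p k)))"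
 proof (rule sum.cong[OF refl])
  fix p :: "'a => 'a" assume "p \<in> perms"
  then have p: "p permutes UNIV" by simp
  have b: "bij p" using p by (rule permutes_bij)
  have iff: "Hilbert_Choice.inv p i = j \<longleftrightarrow> p j = i" using b by (metis bij_inv_eq_iff)
  have s: "sign (Hilbert_Choice.inv p) = sign p" using p by (intro sign_inverse) (auto simp: permutation_permutes)
  have "(\<Prod>k\<in>UNIV - {i}. A$Hilbert_Choice.inv p k$k) = (\<Prod>k\<in>UNIV - {j}. A$k$p k)" if "p j = i"
  proof -
   have "bij_betw p (UNIV - {j}) (UNIV - {i})"
    using b that by (auto simp: bij_betw_def inj_on_def image_iff)
   from prod.reindex_bij_betw[OF this, of "%k. A$Hilbert_Choice.inv p k$k"]
   show ?thesis using b by (simp add: bij_is_inj)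
  qed
  then show "of_int (sign (Hilbert_Choice.inv p))*((if Hilbert_Choice.inv p i = j then 1 else 0) *
    (\<Prod>k\<in>UNIV - {i}. A$Hilbert_Choice.inv p k$k)) =
    of_int (sign p)*((if p j = i then 1 else 0)*(\<Prod>k\<in>UNIV - {j}. A$k$p k))"
   unfolding s iff by auto
 qed
 also have "\<dots> = cof A$j$i" by (simp add: cof_nth)
 finally show ?thesis .
qed

lemma cof_symmetric:
 assumes "!!i j. A$i$j = A$j$i"
 shows "cof A$i$j = cof A$j$i"
proof -
 have "transpose A = A" using assms by (simp add: transpose_def vec_eq_iff)
 then show ?thesis using cof_transpose[of A i j] by simp
qed

lemma cof_bound:
 fixes A :: "real^'n^'n"
 assumes "!!i j. \<bar>A$i$j\<bar> <= B" "1 <= B"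
 shows "\<bar>cof A$i$j\<bar> <= real (card (perms :: ('n => 'n) set))*B^CARD('n)"
proof -
 have "\<bar>cof A$i$j\<bar> <= (\<Sum>p\<in>(perms :: ('n => 'n) set). B^CARD('n))"
  unfolding cof_nth
 proof (rule order_trans[OF sum_abs sum_mono])
  fix p :: "'n => 'n"
  have "\<bar>\<Prod>k\<in>UNIV - {i}. A$k$p k\<bar> <= (\<Prod>k\<in>UNIV - {i}. B)"
   unfolding abs_prod using assms by (intro prod_mono) auto
  also have "\<dots> = B^card (UNIV - {i})" by simp
  also have "\<dots> <= B^CARD('n)" using assms(2) by (intro power_increasing card_mono) auto
  finally have *: "\<bar>\<Prod>k\<in>UNIV - {i}. A$k$p k\<bar> <= B^CARD('n)" .
  moreover have "0 <= B^CARD('n)" using assms(2) by simp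
  moreover have "\<bar>of_int (sign p) :: real\<bar> = 1" by (simp add: sign_def)
  ultimately show "\<bar>of_int (sign p)*((if p i = j then 1 else 0)*(\<Prod>k\<in>UNIV - {i}. A$k$p k))\<bar> <= B^CARD('n)"
   by (simp add: abs_mult)
 qed
 then show ?thesis by simp
qed

lemma tendsto_cof:
 assumes "!!i j. ((%x. A x$i$j) \<longlongrightarrow> B$i$j) F"
 shows "((%x. cof (A x)$i$j) \<longlongrightarrow> cof B$i$j) F"
 unfolding cof_nth by (intro tendsto_intros assms)

text \<open>Jacobi's formula. Along a path of solutions it turns the Monge-Ampere operator into the
  trace of the cofactor matrix with the Hessian of the variation.\<close>

lemma has_derivative_det:
 fixes A :: "real => real^'n^'n"
 assumes "!!i j. ((%t. A t$i$j) has_real_derivative H$i$j) (at t)"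
 shows "((%t. det (A t)) has_real_derivative (\<Sum>i\<in>UNIV. \<Sum>j\<in>UNIV. H$i$j*cof (A t)$i$j)) (at t)"
proof -
 have "((%t. det (A t)) has_real_derivative
  (\<Sum>p\<in>perms. of_int (sign p)*(\<Sum>i\<in>UNIV. H$i$p i*(\<Prod>k\<in>UNIV - {i}. A t$k$p k)))) (at t)"
  unfolding det_def by (intro DERIV_sum DERIV_cmult has_field_derivative_prod assms)
 also have "(\<Sum>p\<in>perms. of_int (sign p)*(\<Sum>i\<in>UNIV. H$i$p i*(\<Prod>k\<in>UNIV - {i}. A t$k$p k))) =
  (\<Sum>i\<in>UNIV. \<Sum>p\<in>perms. of_int (sign p)*(H$i$p i*(\<Prod>k\<in>UNIV - {i}. A t$k$p k)))"
  unfolding sum_distrib_left by (rule sum.swap)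
 also have "\<dots> = (\<Sum>i\<in>UNIV. \<Sum>j\<in>UNIV. H$i$j*cof (A t)$i$j)"
  by (simp add: sum_cof_row det_row_replace)
 finally show ?thesis .
qed

text \<open>
  Pairing each permutation \<open>p\<close> with its composition with the transposition of \<open>i\<close> and \<open>l\<close>: the third
  derivatives are symmetric, the signs are opposite.
\<close>

lemma cof_div_cancel:
 fixes A :: "real^'n^'n" and T :: "'n => 'n => 'n => real"
 assumes T: "!!l m q. T l m q = T l q m"
 shows "(\<Sum>p\<in>perms. of_int (sign p)*(\<Sum>l\<in>UNIV - {i}. T l (p l) (p i)*(\<Prod>k\<in>UNIV - {i} - {l}. A$k$p k))) = 0"
proof -
 have "(\<Sum>p\<in>perms. of_int (sign p)*(T l (p l) (p i)*(\<Prod>k\<in>UNIV - {i} - {l}. A$k$p k))) = 0" (is "?S = 0")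
  if l: "l \<in> UNIV - {i}" for l
 proof -
  define \<tau> where "\<tau> = Transposition.transpose i l"
  have \<tau>: "\<tau> permutes UNIV" unfolding \<tau>_def by (intro permutes_swap_id) auto
  have perm: "permutation p" if "p permutes UNIV" for p :: "'n => 'n" using that by (auto simp: permutation_permutes)
  have "?S = (\<Sum>p\<in>perms. of_int (sign (p \<circ> \<tau>))*(T l ((p \<circ> \<tau>) l) ((p \<circ> \<tau>) i)*(\<Prod>k\<in>UNIV - {i} - {l}. A$k$(p \<circ> \<tau>) k)))"
   by (rule sum_permutations_compose_right[OF \<tau>])
  also have "\<dots> = (\<Sum>p\<in>perms. - (of_int (sign p)*(T l (p l) (p i)*(\<Prod>k\<in>UNIV - {i} - {l}. A$k$p k))))"
  proof (rule sum.cong[OF refl])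
   fix p :: "'n => 'n" assume "p \<in> perms"
   then have "sign (p \<circ> \<tau>) = sign p * sign \<tau>" using \<tau> by (intro sign_compose perm) auto
   moreover have "sign \<tau> = - 1" unfolding \<tau>_def using l by (auto simp: sign_swap_id)
   moreover have "(\<Prod>k\<in>UNIV - {i} - {l}. A$k$(p \<circ> \<tau>) k) = (\<Prod>k\<in>UNIV - {i} - {l}. A$k$p k)"
    by (rule prod.cong) (auto simp: \<tau>_def Transposition.transpose_def)
   moreover have "(p \<circ> \<tau>) l = p i" "(p \<circ> \<tau>) i = p l" by (auto simp: \<tau>_def)
   ultimately show "of_int (sign (p \<circ> \<tau>))*(T l ((p \<circ> \<tau>) l) ((p \<circ> \<tau>) i)*(\<Prod>k\<in>UNIV - {i} - {l}. A$k$(p \<circ> \<tau>) k))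
     = - (of_int (sign p)*(T l (p l) (p i)*(\<Prod>k\<in>UNIV - {i} - {l}. A$k$p k)))"
    using T by simp
  qed
  also have "\<dots> = - ?S" by (simp add: sum_negf)
  finally show ?thesis by simp
 qed
 then have "(\<Sum>l\<in>UNIV - {i}. \<Sum>p\<in>perms. of_int (sign p)*(T l (p l) (p i)*(\<Prod>k\<in>UNIV - {i} - {l}. A$k$p k))) = 0"
  by (rule sum.neutral[OF ballI])
 then show ?thesis unfolding sum_distrib_left by (subst sum.swap)
qed

section \<open>Rows of the cofactor matrix of a Hessian are divergence free\<close>

definition C2b :: "(real^'n) set => real => (real^'n => real) => bool" where
 "C2b Om K v \<longleftrightarrow> Ck_on (Suc (Suc 0)) Om v \<and> 0 <= K \<and>
   (\<forall>x\<in>Om. \<bar>v x\<bar> <= K \<and> norm (grad v x) <= K \<and> (\<forall>i j. \<bar>hess v x$i$j\<bar> <= K))"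

lemma hess_nth: "hess v x$i$j = pderivs [axis i 1, axis j 1] v x"
 by (simp add: hess_def)

lemma grad_grad: "grad (%x. grad v x$j) x$i = hess v x$i$j"
 by (simp add: grad_nth hess_nth)

lemma hess_symmetric:
 assumes "open U" "x \<in> U" "Ck_on (Suc (Suc 0)) U v"
 shows "hess v x$i$j = hess v x$j$i"
 unfolding hess_nth by (rule pderivs_commute[OF assms]) (auto simp: Basis_vec_axis)

lemma C2b_Ck:
 assumes "C2b Om K v"
 shows "Ck_on (Suc 0) Om v" "Ck_on (Suc 0) Om (%x. grad v x$j)" "continuous_on Om (%x. hess v x$i$j)"
proof -
 have C: "Ck_on (Suc (Suc 0)) Om v" using assms by (simp add: C2b_def)
 then show "Ck_on (Suc 0) Om v" by (rule Ck_on_le) simp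
 show 1: "Ck_on (Suc 0) Om (%x. grad v x$j)" for j using C unfolding Ck_on_Suc_grad[of "Suc 0"] by blast
 then show "continuous_on Om (%x. hess v x$i$j)"
  unfolding grad_grad[symmetric] Ck_on_1 by (intro continuous_intros) blast
qed

lemma C2b_bounds:
 fixes v :: "real^'n => real"
 assumes "C2b Om K v" "x \<in> Om"
 shows "0 <= K" "\<bar>v x\<bar> <= K" "norm (grad v x) <= K" "\<bar>grad v x$j\<bar> <= K" "\<bar>hess v x$i$j\<bar> <= K"
  "norm (grad (%x. grad v x$j) x) <= real CARD('n)*K"
proof -
 show *: "0 <= K" "\<bar>v x\<bar> <= K" "norm (grad v x) <= K" "\<bar>hess v x$i$j\<bar> <= K" for i j
  using assms by (auto simp: C2b_def)
 show "\<bar>grad v x$j\<bar> <= K" using component_le_norm_cart[of "grad v x" j] *(3) by linarith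
 have "norm (grad (%x. grad v x$j) x) <= (\<Sum>i\<in>UNIV. \<bar>grad (%x. grad v x$j) x$i\<bar>)" by (rule norm_le_l1_cart)
 also have "\<dots> <= (\<Sum>i\<in>(UNIV :: 'n set). K)" unfolding grad_grad by (intro sum_mono *)
 finally show "norm (grad (%x. grad v x$j) x) <= real CARD('n)*K" by simp
qed

lemma cof_hess_has_derivative:
 assumes \<Psi>: "!!k. Ck_on k UNIV \<Psi>"
 shows "((%x. cof (hess \<Psi> x)$i$j) has_derivative (%h. \<Sum>p\<in>perms. of_int (sign p)*((if p i = j then 1 else 0) *
  (\<Sum>l\<in>UNIV - {i}. (grad (%x. hess \<Psi> x$l$p l) x \<bullet> h)*(\<Prod>k\<in>UNIV - {i} - {l}. hess \<Psi> x$k$p k))))) (at x)"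
proof -
 have d: "(%x. hess \<Psi> x$l$m) differentiable at x" for l m x
 proof -
  have "Ck_on (Suc 0) UNIV (%x. grad (%x. grad \<Psi> x$m) x$l)"
   using \<Psi>[of "Suc (Suc (Suc 0))"] unfolding Ck_on_Suc_grad[of "Suc (Suc 0)"] Ck_on_Suc_grad[of "Suc 0"] by blast
  then show ?thesis unfolding grad_grad by (simp add: Ck_on_1)
 qed
 show ?thesis
  unfolding cof_nth
  by (intro has_derivative_sum has_derivative_mult_right has_derivative_prod has_derivative_grad d)
qed

lemma Ck_on_cof_hess:
 assumes \<Psi>: "!!k. Ck_on k UNIV \<Psi>"
 shows "Ck_on k UNIV (%x. cof (hess \<Psi> x)$i$j)"
proof -
 have "Ck_on k UNIV (%x. hess \<Psi> x$l$m)" for l m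
 proof -
  have "Ck_on k UNIV (%x. grad (%x. grad \<Psi> x$m) x$l)"
   using \<Psi>[of "Suc (Suc k)"] unfolding Ck_on_Suc_grad[of "Suc k"] Ck_on_Suc_grad[of k] by blast
  then show ?thesis unfolding grad_grad .
 qed
 then show ?thesis unfolding cof_nth by (intro Ck_on_sum Ck_on_mult Ck_on_const Ck_on_prod open_UNIV)
qed

text \<open>Differentiating a cofactor of the Hessian produces third derivatives, whose symmetry is
  what cancels the terms in pairs. This is why the identity is first proved for smooth
  functions.\<close>

lemma cof_hess_div:
 fixes \<Psi> :: "real^'n => real"
 assumes \<Psi>: "!!k. Ck_on k UNIV \<Psi>"
 shows "(\<Sum>j\<in>UNIV. grad (%x. cof (hess \<Psi> x)$i$j) x$j) = 0"
proof -
 \<comment> \<open>The derivative along axis \<open>q\<close> of the Hessian entry (l, m);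
   \<open>cof_div_cancel\<close> needs the symmetry in \<open>m\<close> and
   \<open>q\<close>.\<close>
 define T where "T l m q = pderivs [axis q 1, axis l 1, axis m 1] \<Psi> x" for l m q :: 'n
 have c: "pderivs [a, b] f y = pderivs [b, a] f y" if "!!k. Ck_on k UNIV f" "a \<in> Basis" "b \<in> Basis" for f :: "real^'n => real" and a b y
  using that by (intro pderivs_commute[of UNIV]) auto
 have ax: "axis i 1 \<in> (Basis :: (real^'n) set)" for i by (auto simp: Basis_vec_axis)
 have T: "T l m q = T l q m" for l m q
 proof -
  have "Ck_on k UNIV (%x. grad \<Psi> x$l)" for k using \<Psi>[of "Suc k"] by (simp add: Ck_on_Suc_grad)
  then have "!!k. Ck_on k UNIV (pderivs [axis l 1] \<Psi>)" by (simp add: grad_nth)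
  note cl = c[OF this ax ax]
  have sw: "pderivs [axis l 1, axis m 1] \<Psi> = pderivs [axis m 1] (pderivs [axis l 1] \<Psi>)" for m
   using c[OF \<Psi> ax ax, of l m] by (auto simp: fun_eq_iff)
  have "T l m q = pderivs [axis q 1] (pderivs [axis l 1, axis m 1] \<Psi>) x" by (simp add: T_def)
  also have "\<dots> = pderivs [axis q 1, axis m 1] (pderivs [axis l 1] \<Psi>) x" unfolding sw by simp
  also have "\<dots> = pderivs [axis m 1, axis q 1] (pderivs [axis l 1] \<Psi>) x" by (rule cl)
  also have "\<dots> = pderivs [axis m 1] (pderivs [axis l 1, axis q 1] \<Psi>) x" unfolding sw by simp
  also have "\<dots> = T l q m" by (simp add: T_def)
  finally show ?thesis .
 qed
 have gT: "grad (%x. hess \<Psi> x$l$m) x \<bullet> axis q 1 = T l m q" for l m q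
  by (simp add: inner_axis grad_nth hess_nth T_def)
 have "(\<Sum>j\<in>UNIV. grad (%x. cof (hess \<Psi> x)$i$j) x$j) = (\<Sum>j\<in>UNIV. \<Sum>p\<in>perms. if p i = j then of_int (sign p) *
  (\<Sum>l\<in>UNIV - {i}. T l (p l) j*(\<Prod>k\<in>UNIV - {i} - {l}. hess \<Psi> x$k$p k)) else 0)"
  unfolding grad_nth pderivs_single[OF cof_hess_has_derivative[OF \<Psi>]] gT by (intro sum.cong refl) simp
 also have "\<dots> = (\<Sum>p\<in>perms. \<Sum>j\<in>UNIV. if p i = j then of_int (sign p) *
  (\<Sum>l\<in>UNIV - {i}. T l (p l) j*(\<Prod>k\<in>UNIV - {i} - {l}. hess \<Psi> x$k$p k)) else 0)" by (rule sum.swap)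
 also have "\<dots> = (\<Sum>p\<in>perms. of_int (sign p)*(\<Sum>l\<in>UNIV - {i}. T l (p l) (p i)*(\<Prod>k\<in>UNIV - {i} - {l}. hess \<Psi> x$k$p k)))"
  by simp
 also have "\<dots> = 0" by (rule cof_div_cancel[OF T])
 finally show ?thesis .
qed

lemma Piola_smooth:
 fixes \<Psi> :: "real^'n => real"
 assumes Om: "open Om" and \<Psi>: "!!k. Ck_on k UNIV \<Psi>" and \<xi>: "\<xi> \<in> C1c Om"
 shows "(LINT x|lebesgue_on Om. (\<Sum>j\<in>UNIV. cof (hess \<Psi> x)$i$j*grad \<xi> x$j)) = 0"
proof -
 let ?c = "%j x. cof (hess \<Psi> x)$i$j"
 have C: "Ck_on (Suc 0) Om (?c j)" for j using Ck_on_cof_hess[OF \<Psi>] by (rule Ck_on_subset) simp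
 note m = C1c_mult[OF Om \<xi> C]
 have i: "integrable (lebesgue_on Om) (%x. grad (%x. \<xi> x*?c j x) x$j)" for j
  using lebesgue_on_borel(2)[OF Om borel_measurable_integrable[OF C1c_integrable(2)[OF m(1)], simplified]]
   C1c_integrable(2)[OF m(1)] C1c_zero_outside(2)[OF m(1)] by simp
 have "(\<Sum>j\<in>UNIV. ?c j x*grad \<xi> x$j) = (\<Sum>j\<in>UNIV. grad (%x. \<xi> x*?c j x) x$j)" if "x \<in> Om" for x
 proof -
  have "(\<Sum>j\<in>UNIV. grad (%x. \<xi> x*?c j x) x$j) = \<xi> x*(\<Sum>j\<in>UNIV. grad (?c j) x$j) + (\<Sum>j\<in>UNIV. ?c j x*grad \<xi> x$j)"
   by (simp add: m(2)[OF that] sum.distrib sum_distrib_left)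
  then show ?thesis by (simp add: cof_hess_div[OF \<Psi>])
 qed
 then have "(LINT x|lebesgue_on Om. (\<Sum>j\<in>UNIV. ?c j x*grad \<xi> x$j)) =
   (LINT x|lebesgue_on Om. (\<Sum>j\<in>UNIV. grad (%x. \<xi> x*?c j x) x$j))"
  by (intro Bochner_Integration.integral_cong) auto
 also have "\<dots> = (\<Sum>j\<in>UNIV. LINT x|lebesgue_on Om. grad (%x. \<xi> x*?c j x) x$j)"
  using i by (rule Bochner_Integration.integral_sum)
 also have "\<dots> = 0" by (simp add: integral_grad_C1c_lebesgue_on[OF Om m(1)])
 finally show ?thesis .
qed

definition zext :: "(real^'n) set => (real^'n => real) => real^'n => real" where
 "zext Om g x = (if x \<in> Om then g x else 0)"

lemma borel_rep_zext:
 assumes "open Om" "continuous_on Om g"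
 shows "borel_rep Om g (zext Om g)"
proof -
 have "(%x. indicat_real Om x *\<^sub>R g x) \<in> borel_measurable borel"
  using assms by (intro borel_measurable_continuous_on_indicator) auto
 moreover have "(%x. indicat_real Om x *\<^sub>R g x) = zext Om g" by (auto simp: zext_def)
 ultimately show ?thesis by (auto simp: borel_rep_def zext_def intro!: AE_I2)
qed

lemma conv_close:
 assumes k: "mollifier s r k" and w: "w \<in> borel_measurable borel" "integrable lborel w"
  and c: "!!y. y \<in> ball (x + s) r ==> \<bar>w y - c\<bar> <= \<epsilon>"
 shows "\<bar>conv w k x - c\<bar> <= \<epsilon>"
proof -
 have kC: "k \<in> C1c UNIV" by (intro test_functions_C1c mollifier_test[OF k])
 note [measurable] = C1c_borel(1)[OF kC] w(1)
 obtain B where B: "!!x. \<bar>k x\<bar> <= B" using C1c_bounded[OF kC] by metis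
 have i: "integrable lborel (%z. w (x + z)*k z)"
  using lborel_integral_translate(2)[OF w(1), of x] w B
  by (intro integrable_mult_bounded[where B = B]) (auto simp: add.commute)
 have ik: "integrable lborel k" by (rule C1c_integrable(1)[OF kC])
 have "conv w k x - c = (LBINT z. (w (x + z) - c)*k z)"
  using i ik k by (simp add: conv_alt left_diff_distrib mollifier_def)
 also have "norm \<dots> <= (LBINT z. norm ((w (x + z) - c)*k z))" by (rule integral_norm_bound)
 also have "\<dots> <= (LBINT z. \<epsilon>*k z)"
 proof (rule integral_mono)
  show "integrable lborel (%z. norm ((w (x + z) - c)*k z))" using i ik by (simp add: left_diff_distrib)
  show "integrable lborel (%z. \<epsilon>*k z)" using ik by simp
  fix z
  show "norm ((w (x + z) - c)*k z) <= \<epsilon>*k z"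
  proof (cases "k z = 0")
   case False
   then have "z \<in> ball s r" using k by (auto simp: mollifier_def)
   then have "\<bar>w (x + z) - c\<bar> <= \<epsilon>" by (intro c) (simp add: dist_norm)
   then have "\<bar>w (x + z) - c\<bar>*k z <= \<epsilon>*k z" using k by (intro mult_right_mono) (auto simp: mollifier_def)
   then show ?thesis using k by (simp add: abs_mult mollifier_def)
  qed simp
 qed
 also have "\<dots> = \<epsilon>" using k by (simp add: mollifier_def)
 finally show ?thesis by simp
qed

text \<open>Mollification commutes with first derivatives on the whole ball of radius
  \<open>r0 - r\<close>, an open neighbourhood of \<open>x\<close>. This permits a second
  application of \<open>grad_conv_weak\<close>, now to the partial derivatives.\<close>

lemma hess_conv:
 fixes \<Phi> :: "real^'n => real"
 assumes Om: "open Om" "bounded Om" and \<Phi>: "C2b Om K \<Phi>" and k: "mollifier 0 r k" "r < r0" and x: "cball x r0 \<subseteq> Om"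
 shows "hess (conv (zext Om \<Phi>) k) x$i$j = conv (zext Om (%x. hess \<Phi> x$i$j)) k x"
proof -
 have r0: "0 < r0 - r" using k(2) by simp
 have cont: "continuous_on Om \<Phi>" "continuous_on Om (%x. grad \<Phi> x$j)" for j
  using C2b_Ck[OF \<Phi>] by (auto intro: Ck_on_imp_continuous_on)
 note rep = borel_rep_zext[OF Om(1)]
 have n: "K <= real CARD('n)*K" if "x \<in> Om" for x
 proof -
  have "1 <= real CARD('n)" by (simp add: Suc_leI)
  from mult_right_mono[OF this C2b_bounds(1)[OF \<Phi> that]] show ?thesis by simp
 qed
 have wg1: "is_weak_grad Om \<Phi> (grad \<Phi>)" "L2_on Om \<Phi>"
  using C2b_bounds[OF \<Phi>] by (intro C1_bounded_weak_grad[OF Om C2b_Ck(1)[OF \<Phi>]] C1_bounded_L2[OF Om C2b_Ck(1)[OF \<Phi>]]; blast)+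
 have b2: "\<bar>grad \<Phi> x$j\<bar> <= real CARD('n)*K" "norm (grad (%x. grad \<Phi> x$j) x) <= real CARD('n)*K" if "x \<in> Om" for x j
  using C2b_bounds(4,6)[OF \<Phi> that, of j] n[OF that] by linarith+
 have wg2: "is_weak_grad Om (%x. grad \<Phi> x$j) (grad (%x. grad \<Phi> x$j))" "L2_on Om (%x. grad \<Phi> x$j)"
  by (rule C1_bounded_weak_grad[OF Om C2b_Ck(2)[OF \<Phi>] b2], assumption+)
   (rule C1_bounded_L2[OF Om C2b_Ck(2)[OF \<Phi>] b2], assumption+)
 have sub: "cball y r \<subseteq> Om" if "y \<in> ball x (r0 - r)" for y
 proof -
  have "cball y r \<subseteq> cball x r0"
  proof
   fix z assume "z \<in> cball y r"
   then show "z \<in> cball x r0" using that dist_triangle[of x z y] by simp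
  qed
  then show ?thesis using x by blast
 qed
 have g1: "grad (conv (zext Om \<Phi>) k) y$j = conv (zext Om (%x. grad \<Phi> x$j)) k y" if "y \<in> ball x (r0 - r)" for y j
  using sub[OF that] by (intro grad_conv_weak[OF Om wg1(2,1) rep[OF cont(1)] rep[OF cont(2)] k(1)]) simp
 have "hess (conv (zext Om \<Phi>) k) x$i$j = grad (%y. grad (conv (zext Om \<Phi>) k) y$j) x$i"
  by (simp add: grad_grad)
 also have "grad (%y. grad (conv (zext Om \<Phi>) k) y$j) x = grad (conv (zext Om (%x. grad \<Phi> x$j)) k) x"
  by (rule grad_cong_open[of "ball x (r0 - r)"]) (use r0 g1 in auto)
 also have "\<dots>$i = conv (zext Om (%x. grad (%x. grad \<Phi> x$j) x$i)) k x"
  using sub[of x] r0 C2b_Ck(3)[OF \<Phi>, of i j]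
  by (intro grad_conv_weak[OF Om wg2(2,1) rep[OF cont(2)] rep k(1)]) (auto simp: grad_grad)
 finally show ?thesis by (simp add: grad_grad)
qed

text \<open>Mollify \<Phi>. On the support of \<xi> the Hessians of the mollifications are averages
  of the Hessian of \<Phi>, so they are bounded by \<open>K\<close> and converge pointwise.
  Cofactors are polynomials in the entries, and dominated convergence carries the smooth identity
  over.\<close>

lemma Piola_C1c:
 fixes \<Phi> :: "real^'n => real"
 assumes Om: "open Om" "bounded Om" and \<Phi>: "C2b Om K \<Phi>" and \<xi>: "\<xi> \<in> C1c Om"
 shows "(LINT x|lebesgue_on Om. (\<Sum>j\<in>UNIV. cof (hess \<Phi> x)$i$j*grad \<xi> x$j)) = 0"
proof -
 define S where "S = closure {x. \<xi> x ~= 0}"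
 have S: "compact S" "S \<subseteq> Om" using \<xi> by (auto simp: C1c_def S_def)
 have Sz: "grad \<xi> x = 0" if "x \<notin> S" for x using that unfolding S_def by (rule grad_zero_outside)
 obtain r0' where r0': "0 < r0'" "(\<Union>x\<in>S. ball x r0') \<subseteq> Om"
  using compact_subset_open_imp_ball_epsilon_subset[OF S(1) Om(1) S(2)] by blast
 define r0 where "r0 = r0'/2"
 have r0: "0 < r0" using r0' by (simp add: r0_def)
 have cb: "cball x r0 \<subseteq> Om" if "x \<in> S" for x
 proof -
  have "cball x r0 \<subseteq> ball x r0'" using r0' by (auto simp: r0_def)
  then show ?thesis using r0'(2) that by blast
 qed
 define r where "r n = r0/(real n + 2)" for n
 have r: "0 < r n" "r n < r0" for n
 proof -
  have "r0*1 < r0*(real n + 2)" using r0 by (intro mult_strict_left_mono) auto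
  then show "0 < r n" "r n < r0" using r0 by (auto simp: r_def pos_divide_less_eq)
 qed
 have "(%n. r0*(1/real (n + 2))) \<longlonglongrightarrow> r0*0"
  by (intro tendsto_intros LIMSEQ_ignore_initial_segment[OF lim_1_over_n])
 then have rlim: "r \<longlonglongrightarrow> 0" by (simp add: r_def[abs_def] add.commute)
 have "\<forall>n. \<exists>k. mollifier (0 :: real^'n) (r n) k"
  using mollifier_exists[OF r(1)] by metis
 from choice[OF this] obtain k where k: "\<forall>n. mollifier (0 :: real^'n) (r n) (k n)" by (elim exE)
 define \<Psi> where "\<Psi> n = conv (zext Om \<Phi>) (k n)" for n
 have zi: "zext Om g \<in> borel_measurable borel" "integrable lborel (zext Om g)"
  if "continuous_on Om g" "!!x. x \<in> Om ==> \<bar>g x\<bar> <= K" for g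
 proof -
  note rep = borel_rep_zext[OF Om(1) that(1)]
  have "L2_on Om g" using that by (intro L2_on_bounded[OF Om measurable_lebesgue_on_continuous[OF Om(1)], of _ K]) auto
  from borel_rep_L2(1)[OF Om this rep] rep show "zext Om g \<in> borel_measurable borel" "integrable lborel (zext Om g)"
   by (auto simp: borel_rep_def)
 qed
 have \<Phi>c: "continuous_on Om \<Phi>" using C2b_Ck(1)[OF \<Phi>] by (rule Ck_on_imp_continuous_on)
 have \<Psi>s: "Ck_on m UNIV (\<Psi> n)" for m n
  unfolding \<Psi>_def using k C2b_bounds(2)[OF \<Phi>] by (intro Ck_on_conv[OF zi(2)[OF \<Phi>c] mollifier_test]) blast+
 define g where "g i j x = hess \<Phi> x$i$j" for i j x
 have gc: "continuous_on Om (g i j)" "!!x. x \<in> Om ==> \<bar>g i j x\<bar> <= K" for i j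
  using C2b_Ck(3)[OF \<Phi>, of i j] C2b_bounds(5)[OF \<Phi>] by (auto simp: g_def[abs_def])
 have h: "hess (\<Psi> n) x$i$j = conv (zext Om (g i j)) (k n) x" if "x \<in> S" for n x i j
  unfolding \<Psi>_def g_def using hess_conv[OF Om \<Phi> _ r(2) cb[OF that]] k by blast
 have bsub: "ball (x + 0) (r n) \<subseteq> Om" if "x \<in> S" for x n
 proof -
  have "ball (x + 0) (r n) \<subseteq> cball x r0" using r[of n] by auto
  then show ?thesis using cb[OF that] by blast
 qed
 have hb: "\<bar>hess (\<Psi> n) x$i$j\<bar> <= K" if x: "x \<in> S" for n x i j
 proof -
  have "\<bar>conv (zext Om (g i j)) (k n) x - 0\<bar> <= K"
   by (rule conv_close[OF spec[OF k] zi[OF gc]]) (use gc(2) bsub[OF x, of n] in \<open>auto simp: zext_def\<close>)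
  then show ?thesis using h[OF x] by simp
 qed
 have hl: "(%n. hess (\<Psi> n) x$i$j) \<longlonglongrightarrow> hess \<Phi> x$i$j" if x: "x \<in> S" for x i j
 proof (rule LIMSEQ_I)
  fix e :: real assume e: "0 < e"
  have "x \<in> Om" using x S by blast
  then have "isCont (g i j) x" using gc(1)[of i j] Om(1) continuous_on_eq_continuous_at by blast
  then obtain d where d: "0 < d" "!!y. dist y x < d ==> dist (g i j y) (g i j x) < e/2"
   using e unfolding continuous_at_eps_delta by (meson half_gt_zero)
  obtain M where M: "!!n. n >= M ==> r n < d"
   using order_tendstoD(2)[OF rlim d(1)] by (auto simp: eventually_sequentially)
  show "\<exists>no. \<forall>n\<ge>no. norm (hess (\<Psi> n) x$i$j - hess \<Phi> x$i$j) < e"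
  proof (intro exI allI impI)
   fix n assume n: "n >= M"
   have "\<bar>conv (zext Om (g i j)) (k n) x - g i j x\<bar> <= e/2"
   proof (rule conv_close[OF spec[OF k] zi[OF gc]])
    fix y assume y: "y \<in> ball (x + 0) (r n)"
    then have "y \<in> Om" "dist y x < d" using bsub[OF x, of n] M[OF n] by (auto simp: dist_commute)
    then show "\<bar>zext Om (g i j) y - g i j x\<bar> <= e/2"
     using d(2)[of y] by (simp add: zext_def dist_real_def)
   qed
   then show "norm (hess (\<Psi> n) x$i$j - hess \<Phi> x$i$j) < e" using h[OF x] e by (simp add: g_def)
  qed
 qed
 obtain B where B: "0 < B" "!!x. norm (grad \<xi> x) <= B" using C1c_bounded[OF \<xi>] by metis
 define P where "P = real (card (perms :: ('n => 'n) set))*(max 1 K)^CARD('n)"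
 have P0: "0 <= P" unfolding P_def by simp
 have cb': "\<bar>cof (hess (\<Psi> n) x)$i$j\<bar> <= P" if "x \<in> S" for x n i j
  unfolding P_def using hb[OF that] by (intro cof_bound) (auto simp: le_max_iff_disj)
 have gb: "\<bar>grad \<xi> x$j\<bar> <= B" for x j using component_le_norm_cart[of "grad \<xi> x" j] B(2)[of x] by linarith
 have "(%n. LINT x|lebesgue_on Om. (\<Sum>j\<in>UNIV. cof (hess (\<Psi> n) x)$i$j*grad \<xi> x$j)) \<longlonglongrightarrow>
  (LINT x|lebesgue_on Om. (\<Sum>j\<in>UNIV. cof (hess \<Phi> x)$i$j*grad \<xi> x$j))"
 proof (rule integral_dominated_convergence[where w = "%x. real CARD('n)*(P*B)"])
  have cm: "continuous_on Om (%x. cof (hess v x)$i$j)" if "!!l m. continuous_on Om (%x. hess v x$l$m)" for v :: "real^'n => real" and j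
   unfolding cof_nth by (intro continuous_intros that)
  have m: "(%x. \<Sum>j\<in>UNIV. cof (hess v x)$i$j*grad \<xi> x$j) \<in> borel_measurable (lebesgue_on Om)"
   if "!!l m. continuous_on Om (%x. hess v x$l$m)" for v
   by (intro measurable_lebesgue_on_continuous[OF Om(1)] continuous_intros cm that C1c_continuous_grad[OF \<xi>])
  show "(%x. \<Sum>j\<in>UNIV. cof (hess \<Phi> x)$i$j*grad \<xi> x$j) \<in> borel_measurable (lebesgue_on Om)"
   by (rule m) (rule C2b_Ck(3)[OF \<Phi>])
  have "continuous_on Om (%x. hess (\<Psi> n) x$l$m)" for n l m
  proof -
   have "Ck_on 0 UNIV (%x. grad (%x. grad (\<Psi> n) x$m) x$l)"
    using \<Psi>s[of "Suc (Suc 0)" n] unfolding Ck_on_Suc_grad by blast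
   then show ?thesis unfolding grad_grad Ck_on_0 by (rule continuous_on_subset) simp
  qed
  then show "(%x. \<Sum>j\<in>UNIV. cof (hess (\<Psi> n) x)$i$j*grad \<xi> x$j) \<in> borel_measurable (lebesgue_on Om)" for n
   by (rule m)
  show "integrable (lebesgue_on Om) (%x. real CARD('n)*(P*B))" by (rule integrable_lebesgue_on_const[OF Om])
  show "AE x in lebesgue_on Om. (%n. \<Sum>j\<in>UNIV. cof (hess (\<Psi> n) x)$i$j*grad \<xi> x$j) \<longlonglongrightarrow>
    (\<Sum>j\<in>UNIV. cof (hess \<Phi> x)$i$j*grad \<xi> x$j)"
  proof (rule AE_I2)
   fix x
   show "(%n. \<Sum>j\<in>UNIV. cof (hess (\<Psi> n) x)$i$j*grad \<xi> x$j) \<longlonglongrightarrow> (\<Sum>j\<in>UNIV. cof (hess \<Phi> x)$i$j*grad \<xi> x$j)"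
   proof (cases "x \<in> S")
    case True
    then show ?thesis by (intro tendsto_intros tendsto_cof hl)
   qed (simp add: Sz)
  qed
  show "AE x in lebesgue_on Om. norm (\<Sum>j\<in>UNIV. cof (hess (\<Psi> n) x)$i$j*grad \<xi> x$j) <= real CARD('n)*(P*B)" for n
  proof (rule AE_I2)
   fix x
   show "norm (\<Sum>j\<in>UNIV. cof (hess (\<Psi> n) x)$i$j*grad \<xi> x$j) <= real CARD('n)*(P*B)"
   proof (cases "x \<in> S")
    case True
    have "norm (\<Sum>j\<in>UNIV. cof (hess (\<Psi> n) x)$i$j*grad \<xi> x$j) <= (\<Sum>j\<in>(UNIV :: 'n set). P*B)"
    proof (rule sum_norm_le)
     fix j
     show "norm (cof (hess (\<Psi> n) x)$i$j*grad \<xi> x$j) <= P*B"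
      unfolding real_norm_def abs_mult using cb'[OF True] gb P0 by (intro mult_mono) auto
    qed
    then show ?thesis by simp
   qed (use P0 B in \<open>simp add: Sz\<close>)
  qed
 qed
 then have "(%n. 0) \<longlonglongrightarrow> (LINT x|lebesgue_on Om. (\<Sum>j\<in>UNIV. cof (hess \<Phi> x)$i$j*grad \<xi> x$j))"
  using Piola_smooth[OF Om(1) \<Psi>s \<xi>] by simp
 then show ?thesis using LIMSEQ_unique tendsto_const by blast
qed

section \<open>Integration by parts\<close>

lemma cof_hess_bounded:
 fixes \<Phi> :: "real^'n => real"
 assumes "C2b Om K \<Phi>"
 shows "\<exists>P\<ge>0. \<forall>x\<in>Om. \<forall>i j. \<bar>cof (hess \<Phi> x)$i$j\<bar> <= P"
proof -
 define P where "P = real (card (perms :: ('n => 'n) set))*(max 1 K)^CARD('n)"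
 have "\<bar>cof (hess \<Phi> x)$i$j\<bar> <= P" if "x \<in> Om" for x i j
  unfolding P_def using C2b_bounds(5)[OF assms that] by (intro cof_bound) (auto simp: le_max_iff_disj)
 moreover have "0 <= P" unfolding P_def by simp
 ultimately show ?thesis by blast
qed

lemma continuous_on_cof_hess:
 assumes "C2b Om K \<Phi>"
 shows "continuous_on Om (%x. cof (hess \<Phi> x)$i$j)"
 unfolding cof_nth by (intro continuous_intros C2b_Ck(3)[OF assms])

lemma Piola_zero_boundary:
 fixes \<Phi> f :: "real^'n => real"
 assumes Om: "open Om" "bounded Om" and \<Phi>: "C2b Om K \<Phi>" and f: "Ck_on (Suc 0) Om f"
  and B: "!!x. x \<in> Om ==> \<bar>f x\<bar> <= B" "!!x. x \<in> Om ==> norm (grad f x) <= B"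
  and cont: "continuous_on (closure Om) f" and 0: "!!x. x \<in> frontier Om ==> f x = 0"
 shows "(LINT x|lebesgue_on Om. (\<Sum>j\<in>UNIV. cof (hess \<Phi> x)$i$j*grad f x$j)) = 0"
proof -
 obtain F where F: "!!n. F n \<in> C1c Om"
  "!!n x. x \<in> Om ==> \<bar>F n x\<bar> <= 4*B" "!!n x. x \<in> Om ==> norm (grad (F n) x) <= 4*B"
  "!!x. x \<in> Om ==> (%n. F n x) \<longlonglongrightarrow> f x" "!!x. x \<in> Om ==> (%n. grad (F n) x) \<longlonglongrightarrow> grad f x"
  using zero_boundary_approx[OF Om f B cont 0] by blast
 obtain P where P: "0 <= P" "\<forall>x\<in>Om. \<forall>i j. \<bar>cof (hess \<Phi> x)$i$j\<bar> <= P" using cof_hess_bounded[OF \<Phi>] by blast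
 have "(%n. LINT x|lebesgue_on Om. (\<Sum>j\<in>UNIV. cof (hess \<Phi> x)$i$j*grad (F n) x$j)) \<longlonglongrightarrow>
  (LINT x|lebesgue_on Om. (\<Sum>j\<in>UNIV. cof (hess \<Phi> x)$i$j*grad f x$j))"
 proof (rule integral_dominated_convergence[where w = "%x. real CARD('n)*(P*(4*B))"])
  show "(%x. \<Sum>j\<in>UNIV. cof (hess \<Phi> x)$i$j*grad f x$j) \<in> borel_measurable (lebesgue_on Om)"
   using f by (intro measurable_lebesgue_on_continuous[OF Om(1)] continuous_intros continuous_on_cof_hess[OF \<Phi>]) (simp add: Ck_on_1)
  show "(%x. \<Sum>j\<in>UNIV. cof (hess \<Phi> x)$i$j*grad (F n) x$j) \<in> borel_measurable (lebesgue_on Om)" for n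
   by (intro measurable_lebesgue_on_continuous[OF Om(1)] continuous_intros continuous_on_cof_hess[OF \<Phi>] C1c_continuous_grad[OF F(1)])
  show "integrable (lebesgue_on Om) (%x. real CARD('n)*(P*(4*B)))" by (rule integrable_lebesgue_on_const[OF Om])
  show "AE x in lebesgue_on Om. (%n. \<Sum>j\<in>UNIV. cof (hess \<Phi> x)$i$j*grad (F n) x$j) \<longlonglongrightarrow>
    (\<Sum>j\<in>UNIV. cof (hess \<Phi> x)$i$j*grad f x$j)"
  proof (rule AE_I2)
   fix x assume "x \<in> space (lebesgue_on Om)"
   then have "x \<in> Om" by simp
   then show "(%n. \<Sum>j\<in>UNIV. cof (hess \<Phi> x)$i$j*grad (F n) x$j) \<longlonglongrightarrow>
    (\<Sum>j\<in>UNIV. cof (hess \<Phi> x)$i$j*grad f x$j)"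
    by (intro tendsto_intros F)
  qed
  show "AE x in lebesgue_on Om. norm (\<Sum>j\<in>UNIV. cof (hess \<Phi> x)$i$j*grad (F n) x$j) <= real CARD('n)*(P*(4*B))" for n
  proof (rule AE_I2)
   fix x assume "x \<in> space (lebesgue_on Om)"
   then have x: "x \<in> Om" by simp
   have "norm (\<Sum>j\<in>UNIV. cof (hess \<Phi> x)$i$j*grad (F n) x$j) <= (\<Sum>j\<in>(UNIV :: 'n set). P*(4*B))"
   proof (rule sum_norm_le)
    fix j
    have "\<bar>grad (F n) x$j\<bar> <= 4*B" using component_le_norm_cart[of "grad (F n) x" j] F(3)[OF x, of n] by linarith
    then show "norm (cof (hess \<Phi> x)$i$j*grad (F n) x$j) <= P*(4*B)"
     unfolding real_norm_def abs_mult using P x by (intro mult_mono) auto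
   qed
   then show "norm (\<Sum>j\<in>UNIV. cof (hess \<Phi> x)$i$j*grad (F n) x$j) <= real CARD('n)*(P*(4*B))" by simp
  qed
 qed
 then have "(%n. 0) \<longlonglongrightarrow> (LINT x|lebesgue_on Om. (\<Sum>j\<in>UNIV. cof (hess \<Phi> x)$i$j*grad f x$j))"
  using Piola_C1c[OF Om \<Phi> F(1)] by simp
 then show ?thesis using LIMSEQ_unique tendsto_const by blast
qed

text \<open>The principal part in nondivergence form. For smooth \<Phi> it equals div (C grad u),
  because the rows of the cofactor matrix are divergence free.\<close>

definition lin_tr :: "(real^'n => real) => (real^'n => real) => real^'n => real" where
 "lin_tr \<Phi> u x = (\<Sum>i\<in>UNIV. \<Sum>j\<in>UNIV. lin_C \<Phi> x$i$j*hess u x$i$j)"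

lemma lin_C_symmetric:
 assumes "open Om" "C2b Om K \<Phi>" "x \<in> Om"
 shows "lin_C \<Phi> x$i$j = lin_C \<Phi> x$j$i"
 unfolding lin_C_def using assms
 by (intro cof_symmetric hess_symmetric[OF assms(1,3)]) (simp add: C2b_def)

lemma inner_lin_C: "(lin_C \<Phi> x *v G) \<bullet> H = (\<Sum>i\<in>UNIV. \<Sum>j\<in>UNIV. lin_C \<Phi> x$i$j*G$j*H$i)"
 by (simp add: inner_vec_def matrix_vector_mult_def sum_distrib_right)

lemma lin_C_inner_commute:
 assumes "open Om" "C2b Om K \<Phi>" "x \<in> Om"
 shows "(lin_C \<Phi> x *v G) \<bullet> H = (lin_C \<Phi> x *v H) \<bullet> G"
 unfolding inner_lin_C by (subst sum.swap) (simp add: lin_C_symmetric[OF assms] mult_ac)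

lemma continuous_on_zext:
 assumes Om: "open Om" and g: "continuous_on Om g" and lim: "!!x. x \<in> frontier Om ==> (g \<longlongrightarrow> 0) (at x within Om)"
 shows "continuous_on (closure Om) (zext Om g)"
 unfolding continuous_on_def
proof
 fix x assume x: "x \<in> closure Om"
 have "(zext Om g \<longlongrightarrow> zext Om g x) (at x within Om)"
 proof (cases "x \<in> Om")
  case True
  then have "(g \<longlongrightarrow> g x) (at x within Om)" using g by (simp add: continuous_on_def)
  then have "(zext Om g \<longlongrightarrow> g x) (at x within Om)"
   by (rule Lim_transform_eventually) (auto simp: eventually_at_filter zext_def)
  then show ?thesis using True by (simp add: zext_def)
 next
  case False
  then have "x \<in> frontier Om" using x Om by (simp add: frontier_def interior_open)
  then have "(zext Om g \<longlongrightarrow> 0) (at x within Om)"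
   by (intro Lim_transform_eventually[OF lim]) (auto simp: eventually_at_filter zext_def)
  then show ?thesis using False by (simp add: zext_def)
 qed
 moreover have "(zext Om g \<longlongrightarrow> zext Om g x) (at x within frontier Om)"
 proof (cases "x \<in> Om")
  case True
  have "closed (frontier Om)" by simp
  moreover have "x \<notin> frontier Om" using True Om by (simp add: frontier_def interior_open)
  ultimately have "at x within frontier Om = bot"
   using closed_limpt trivial_limit_within by blast
  then show ?thesis by simp
 next
  case False
  have "(zext Om g \<longlongrightarrow> 0) (at x within frontier Om)"
  proof (rule Lim_transform_eventually[OF tendsto_const])
   show "\<forall>\<^sub>F y in at x within frontier Om. 0 = zext Om g y"
    using frontier_at_within_nontrivial(2)[OF Om] by (auto simp: eventually_at_filter zext_def)
  qed
  then show ?thesis using False by (simp add: zext_def)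
 qed
 ultimately have "(zext Om g \<longlongrightarrow> zext Om g x) (at x within Om \<union> frontier Om)" by (simp add: Lim_Un)
 moreover have "Om \<union> frontier Om = closure Om" by (simp add: closure_Un_frontier)
 ultimately show "(zext Om g \<longlongrightarrow> zext Om g x) (at x within closure Om)" by simp
qed

text \<open>The rows of the cofactor matrix are tested with \<open>F\<close> times the partial
  derivatives of \<open>u\<close> and summed, so no derivative falls on the coefficients, which are
  only continuous. The boundary condition concerns the product: it holds if \<open>F\<close>
  vanishes at the boundary or if the gradient of \<open>u\<close> does.\<close>

lemma Green:
 fixes \<Phi> u F :: "real^'n => real"
 assumes Om: "open Om" "bounded Om" and \<Phi>: "C2b Om K \<Phi>" and u: "C2b Om K' u" and F: "Ck_on (Suc 0) Om F"
  and B: "!!x. x \<in> Om ==> \<bar>F x\<bar> <= B" "!!x. x \<in> Om ==> norm (grad F x) <= B"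
  and lim: "!!x i. x \<in> frontier Om ==> ((%x. F x*grad u x$i) \<longlongrightarrow> 0) (at x within Om)"
 shows "(LINT x|lebesgue_on Om. (lin_C \<Phi> x *v grad u x) \<bullet> grad F x + lin_tr \<Phi> u x*F x) = 0"
proof -
 define f where "f i = zext Om (%x. F x*grad u x$i)" for i
 have Fu: "Ck_on (Suc 0) Om (%x. F x*grad u x$i)" for i by (rule Ck_on_mult[OF Om(1) F C2b_Ck(2)[OF u]])
 have eq: "f i x = F x*grad u x$i" if "x \<in> Om" for i x using that by (simp add: f_def zext_def)
 have fC: "Ck_on (Suc 0) Om (f i)" for i using Ck_on_cong[OF Om(1), of "f i", OF eq] Fu by blast
 have fg: "grad (f i) x = F x *\<^sub>R grad (%x. grad u x$i) x + (grad u x$i) *\<^sub>R grad F x" if x: "x \<in> Om" for i x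
 proof -
  have "grad (f i) x = grad (%x. F x*grad u x$i) x" by (rule grad_cong_open[OF Om(1) x eq])
  also have "\<dots> = F x *\<^sub>R grad (%x. grad u x$i) x + (grad u x$i) *\<^sub>R grad F x"
  proof (rule grad_eqI)
   have "(F has_derivative (%h. grad F x \<bullet> h)) (at x)" "((%x. grad u x$i) has_derivative (%h. grad (%x. grad u x$i) x \<bullet> h)) (at x)"
    using F C2b_Ck(2)[OF u] x by (auto intro!: has_derivative_grad simp: Ck_on_1)
   from has_derivative_mult[OF this]
   show "((%x. F x*grad u x$i) has_derivative (%h. (F x *\<^sub>R grad (%x. grad u x$i) x + (grad u x$i) *\<^sub>R grad F x) \<bullet> h)) (at x)"
    by (simp add: inner_add_left mult.commute)
  qed
  finally show ?thesis .
 qed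
 define B' where "B' = \<bar>B\<bar>*K' + \<bar>B\<bar>*(real CARD('n)*K') + K'*\<bar>B\<bar>"
 have fb: "\<bar>f i x\<bar> <= B'" "norm (grad (f i) x) <= B'" if x: "x \<in> Om" for i x
 proof -
  note b = C2b_bounds[OF u x]
  have B': "\<bar>F x\<bar> <= \<bar>B\<bar>" "norm (grad F x) <= \<bar>B\<bar>" using B[OF x] by linarith+
  have "\<bar>F x\<bar>*\<bar>grad u x$i\<bar> <= \<bar>B\<bar>*K'" using b B' by (intro mult_mono) auto
  moreover have "norm (F x *\<^sub>R grad (%x. grad u x$i) x) <= \<bar>B\<bar>*(real CARD('n)*K')"
   unfolding norm_scaleR using b B' by (intro mult_mono) auto
  moreover have "norm ((grad u x$i) *\<^sub>R grad F x) <= K'*\<bar>B\<bar>"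
   unfolding norm_scaleR using b B' by (intro mult_mono) auto
  moreover have "0 <= \<bar>B\<bar>*K'" "0 <= \<bar>B\<bar>*(real CARD('n)*K')" "0 <= K'*\<bar>B\<bar>" using b(1) by auto
  moreover have "norm (grad (f i) x) <= norm (F x *\<^sub>R grad (%x. grad u x$i) x) + norm ((grad u x$i) *\<^sub>R grad F x)"
   unfolding fg[OF x] by (rule norm_triangle_ineq)
  ultimately show "\<bar>f i x\<bar> <= B'" "norm (grad (f i) x) <= B'" by (simp_all only: eq[OF x] abs_mult B'_def)
 qed
 have fcont: "continuous_on (closure Om) (f i)" for i
  unfolding f_def by (rule continuous_on_zext[OF Om(1) Ck_on_imp_continuous_on[OF Fu] lim])
 have f0: "f i x = 0" if "x \<in> frontier Om" for i x
  using frontier_at_within_nontrivial(2)[OF Om(1) that] by (simp add: f_def zext_def)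
 have I: "(LINT x|lebesgue_on Om. (\<Sum>j\<in>UNIV. cof (hess \<Phi> x)$i$j*grad (f i) x$j)) = 0" for i
  by (rule Piola_zero_boundary[OF Om \<Phi> fC fb fcont f0])
 obtain P where P: "0 <= P" "\<forall>x\<in>Om. \<forall>i j. \<bar>cof (hess \<Phi> x)$i$j\<bar> <= P" using cof_hess_bounded[OF \<Phi>] by blast
 have int: "integrable (lebesgue_on Om) (%x. \<Sum>j\<in>UNIV. cof (hess \<Phi> x)$i$j*grad (f i) x$j)" for i
 proof (rule integrable_lebesgue_on_bounded[OF Om, where B = "real CARD('n)*(P*B')"])
  show "(%x. \<Sum>j\<in>UNIV. cof (hess \<Phi> x)$i$j*grad (f i) x$j) \<in> borel_measurable (lebesgue_on Om)"
   using fC[of i] by (intro measurable_lebesgue_on_continuous[OF Om(1)] continuous_intros continuous_on_cof_hess[OF \<Phi>]) (simp add: Ck_on_1)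
  fix x assume x: "x \<in> Om"
  have "norm (\<Sum>j\<in>UNIV. cof (hess \<Phi> x)$i$j*grad (f i) x$j) <= (\<Sum>j\<in>(UNIV :: 'n set). P*B')"
  proof (rule sum_norm_le)
   fix j
   have "\<bar>grad (f i) x$j\<bar> <= B'" using component_le_norm_cart[of "grad (f i) x" j] fb(2)[OF x, of i] by linarith
   then show "norm (cof (hess \<Phi> x)$i$j*grad (f i) x$j) <= P*B'"
    unfolding real_norm_def abs_mult using P x by (intro mult_mono) auto
  qed
  then show "norm (\<Sum>j\<in>UNIV. cof (hess \<Phi> x)$i$j*grad (f i) x$j) <= real CARD('n)*(P*B')" by simp
 qed
 have "(LINT x|lebesgue_on Om. (lin_C \<Phi> x *v grad u x) \<bullet> grad F x + lin_tr \<Phi> u x*F x) =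
  (LINT x|lebesgue_on Om. (\<Sum>i\<in>UNIV. \<Sum>j\<in>UNIV. cof (hess \<Phi> x)$i$j*grad (f i) x$j))"
 proof (rule Bochner_Integration.integral_cong[OF refl])
  fix x assume "x \<in> space (lebesgue_on Om)"
  then have x: "x \<in> Om" by simp
  have "(\<Sum>i\<in>UNIV. \<Sum>j\<in>UNIV. cof (hess \<Phi> x)$i$j*grad (f i) x$j) =
   (\<Sum>i\<in>UNIV. \<Sum>j\<in>UNIV. lin_C \<Phi> x$i$j*grad F x$j*grad u x$i + lin_C \<Phi> x$i$j*hess u x$j$i*F x)"
   by (simp add: fg[OF x] grad_grad lin_C_def algebra_simps)
  also have "\<dots> = (lin_C \<Phi> x *v grad F x) \<bullet> grad u x + lin_tr \<Phi> u x*F x"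
   using hess_symmetric[OF Om(1) x, of u] u
   by (simp add: inner_lin_C sum.distrib lin_tr_def sum_distrib_right C2b_def)
  also have "(lin_C \<Phi> x *v grad F x) \<bullet> grad u x = (lin_C \<Phi> x *v grad u x) \<bullet> grad F x"
   by (rule lin_C_inner_commute[OF Om(1) \<Phi> x])
  finally show "(lin_C \<Phi> x *v grad u x) \<bullet> grad F x + lin_tr \<Phi> u x*F x =
    (\<Sum>i\<in>UNIV. \<Sum>j\<in>UNIV. cof (hess \<Phi> x)$i$j*grad (f i) x$j)" by simp
 qed
 also have "\<dots> = 0" using int I by (subst Bochner_Integration.integral_sum) auto
 finally show ?thesis .
qed

lemma Green_C1c:
 assumes Om: "open Om" "bounded Om" and \<Phi>: "C2b Om K \<Phi>" and u: "C2b Om K' u" and \<xi>: "\<xi> \<in> C1c Om"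
 shows "(LINT x|lebesgue_on Om. (lin_C \<Phi> x *v grad u x) \<bullet> grad \<xi> x + lin_tr \<Phi> u x*\<xi> x) = 0"
proof -
 obtain B where B: "!!x. \<bar>\<xi> x\<bar> <= B" "!!x. norm (grad \<xi> x) <= B" using C1c_bounded[OF \<xi>] by metis
 have C: "Ck_on (Suc 0) Om \<xi>" using \<xi> by (auto simp: C1c_def intro: Ck_on_subset)
 show ?thesis
 proof (rule Green[OF Om \<Phi> u C B])
  fix x i assume x: "x \<in> frontier Om"
  have "\<xi> x = 0" using C1c_zero_outside(1)[OF \<xi>] frontier_at_within_nontrivial(2)[OF Om(1) x] by blast
  moreover have "(\<xi> \<longlongrightarrow> \<xi> x) (at x within Om)"
   using differentiable_imp_continuous_within[OF C1c_differentiable[OF \<xi>, of x]] 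
   by (simp add: continuous_within tendsto_within_subset[OF _ subset_UNIV])
  ultimately have "((%x. \<bar>\<xi> x\<bar>*K') \<longlongrightarrow> 0) (at x within Om)"
   by (auto intro!: tendsto_eq_intros)
  then show "((%x. \<xi> x*grad u x$i) \<longlongrightarrow> 0) (at x within Om)"
  proof (rule Lim_null_comparison[rotated])
   show "\<forall>\<^sub>F x in at x within Om. norm (\<xi> x*grad u x$i) <= \<bar>\<xi> x\<bar>*K'"
    using C2b_bounds(4)[OF u] by (auto simp: eventually_at_filter abs_mult intro!: mult_left_mono always_eventually)
  qed
 qed
qed

section \<open>Approximate solvability in pre-Hilbert spaces\<close>

text \<open>
  No completeness is available or needed: instead of solving \<open>b f \<chi> = L f\<close> for \<open>\<chi>\<close>, the equation is
  solved up to an arbitrarily small multiple of the norm of \<open>f\<close>.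
\<close>

locale prehilbert =
 fixes X :: "('a => real) set" and ip :: "('a => real) => ('a => real) => real"
 assumes zero_mem: "(%x. 0) \<in> X"
  and lin_mem: "!!f g c. f \<in> X ==> g \<in> X ==> (%x. c*f x + g x) \<in> X"
  and ip_lin: "!!f g h c. f \<in> X ==> g \<in> X ==> h \<in> X ==> ip (%x. c*f x + g x) h = c*ip f h + ip g h"
  and ip_commute: "!!f g. f \<in> X ==> g \<in> X ==> ip f g = ip g f"
  and ip_nonneg: "!!f. f \<in> X ==> 0 <= ip f f"
begin

definition nrm :: "('a => real) => real" where
 "nrm f = sqrt (ip f f)"

definition lin_fun :: "(('a => real) => real) => bool" where
 "lin_fun L \<longleftrightarrow> (\<forall>f\<in>X. \<forall>g\<in>X. \<forall>c. L (%x. c*f x + g x) = c*L f + L g)"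

definition bounded_by :: "(('a => real) => real) => real => bool" where
 "bounded_by L G \<longleftrightarrow> (\<forall>f\<in>X. \<bar>L f\<bar> <= G*nrm f)"

definition bilin :: "(('a => real) => ('a => real) => real) => bool" where
 "bilin b \<longleftrightarrow> (\<forall>h\<in>X. lin_fun (%f. b f h) \<and> lin_fun (%f. b h f))"

text \<open>Here and in \<open>apriori\<close> the unknown is the second argument of
  \<open>b\<close>. For the form of the linearised operator this is the adjoint problem.\<close>

definition solvable :: "(('a => real) => ('a => real) => real) => bool" where
 "solvable b \<longleftrightarrow> (\<forall>L G e. lin_fun L --> 0 <= G --> bounded_by L G --> 0 < e -->
   (\<exists>\<xi>\<in>X. bounded_by (%f. L f - b f \<xi>) e))"

definition apriori :: "real => (('a => real) => ('a => real) => real) => bool" where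
 "apriori C b \<longleftrightarrow> (\<forall>\<xi>\<in>X. \<forall>G\<ge>0. bounded_by (%f. b f \<xi>) G --> nrm \<xi> <= C*G)"

lemma nrm_nonneg [simp]: "f \<in> X ==> 0 <= nrm f"
 by (simp add: nrm_def ip_nonneg)

lemma nrm_power2: "f \<in> X ==> (nrm f)^2 = ip f f"
 by (simp add: nrm_def ip_nonneg)

lemma lin_fun_comb:
 assumes "lin_fun L" "lin_fun L'"
 shows "lin_fun (%f. L f + s*L' f)"
 unfolding lin_fun_def
proof (intro ballI allI)
 fix f g c assume "f \<in> X" "g \<in> X"
 then have *: "L (%x. c*f x + g x) = c*L f + L g" "L' (%x. c*f x + g x) = c*L' f + L' g"
  using assms by (simp_all add: lin_fun_def)
 show "L (%x. c*f x + g x) + s*L' (%x. c*f x + g x) = c*(L f + s*L' f) + (L g + s*L' g)"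
  unfolding * by (simp add: algebra_simps)
qed

lemma bilin_comb:
 assumes "bilin b" "bilin d"
 shows "bilin (%f h. b f h + s*d f h)"
 using assms unfolding bilin_def by (intro ballI conjI lin_fun_comb) auto

lemma bilin_ip: "bilin ip"
 unfolding bilin_def lin_fun_def
proof (intro ballI conjI allI)
 fix f g h c assume "h \<in> X" "f \<in> X" "g \<in> X"
 then show "ip (%x. c*f x + g x) h = c*ip f h + ip g h" "ip h (%x. c*f x + g x) = c*ip h f + ip h g"
  using ip_lin[of f g h c] ip_commute[of h f] ip_commute[of h g] ip_commute[of h "%x. c*f x + g x"] lin_mem[of f g c]
  by simp_all
qed

lemma ip_expand:
 assumes "f \<in> X" "g \<in> X"
 shows "ip (%x. t*g x + f x) (%x. t*g x + f x) = ip f f + 2*t*ip f g + t^2*ip g g"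
proof -
 have h: "(%x. t*g x + f x) \<in> X" using assms by (simp add: lin_mem)
 have "ip (%x. t*g x + f x) (%x. t*g x + f x) = t*ip g (%x. t*g x + f x) + ip f (%x. t*g x + f x)"
  using assms h by (simp add: ip_lin)
 also have "ip g (%x. t*g x + f x) = t*ip g g + ip f g"
  using assms h ip_commute[of g "%x. t*g x + f x"] by (simp add: ip_lin)
 also have "ip f (%x. t*g x + f x) = t*ip f g + ip f f"
  using assms h ip_commute[of f "%x. t*g x + f x"] ip_commute[of g f] by (simp add: ip_lin)
 finally show ?thesis by (simp add: power2_eq_square algebra_simps)
qed

lemma ip_Cauchy_Schwarz:
 assumes "f \<in> X" "g \<in> X"
 shows "\<bar>ip f g\<bar> <= nrm f*nrm g"
 unfolding nrm_def
proof (rule quadratic_nonneg_discriminant)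
 show "0 <= ip f f + 2*t*ip f g + t^2*ip g g" for t
  using ip_nonneg[OF lin_mem[OF assms(2,1)], of t] ip_expand[OF assms, of t] by simp
qed (use assms ip_nonneg in auto)

text \<open>An approximate Riesz theorem. A function within e^2 of the infimum of |f|^2 - 2 L f
  makes a quadratic in t nonnegative for every direction, and its discriminant bounds the residual
  by \<open>e\<close>.\<close>

lemma solvable_ip: "solvable ip"
 unfolding solvable_def
proof (intro allI impI)
 fix L G e assume L: "lin_fun L" "0 <= G" "bounded_by L G" and e: "(0::real) < e"
 define J where "J f = ip f f - 2*L f" for f
 have bdd: "- (G^2) <= J f" if "f \<in> X" for f
 proof -
  have "L f <= G*nrm f" using L(3) that unfolding bounded_by_def by force
  moreover have "0 <= (nrm f - G)^2" by simp
  ultimately show ?thesis using nrm_power2[OF that] by (simp add: J_def power2_diff mult_ac)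
 qed
 have "bdd_below (J ` X)" using bdd by (intro bdd_belowI[of _ "- (G^2)"]) auto
 have ne: "J ` X ~= {}" using zero_mem by blast
 have "Inf (J ` X) < Inf (J ` X) + e^2" using e by simp
 from cInf_lessD[OF ne this] obtain \<xi> where \<xi>: "\<xi> \<in> X" "J \<xi> < Inf (J ` X) + e^2" by auto
 show "\<exists>\<xi>\<in>X. bounded_by (%f. L f - ip f \<xi>) e"
 proof (intro bexI[OF _ \<xi>(1)])
  show "bounded_by (%f. L f - ip f \<xi>) e"
   unfolding bounded_by_def
  proof
   fix f assume f: "f \<in> X"
   have "\<bar>ip \<xi> f - L f\<bar> <= sqrt (e^2) * sqrt (ip f f)"
   proof (rule quadratic_nonneg_discriminant)
    fix t
    have "Inf (J ` X) <= J (%x. t*f x + \<xi> x)"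
     using f \<xi>(1) \<open>bdd_below (J ` X)\<close> by (intro cInf_lower) (auto simp: lin_mem)
    also have "\<dots> = J \<xi> + 2*t*(ip \<xi> f - L f) + t^2*ip f f"
    proof -
     have Lt: "L (%x. t*f x + \<xi> x) = t*L f + L \<xi>" using L(1) f \<xi>(1) by (simp add: lin_fun_def)
     show ?thesis unfolding J_def ip_expand[OF \<xi>(1) f] Lt by (simp add: algebra_simps)
    qed
    finally show "0 <= e^2 + 2*t*(ip \<xi> f - L f) + t^2*ip f f" using \<xi>(2) by linarith
   qed (use f ip_nonneg in auto)
   then show "\<bar>L f - ip f \<xi>\<bar> <= e*nrm f"
    using e ip_commute[OF f \<xi>(1)] by (simp add: nrm_def abs_minus_commute)
  qed
 qed
qed

text \<open>Iterated correction. If the residual is bounded by R, solve with \<open>b\<close> alone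
  up to R/4. The correction has norm at most C (5/4) R, so the perturbation adds at most 5/16 R, and
  the new residual is below 3/4 R.\<close>

lemma solvable_step:
 assumes b: "bilin b" and d: "bilin d" and D: "0 <= D" "!!f h. f \<in> X ==> h \<in> X ==> \<bar>d f h\<bar> <= D*nrm f*nrm h"
  and C: "0 <= C" "apriori C b" and s: "\<bar>s\<bar>*D*C <= 1/4" and solv: "solvable b"
 shows "solvable (%f h. b f h + s*d f h)"
 unfolding solvable_def
proof (intro allI impI)
 fix L G e assume L: "lin_fun L" "0 <= G" "bounded_by L G" and e: "(0::real) < e"
 define b' where "b' f h = b f h + s*d f h" for f h
 have blin: "b f (%x. c*g x + h x) = c*b f g + b f h" "d f (%x. c*g x + h x) = c*d f g + d f h"
  "b (%x. c*g x + h x) f = c*b g f + b h f" "d (%x. c*g x + h x) f = c*d g f + d h f"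
  if "f \<in> X" "g \<in> X" "h \<in> X" for f g h c
  using b d that by (simp_all add: bilin_def lin_fun_def)
 have "\<exists>\<xi>\<in>X. bounded_by (%f. L f - b' f \<xi>) (G*(3/4)^n)" for n
 proof (induction n)
  case 0
  have "b' f (%x. 0) = 0" if "f \<in> X" for f
   using blin(1,2)[OF that zero_mem zero_mem, of 1] by (simp add: b'_def)
  then show ?case using L(3) zero_mem by (intro bexI[of _ "%x. 0"]) (auto simp: bounded_by_def)
 next
  case (Suc n)
  then obtain \<xi> where \<xi>: "\<xi> \<in> X" "bounded_by (%f. L f - b' f \<xi>) (G*(3/4)^n)" by blast
  define R where "R = G*(3/4)^n"
  have R0: "0 <= R" using L(2) by (simp add: R_def)
  show ?case
  proof (cases "R = 0")
   case True
   then show ?thesis using \<xi> by (intro bexI[OF _ \<xi>(1)]) (auto simp: R_def)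
  next
   case False
   then have R: "0 < R" using R0 by simp
   have "lin_fun (%f. L f - b' f \<xi>)"
   proof -
    have "lin_fun (%f. b' f \<xi>)" using bilin_comb[OF b d, of s] \<xi>(1) by (simp add: bilin_def b'_def)
    from lin_fun_comb[OF L(1) this, of "-1"] show ?thesis by simp
   qed
   moreover have "bounded_by (%f. L f - b' f \<xi>) R" using \<xi>(2) by (simp add: R_def)
   moreover have "0 < R/4" using R by simp
   ultimately have "\<exists>\<zeta>\<in>X. bounded_by (%f. L f - b' f \<xi> - b f \<zeta>) (R/4)"
    using solv[unfolded solvable_def, rule_format, of "%f. L f - b' f \<xi>" R "R/4"] R0 by simp
   then obtain \<zeta> where \<zeta>: "\<zeta> \<in> X" "bounded_by (%f. L f - b' f \<xi> - b f \<zeta>) (R/4)" by (elim bexE)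
   have "bounded_by (%f. b f \<zeta>) (5/4*R)"
    unfolding bounded_by_def
   proof
    fix f assume f: "f \<in> X"
    have "\<bar>L f - b' f \<xi> - b f \<zeta>\<bar> <= R/4*nrm f" "\<bar>L f - b' f \<xi>\<bar> <= R*nrm f"
     using \<zeta>(2) \<xi>(2) f by (auto simp: bounded_by_def R_def)
    then have "\<bar>b f \<zeta>\<bar> <= R/4*nrm f + R*nrm f" by linarith
    then show "\<bar>b f \<zeta>\<bar> <= 5/4*R*nrm f" by simp
   qed
   then have n\<zeta>: "nrm \<zeta> <= C*(5/4*R)" using C(2)[unfolded apriori_def, rule_format, OF \<zeta>(1), of "5/4*R"] R by simp
   have "bounded_by (%f. L f - b' f (%x. 1*\<zeta> x + \<xi> x)) (G*(3/4)^Suc n)"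
    unfolding bounded_by_def
   proof
    fix f assume f: "f \<in> X"
    have eq: "L f - b' f (%x. 1*\<zeta> x + \<xi> x) = (L f - b' f \<xi> - b f \<zeta>) - s*d f \<zeta>"
     unfolding b'_def blin(1,2)[OF f \<zeta>(1) \<xi>(1)] by (simp add: algebra_simps)
    have "\<bar>s*d f \<zeta>\<bar> <= \<bar>s\<bar>*(D*nrm f*nrm \<zeta>)"
     unfolding abs_mult using D(2)[OF f \<zeta>(1)] by (rule mult_left_mono) simp
    also have "\<dots> <= \<bar>s\<bar>*(D*nrm f*(C*(5/4*R)))"
     using n\<zeta> D(1) f by (intro mult_left_mono) auto
    also have "\<dots> = (\<bar>s\<bar>*D*C)*(5/4*R*nrm f)" by simp
    also have "\<dots> <= 1/4*(5/4*R*nrm f)" using s R f by (intro mult_right_mono) auto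
    finally have 1: "\<bar>s*d f \<zeta>\<bar> <= 5/16*(R*nrm f)" by simp
    have 2: "\<bar>L f - b' f \<xi> - b f \<zeta>\<bar> <= 1/4*(R*nrm f)"
     using \<zeta>(2) f by (simp add: bounded_by_def)
    have 3: "0 <= R*nrm f" using R f by simp
    have "\<bar>L f - b' f (%x. 1*\<zeta> x + \<xi> x)\<bar> <= 3/4*(R*nrm f)"
     unfolding eq using 1 2 3 by linarith
    then show "\<bar>L f - b' f (%x. 1*\<zeta> x + \<xi> x)\<bar> <= G*(3/4)^Suc n*nrm f" by (simp add: R_def)
   qed
   then show ?thesis using lin_mem[OF \<zeta>(1) \<xi>(1), of 1] by blast
  qed
 qed
 moreover obtain n where n: "G*(3/4)^n <= e"
 proof -
  have "(%n. G*(3/4)^n) \<longlonglongrightarrow> G*0" by (intro tendsto_intros LIMSEQ_power_zero) simp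
  from order_tendstoD(2)[OF this, of e] e obtain n where "G*(3/4)^n < e" by (auto simp: eventually_sequentially)
  then show thesis by (intro that less_imp_le)
 qed
 ultimately obtain \<xi> where \<xi>: "\<xi> \<in> X" "bounded_by (%f. L f - b' f \<xi>) (G*(3/4)^n)" by blast
 have "bounded_by (%f. L f - b' f \<xi>) e"
  unfolding bounded_by_def
 proof
  fix f assume f: "f \<in> X"
  have "\<bar>L f - b' f \<xi>\<bar> <= G*(3/4)^n*nrm f" using \<xi>(2) f by (simp add: bounded_by_def)
  also have "\<dots> <= e*nrm f" using n f by (intro mult_right_mono) auto
  finally show "\<bar>L f - b' f \<xi>\<bar> <= e*nrm f" .
 qed
 then show "\<exists>\<xi>\<in>X. bounded_by (%f. L f - (b f \<xi> + s*d f \<xi>)) e" using \<xi>(1) by (auto simp: b'_def)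
qed

text \<open>The admissible step depends only on \<open>D\<close> and \<open>C\<close>, and
  \<open>C\<close> serves for all t, so finitely many steps of size 1/m with D C/m at most 1/4 lead
  from 0 to 1.\<close>

lemma method_of_continuity:
 assumes b: "bilin b" and d: "bilin d" and D: "0 <= D" "!!f h. f \<in> X ==> h \<in> X ==> \<bar>d f h\<bar> <= D*nrm f*nrm h"
  and C: "0 <= C" "!!t. 0 <= t ==> t <= 1 ==> apriori C (%f h. b f h + t*d f h)" and solv: "solvable b"
 shows "solvable (%f h. b f h + d f h)"
proof -
 obtain m :: nat where m: "4*D*C + 1 <= real m" using real_arch_simple by blast
 then have m0: "0 < real m" using D(1) C(1) by (smt (verit) mult_nonneg_nonneg)
 have "solvable (%f h. b f h + (real k/real m)*d f h)" if "k <= m" for k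
  using that
 proof (induction k)
  case 0
  then show ?case using solv by simp
 next
  case (Suc k)
  define b' where "b' f h = b f h + (real k/real m)*d f h" for f h
  have "bilin b'" unfolding b'_def by (rule bilin_comb[OF b d])
  moreover have "apriori C b'" unfolding b'_def using Suc.prems m0 by (intro C(2)) auto
  moreover have "\<bar>1/real m\<bar>*D*C <= 1/4" using m m0 by (simp add: field_simps)
  moreover have "solvable b'" unfolding b'_def using Suc by simp
  ultimately have "solvable (%f h. b' f h + (1/real m)*d f h)" using d D C(1) by (intro solvable_step) auto
  then show ?case by (simp add: b'_def add_divide_distrib distrib_right add_ac)
 qed
 from this[of m] show ?thesis using m0 by simp
qed

text \<open>Duality turns a bound for second arguments into one for first arguments: solve
  \<open>b f \<xi>\<close> = \<open>ip f \<theta>\<close> up to half the norm of \<theta> and insert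
  f = \<theta>. The error absorbs half of |\<theta>|^2 and the norm of \<xi> is at most 3/2 C times
  that of \<theta>, whence the factor 3.\<close>

lemma inf_sup:
 assumes C: "0 <= C" "apriori C b" and solv: "solvable b" and \<theta>: "\<theta> \<in> X" and G: "0 <= G" "bounded_by (b \<theta>) G"
 shows "nrm \<theta> <= 3*C*G"
proof (cases "nrm \<theta> = 0")
 case True
 then show ?thesis using C(1) G(1) by simp
next
 case False
 then have n: "0 < nrm \<theta>" using nrm_nonneg[OF \<theta>] by simp
 have "lin_fun (%f. ip f \<theta>)" using \<theta> by (simp add: lin_fun_def ip_lin)
 moreover have "bounded_by (%f. ip f \<theta>) (nrm \<theta>)"
  unfolding bounded_by_def using ip_Cauchy_Schwarz[OF _ \<theta>] by (simp add: mult.commute)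
 moreover have "0 < nrm \<theta>/2" using n by simp
 ultimately obtain \<xi> where \<xi>: "\<xi> \<in> X" "bounded_by (%f. ip f \<theta> - b f \<xi>) (nrm \<theta>/2)"
  using solv n unfolding solvable_def by (meson less_imp_le)
 have "bounded_by (%f. b f \<xi>) (3/2*nrm \<theta>)"
  unfolding bounded_by_def
 proof
  fix f assume f: "f \<in> X"
  have "\<bar>ip f \<theta> - b f \<xi>\<bar> <= nrm \<theta>/2*nrm f" "\<bar>ip f \<theta>\<bar> <= nrm f*nrm \<theta>"
   using \<xi>(2) f ip_Cauchy_Schwarz[OF f \<theta>] by (auto simp: bounded_by_def)
  moreover have "\<bar>b f \<xi>\<bar> <= \<bar>ip f \<theta> - b f \<xi>\<bar> + \<bar>ip f \<theta>\<bar>" by linarith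
  ultimately have "\<bar>b f \<xi>\<bar> <= nrm \<theta>/2*nrm f + nrm f*nrm \<theta>" by linarith
  also have "\<dots> = 3/2*nrm \<theta>*nrm f" by simp
  finally show "\<bar>b f \<xi>\<bar> <= 3/2*nrm \<theta>*nrm f" .
 qed
 then have "nrm \<xi> <= C*(3/2*nrm \<theta>)"
  using C(2)[unfolded apriori_def, rule_format, OF \<xi>(1), of "3/2*nrm \<theta>"] n by simp
 then have "G*nrm \<xi> <= G*(C*(3/2*nrm \<theta>))" using G(1) by (rule mult_left_mono)
 moreover have "\<bar>b \<theta> \<xi>\<bar> <= G*nrm \<xi>" using G(2) \<xi>(1) by (simp add: bounded_by_def)
 moreover have "\<bar>(nrm \<theta>)^2 - b \<theta> \<xi>\<bar> <= nrm \<theta>/2*nrm \<theta>"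
  using \<xi>(2) \<theta> by (simp add: bounded_by_def nrm_power2)
 ultimately have "(nrm \<theta>)^2 - nrm \<theta>/2*nrm \<theta> <= G*(C*(3/2*nrm \<theta>))" by linarith
 then have "nrm \<theta>*nrm \<theta> <= (3*C*G)*nrm \<theta>" by (simp add: power2_eq_square mult_ac)
 then show ?thesis using n by simp
qed

end

section \<open>An interpolation inequality\<close>

text \<open>
  The autocorrelation of \<open>\<xi>\<close> equals the square of the norm of \<open>\<xi>\<close> at \<open>0\<close>, has a small gradient, and
  its average over a ball is controlled by the integral of \<open>\<bar>\<xi>\<bar>\<close>.
\<close>

lemma L2_L1_interpolation:
 fixes \<xi> :: "real^'n => real"
 assumes Om: "open Om" "bounded Om" and \<xi>: "\<xi> \<in> C1c Om" and \<delta>: "0 < \<delta>"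
 shows "L2sq Om \<xi> <= \<delta>*(sqrt (L2sq Om \<xi>) * sqrt (L2sq Om (grad \<xi>))) +
  (LINT x|lebesgue_on Om. \<bar>\<xi> x\<bar>)^2/measure lborel (ball (0 :: real^'n) \<delta>)"
proof -
 define c where "c = conv \<xi> \<xi>"
 note [measurable] = C1c_borel(1)[OF \<xi>]
 note i1 = C1c_integrable(1)[OF \<xi>]
 obtain B where B: "!!x. \<bar>\<xi> x\<bar> <= B" "!!x. norm (grad \<xi> x) <= B" using C1c_bounded[OF \<xi>] by metis
 have z: "\<xi> x = 0" "grad \<xi> x = 0" if "x \<notin> Om" for x using C1c_zero_outside[OF \<xi> that] by auto
 define U where "U = L2sq Om \<xi>"
 define V where "V = L2sq Om (grad \<xi>)"
 have UV: "0 <= U" "0 <= V" by (simp_all add: U_def V_def)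
 have U: "(LBINT x. (\<xi> x)^2) = U"
  using lebesgue_on_borel(1)[OF Om(1), of "%x. (\<xi> x)^2"] z by (simp add: U_def L2sq_def)
 have gm: "(%x. (norm (grad \<xi> x))^2) \<in> borel_measurable borel" using C1c_borel(2)[OF \<xi>] by measurable
 have V: "(LBINT x. (norm (grad \<xi> x))^2) = V"
  using lebesgue_on_borel(1)[OF Om(1) gm] z by (simp add: V_def L2sq_def)
 have V2: "integrable lborel (%x. (norm (grad \<xi> x))^2)"
  using lebesgue_on_borel(2)[OF Om(1) gm] z C1c_L2(2)[OF Om \<xi>] by (simp add: L2_on_def)
 have U2: "integrable lborel (%x. (\<xi> x)^2)"
  using lebesgue_on_borel(2)[OF Om(1), of "%x. (\<xi> x)^2"] z C1c_L2(1)[OF Om \<xi>] by (simp add: L2_on_def)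
 have cg: "(c has_derivative (%h. grad c x \<bullet> h)) (at x)" for x
  using has_derivative_conv[OF i1 \<xi>, of x] grad_eqI[OF has_derivative_conv[OF i1 \<xi>, of x]] by (simp add: c_def)
 have gcb: "norm (grad c x) <= sqrt U * sqrt V" for x
 proof -
  have i: "integrable lborel (%y. \<xi> y*grad \<xi> (y - x)$i)" for i
   using C1c_integrable(2)[OF \<xi>, of i] B component_le_norm_cart[of "grad \<xi> _" i]
   by (intro integrable_conv[OF i1, where B = B]) (auto intro: order_trans)
  have gm': "(%y. grad \<xi> (y - x)) \<in> borel_measurable borel" using C1c_borel(2)[OF \<xi>] by measurable
  have eq: "\<xi> y*(grad c x \<bullet> grad \<xi> (y - x)) = (\<Sum>i\<in>UNIV. grad c x$i*(\<xi> y*grad \<xi> (y - x)$i))" for y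
   by (simp add: inner_vec_def sum_distrib_left mult_ac)
  \<comment> \<open>Pairing the gradient of \<open>c\<close> at \<open>x\<close> with itself, as a
    constant vector, reduces the bound to a scalar Cauchy-Schwarz inequality.\<close>
  have "(norm (grad c x))^2 = (\<Sum>i\<in>UNIV. grad c x$i*- (LBINT y. \<xi> y*grad \<xi> (y - x)$i))"
   by (simp add: power2_norm_eq_inner inner_vec_def c_def grad_conv[OF i1 \<xi>] conv_def)
  also have "\<dots> = - (LBINT y. \<xi> y*(grad c x \<bullet> grad \<xi> (y - x)))"
   unfolding eq using i by (simp add: sum_negf Bochner_Integration.integral_sum)
  also have "\<dots> <= sqrt U * sqrt ((norm (grad c x))^2*V)"
  proof (rule order_trans[OF abs_ge_minus_self], rule quadratic_nonneg_discriminant)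
   fix t
   have gq: "integrable lborel (%y. (norm (grad \<xi> (y - x)))^2)"
    using lborel_integral_translate(2)[OF gm, of "- x"] V2 by simp
   have igx: "integrable lborel (%y. \<xi> y*(grad c x \<bullet> grad \<xi> (y - x)))"
    unfolding eq using i by (intro Bochner_Integration.integrable_sum) simp
   have gsq: "integrable lborel (%y. (norm (grad c x))^2*(norm (grad \<xi> (y - x)))^2)" using gq by simp
   have "0 <= (LBINT y. (\<xi> y)^2 + 2*t*(\<xi> y*(grad c x \<bullet> grad \<xi> (y - x))) + t^2*((norm (grad c x))^2*(norm (grad \<xi> (y - x)))^2))"
   proof (rule integral_nonneg_AE[OF AE_I2])
    fix y
    have "(grad c x \<bullet> grad \<xi> (y - x))^2 <= (norm (grad c x))^2*(norm (grad \<xi> (y - x)))^2"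
     using Cauchy_Schwarz_ineq[of "grad c x" "grad \<xi> (y - x)"] by (simp add: power2_norm_eq_inner)
    then have "t^2*(grad c x \<bullet> grad \<xi> (y - x))^2 <= t^2*((norm (grad c x))^2*(norm (grad \<xi> (y - x)))^2)"
     by (rule mult_left_mono) simp
    moreover have "(\<xi> y)^2 + 2*t*(\<xi> y*(grad c x \<bullet> grad \<xi> (y - x))) + t^2*(grad c x \<bullet> grad \<xi> (y - x))^2 =
      (\<xi> y + t*(grad c x \<bullet> grad \<xi> (y - x)))^2"
     by (simp add: power2_eq_square algebra_simps)
    moreover have "0 <= (\<xi> y + t*(grad c x \<bullet> grad \<xi> (y - x)))^2" by simp
    ultimately show "0 <= (\<xi> y)^2 + 2*t*(\<xi> y*(grad c x \<bullet> grad \<xi> (y - x))) + t^2*((norm (grad c x))^2*(norm (grad \<xi> (y - x)))^2)"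
     by linarith
   qed
   also have "\<dots> = U + 2*t*(LBINT y. \<xi> y*(grad c x \<bullet> grad \<xi> (y - x))) + t^2*((norm (grad c x))^2*(LBINT y. (norm (grad \<xi> (y - x)))^2))"
    using U2 igx gsq U by simp
   also have "(LBINT y. (norm (grad \<xi> (y - x)))^2) = V"
    using lborel_integral_translate(1)[OF gm, of "- x"] V by simp
   finally show "0 <= U + 2*t*(LBINT y. \<xi> y*(grad c x \<bullet> grad \<xi> (y - x))) + t^2*((norm (grad c x))^2*V)" .
  qed (use UV in auto)
  also have "\<dots> = norm (grad c x)*(sqrt U * sqrt V)" by (simp add: real_sqrt_mult)
  finally have "norm (grad c x)*norm (grad c x) <= (sqrt U * sqrt V)*norm (grad c x)" by (simp add: power2_eq_square mult.commute)
  then show ?thesis using UV by (cases "grad c x = 0") auto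
 qed
 have c0: "c 0 = U" using U by (simp add: c_def conv_def power2_eq_square)
 have cz: "U <= c x + \<delta>*(sqrt U * sqrt V)" if "x \<in> ball 0 \<delta>" for x
 proof -
  have "\<bar>c 0 - c x\<bar> <= (sqrt U * sqrt V)*norm (0 - x)"
   using cg gcb by (intro convex_grad_Lipschitz[OF convex_UNIV]) (auto simp: differentiable_def)
  also have "\<dots> <= (sqrt U * sqrt V)*\<delta>" using that UV by (intro mult_left_mono) auto
  finally show ?thesis using c0 by (simp add: mult.commute abs_le_iff)
 qed
 define W where "W = (LBINT x. \<bar>\<xi> x\<bar>)"
 have W: "(LINT x|lebesgue_on Om. \<bar>\<xi> x\<bar>) = W"
  unfolding W_def using lebesgue_on_borel(1)[OF Om(1), of "%x. \<bar>\<xi> x\<bar>"] z by simp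
 define a where "a y x = \<bar>\<xi> y\<bar>*\<bar>\<xi> (y + x)\<bar>" for y x
 have cneg: "c (- x) = (LBINT y. \<xi> y*\<xi> (y + x))" for x by (simp add: c_def conv_def)
 have ia: "integrable lborel (%y. \<xi> y*\<xi> (y + x))" for x
  using integrable_conv[OF i1, of \<xi> B "- x"] B by simp
 let ?b = "ball (0 :: real^'n) \<delta>"
 have fin: "emeasure lborel ?b < \<infinity>" using emeasure_bounded_finite[of ?b] by auto
 have mpos: "0 < measure lborel ?b" using content_ball_pos[OF \<delta>, of "0 :: real^'n"] by simp
 have cont_c: "continuous_on UNIV c" using cg by (auto intro!: continuous_at_imp_continuous_on has_derivative_continuous)
 then have [measurable]: "c \<in> borel_measurable borel" by (rule borel_measurable_continuous_onI)
 define M where "M = U - \<delta>*(sqrt U * sqrt V)"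
 have Mc: "M <= c (- x)" if "x \<in> ?b" for x using cz[of "- x"] that by (simp add: M_def)
 \<comment> \<open>Integrate the lower bound \<open>M\<close> of the autocorrelation over the ball.
   Enlarging the ball to the whole space, Tonelli factors the double integral into W times
   W.\<close>
 have "ennreal (measure lborel ?b*M) <= ennreal (W^2)"
 proof (cases "0 <= M")
  case True
  have "ennreal (measure lborel ?b*M) = (\<integral>\<^sup>+x. ennreal M*indicator ?b x \<partial>lborel)"
   using fin True by (simp add: nn_integral_cmult_indicator emeasure_eq_ennreal_measure ennreal_mult' mult.commute)
  also have "\<dots> <= (\<integral>\<^sup>+x. \<integral>\<^sup>+y. ennreal (a y x) \<partial>lborel \<partial>lborel)"
  proof (rule nn_integral_mono)
   fix x
   show "ennreal M*indicator ?b x <= (\<integral>\<^sup>+y. ennreal (a y x) \<partial>lborel)"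
   proof (cases "x \<in> ?b")
    case True
    have ai: "integrable lborel (%y. a y x)" using integrable_abs[OF ia[of x]] by (simp add: a_def abs_mult)
    have "M <= \<bar>\<integral>y. \<xi> y*\<xi> (y + x) \<partial>lborel\<bar>" using Mc[OF True] cneg[of x] by simp
    also have "\<dots> <= (LBINT y. a y x)"
     using integral_abs_bound[of lborel "%y. \<xi> y*\<xi> (y + x)"] by (simp add: a_def abs_mult)
    finally have "ennreal M <= ennreal (LBINT y. a y x)" by (rule ennreal_leI)
    also have "\<dots> = (\<integral>\<^sup>+y. ennreal (a y x) \<partial>lborel)"
     using ai by (subst nn_integral_eq_integral) (auto simp: a_def)
    finally show ?thesis using True by simp
   qed simp
  qed
  also have "\<dots> = (\<integral>\<^sup>+y. \<integral>\<^sup>+x. ennreal (a y x) \<partial>lborel \<partial>lborel)"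
   unfolding a_def by (rule lborel_pair.Fubini') measurable
  also have "\<dots> = (\<integral>\<^sup>+y. ennreal \<bar>\<xi> y\<bar>*ennreal W \<partial>lborel)"
  proof (rule nn_integral_cong)
   fix y
   have "(\<integral>\<^sup>+x. ennreal (a y x) \<partial>lborel) = ennreal \<bar>\<xi> y\<bar>*(\<integral>\<^sup>+x. ennreal \<bar>\<xi> (x + y)\<bar> \<partial>lborel)"
    unfolding a_def by (subst nn_integral_cmult[symmetric]) (auto simp: ennreal_mult' add.commute)
   also have "(\<integral>\<^sup>+x. ennreal \<bar>\<xi> (x + y)\<bar> \<partial>lborel) = (\<integral>\<^sup>+x. ennreal \<bar>\<xi> x\<bar> \<partial>lborel)"
    by (rule lborel_nn_integral_translate) measurable
   also have "\<dots> = ennreal W" unfolding W_def using i1 by (subst nn_integral_eq_integral) auto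
   finally show "(\<integral>\<^sup>+x. ennreal (a y x) \<partial>lborel) = ennreal \<bar>\<xi> y\<bar>*ennreal W" .
  qed
  also have "\<dots> = ennreal W*ennreal W"
   unfolding W_def using i1 by (subst nn_integral_multc) (auto simp: nn_integral_eq_integral)
  also have "\<dots> = ennreal (W^2)" by (simp add: W_def ennreal_mult'[symmetric] power2_eq_square integral_nonneg_AE)
  finally show ?thesis .
 next
  case False
  then have "measure lborel ?b*M <= 0" using mpos by (simp add: mult_le_0_iff)
  then show ?thesis by (simp add: ennreal_neg)
 qed
 then have "measure lborel ?b*M <= W^2" by (simp add: ennreal_le_iff)
 then have "M <= W^2/measure lborel ?b" using mpos by (simp add: field_simps)
 then show ?thesis unfolding W by (simp add: M_def U_def V_def)
qed

section \<open>Coercive forms\<close>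

context prehilbert
begin

lemma coercive_apriori:
 assumes "0 < \<kappa>" "!!\<xi>. \<xi> \<in> X ==> \<kappa>*(nrm \<xi>)^2 <= b \<xi> \<xi>"
 shows "apriori (1/\<kappa>) b"
 unfolding apriori_def
proof (intro ballI allI impI)
 fix \<xi> G assume \<xi>: "\<xi> \<in> X" and G: "0 <= G" "bounded_by (%f. b f \<xi>) G"
 have "\<kappa>*(nrm \<xi>)^2 <= G*nrm \<xi>"
  using assms(2)[OF \<xi>] G(2) \<xi> unfolding bounded_by_def by fastforce
 then have "(\<kappa>*nrm \<xi>)*nrm \<xi> <= G*nrm \<xi>" by (simp add: power2_eq_square mult_ac)
 then have "\<kappa>*nrm \<xi> <= G" using G(1) nrm_nonneg[OF \<xi>] by (cases "nrm \<xi> = 0") auto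
 then show "nrm \<xi> <= 1/\<kappa>*G" using assms(1) by (simp add: field_simps)
qed

text \<open>A Lax-Milgram theorem by continuity: the forms (1 - t) \<open>ip\<close> + t
  \<open>b\<close> join the inner product to \<open>b\<close> and are all coercive with the constant
  min 1 \<kappa>.\<close>

lemma coercive_solvable:
 assumes b: "bilin b" and D: "0 <= D" "!!f h. f \<in> X ==> h \<in> X ==> \<bar>b f h\<bar> <= D*nrm f*nrm h"
  and \<kappa>: "0 < \<kappa>" "!!\<xi>. \<xi> \<in> X ==> \<kappa>*(nrm \<xi>)^2 <= b \<xi> \<xi>"
 shows "solvable b"
proof -
 define d where "d f h = b f h + (- 1)*ip f h" for f h
 have d: "bilin d" unfolding d_def by (rule bilin_comb[OF b bilin_ip])
 have dD: "\<bar>d f h\<bar> <= (D + 1)*nrm f*nrm h" if "f \<in> X" "h \<in> X" for f h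
  using D(2)[OF that] ip_Cauchy_Schwarz[OF that] by (simp add: d_def algebra_simps)
 define \<mu> where "\<mu> = min 1 \<kappa>"
 have ap: "apriori (1/\<mu>) (%f h. ip f h + t*d f h)" if "0 <= t" "t <= 1" for t
 proof (rule coercive_apriori)
  fix \<xi> assume \<xi>: "\<xi> \<in> X"
  have "\<mu>*(nrm \<xi>)^2 <= 1*(nrm \<xi>)^2" "\<mu>*(nrm \<xi>)^2 <= \<kappa>*(nrm \<xi>)^2"
   unfolding \<mu>_def by (rule mult_right_mono; simp)+
  then have "\<mu>*(nrm \<xi>)^2 <= ip \<xi> \<xi>" "\<mu>*(nrm \<xi>)^2 <= b \<xi> \<xi>" using \<kappa>(2)[OF \<xi>] nrm_power2[OF \<xi>] by auto
  then have "(1 - t)*(\<mu>*(nrm \<xi>)^2) + t*(\<mu>*(nrm \<xi>)^2) <= (1 - t)*ip \<xi> \<xi> + t*b \<xi> \<xi>"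
   using that by (intro add_mono mult_left_mono) auto
  then show "\<mu>*(nrm \<xi>)^2 <= ip \<xi> \<xi> + t*d \<xi> \<xi>" by (simp add: d_def algebra_simps)
 qed (use \<kappa>(1) in \<open>simp add: \<mu>_def\<close>)
 have "solvable (%f h. ip f h + d f h)"
  by (rule method_of_continuity[OF bilin_ip d _ dD _ ap solvable_ip]) (use D(1) \<kappa>(1) in \<open>auto simp: \<mu>_def\<close>)
 then show ?thesis by (simp add: d_def)
qed

end

section \<open>The bilinear form of the linearised operator\<close>

lemma C1c_zero [simp]: "(%x. 0) \<in> C1c Om"
 by (simp add: C1c_def Ck_on_const)

lemma C1c_lin:
 assumes f: "f \<in> C1c Om" and g: "g \<in> C1c Om"
 shows "(%x. c*f x + g x) \<in> C1c Om" "jet (%x. c*f x + g x) = (%x. c *\<^sub>R jet f x + jet g x)"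
proof -
 have sub: "{x. c*f x + g x ~= 0} \<subseteq> closure {x. f x ~= 0} \<union> closure {x. g x ~= 0}" (is "?A \<subseteq> ?K")
 proof
  fix x assume "x \<in> ?A"
  then have "f x ~= 0 \<or> g x ~= 0" by auto
  then show "x \<in> ?K" using closure_subset[of "{x. f x ~= 0}"] closure_subset[of "{x. g x ~= 0}"] by blast
 qed
 have K: "compact ?K" "?K \<subseteq> Om" using f g by (auto simp: C1c_def)
 have cl: "closure ?A \<subseteq> ?K" using sub by (rule closure_minimal) auto
 have "compact (closure ?A)" using bounded_subset[OF compact_imp_bounded[OF K(1)] sub] by simp
 moreover have "Ck_on (Suc 0) UNIV (%x. c*f x + g x)"
  using f g by (intro Ck_on_add Ck_on_mult Ck_on_const) (auto simp: C1c_def)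
 ultimately show "(%x. c*f x + g x) \<in> C1c Om" using cl K(2) by (auto simp: C1c_def)
 have "grad (%x. c*f x + g x) x = c *\<^sub>R grad f x + grad g x" for x
  by (rule grad_eqI) (auto intro!: derivative_eq_intros C1c_has_derivative[OF f] C1c_has_derivative[OF g] simp: inner_add_left)
 then show "jet (%x. c*f x + g x) = (%x. c *\<^sub>R jet f x + jet g x)" by (auto simp: jet_def)
qed

lemma C1c_compose:
 assumes f: "f \<in> C1c Om" and s: "!!x. (s has_real_derivative s' x) (at x)" "continuous_on UNIV s'" "s 0 = 0"
 shows "(%x. s (f x)) \<in> C1c Om" "grad (%x. s (f x)) x = s' (f x) *\<^sub>R grad f x"
proof -
 have D: "((%x. s (f x)) has_derivative (%h. (s' (f x) *\<^sub>R grad f x) \<bullet> h)) (at x)" for x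
  using has_derivative_compose[OF C1c_has_derivative[OF f, of x] s(1)[unfolded has_field_derivative_def, of "f x"]]
  by simp
 show g: "grad (%x. s (f x)) x = s' (f x) *\<^sub>R grad f x" for x by (rule grad_eqI[OF D])
 have "continuous_on UNIV (%x. s' (f x) *\<^sub>R grad f x)"
  by (intro continuous_on_scaleR C1c_continuous_grad[OF f] continuous_on_compose2[OF s(2) C1c_continuous[OF f]]) auto
 then have 1: "Ck_on (Suc 0) UNIV (%x. s (f x))"
  unfolding Ck_on_1 using D by (auto simp: differentiable_def g[abs_def])
 have sub: "{x. s (f x) ~= 0} \<subseteq> {x. f x ~= 0}" using s(3) by auto
 have K: "compact (closure {x. f x ~= 0})" "closure {x. f x ~= 0} \<subseteq> Om" using f by (auto simp: C1c_def)
 have "closure {x. s (f x) ~= 0} \<subseteq> closure {x. f x ~= 0}" by (rule closure_mono[OF sub])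
 then show "(%x. s (f x)) \<in> C1c Om"
  using 1 K bounded_subset[OF _ sub] by (auto simp: C1c_def)
qed

locale elliptic =
 fixes Om :: "(real^'n) set" and C :: "real^'n => real^'n^'n" and b :: "real^'n => real^'n"
  and q :: "real^'n => real" and N lam :: real
 assumes opn: "open Om" and bnd: "bounded Om"
  and C_cont: "continuous_on Om C" and b_cont: "continuous_on Om b" and q_cont: "continuous_on Om q"
  and N_nonneg: "0 <= N" and C_le: "!!x \<xi>. x \<in> Om ==> norm (C x *v \<xi>) <= N*norm \<xi>"
  and b_le: "!!x. x \<in> Om ==> norm (b x) <= N" and q_le: "!!x. x \<in> Om ==> q x <= N"
  and q_nonneg: "!!x. x \<in> Om ==> 0 <= q x"
  and lam: "0 < lam" and C_ge: "!!x \<xi>. x \<in> Om ==> lam*(norm \<xi>)^2 <= (C x *v \<xi>) \<bullet> \<xi>"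
begin

text \<open>Sends the jet of \<open>v\<close> to the vector whose inner product with the jet of a
  test function is the integrand of the weak formulation.\<close>

definition A :: "real^'n => real \<times> (real^'n) => real \<times> (real^'n)" where
 "A x p = (b x \<bullet> snd p + q x*fst p, C x *v snd p)"

definition form :: "(real^'n => real \<times> (real^'n)) => (real^'n => real \<times> (real^'n)) => real" where
 "form P Q = (LINT x|lebesgue_on Om. A x (P x) \<bullet> Q x)"

lemma A_lin: "A x (c *\<^sub>R p + r) = c *\<^sub>R A x p + A x r"
 by (simp add: A_def inner_add_right matrix_vector_right_distrib scaleR_matrix_vector_assoc[symmetric]
   matrix_vector_mult_scaleR algebra_simps)

lemma A_diff: "A x (p - r) = A x p - A x r"
 using A_lin[of x "- 1" r p] by simp

lemma A_le:
 assumes "x \<in> Om"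
 shows "norm (A x p) <= 3*N*norm p"
proof -
 have p: "\<bar>fst p\<bar> <= norm p" "norm (snd p) <= norm p"
  using norm_fst_le[of "fst p" "snd p"] norm_snd_le[of "snd p" "fst p"] by simp_all
 have "\<bar>b x \<bullet> snd p\<bar> <= N*norm p"
  using Cauchy_Schwarz_ineq2[of "b x" "snd p"] mult_mono[OF b_le[OF assms] p(2) N_nonneg] by auto
 moreover have "\<bar>q x*fst p\<bar> <= N*norm p"
  unfolding abs_mult using q_le[OF assms] q_nonneg[OF assms] p(1) N_nonneg by (intro mult_mono) auto
 moreover have "norm (C x *v snd p) <= N*norm p"
  using C_le[OF assms, of "snd p"] mult_left_mono[OF p(2) N_nonneg] by linarith
 moreover have "norm (A x p) <= \<bar>b x \<bullet> snd p + q x*fst p\<bar> + norm (C x *v snd p)"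
  unfolding A_def using norm_Pair_le[of "b x \<bullet> snd p + q x*fst p" "C x *v snd p"] by simp
 ultimately show ?thesis by linarith
qed

lemma L2_A:
 assumes P: "L2_on Om P"
 shows "L2_on Om (%x. A x (P x))" "L2sq Om (%x. A x (P x)) <= (3*N)^2*L2sq Om P"
proof -
 note [measurable] = measurable_lebesgue_on_continuous[OF opn C_cont] measurable_lebesgue_on_continuous[OF opn b_cont]
  measurable_lebesgue_on_continuous[OF opn q_cont]
 have [measurable]: "P \<in> borel_measurable (lebesgue_on Om)" and i: "integrable (lebesgue_on Om) (%x. (norm (P x))^2)"
  using P by (auto simp: L2_on_def)
 note fs = L2_on_fst_snd[OF P]
 have [measurable]: "(%x. fst (P x)) \<in> borel_measurable (lebesgue_on Om)" "(%x. snd (P x)) \<in> borel_measurable (lebesgue_on Om)"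
  using fs by (auto simp: L2_on_def)
 have mv: "continuous_on UNIV (%z :: (real^'n^'n) \<times> (real^'n). fst z *v snd z)"
  unfolding matrix_vector_mult_def by (intro continuous_intros)
 have "(%x. C x *v snd (P x)) \<in> borel_measurable (lebesgue_on Om)"
  by (rule borel_measurable_continuous_Pair[OF _ _ mv]) measurable
 then have [measurable]: "(%x. A x (P x)) \<in> borel_measurable (lebesgue_on Om)"
  unfolding A_def by (intro borel_measurable_Pair) measurable
 have le: "(norm (A x (P x)))^2 <= (3*N)^2*(norm (P x))^2" if "x \<in> Om" for x
  unfolding power_mult_distrib[symmetric] by (rule power_mono[OF A_le[OF that]]) simp
 have ii: "integrable (lebesgue_on Om) (%x. (norm (A x (P x)))^2)"
  by (rule Bochner_Integration.integrable_bound[of _ "%x. (3*N)^2*(norm (P x))^2"])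
   (use i le in \<open>auto intro!: AE_I2\<close>)
 then show "L2_on Om (%x. A x (P x))" by (simp add: L2_on_def)
 have "L2sq Om (%x. A x (P x)) <= (LINT x|lebesgue_on Om. (3*N)^2*(norm (P x))^2)"
  unfolding L2sq_def by (rule integral_mono) (use i ii le in auto)
 then show "L2sq Om (%x. A x (P x)) <= (3*N)^2*L2sq Om P" by (simp add: L2sq_def)
qed

lemma form_le:
 assumes "L2_on Om P" "L2_on Om Q"
 shows "\<bar>form P Q\<bar> <= 3*N * sqrt (L2sq Om P) * sqrt (L2sq Om Q)"
proof -
 have "sqrt (L2sq Om (%x. A x (P x))) <= 3*N * sqrt (L2sq Om P)"
  using real_sqrt_le_mono[OF L2_A(2)[OF assms(1)]] N_nonneg by (simp add: real_sqrt_mult)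
 then show ?thesis
  using L2_Cauchy_Schwarz[OF L2_A(1)[OF assms(1)] assms(2)] mult_right_mono[of "sqrt (L2sq Om (%x. A x (P x)))" "3*N * sqrt (L2sq Om P)" "sqrt (L2sq Om Q)"]
  by (simp add: form_def)
qed

lemma form_lin:
 assumes "L2_on Om P" "L2_on Om Q" "L2_on Om R"
 shows "form (%x. c *\<^sub>R P x + Q x) R = c*form P R + form Q R"
  and "form R (%x. c *\<^sub>R P x + Q x) = c*form R P + form R Q"
 using assms L2_on_inner_integrable[OF L2_A(1)]
 by (simp_all add: form_def A_lin inner_add_left inner_add_right)

definition ipj :: "(real^'n => real) => (real^'n => real) => real" where
 "ipj f g = (LINT x|lebesgue_on Om. jet f x \<bullet> jet g x)"

lemmas C1c_jet_L2 = C1c_L2(3)[OF opn bnd]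

sublocale prehilbert "C1c Om" ipj
proof
 fix f g h :: "real^'n => real" and c assume "f \<in> C1c Om" "g \<in> C1c Om" "h \<in> C1c Om"
 then show "ipj (%x. c*f x + g x) h = c*ipj f h + ipj g h"
  unfolding ipj_def C1c_lin(2)[OF \<open>f \<in> C1c Om\<close> \<open>g \<in> C1c Om\<close>]
  using L2_on_inner_integrable[OF C1c_jet_L2 C1c_jet_L2] by (simp add: inner_add_left)
qed (auto simp: C1c_lin ipj_def inner_commute)

lemma nrm_jet: "nrm f = sqrt (L2sq Om (jet f))"
 by (simp add: nrm_def ipj_def L2sq_def power2_norm_eq_inner)

definition mass :: "(real^'n => real) => (real^'n => real) => real" where
 "mass f g = (LINT x|lebesgue_on Om. f x*g x)"

lemma bilin_form: "bilin (%f g. form (jet f) (jet g))"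
 unfolding bilin_def lin_fun_def
 using form_lin[OF C1c_jet_L2 C1c_jet_L2 C1c_jet_L2] by (simp add: C1c_lin(2))

lemma bilin_mass: "bilin mass"
 unfolding bilin_def lin_fun_def mass_def
 using L2_on_mult_integrable[OF C1c_L2(1)[OF opn bnd] C1c_L2(1)[OF opn bnd]]
 by (simp add: distrib_right distrib_left mult.assoc mult.left_commute)

lemma L2sq_le_jet:
 assumes "f \<in> C1c Om"
 shows "sqrt (L2sq Om f) <= nrm f" "sqrt (L2sq Om (grad f)) <= nrm f" "(nrm f)^2 = L2sq Om f + L2sq Om (grad f)"
proof -
 have "L2sq Om (jet f) = L2sq Om f + L2sq Om (grad f)"
  unfolding jet_def[abs_def] by (rule L2_on_jet_iff(2)[OF C1c_L2(1,2)[OF opn bnd assms]])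
 then show "sqrt (L2sq Om f) <= nrm f" "sqrt (L2sq Om (grad f)) <= nrm f" "(nrm f)^2 = L2sq Om f + L2sq Om (grad f)"
  by (auto simp: nrm_jet)
qed

lemma mass_le:
 assumes "f \<in> C1c Om" "g \<in> C1c Om"
 shows "\<bar>mass f g\<bar> <= sqrt (L2sq Om f) * sqrt (L2sq Om g)"
 using L2_Cauchy_Schwarz[OF C1c_L2(1)[OF opn bnd assms(1)] C1c_L2(1)[OF opn bnd assms(2)]] by (simp add: mass_def)

text \<open>The constant in Garding's inequality. Young's inequality splits the drift term N |grad
  f| |f| into lam/2 |grad f|^2 + N^2/(2 lam) f^2, and the other lam/2 restores the value part of the
  \<open>H1\<close> norm.\<close>

definition sig :: real where
 "sig = lam/2 + N^2/(2*lam)"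

lemma Garding_pointwise:
 assumes "x \<in> Om"
 shows "lam/2*(norm p)^2 <= A x p \<bullet> p + sig*(fst p)^2"
proof -
 define g where "g = norm (snd p)"
 have b: "\<bar>b x \<bullet> snd p\<bar> <= N*g"
  unfolding g_def using Cauchy_Schwarz_ineq2[of "b x" "snd p"] mult_right_mono[OF b_le[OF assms], of "norm (snd p)"] by simp
 have "\<bar>(b x \<bullet> snd p)*fst p\<bar> <= (N*g)*\<bar>fst p\<bar>" unfolding abs_mult using b by (rule mult_right_mono) simp
 moreover have "0 <= (lam*g - N*\<bar>fst p\<bar>)^2/(2*lam)" using lam by simp
 then have "(N*g)*\<bar>fst p\<bar> <= lam/2*g^2 + N^2/(2*lam)*(fst p)^2"
  using lam by (simp add: power2_eq_square field_simps)
 moreover have "lam*g^2 <= (C x *v snd p) \<bullet> snd p" unfolding g_def by (rule C_ge[OF assms])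
 moreover have "0 <= q x*(fst p)^2" using q_nonneg[OF assms] by simp
 moreover have "A x p \<bullet> p = (b x \<bullet> snd p)*fst p + q x*(fst p)^2 + (C x *v snd p) \<bullet> snd p"
  by (simp add: A_def inner_prod_def power2_eq_square distrib_right)
 moreover have "(norm p)^2 = (fst p)^2 + g^2" by (simp add: g_def norm_prod_def)
 ultimately show ?thesis by (simp add: sig_def distrib_right distrib_left)
qed

lemma Garding:
 assumes "f \<in> C1c Om"
 shows "lam/2*(nrm f)^2 <= form (jet f) (jet f) + sig*L2sq Om f"
proof -
 note L = C1c_L2[OF opn bnd assms]
 have i: "integrable (lebesgue_on Om) (%x. A x (jet f x) \<bullet> jet f x)" "integrable (lebesgue_on Om) (%x. (f x)^2)"
  "integrable (lebesgue_on Om) (%x. (norm (jet f x))^2)"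
  using L2_on_inner_integrable[OF L2_A(1)[OF L(3)] L(3)] L by (auto simp: L2_on_def)
 have "(LINT x|lebesgue_on Om. lam/2*(norm (jet f x))^2) <= (LINT x|lebesgue_on Om. A x (jet f x) \<bullet> jet f x + sig*(f x)^2)"
 proof (rule integral_mono)
  fix x assume "x \<in> space (lebesgue_on Om)"
  then show "lam/2*(norm (jet f x))^2 <= A x (jet f x) \<bullet> jet f x + sig*(f x)^2"
   using Garding_pointwise[of x "jet f x"] by (simp add: jet_def)
 qed (use i in simp_all)
 then show ?thesis using i by (simp add: form_def L2sq_def nrm_jet)
qed

end

section \<open>An $L^1$ estimate\<close>

text \<open>A regularised modulus, its derivative and its second derivative. The shift by \<kappa>
  makes the modulus vanish at 0, so that composition preserves compact support.\<close>

definition soft_abs :: "real => real => real" where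
 "soft_abs \<kappa> x = sqrt (x^2 + \<kappa>^2) - \<kappa>"

definition soft_sgn :: "real => real => real" where
 "soft_sgn \<kappa> x = x/sqrt (x^2 + \<kappa>^2)"

definition soft_sgn_deriv :: "real => real => real" where
 "soft_sgn_deriv \<kappa> x = \<kappa>^2/((x^2 + \<kappa>^2) * sqrt (x^2 + \<kappa>^2))"

lemma soft_derivs:
 assumes "0 < \<kappa>"
 shows "(soft_abs \<kappa> has_real_derivative soft_sgn \<kappa> x) (at x)"
  and "(soft_sgn \<kappa> has_real_derivative soft_sgn_deriv \<kappa> x) (at x)"
  and "continuous_on UNIV (soft_sgn \<kappa>)" "continuous_on UNIV (soft_sgn_deriv \<kappa>)"
  and "soft_abs \<kappa> 0 = 0" "soft_sgn \<kappa> 0 = 0"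
proof -
 have p: "0 < x^2 + \<kappa>^2" for x using assms by (simp add: add_nonneg_pos)
 have p0: "x^2 + \<kappa>^2 ~= 0" for x using p[of x] by linarith
 show "(soft_abs \<kappa> has_real_derivative soft_sgn \<kappa> x) (at x)"
  unfolding soft_abs_def[abs_def] soft_sgn_def
  using p[of x] by (auto intro!: derivative_eq_intros simp: field_simps)
 define w where "w = sqrt (x^2 + \<kappa>^2)"
 have w: "0 < w" "w^2 = x^2 + \<kappa>^2" using p[of x] by (auto simp: w_def)
 have "(soft_sgn \<kappa> has_real_derivative (1*w - x*(2*x*(inverse w/2)))/(w*w)) (at x)"
  unfolding soft_sgn_def[abs_def] w_def using p[of x]
  by (auto intro!: derivative_eq_intros)
 also have "(1*w - x*(2*x*(inverse w/2)))/(w*w) = (w^2 - x^2)/(w^2*w)"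
  using w(1) by (simp add: power2_eq_square field_simps)
 also have "\<dots> = soft_sgn_deriv \<kappa> x"
  using w(2) by (simp add: soft_sgn_deriv_def w_def[symmetric])
 finally show "(soft_sgn \<kappa> has_real_derivative soft_sgn_deriv \<kappa> x) (at x)" .
 show "continuous_on UNIV (soft_sgn \<kappa>)" "continuous_on UNIV (soft_sgn_deriv \<kappa>)"
  unfolding soft_sgn_def[abs_def] soft_sgn_deriv_def[abs_def] using p0 by (auto intro!: continuous_intros)
qed (use assms in \<open>auto simp: soft_abs_def soft_sgn_def\<close>)

text \<open>The decisive bound is that of the derivative of the sign times x^2 by \<kappa>: after
  Young's inequality the drift leaves exactly such a term, which disappears with \<kappa>.\<close>

lemma soft_bounds:
 assumes "0 < \<kappa>"
 shows "\<bar>soft_sgn \<kappa> x\<bar> <= 1" "0 <= soft_sgn_deriv \<kappa> x" "soft_sgn_deriv \<kappa> x <= 1/\<kappa>"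
  and "soft_sgn_deriv \<kappa> x*x^2 <= \<kappa>" "0 <= soft_abs \<kappa> x" "\<bar>x\<bar> <= soft_abs \<kappa> x + \<kappa>"
  and "soft_abs \<kappa> x <= soft_sgn \<kappa> x*x" "soft_sgn \<kappa> x*x <= soft_abs \<kappa> x + \<kappa>"
proof -
 define w where "w = sqrt (x^2 + \<kappa>^2)"
 have w2: "w^2 = x^2 + \<kappa>^2" by (simp add: w_def)
 have wk: "\<kappa> <= w" using assms unfolding w_def by (intro real_le_rsqrt) simp
 have wx: "\<bar>x\<bar> <= w" unfolding w_def by (intro real_le_rsqrt) simp
 have w: "0 < w" using wk assms by simp
 have e: "soft_sgn \<kappa> x = x/w" "soft_sgn_deriv \<kappa> x = \<kappa>^2/(w^2*w)" "soft_abs \<kappa> x = w - \<kappa>"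
  using w2 by (simp_all add: soft_sgn_def soft_sgn_deriv_def soft_abs_def w_def)
 show "\<bar>soft_sgn \<kappa> x\<bar> <= 1" using wx w by (simp add: e)
 show "0 <= soft_sgn_deriv \<kappa> x" using w by (simp add: e)
 have k2: "\<kappa>^2 <= w^2" "x^2 <= w^2" using w2 by auto
 have "\<kappa>^2*\<kappa> <= w^2*w" using k2 wk assms by (intro mult_mono) auto
 then show "soft_sgn_deriv \<kappa> x <= 1/\<kappa>" unfolding e using w assms by (simp add: field_simps)
 have "\<kappa>^2*x^2 = \<kappa>*\<kappa>*x^2" by (simp add: power2_eq_square)
 also have "\<dots> <= \<kappa>*w*w^2" using k2 wk assms by (intro mult_mono) auto
 finally show "soft_sgn_deriv \<kappa> x*x^2 <= \<kappa>" unfolding e using w by (simp add: field_simps)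
 show "0 <= soft_abs \<kappa> x" "\<bar>x\<bar> <= soft_abs \<kappa> x + \<kappa>" using wk wx by (auto simp: e)
 have s: "soft_sgn \<kappa> x*x = w - \<kappa>*(\<kappa>/w)" unfolding e using w w2 by (simp add: field_simps power2_eq_square)
 have "\<kappa>*(\<kappa>/w) <= \<kappa>*1" using wk w assms by (intro mult_left_mono) auto
 then show "soft_abs \<kappa> x <= soft_sgn \<kappa> x*x" unfolding s e(3) by simp
 show "soft_sgn \<kappa> x*x <= soft_abs \<kappa> x + \<kappa>" unfolding s e(3) using w assms by simp
qed

text \<open>\<open>g\<close> stands for - div (C grad \<phi>), given by the weak identity because
  \<open>C\<close> need not be differentiable. With it, \<open>super\<close> says that \<phi> is a
  strict supersolution of the operator with drift \<open>b\<close> and zeroth order term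
  \<open>q\<close>.\<close>

locale elliptic_super = elliptic Om C b q N lam
 for Om :: "(real^'n) set" and C b q N lam +
 fixes \<phi> g :: "real^'n => real" and K c :: real
 assumes \<phi>_C1: "Ck_on (Suc 0) UNIV \<phi>" and \<phi>_nonneg: "!!x. x \<in> Om ==> 0 <= \<phi> x"
  and K_nonneg: "0 <= K" and \<phi>_le: "!!x. x \<in> Om ==> \<phi> x <= K" "!!x. x \<in> Om ==> norm (grad \<phi> x) <= K"
  and g_cont: "continuous_on Om g" and g_le: "!!x. x \<in> Om ==> \<bar>g x\<bar> <= K"
  and weak: "!!\<xi>. \<xi> \<in> C1c Om ==> (LINT x|lebesgue_on Om. (C x *v grad \<phi> x) \<bullet> grad \<xi> x) = (LINT x|lebesgue_on Om. g x*\<xi> x)"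
  and c_pos: "0 < c" and super: "!!x. x \<in> Om ==> c <= g x + b x \<bullet> grad \<phi> x + q x*\<phi> x"
begin

definition vol :: real where "vol = (LINT x|lebesgue_on Om. 1)"

text \<open>A \<open>C1c\<close> substitute for \<phi> times the sign of \<xi>. Inserted in the
  first argument of the form it lets the operator act on \<phi>, leaving at least \<open>c\<close>
  times the integral of the modulus of \<xi>.\<close>

definition test :: "real => (real^'n => real) => real^'n => real" where
 "test \<kappa> \<xi> x = soft_sgn \<kappa> (\<xi> x)*\<phi> x"

lemma vol_nonneg: "0 <= vol" by (simp add: vol_def)

lemma const_integral: "(LINT x|lebesgue_on Om. a) = a * vol" "integrable (lebesgue_on Om) (%x. a)"
 using integrable_lebesgue_on_const[OF opn bnd, of a] integrable_lebesgue_on_const[OF opn bnd, of 1]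
  Bochner_Integration.integral_mult_right_zero[of "lebesgue_on Om" a "%x. 1"]
 by (simp_all add: vol_def)

lemma test_C1c:
 assumes "0 < \<kappa>" "\<xi> \<in> C1c Om"
 shows "test \<kappa> \<xi> \<in> C1c Om"
  and "x \<in> Om ==> grad (test \<kappa> \<xi>) x = soft_sgn \<kappa> (\<xi> x) *\<^sub>R grad \<phi> x + (\<phi> x * soft_sgn_deriv \<kappa> (\<xi> x)) *\<^sub>R grad \<xi> x"
proof -
 note s = C1c_compose[OF assms(2) soft_derivs(2,4,6)[OF assms(1)]]
 have p: "Ck_on (Suc 0) Om \<phi>" using \<phi>_C1 by (rule Ck_on_subset) simp
 show "test \<kappa> \<xi> \<in> C1c Om" using C1c_mult(1)[OF opn s(1) p] by (simp add: test_def[abs_def])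
 show "x \<in> Om ==> grad (test \<kappa> \<xi>) x = soft_sgn \<kappa> (\<xi> x) *\<^sub>R grad \<phi> x + (\<phi> x * soft_sgn_deriv \<kappa> (\<xi> x)) *\<^sub>R grad \<xi> x"
  using C1c_mult(2)[OF opn s(1) p, of x] by (simp add: test_def[abs_def] s(2))
qed

text \<open>Only the \<open>L2\<close> bound is uniform in \<kappa>. The \<open>H1\<close> bound
  grows like 1/\<kappa>, and may therefore be paired only with residuals of smaller order than
  \<kappa>.\<close>

lemma test_le:
 assumes \<kappa>: "0 < \<kappa>" and \<xi>: "\<xi> \<in> C1c Om"
 shows "sqrt (L2sq Om (test \<kappa> \<xi>)) <= K * sqrt vol"
  and "nrm (test \<kappa> \<xi>) <= 4*K*(sqrt vol + nrm \<xi>/\<kappa>)"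
proof -
 note T = test_C1c[OF assms]
 have t: "\<bar>test \<kappa> \<xi> x\<bar> <= K" if "x \<in> Om" for x
  using mult_mono[OF soft_bounds(1)[OF \<kappa>, of "\<xi> x"] \<phi>_le(1)[OF that]] \<phi>_nonneg[OF that] by (simp add: test_def abs_mult)
 have "L2sq Om (test \<kappa> \<xi>) <= (LINT x|lebesgue_on Om. K^2)"
  unfolding L2sq_def
 proof (rule integral_mono)
  show "integrable (lebesgue_on Om) (%x. (norm (test \<kappa> \<xi> x))^2)" using C1c_L2(1)[OF opn bnd T(1)] by (simp add: L2_on_def)
  show "(norm (test \<kappa> \<xi> x))^2 <= K^2" if "x \<in> space (lebesgue_on Om)" for x
   using t[of x] that by (intro power_mono) auto
 qed (rule const_integral(2))
 also have "\<dots> = K^2 * vol" by (rule const_integral(1))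
 finally show "sqrt (L2sq Om (test \<kappa> \<xi>)) <= K * sqrt vol"
  using K_nonneg real_sqrt_le_mono[of "L2sq Om (test \<kappa> \<xi>)" "K^2 * vol"] by (simp add: real_sqrt_mult)
 have j: "norm (jet (test \<kappa> \<xi>) x) <= 2*K + K/\<kappa>*norm (jet \<xi> x)" if x: "x \<in> Om" for x
 proof -
  have "norm (soft_sgn \<kappa> (\<xi> x) *\<^sub>R grad \<phi> x) <= 1*K"
   unfolding norm_scaleR using soft_bounds(1)[OF \<kappa>] \<phi>_le(2)[OF x] by (intro mult_mono) auto
  moreover have "norm ((\<phi> x * soft_sgn_deriv \<kappa> (\<xi> x)) *\<^sub>R grad \<xi> x) <= (K*(1/\<kappa>))*norm (jet \<xi> x)"
   unfolding norm_scaleR abs_mult using soft_bounds(2,3)[OF \<kappa>, of "\<xi> x"] \<phi>_le(1)[OF x] \<phi>_nonneg[OF x] K_nonneg \<kappa> norm_snd_le[of "grad \<xi> x" "\<xi> x"]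
   by (intro mult_mono) (auto simp: jet_def)
  moreover have "norm (jet (test \<kappa> \<xi>) x) <= \<bar>test \<kappa> \<xi> x\<bar> + norm (grad (test \<kappa> \<xi>) x)"
   unfolding jet_def using norm_Pair_le[of "test \<kappa> \<xi> x" "grad (test \<kappa> \<xi>) x"] by simp
  ultimately show ?thesis
   using t[OF x] norm_triangle_ineq[of "soft_sgn \<kappa> (\<xi> x) *\<^sub>R grad \<phi> x" "(\<phi> x * soft_sgn_deriv \<kappa> (\<xi> x)) *\<^sub>R grad \<xi> x"]
   unfolding T(2)[OF x] by simp
 qed
 have i: "integrable (lebesgue_on Om) (%x. (norm (jet \<xi> x))^2)" using C1c_jet_L2[OF \<xi>] by (simp add: L2_on_def)
 have "L2sq Om (jet (test \<kappa> \<xi>)) <= (LINT x|lebesgue_on Om. 2*(2*K)^2 + 2*(K/\<kappa>)^2*(norm (jet \<xi> x))^2)"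
  unfolding L2sq_def
 proof (rule integral_mono)
  show "integrable (lebesgue_on Om) (%x. (norm (jet (test \<kappa> \<xi>) x))^2)" using C1c_jet_L2[OF T(1)] by (simp add: L2_on_def)
  show "(norm (jet (test \<kappa> \<xi>) x))^2 <= 2*(2*K)^2 + 2*(K/\<kappa>)^2*(norm (jet \<xi> x))^2" if "x \<in> space (lebesgue_on Om)" for x
  proof -
   have "(norm (jet (test \<kappa> \<xi>) x))^2 <= (2*K + K/\<kappa>*norm (jet \<xi> x))^2"
    using j[of x] that by (intro power_mono) auto
   also have "\<dots> <= 2*(2*K)^2 + 2*(K/\<kappa>*norm (jet \<xi> x))^2" by (rule power2_sum2_le)
   finally show ?thesis by (simp add: power_mult_distrib power_divide)
  qed
 qed (use i const_integral(2) in simp)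
 also have "\<dots> = 2*(2*K)^2 * vol + 2*(K/\<kappa>)^2*L2sq Om (jet \<xi>)"
  unfolding L2sq_def using i const_integral by simp
 also have "\<dots> <= (4*K * sqrt vol)^2 + (4*K/\<kappa>*nrm \<xi>)^2"
  using vol_nonneg by (intro add_mono) (simp_all add: power_mult_distrib nrm_jet power_divide divide_right_mono mult_right_mono)
 also have "\<dots> <= (4*K * sqrt vol + 4*K/\<kappa>*nrm \<xi>)^2"
  using K_nonneg \<kappa> vol_nonneg \<xi> by (simp add: power2_sum)
 finally have "nrm (test \<kappa> \<xi>) <= 4*K * sqrt vol + 4*K/\<kappa>*nrm \<xi>"
  unfolding nrm_jet[of "test \<kappa> \<xi>"] using K_nonneg \<kappa> vol_nonneg \<xi> by (intro real_le_lsqrt) auto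
 then show "nrm (test \<kappa> \<xi>) <= 4*K*(sqrt vol + nrm \<xi>/\<kappa>)" by (simp add: algebra_simps)
qed

text \<open>The mixed term with C grad \<phi> cancels, because the gradient of \<rho> is the soft
  sign times that of \<xi>. The three errors of order \<kappa> come from |\<xi>| versus \<rho>, from
  completing the square in the term with the derivative of the sign, and from replacing sign times
  \<xi> by \<rho> in the drift of \<phi>.\<close>

lemma test_pointwise:
 assumes \<kappa>: "0 < \<kappa>" and \<xi>: "\<xi> \<in> C1c Om" and \<tau>: "0 <= \<tau>" and x: "x \<in> Om"
 defines "\<rho> \<equiv> %x. soft_abs \<kappa> (\<xi> x)"
 shows "c*\<bar>\<xi> x\<bar> - \<kappa>*(c + K*N^2/(4*lam) + N*K) \<le>
  A x (jet (test \<kappa> \<xi>) x) \<bullet> jet \<xi> x + \<tau>*(test \<kappa> \<xi> x*\<xi> x) - ((C x *v grad \<phi> x) \<bullet> grad \<rho> x - g x*\<rho> x)"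
proof -
 define s where "s = soft_sgn \<kappa> (\<xi> x)"
 define s' where "s' = soft_sgn_deriv \<kappa> (\<xi> x)"
 define G where "G = grad \<xi> x"
 define n where "n = norm G"
 note sb = soft_bounds[OF \<kappa>, of "\<xi> x", folded s_def s'_def]
 note px = \<phi>_nonneg[OF x] \<phi>_le[OF x]
 have gT: "grad (test \<kappa> \<xi>) x = s *\<^sub>R grad \<phi> x + (\<phi> x * s') *\<^sub>R G"
  using test_C1c(2)[OF \<kappa> \<xi> x] by (simp add: s_def s'_def G_def)
 have gR: "grad \<rho> x = s *\<^sub>R G"
  using C1c_compose(2)[OF \<xi> soft_derivs(1,3,5)[OF \<kappa>]] by (simp add: \<rho>_def s_def G_def)
 have eq: "A x (jet (test \<kappa> \<xi>) x) \<bullet> jet \<xi> x + \<tau>*(test \<kappa> \<xi> x*\<xi> x) - ((C x *v grad \<phi> x) \<bullet> grad \<rho> x - g x*\<rho> x) =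
  \<phi> x*(s'*((C x *v G) \<bullet> G + (b x \<bullet> G)*\<xi> x)) + (b x \<bullet> grad \<phi> x)*(s*\<xi> x) + (q x + \<tau>)*\<phi> x*(s*\<xi> x) + g x*\<rho> x"
  unfolding gR A_def jet_def fst_conv snd_conv inner_prod_def gT test_def s_def[symmetric] G_def[symmetric]
  by (simp add: matrix_vector_right_distrib scaleR_matrix_vector_assoc[symmetric] matrix_vector_mult_scaleR
    inner_add_left inner_add_right algebra_simps)
 have "\<bar>b x \<bullet> G\<bar>*\<bar>\<xi> x\<bar> <= (N*n)*\<bar>\<xi> x\<bar>"
  unfolding n_def using Cauchy_Schwarz_ineq2[of "b x" G] mult_right_mono[OF b_le[OF x], of "norm G"] by (intro mult_right_mono) auto
 moreover have "0 <= (2*lam*n - N*\<bar>\<xi> x\<bar>)^2/(4*lam)" using lam by simp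
 then have "(N*n)*\<bar>\<xi> x\<bar> <= lam*n^2 + N^2/(4*lam)*(\<xi> x)^2"
  using lam by (simp add: power2_eq_square field_simps)
 moreover have "lam*n^2 <= (C x *v G) \<bullet> G" unfolding n_def by (rule C_ge[OF x])
 moreover have "- (\<bar>b x \<bullet> G\<bar>*\<bar>\<xi> x\<bar>) <= (b x \<bullet> G)*\<xi> x" unfolding abs_mult[symmetric] by linarith
 ultimately have "- (N^2/(4*lam)*(\<xi> x)^2) <= (C x *v G) \<bullet> G + (b x \<bullet> G)*\<xi> x" by linarith
 from mult_left_mono[OF this sb(2)] have "- (N^2/(4*lam)*(s'*(\<xi> x)^2)) <= s'*((C x *v G) \<bullet> G + (b x \<bullet> G)*\<xi> x)"
  by (simp add: mult_ac)
 moreover have "N^2/(4*lam)*(s'*(\<xi> x)^2) <= N^2/(4*lam)*\<kappa>" using sb(4) lam by (intro mult_left_mono) auto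
 ultimately have "- (N^2/(4*lam)*\<kappa>) <= s'*((C x *v G) \<bullet> G + (b x \<bullet> G)*\<xi> x)" by linarith
 from mult_left_mono[OF this px(1)]
 have 1: "- (\<phi> x*(N^2/(4*lam)*\<kappa>)) <= \<phi> x*(s'*((C x *v G) \<bullet> G + (b x \<bullet> G)*\<xi> x))" by simp
 have 3: "\<phi> x*(N^2/(4*lam)*\<kappa>) <= K*(N^2/(4*lam)*\<kappa>)" using px lam \<kappa> by (intro mult_right_mono) auto
 define r where "r = soft_abs \<kappa> (\<xi> x)"
 have "\<bar>b x \<bullet> grad \<phi> x\<bar> <= N*K"
  using Cauchy_Schwarz_ineq2[of "b x" "grad \<phi> x"] mult_mono[OF b_le[OF x] px(3) N_nonneg] by simp
 then have "\<bar>b x \<bullet> grad \<phi> x\<bar>*\<bar>s*\<xi> x - r\<bar> <= (N*K)*\<kappa>"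
  using sb(7,8) N_nonneg K_nonneg unfolding r_def by (intro mult_mono) auto
 then have 2: "- (N*K*\<kappa>) <= (b x \<bullet> grad \<phi> x)*(s*\<xi> x) - (b x \<bullet> grad \<phi> x)*r"
  unfolding abs_mult[symmetric] right_diff_distrib by linarith
 have "(q x*\<phi> x)*r <= ((q x + \<tau>)*\<phi> x)*(s*\<xi> x)"
  using sb(5,7) q_nonneg[OF x] \<tau> px(1) unfolding r_def by (intro mult_mono mult_right_mono) auto
 moreover have "c*r <= (g x + b x \<bullet> grad \<phi> x + q x*\<phi> x)*r"
  using super[OF x] sb(5) unfolding r_def by (rule mult_right_mono)
 moreover have "c*\<bar>\<xi> x\<bar> <= c*(r + \<kappa>)" using sb(6) c_pos unfolding r_def by (intro mult_left_mono) auto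
 ultimately show ?thesis unfolding eq unfolding \<rho>_def r_def[symmetric] using 1 3 2
  by (simp add: algebra_simps)
qed

lemma L1_estimate:
 assumes \<kappa>: "0 < \<kappa>" and \<xi>: "\<xi> \<in> C1c Om" and \<tau>: "0 <= \<tau>"
 shows "c*(LINT x|lebesgue_on Om. \<bar>\<xi> x\<bar>) \<le>
  form (jet (test \<kappa> \<xi>)) (jet \<xi>) + \<tau>*mass (test \<kappa> \<xi>) \<xi> + \<kappa>*((c + K*N^2/(4*lam) + N*K) * vol)"
proof -
 define \<rho> where "\<rho> = (%x. soft_abs \<kappa> (\<xi> x))"
 define M where "M = c + K*N^2/(4*lam) + N*K"
 define E where "E x = A x (jet (test \<kappa> \<xi>) x) \<bullet> jet \<xi> x" for x
 define F where "F x = test \<kappa> \<xi> x*\<xi> x" for x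
 have \<rho>: "\<rho> \<in> C1c Om" unfolding \<rho>_def by (rule C1c_compose(1)[OF \<xi> soft_derivs(1,3,5)[OF \<kappa>]])
 note T = test_C1c(1)[OF \<kappa> \<xi>]
 have \<phi>L: "L2_on Om (jet \<phi>)"
  using \<phi>_le \<phi>_nonneg by (intro C1_bounded_L2(3)[OF opn bnd Ck_on_subset[OF \<phi>_C1]]) auto
 have gL: "L2_on Om g" using measurable_lebesgue_on_continuous[OF opn g_cont] g_le by (intro L2_on_bounded[OF opn bnd]) auto
 have "L2_on Om (%x. C x *v grad \<phi> x)"
  using L2_on_fst_snd(2)[OF L2_A(1)[OF \<phi>L]] by (simp add: A_def jet_def)
 then have i1: "integrable (lebesgue_on Om) (%x. (C x *v grad \<phi> x) \<bullet> grad \<rho> x)"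
  by (rule L2_on_inner_integrable[OF _ C1c_L2(2)[OF opn bnd \<rho>]])
 have i2: "integrable (lebesgue_on Om) (%x. g x*\<rho> x)" by (rule L2_on_mult_integrable[OF gL C1c_L2(1)[OF opn bnd \<rho>]])
 have i3: "integrable (lebesgue_on Om) E"
  unfolding E_def by (rule L2_on_inner_integrable[OF L2_A(1)[OF C1c_jet_L2[OF T]] C1c_jet_L2[OF \<xi>]])
 have i4: "integrable (lebesgue_on Om) F"
  unfolding F_def by (rule L2_on_mult_integrable[OF C1c_L2(1)[OF opn bnd T] C1c_L2(1)[OF opn bnd \<xi>]])
 have i5: "integrable (lebesgue_on Om) (%x. \<bar>\<xi> x\<bar>)"
  using integrable_abs[OF L2_on_mult_integrable[OF C1c_L2(1)[OF opn bnd \<xi>], of "%x. 1"]]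
   L2_on_bounded[OF opn bnd, of "%x. 1 :: real" 1] by simp
 have "(LINT x|lebesgue_on Om. c*\<bar>\<xi> x\<bar> - \<kappa>*M) \<le>
   (LINT x|lebesgue_on Om. E x + \<tau>*F x - ((C x *v grad \<phi> x) \<bullet> grad \<rho> x - g x*\<rho> x))"
 proof (rule integral_mono)
  show "integrable (lebesgue_on Om) (%x. c*\<bar>\<xi> x\<bar> - \<kappa>*M)" using i5 const_integral(2) by simp
  show "integrable (lebesgue_on Om) (%x. E x + \<tau>*F x - ((C x *v grad \<phi> x) \<bullet> grad \<rho> x - g x*\<rho> x))"
   using i1 i2 i3 i4 by simp
  fix x assume "x \<in> space (lebesgue_on Om)"
  then show "c*\<bar>\<xi> x\<bar> - \<kappa>*M <= E x + \<tau>*F x - ((C x *v grad \<phi> x) \<bullet> grad \<rho> x - g x*\<rho> x)"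
   unfolding E_def F_def M_def \<rho>_def by (intro test_pointwise[OF \<kappa> \<xi> \<tau>]) simp
 qed
 \<comment> \<open>The subtracted expression has integral 0 by the assumption \<open>weak\<close>
   with test function \<rho>.\<close>
 moreover have "(LINT x|lebesgue_on Om. E x + \<tau>*F x - ((C x *v grad \<phi> x) \<bullet> grad \<rho> x - g x*\<rho> x)) =
   form (jet (test \<kappa> \<xi>)) (jet \<xi>) + \<tau>*mass (test \<kappa> \<xi>) \<xi>"
  using i1 i2 i3 i4 weak[OF \<rho>] by (simp add: form_def mass_def E_def[symmetric] F_def[symmetric])
 moreover have "(LINT x|lebesgue_on Om. c*\<bar>\<xi> x\<bar> - \<kappa>*M) = c*(LINT x|lebesgue_on Om. \<bar>\<xi> x\<bar>) - \<kappa>*M * vol"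
  using i5 const_integral by simp
 ultimately show ?thesis unfolding M_def by (simp add: mult.assoc)
qed

end

section \<open>A priori bounds uniform in the zeroth order term, and stability\<close>

context elliptic_super
begin

text \<open>The path between the coercive form at \<tau> = \<open>sig\<close> and the form of the
  operator at \<tau> = 0. It replaces \<open>q\<close> by \<open>q + \<tau>\<close>, so the
  \<open>L1\<close> estimate applies all along.\<close>

definition B :: "real => (real^'n => real) => (real^'n => real) => real" where
 "B \<tau> f h = form (jet f) (jet h) + \<tau>*mass f h"

definition L1n :: "(real^'n => real) => real" where
 "L1n f = (LINT x|lebesgue_on Om. \<bar>f x\<bar>)"

lemma bilin_B: "bilin (B \<tau>)"
 unfolding B_def[abs_def] by (rule bilin_comb[OF bilin_form bilin_mass])

lemma sig_pos: "0 < sig"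
 using lam by (simp add: sig_def add_pos_nonneg)

lemma mass_le_nrm:
 assumes "f \<in> C1c Om" "h \<in> C1c Om"
 shows "\<bar>mass f h\<bar> <= sqrt (L2sq Om f)*nrm h" "\<bar>mass f h\<bar> <= nrm f*nrm h"
proof -
 show *: "\<bar>mass f h\<bar> <= sqrt (L2sq Om f)*nrm h"
  using mass_le[OF assms] mult_left_mono[OF L2sq_le_jet(1)[OF assms(2)], of "sqrt (L2sq Om f)"] by simp
 show "\<bar>mass f h\<bar> <= nrm f*nrm h"
  using * mult_right_mono[OF L2sq_le_jet(1)[OF assms(1)], of "nrm h"] assms by simp
qed

lemma B_sig_coercive: "f \<in> C1c Om ==> lam/2*(nrm f)^2 <= B sig f f"
 using Garding[of f] by (simp add: B_def mass_def L2sq_def power2_eq_square)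

lemma B_sig_apriori: "apriori (2/lam) (B sig)"
 using coercive_apriori[of "lam/2" "B sig"] B_sig_coercive lam by simp

lemma B_sig_solvable: "solvable (B sig)"
proof (rule coercive_solvable[OF bilin_B _ _ _ B_sig_coercive])
 fix f h assume "f \<in> C1c Om" "h \<in> C1c Om"
 then have "\<bar>form (jet f) (jet h)\<bar> <= 3*N*nrm f*nrm h" "\<bar>sig*mass f h\<bar> <= sig*(nrm f*nrm h)"
  using form_le[OF C1c_jet_L2 C1c_jet_L2] mass_le_nrm(2) sig_pos by (simp_all add: nrm_jet abs_mult)
 then show "\<bar>B sig f h\<bar> <= (3*N + sig)*nrm f*nrm h"
  unfolding B_def distrib_right mult.assoc by linarith
qed (use lam sig_pos N_nonneg in auto)

lemma L1n_integrable: "f \<in> C1c Om ==> integrable (lebesgue_on Om) (%x. \<bar>f x\<bar>)"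
 using integrable_abs[OF L2_on_mult_integrable[OF C1c_L2(1)[OF opn bnd], of f Om "%x. 1"]]
  L2_on_bounded[OF opn bnd, of "%x. 1 :: real" 1] by simp

lemma L1n_le:
 assumes f: "f \<in> C1c Om"
 shows "L1n f <= sqrt vol*nrm f"
proof -
 have 1: "L2_on Om (%x. 1 :: real)" by (rule L2_on_bounded[OF opn bnd, of _ 1]) auto
 have 2: "L2_on Om (%x. \<bar>f x\<bar>)" using C1c_L2(1)[OF opn bnd f] by (auto simp: L2_on_def)
 have "L1n f <= sqrt (L2sq Om (%x. 1 :: real)) * sqrt (L2sq Om (%x. \<bar>f x\<bar>))"
  using L2_Cauchy_Schwarz[OF 1 2] by (simp add: L1n_def)
 also have "\<dots> = sqrt vol * sqrt (L2sq Om f)" by (simp add: L2sq_def vol_def)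
 also have "\<dots> <= sqrt vol*nrm f" using L2sq_le_jet(1)[OF f] vol_nonneg by (intro mult_left_mono) auto
 finally show ?thesis .
qed

definition K1 :: real where "K1 = (c + K*N^2/(4*lam) + N*K) * vol"
text \<open>Collects the two places where the coercive auxiliary solution \<zeta> enters: the mass
  term against the test function, with factor \<open>sig * K\<close>, and its own \<open>L1\<close>
  norm, with factor \<open>c\<close>. The 2/lam is the a priori constant of the coercive
  form.\<close>

definition K2 :: real where "K2 = (sig*K + c) * sqrt vol*(2/lam)"

text \<open>
  Subtracting an approximate solution of the coercive problem replaces the bound of \<open>B \<tau> f \<xi>\<close> in
  terms of \<open>nrm f\<close> by a bound in terms of the \<open>L\<^sup>2\<close> norm of \<open>f\<close>, up to a small remainder.
\<close>

lemma L1n_step: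
 assumes \<tau>: "0 <= \<tau>" "\<tau> <= sig" and \<xi>: "\<xi> \<in> C1c Om" and G: "0 <= G" "bounded_by (%f. B \<tau> f \<xi>) G" and \<kappa>: "0 < \<kappa>"
 shows "c*L1n \<xi> <= 4*K*(\<kappa>^2 * sqrt vol + \<kappa>*(2*(nrm \<xi> + 2/lam*(G + \<kappa>^2)))) + K2*(G + \<kappa>^2) + \<kappa>*K1"
proof -
 have k2: "0 < \<kappa>^2" using \<kappa> by simp
 have "lin_fun (%f. B \<tau> f \<xi>)" using bilin_B[of \<tau>] \<xi> by (simp add: bilin_def)
 \<comment> \<open>The residual is taken as \<kappa>^2 because it will be tested with a function
   whose \<open>H1\<close> norm grows like 1/\<kappa>; their product still tends to 0.\<close>
 with B_sig_solvable G k2 obtain \<zeta> where \<zeta>: "\<zeta> \<in> C1c Om" "bounded_by (%f. B \<tau> f \<xi> - B sig f \<zeta>) (\<kappa>^2)"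
  unfolding solvable_def by blast
 have \<zeta>': "\<bar>B \<tau> f \<xi> - B sig f \<zeta>\<bar> <= \<kappa>^2*nrm f" if "f \<in> C1c Om" for f using \<zeta>(2) that by (simp add: bounded_by_def)
 have "bounded_by (%f. B sig f \<zeta>) (G + \<kappa>^2)"
  unfolding bounded_by_def
 proof
  fix f assume f: "f \<in> C1c Om"
  then have "\<bar>B \<tau> f \<xi>\<bar> <= G*nrm f" using G(2) by (simp add: bounded_by_def)
  then show "\<bar>B sig f \<zeta>\<bar> <= (G + \<kappa>^2)*nrm f" using \<zeta>'[OF f] unfolding distrib_right by linarith
 qed
 then have n\<zeta>: "nrm \<zeta> <= 2/lam*(G + \<kappa>^2)"
  using B_sig_apriori[unfolded apriori_def, rule_format, OF \<zeta>(1), of "G + \<kappa>^2"] G(1) by simp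
 define \<omega> where "\<omega> = (%x. (- 1)*\<zeta> x + \<xi> x)"
 have \<omega>: "\<omega> \<in> C1c Om" "jet \<omega> = (%x. jet \<xi> x - jet \<zeta> x)" unfolding \<omega>_def using C1c_lin[OF \<zeta>(1) \<xi>, of "- 1"] by auto
 have "(nrm \<omega>)^2 <= 2*(nrm \<xi>)^2 + 2*(nrm \<zeta>)^2"
  using L2_on_diff(2)[OF C1c_jet_L2[OF \<xi>] C1c_jet_L2[OF \<zeta>(1)]] by (simp add: nrm_jet \<omega>(2))
 also have "\<dots> <= (2*(nrm \<xi> + nrm \<zeta>))^2" using \<xi> \<zeta>(1) by (simp add: power2_eq_square algebra_simps)
 finally have "nrm \<omega> <= 2*(nrm \<xi> + nrm \<zeta>)" by (rule power2_le_imp_le) (use \<xi> \<zeta>(1) in simp)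
 then have n\<omega>: "nrm \<omega> <= 2*(nrm \<xi> + 2/lam*(G + \<kappa>^2))"
  by (rule order_trans) (intro mult_left_mono add_left_mono n\<zeta>, simp)
 define \<theta> where "\<theta> = test \<kappa> \<omega>"
 have \<theta>: "\<theta> \<in> C1c Om" unfolding \<theta>_def by (rule test_C1c(1)[OF \<kappa> \<omega>(1)])
 have "B \<tau> \<theta> \<omega> = (- 1)*B \<tau> \<theta> \<zeta> + B \<tau> \<theta> \<xi>"
  using bilin_B[of \<tau>] \<theta> \<zeta>(1) \<xi> unfolding bilin_def lin_fun_def \<omega>_def by blast
 moreover have "B \<tau> \<theta> \<zeta> = B sig \<theta> \<zeta> - (sig - \<tau>)*mass \<theta> \<zeta>" by (simp add: B_def algebra_simps)
 ultimately have "B \<tau> \<theta> \<omega> = (B \<tau> \<theta> \<xi> - B sig \<theta> \<zeta>) + (sig - \<tau>)*mass \<theta> \<zeta>" by simp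
 moreover have "B \<tau> \<theta> \<xi> - B sig \<theta> \<zeta> <= \<kappa>^2*nrm \<theta>" using \<zeta>'[OF \<theta>] by linarith
 moreover have "\<kappa>^2*nrm \<theta> <= \<kappa>^2*(4*K*(sqrt vol + nrm \<omega>/\<kappa>))"
  unfolding \<theta>_def by (rule mult_left_mono[OF test_le(2)[OF \<kappa> \<omega>(1)]]) simp
 moreover have "\<dots> = 4*K*(\<kappa>^2 * sqrt vol + \<kappa>*nrm \<omega>)" using \<kappa> by (simp add: power2_eq_square field_simps)
 moreover have "\<dots> <= 4*K*(\<kappa>^2 * sqrt vol + \<kappa>*(2*(nrm \<xi> + 2/lam*(G + \<kappa>^2))))"
  using n\<omega> K_nonneg \<kappa> by (intro mult_left_mono add_left_mono) auto
 moreover have "(sig - \<tau>)*mass \<theta> \<zeta> <= sig*((K * sqrt vol)*(2/lam*(G + \<kappa>^2)))"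
 proof -
  have "(sig - \<tau>)*mass \<theta> \<zeta> <= (sig - \<tau>)*\<bar>mass \<theta> \<zeta>\<bar>" using \<tau> by (intro mult_left_mono) auto
  also have "\<dots> <= sig*(sqrt (L2sq Om \<theta>)*nrm \<zeta>)" using \<tau> mass_le_nrm(1)[OF \<theta> \<zeta>(1)] by (intro mult_mono) auto
  also have "\<dots> <= sig*((K * sqrt vol)*(2/lam*(G + \<kappa>^2)))"
   using test_le(1)[OF \<kappa> \<omega>(1)] n\<zeta> sig_pos K_nonneg vol_nonneg \<zeta>(1) unfolding \<theta>_def
   by (intro mult_left_mono mult_mono) auto
  finally show ?thesis .
 qed
 moreover have "c*L1n \<omega> <= B \<tau> \<theta> \<omega> + \<kappa>*K1"
  using L1_estimate[OF \<kappa> \<omega>(1) \<tau>(1)] by (simp add: L1n_def B_def \<theta>_def K1_def)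
 moreover have "L1n \<xi> <= L1n \<omega> + L1n \<zeta>"
 proof -
  have "L1n \<xi> <= (LINT x|lebesgue_on Om. \<bar>\<omega> x\<bar> + \<bar>\<zeta> x\<bar>)"
   unfolding L1n_def by (rule integral_mono) (use L1n_integrable \<xi> \<omega>(1) \<zeta>(1) in \<open>auto simp: \<omega>_def\<close>)
  then show ?thesis using L1n_integrable[OF \<omega>(1)] L1n_integrable[OF \<zeta>(1)] by (simp add: L1n_def)
 qed
 then have "c*L1n \<xi> <= c*L1n \<omega> + c*L1n \<zeta>" using mult_left_mono[of _ _ c] c_pos by (simp add: distrib_left[symmetric])
 moreover have "c*L1n \<zeta> <= c*(sqrt vol*(2/lam*(G + \<kappa>^2)))"
  using L1n_le[OF \<zeta>(1)] mult_left_mono[OF n\<zeta>, of "sqrt vol"] vol_nonneg c_pos by (intro mult_left_mono) auto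
 moreover have "K2*(G + \<kappa>^2) = sig*((K * sqrt vol)*(2/lam*(G + \<kappa>^2))) + c*(sqrt vol*(2/lam*(G + \<kappa>^2)))"
  unfolding K2_def by (simp add: algebra_simps add_divide_distrib)
 ultimately show ?thesis by linarith
qed

lemma L1n_bound:
 assumes \<tau>: "0 <= \<tau>" "\<tau> <= sig" and \<xi>: "\<xi> \<in> C1c Om" and G: "0 <= G" "bounded_by (%f. B \<tau> f \<xi>) G"
 shows "c*L1n \<xi> <= K2*G"
proof -
 define R where "R \<kappa> = 4*K*(\<kappa>^2 * sqrt vol + \<kappa>*(2*(nrm \<xi> + 2/lam*(G + \<kappa>^2)))) + K2*(G + \<kappa>^2) + \<kappa>*K1" for \<kappa>
 have "(R \<longlongrightarrow> R 0) (at_right 0)"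
  unfolding R_def[abs_def] by (intro tendsto_intros) 
 moreover have "\<forall>\<^sub>F \<kappa> in at_right 0. c*L1n \<xi> <= R \<kappa>"
  using L1n_step[OF \<tau> \<xi> G] by (auto simp: R_def eventually_at_filter)
 ultimately have "c*L1n \<xi> <= R 0" by (intro tendsto_lowerbound) auto
 then show ?thesis by (simp add: R_def)
qed

text \<open>The radius of the ball is the interpolation parameter. At lam/(4 sig), multiplication by
  \<open>sig\<close> gives lam/4, half of the coercivity lam/2 in Garding's inequality.\<close>

definition K3 :: real where
 "K3 = sig*(K2/c)^2/measure lborel (ball (0 :: real^'n) (lam/(4 * sig)))"
definition K4 :: real where "K4 = sqrt (8/lam*(2/lam + K3))"

lemma K3_nonneg: "0 <= K3"
 using sig_pos by (simp add: K3_def)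

text \<open>Garding's inequality misses coercivity by \<open>sig\<close> times the squared
  \<open>L2\<close> norm. Interpolation bounds this by lam/4 times the squared \<open>H1\<close>
  norm plus a multiple of the squared \<open>L1\<close> norm, and the latter is controlled by
  \<open>G\<close>. Of the remaining lam/4, half absorbs the product G n.\<close>

lemma B_apriori:
 assumes \<tau>: "0 <= \<tau>" "\<tau> <= sig"
 shows "apriori K4 (B \<tau>)"
 unfolding apriori_def
proof (intro ballI allI impI)
 fix \<xi> G assume \<xi>: "\<xi> \<in> C1c Om" and G: "0 <= G" "bounded_by (%f. B \<tau> f \<xi>) G"
 define n where "n = nrm \<xi>"
 define V where "V = measure lborel (ball (0 :: real^'n) (lam/(4 * sig)))"
 have n0: "0 <= n" using \<xi> by (simp add: n_def)
 have "0 <= \<tau>*mass \<xi> \<xi>" using \<tau> by (simp add: mass_def)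
 then have 1: "lam/2*n^2 <= B \<tau> \<xi> \<xi> + sig*L2sq Om \<xi>" using Garding[OF \<xi>] by (simp add: B_def n_def)
 have 2: "B \<tau> \<xi> \<xi> <= G*n" using G(2) \<xi> by (force simp: bounded_by_def n_def)
 have l: "0 <= L1n \<xi>" by (simp add: L1n_def)
 have "L1n \<xi> <= K2/c*G" using L1n_bound[OF \<tau> \<xi> G] c_pos by (simp add: field_simps)
 then have "(L1n \<xi>)^2 <= (K2/c*G)^2" using l by (rule power_mono)
 then have 3: "(L1n \<xi>)^2/V <= (K2/c)^2*G^2/V" unfolding power_mult_distrib by (rule divide_right_mono) (simp add: V_def)
 have "sqrt (L2sq Om \<xi>) * sqrt (L2sq Om (grad \<xi>)) <= n*n"
  unfolding n_def using L2sq_le_jet(1,2)[OF \<xi>] \<xi> by (intro mult_mono) auto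
 then have "lam/(4 * sig)*(sqrt (L2sq Om \<xi>) * sqrt (L2sq Om (grad \<xi>))) <= lam/(4 * sig)*(n*n)"
  using lam sig_pos by (intro mult_left_mono) auto
 then have "L2sq Om \<xi> <= lam/(4 * sig)*(n*n) + (K2/c)^2*G^2/V"
  using L2_L1_interpolation[OF opn bnd \<xi>, of "lam/(4 * sig)"] lam sig_pos 3 by (simp add: L1n_def V_def)
 then have "sig*L2sq Om \<xi> <= sig*(lam/(4 * sig)*(n*n) + (K2/c)^2*G^2/V)"
  using sig_pos by (intro mult_left_mono) auto
 also have "\<dots> = lam/4*n^2 + K3*G^2"
  using sig_pos by (simp add: K3_def V_def power2_eq_square distrib_left)
 finally have 4: "lam/4*n^2 <= G*n + K3*G^2" using 1 2 by linarith
 have "0 <= (lam*n - 4*G)^2/(8*lam)" using lam by simp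
 then have "G*n <= lam/8*n^2 + 2/lam*G^2" using lam by (simp add: power2_eq_square field_simps)
 with 4 have "lam/8*n^2 <= (2/lam + K3)*G^2" unfolding distrib_right by linarith
 then have "n^2 <= (8/lam*(2/lam + K3))*G^2" using lam by (simp add: field_simps)
 also have "\<dots> = (K4*G)^2" using lam K3_nonneg by (simp add: K4_def power_mult_distrib)
 finally show "nrm \<xi> <= K4*G"
  unfolding n_def[symmetric] using G(1) lam K3_nonneg by (rule_tac power2_le_imp_le) (auto simp: K4_def)
qed

text \<open>Continuity runs through the forms \<open>B (sig*(1 - t))\<close>, which share the
  constant \<open>K4\<close>, and makes the adjoint problem of \<open>B 0\<close> approximately
  solvable. Then \<open>inf_sup\<close> transfers the bound to the first argument.\<close>

lemma stability:
 assumes \<theta>: "\<theta> \<in> C1c Om" and G: "0 <= G" "!!\<xi>. \<xi> \<in> C1c Om ==> \<bar>form (jet \<theta>) (jet \<xi>)\<bar> <= G*nrm \<xi>"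
 shows "nrm \<theta> <= 3*K4*G"
proof -
 have K4: "0 <= K4" using lam K3_nonneg by (simp add: K4_def)
 define d where "d f h = - sig*mass f h" for f h
 have B: "(%f h. B sig f h + t*d f h) = B (sig*(1 - t))" for t
  by (intro ext) (simp add: B_def d_def algebra_simps)
 have "bilin (%f h. 0*mass f h + (- sig)*mass f h)"
  by (rule bilin_comb[OF _ bilin_mass]) (simp add: bilin_def lin_fun_def)
 then have d: "bilin d" by (simp add: d_def[abs_def])
 have "solvable (%f h. B sig f h + d f h)"
 proof (rule method_of_continuity[OF bilin_B d _ _ K4 _ B_sig_solvable])
  show "0 <= sig" using sig_pos by simp
  show "\<bar>d f h\<bar> <= sig*nrm f*nrm h" if "f \<in> C1c Om" "h \<in> C1c Om" for f h
   using mult_left_mono[OF mass_le_nrm(2)[OF that], of sig] sig_pos by (simp add: d_def abs_mult mult_ac)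
  show "apriori K4 (%f h. B sig f h + t*d f h)" if "0 <= t" "t <= 1" for t
   unfolding B using that sig_pos by (intro B_apriori) (auto simp: mult_left_le)
 qed
 then have "solvable (B 0)" using B[of 1] by simp
 moreover have "apriori K4 (B 0)" using sig_pos by (intro B_apriori) auto
 ultimately show ?thesis using G
  by (intro inf_sup[OF K4 _ _ \<theta>, of "B 0"]) (auto simp: bounded_by_def B_def)
qed

end

section \<open>The linearised operator is elliptic\<close>

lemma matvec_bound:
 fixes M :: "real^'n^'m"
 assumes "!!i j. \<bar>M$i$j\<bar> <= B"
 shows "norm (M *v x) <= real CARD('m)*real CARD('n)*B*norm x"
 using onorm[OF matrix_vector_mul_bounded_linear[of M], of x] onorm_le_matrix_component[of M B] assms
  mult_right_mono[of "onorm ((*v) M)" "real CARD('m)*real CARD('n)*B" "norm x"]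
 by simp

lemma continuous_on_lin_C:
 assumes "C2b Om K \<Phi>"
 shows "continuous_on Om (lin_C \<Phi>)"
proof -
 have "continuous_on Om (%x. \<chi> i j. cof (hess \<Phi> x)$i$j)"
  by (intro continuous_on_vec_lambda continuous_on_cof_hess[OF assms])
 then show ?thesis by (simp add: lin_C_def[abs_def])
qed

lemma Ck_on_exp_nth:
 fixes i :: "'n::finite"
 shows "Ck_on k UNIV (%x :: real^'n. exp (\<mu>*x$i))"
  and "grad (%x :: real^'n. exp (\<mu>*x$i)) x = (\<mu>*exp (\<mu>*x$i)) *\<^sub>R axis i 1"
proof -
 have D: "((%x :: real^'n. exp (\<mu>*x$i)) has_derivative (%h. ((\<mu>*exp (\<mu>*x$i)) *\<^sub>R axis i 1) \<bullet> h)) (at x)" for x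
  by (auto intro!: derivative_eq_intros bounded_linear.has_derivative[OF bounded_linear_vec_nth] simp: inner_axis' mult_ac)
 show g: "grad (%x :: real^'n. exp (\<mu>*x$i)) x = (\<mu>*exp (\<mu>*x$i)) *\<^sub>R axis i 1" for x
  by (rule grad_eqI[OF D])
 show "Ck_on k UNIV (%x :: real^'n. exp (\<mu>*x$i))"
 proof (induction k)
  case 0
  show ?case by (auto intro!: continuous_intros)
 next
  case (Suc k)
  have "Ck_on k UNIV (%x :: real^'n. (\<mu>*axis i 1$j)*exp (\<mu>*x$i))" for j
   by (intro Ck_on_mult Suc Ck_on_const open_UNIV)
  then show ?case unfolding Ck_on_Suc_grad g using D by (auto simp: differentiable_def mult_ac)
 qed
qed

text \<open>For \<eta> = cof M \<xi> one has M \<eta> = det M \<xi>. Hence det M (\<eta> . \<xi>) =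
  \<eta> . M \<eta> is at least c0 |\<eta>|^2, while det M |\<xi>| is at most P |\<eta>|. This
  avoids diagonalising \<open>M\<close>.\<close>

lemma cof_coercive:
 fixes M :: "real^'n^'n"
 assumes sym: "!!i j. M$i$j = M$j$i" and c0: "0 < c0" "!!\<xi>. c0*(norm \<xi>)^2 <= \<xi> \<bullet> (M *v \<xi>)"
  and d: "0 < d" "d <= det M" and P: "!!\<xi>. norm (M *v \<xi>) <= P*norm \<xi>" "0 < P"
 shows "c0*d/P^2*(norm \<xi>)^2 <= (cof M *v \<xi>) \<bullet> \<xi>"
proof -
 define \<eta> where "\<eta> = cof M *v \<xi>"
 have "transpose (cof M) = cof M" using cof_symmetric[OF sym] by (simp add: transpose_def vec_eq_iff)
 then have "M *v \<eta> = (det M *\<^sub>R mat 1) *v \<xi>"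
  unfolding \<eta>_def matrix_vector_mul_assoc using matrix_mult_cof[of M] by simp
 then have M\<eta>: "M *v \<eta> = det M *\<^sub>R \<xi>" by (simp add: scaleR_matrix_vector_assoc[symmetric])
 have "(det M*norm \<xi>)^2 = (norm (M *v \<eta>))^2" unfolding M\<eta> using d by simp
 also have "\<dots> <= (P*norm \<eta>)^2" by (rule power_mono[OF P(1)]) simp
 finally have 1: "(det M)^2*(norm \<xi>)^2 <= P^2*(norm \<eta>)^2" by (simp add: power_mult_distrib)
 have 2: "c0*(norm \<eta>)^2 <= det M*(\<eta> \<bullet> \<xi>)" using c0(2)[of \<eta>] unfolding M\<eta> by simp
 have "det M*(c0*d*(norm \<xi>)^2) <= c0*((det M)^2*(norm \<xi>)^2)"
  using d c0(1) mult_right_mono[OF d(2), of "det M*c0*(norm \<xi>)^2"] by (simp add: power2_eq_square mult_ac)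
 also have "\<dots> <= P^2*(c0*(norm \<eta>)^2)" using mult_left_mono[OF 1, of c0] c0(1) by (simp add: mult_ac)
 also have "\<dots> <= P^2*(det M*(\<eta> \<bullet> \<xi>))" by (rule mult_left_mono[OF 2]) simp
 finally have "det M*(c0*d*(norm \<xi>)^2) <= det M*(P^2*(\<eta> \<bullet> \<xi>))" by (simp add: mult_ac)
 then have "c0*d*(norm \<xi>)^2 <= P^2*(\<eta> \<bullet> \<xi>)" using d by simp
 then show ?thesis using P(2) by (simp add: \<eta>_def field_simps)
qed

text \<open>The supersolution is exp(\<mu> R) - exp(\<mu> x_i) for an arbitrary coordinate i. Its
  principal part contributes \<mu>^2 C_ii exp(\<mu> x_i) and the drift at worst - \<mu> N exp(\<mu>
  x_i). The choice lam \<mu> = N + 1 leaves \<mu> exp(\<mu> x_i), at least \<mu> exp(- \<mu> R). The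
  subtracted constant makes \<phi> nonnegative, so that \<open>q\<close> only helps.\<close>

lemma elliptic_super_lin_C:
 fixes Om :: "(real^'n) set" and \<Phi> :: "real^'n => real"
 assumes Om: "open Om" "bounded Om" and \<Phi>: "C2b Om K0 \<Phi>"
  and c0: "0 < c0" "!!x \<xi>. x \<in> Om ==> c0*(norm \<xi>)^2 <= \<xi> \<bullet> (hess \<Phi> x *v \<xi>)"
  and d: "0 < d" "!!x. x \<in> Om ==> d <= det (hess \<Phi> x)"
  and b: "continuous_on Om b" "!!x. x \<in> Om ==> norm (b x) <= Nb"
  and q: "continuous_on Om q" "!!x. x \<in> Om ==> q x <= Nq" "!!x. x \<in> Om ==> 0 <= q x"
 shows "\<exists>N lam \<phi> g K c. elliptic_super Om (lin_C \<Phi>) b q N lam \<phi> g K c"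
proof -
 obtain P where P: "0 <= P" "\<forall>x\<in>Om. \<forall>i j. \<bar>lin_C \<Phi> x$i$j\<bar> <= P" using cof_hess_bounded[OF \<Phi>] unfolding lin_C_def by blast
 define Nc where "Nc = real CARD('n)*real CARD('n)*P"
 define N where "N = Nc + \<bar>Nb\<bar> + \<bar>Nq\<bar>"
 have Nc: "0 <= Nc" using P(1) by (simp add: Nc_def)
 define M where "M = real CARD('n)*real CARD('n)*K0 + 1"
 have K0: "0 <= K0" using \<Phi> by (simp add: C2b_def)
 have M: "0 < M" using K0 by (simp add: M_def add_nonneg_pos)
 define lam where "lam = c0*d/M^2"
 have lam: "0 < lam" using c0 d M by (simp add: lam_def)
 have coer: "lam*(norm \<xi>)^2 <= (lin_C \<Phi> x *v \<xi>) \<bullet> \<xi>" if x: "x \<in> Om" for x \<xi>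
  unfolding lam_def lin_C_def
 proof (rule cof_coercive[OF _ c0(1) c0(2)[OF x] d(1) d(2)[OF x] _ M])
  show "hess \<Phi> x$i$j = hess \<Phi> x$j$i" for i j
   using \<Phi> by (intro hess_symmetric[OF Om(1) x]) (simp add: C2b_def)
  show "norm (hess \<Phi> x *v \<xi>) <= M*norm \<xi>" for \<xi>
   using matvec_bound[OF C2b_bounds(5)[OF \<Phi> x], of \<xi>] norm_ge_zero[of \<xi>]
   unfolding M_def distrib_right by linarith
 qed
 have E: "elliptic Om (lin_C \<Phi>) b q N lam"
 proof
  fix x \<xi> assume x: "x \<in> Om"
  have "norm (lin_C \<Phi> x *v \<xi>) <= Nc*norm \<xi>" using matvec_bound[of "lin_C \<Phi> x" P \<xi>] P(2) x by (simp add: Nc_def)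
  also have "\<dots> <= N*norm \<xi>" by (rule mult_right_mono) (auto simp: N_def)
  finally show "norm (lin_C \<Phi> x *v \<xi>) <= N*norm \<xi>" .
  show "norm (b x) <= N" "q x <= N" using b(2)[OF x] q(2)[OF x] Nc by (auto simp: N_def)
 qed (use Om b q lam coer continuous_on_lin_C[OF \<Phi>] Nc in \<open>auto simp: N_def\<close>)
 interpret elliptic Om "lin_C \<Phi>" b q N lam by (rule E)
 obtain R where R: "0 < R" "!!x. x \<in> Om ==> norm x <= R" using Om(2) by (auto simp: bounded_pos)
 define i :: 'n where "i = undefined"
 define \<mu> where "\<mu> = (N + 1)/lam"
 have \<mu>: "0 < \<mu>" "lam*\<mu> = N + 1" using N_nonneg lam by (auto simp: \<mu>_def)
 define e where "e x = exp (\<mu>*x$i)" for x :: "real^'n"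
 define \<phi> where "\<phi> x = exp (\<mu>*R) - e x" for x
 define g where "g x = \<mu>^2*lin_C \<Phi> x$i$i*e x" for x
 have ee: "exp (- (\<mu>*R)) <= e x" "e x <= exp (\<mu>*R)" if "x \<in> Om" for x
 proof -
  have "\<bar>x$i\<bar> <= R" using component_le_norm_cart[of x i] R(2)[OF that] by linarith
  then have "\<mu>*(- R) <= \<mu>*x$i" "\<mu>*x$i <= \<mu>*R" using \<mu>(1) by (intro mult_left_mono; linarith)+
  then show "exp (- (\<mu>*R)) <= e x" "e x <= exp (\<mu>*R)" by (auto simp: e_def)
 qed
 have e0: "0 < e x" for x by (simp add: e_def)
 have eC: "Ck_on k UNIV e" for k unfolding e_def[abs_def] by (rule Ck_on_exp_nth(1))
 have ge: "grad e x = (\<mu>*e x) *\<^sub>R axis i 1" for x unfolding e_def[abs_def] by (rule Ck_on_exp_nth(2))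
 have de: "(e has_derivative (%h. grad e x \<bullet> h)) (at x)" for x
  using eC[of "Suc 0"] by (intro has_derivative_grad) (simp add: Ck_on_1)
 have \<phi>C: "Ck_on k UNIV \<phi>" for k unfolding \<phi>_def[abs_def] by (intro Ck_on_diff Ck_on_const eC) simp
 have g\<phi>: "grad \<phi> x = - ((\<mu>*e x) *\<^sub>R axis i 1)" for x
  unfolding \<phi>_def[abs_def] ge[symmetric] by (rule grad_eqI) (auto intro!: derivative_eq_intros de)
 have h\<phi>: "hess \<phi> x$k$j = - (if j = i \<and> k = i then \<mu>^2*e x else 0)" for x k j
 proof -
  have "grad (%x. grad \<phi> x$j) x = - (\<mu>*axis i 1$j) *\<^sub>R grad e x"
   unfolding g\<phi> by (rule grad_eqI) (auto intro!: derivative_eq_intros de)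
  from arg_cong[OF this, of "%v. v$k"] show ?thesis
   unfolding grad_grad ge by (auto simp: axis_def power2_eq_square)
 qed
 have tr: "lin_tr \<Phi> \<phi> x = - g x" for x
  unfolding lin_tr_def h\<phi> g_def
  by (simp add: if_distrib[of "%z. _*- z"] if_distrib[of "%z. _*z"] if_distrib[of uminus] if_conn sum.delta' cong: if_cong)
 define K where "K = (1 + \<mu> + \<mu>^2*(1 + P))*exp (\<mu>*R)"
 have KK: "exp (\<mu>*R) <= K" "\<mu>*exp (\<mu>*R) <= K" "\<mu>^2*exp (\<mu>*R) <= K" "\<mu>^2*P*exp (\<mu>*R) <= K" "0 <= K"
  unfolding K_def using \<mu>(1) P(1) by (auto intro!: mult_right_mono simp: distrib_left)
 have ng: "norm (grad \<phi> x) <= K" if "x \<in> Om" for x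
 proof -
  have "norm (grad \<phi> x) = \<mu>*e x" using \<mu>(1) e0[of x] unfolding g\<phi> by (simp add: abs_mult)
  then show ?thesis using KK(2) mult_left_mono[OF ee(2)[OF that] less_imp_le[OF \<mu>(1)]] by linarith
 qed
 have \<phi>K: "0 <= \<phi> x" "\<phi> x <= K" if "x \<in> Om" for x using ee(2)[OF that] e0[of x] KK(1) by (auto simp: \<phi>_def)
 have C2: "C2b Om K \<phi>"
  unfolding C2b_def
 proof (intro conjI ballI allI)
  show "Ck_on (Suc (Suc 0)) Om \<phi>" by (rule Ck_on_subset[OF \<phi>C]) simp
  fix x k j assume x: "x \<in> Om"
  show "\<bar>\<phi> x\<bar> <= K" using \<phi>K[OF x] by simp
  show "norm (grad \<phi> x) <= K" by (rule ng[OF x])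
  show "\<bar>hess \<phi> x$k$j\<bar> <= K"
  proof -
   have "\<bar>hess \<phi> x$k$j\<bar> <= \<mu>^2*e x" using e0[of x] unfolding h\<phi> by (simp add: abs_mult)
   also have "\<dots> <= K" using KK(3) mult_left_mono[OF ee(2)[OF x] zero_le_power2[of \<mu>]] by linarith
   finally show ?thesis .
  qed
 qed (rule KK(5))
 have gc: "continuous_on Om g"
  unfolding g_def e_def lin_C_def by (intro continuous_intros continuous_on_cof_hess[OF \<Phi>])
 have gK: "\<bar>g x\<bar> <= K" if x: "x \<in> Om" for x
 proof -
  have "\<mu>^2*\<bar>lin_C \<Phi> x$i$i\<bar>*e x <= \<mu>^2*P*exp (\<mu>*R)"
   using P x ee(2)[OF x] e0[of x] by (intro mult_mono) auto
  then show ?thesis using KK(4) e0[of x] by (simp add: g_def abs_mult)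
 qed
 have \<phi>1: "Ck_on (Suc 0) Om \<phi>" by (rule Ck_on_subset[OF \<phi>C]) simp
 have "elliptic_super Om (lin_C \<Phi>) b q N lam \<phi> g K (\<mu>*exp (- (\<mu>*R)))"
 proof
  fix \<xi> :: "real^'n => real" assume \<xi>: "\<xi> \<in> C1c Om"
  have J: "L2_on Om (jet \<phi>)" using \<phi>K ng by (intro C1_bounded_L2(3)[OF Om \<phi>1, of K]) auto
  have "L2_on Om (%x. lin_C \<Phi> x *v grad \<phi> x)"
   using L2_on_fst_snd(2)[OF L2_A(1)[OF J]] by (simp add: A_def jet_def)
  then have i1: "integrable (lebesgue_on Om) (%x. (lin_C \<Phi> x *v grad \<phi> x) \<bullet> grad \<xi> x)"
   by (rule L2_on_inner_integrable[OF _ C1c_L2(2)[OF Om \<xi>]])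
  have "L2_on Om g" using measurable_lebesgue_on_continuous[OF Om(1) gc] gK by (intro L2_on_bounded[OF Om]) auto
  then have i2: "integrable (lebesgue_on Om) (%x. g x*\<xi> x)" by (rule L2_on_mult_integrable[OF _ C1c_L2(1)[OF Om \<xi>]])
  show "(LINT x|lebesgue_on Om. (lin_C \<Phi> x *v grad \<phi> x) \<bullet> grad \<xi> x) = (LINT x|lebesgue_on Om. g x*\<xi> x)"
   using Green_C1c[OF Om \<Phi> C2 \<xi>] i1 i2 by (simp add: tr)
 next
  fix x assume x: "x \<in> Om"
  have ax: "(lin_C \<Phi> x *v axis i 1) \<bullet> axis i 1 = lin_C \<Phi> x$i$i"
   by (simp add: matrix_vector_mult_basis column_def inner_axis)
  have l: "lam <= lin_C \<Phi> x$i$i" using coer[OF x, of "axis i 1"] ax by simp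
  have "\<bar>b x$i\<bar> <= N" using component_le_norm_cart[of "b x" i] b_le[OF x] by linarith
  then have "1 <= \<mu>*lin_C \<Phi> x$i$i - b x$i" using mult_right_mono[OF l less_imp_le[OF \<mu>(1)]] \<mu>(2)
   unfolding mult.commute[of \<mu>] by linarith
  then have "\<mu>*e x*1 <= \<mu>*e x*(\<mu>*lin_C \<Phi> x$i$i - b x$i)" using \<mu>(1) e0[of x] by (intro mult_left_mono) auto
  moreover have "\<mu>*exp (- (\<mu>*R)) <= \<mu>*e x" using ee(1)[OF x] \<mu>(1) by (intro mult_left_mono) auto
  moreover have "0 <= q x*\<phi> x" using q_nonneg[OF x] \<phi>K(1)[OF x] by simp
  ultimately show "\<mu>*exp (- (\<mu>*R)) <= g x + b x \<bullet> grad \<phi> x + q x*\<phi> x"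
   unfolding g\<phi> g_def by (simp add: inner_axis power2_eq_square algebra_simps)
 qed (use \<phi>C \<phi>K ng gc gK KK(5) \<mu>(1) in auto)
 then show ?thesis by blast
qed

section \<open>Hoelder spaces as vector spaces\<close>

lemma pderivs_lin:
 assumes U: "open U" and f: "Ck_on k U f" and g: "Ck_on k U g"
 shows "length bs <= k ==> set bs \<subseteq> Basis ==> x \<in> U ==>
  pderivs bs (%x. c*f x + g x) x = c*pderivs bs f x + pderivs bs g x"
proof (induction bs arbitrary: x)
 case (Cons b bs)
 have IH: "!!y. y \<in> U ==> pderivs bs (%x. c*f x + g x) y = c*pderivs bs f y + pderivs bs g y"
  using Cons by simp
 have bs: "bs \<in> multi_indices (length bs)" "length bs < k" using Cons.prems by (auto simp: multi_indices_def)
 then have d: "pderivs bs f differentiable at x" "pderivs bs g differentiable at x"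
  using f g Cons.prems(3) unfolding Ck_on_def by blast+
 have "((%y. c*pderivs bs f y + pderivs bs g y) has_derivative
   (%h. c*frechet_derivative (pderivs bs f) (at x) h + frechet_derivative (pderivs bs g) (at x) h)) (at x)"
  by (intro has_derivative_add has_derivative_mult_right d[unfolded frechet_derivative_works])
 then have "frechet_derivative (%y. c*pderivs bs f y + pderivs bs g y) (at x) b =
   c*frechet_derivative (pderivs bs f) (at x) b + frechet_derivative (pderivs bs g) (at x) b"
  by (simp add: frechet_derivative_at[symmetric])
 then show ?case using frechet_derivative_cong_open[OF U Cons.prems(3) IH] by simp
qed simp

lemma holder_space_lin:
 assumes U: "open U" and f: "f \<in> holder_space k \<alpha> U" and g: "g \<in> holder_space k \<alpha> U"
 shows "(%x. c*f x + g x) \<in> holder_space k \<alpha> U"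
proof -
 let ?h = "%x. c*f x + g x"
 have fg: "Ck_on k U f" "Ck_on k U g" using f g holder_space_Ck[of _ k \<alpha> U k] by auto
 have p: "pderivs bs ?h x = c*pderivs bs f x + pderivs bs g x" if "bs \<in> multi_indices j" "j <= k" "x \<in> U" for bs j x
  using that by (intro pderivs_lin[OF U fg]) (auto simp: multi_indices_def)
 show ?thesis
  unfolding holder_space_def
 proof (intro CollectI conjI allI impI ballI)
  show "Ck_on k U ?h" using U fg by (intro Ck_on_add Ck_on_mult Ck_on_const)
  show "continuous_on (closure U) ?h" using f g by (auto simp: holder_space_def intro!: continuous_intros)
  fix j bs assume j: "j <= k" and bs: "bs \<in> (multi_indices j :: 'a list set)"
  obtain f' where f': "continuous_on (closure U) f'" "\<forall>x\<in>U. f' x = pderivs bs f x"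
   using f[unfolded holder_space_def] j bs by blast
  obtain g' where g': "continuous_on (closure U) g'" "\<forall>x\<in>U. g' x = pderivs bs g x"
   using g[unfolded holder_space_def] j bs by blast
  show "\<exists>h. continuous_on (closure U) h \<and> (\<forall>x\<in>U. h x = pderivs bs ?h x)"
   using f' g' p[OF bs j] by (intro exI[of _ "%x. c*f' x + g' x"]) (auto intro!: continuous_intros)
  obtain K where K: "\<forall>bs\<in>multi_indices j. \<forall>x\<in>U. \<bar>pderivs bs f x\<bar> <= K" using holder_space_bound[OF f j] by blast
  obtain K' where K': "\<forall>bs\<in>multi_indices j. \<forall>x\<in>U. \<bar>pderivs bs g x\<bar> <= K'" using holder_space_bound[OF g j] by blast
  show "\<exists>K. \<forall>x\<in>U. \<bar>pderivs bs ?h x\<bar> <= K"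
  proof (intro exI ballI)
   fix x assume x: "x \<in> U"
   have "\<bar>c*pderivs bs f x\<bar> <= \<bar>c\<bar>*K" unfolding abs_mult using K bs x by (intro mult_left_mono) auto
   then show "\<bar>pderivs bs ?h x\<bar> <= \<bar>c\<bar>*K + K'" using K' bs x unfolding p[OF bs j x] by fastforce
  qed
 next
  fix bs assume bs: "bs \<in> (multi_indices k :: 'a list set)"
  obtain K where K: "\<forall>x\<in>U. \<forall>y\<in>U. \<bar>pderivs bs f x - pderivs bs f y\<bar> <= K*norm (x - y) powr \<alpha>"
   using f bs by (auto simp: holder_space_def)
  obtain K' where K': "\<forall>x\<in>U. \<forall>y\<in>U. \<bar>pderivs bs g x - pderivs bs g y\<bar> <= K'*norm (x - y) powr \<alpha>"
   using g bs by (auto simp: holder_space_def)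
  show "\<exists>K. \<forall>x\<in>U. \<forall>y\<in>U. \<bar>pderivs bs ?h x - pderivs bs ?h y\<bar> <= K*norm (x - y) powr \<alpha>"
  proof (intro exI ballI)
   fix x y assume xy: "x \<in> U" "y \<in> U"
   have "\<bar>c*(pderivs bs f x - pderivs bs f y)\<bar> <= \<bar>c\<bar>*(K*norm (x - y) powr \<alpha>)"
    unfolding abs_mult using K xy by (intro mult_left_mono) auto
   moreover have "\<bar>pderivs bs g x - pderivs bs g y\<bar> <= K'*norm (x - y) powr \<alpha>" using K' xy by blast
   ultimately have "\<bar>c*(pderivs bs f x - pderivs bs f y) + (pderivs bs g x - pderivs bs g y)\<bar> \<le>
     \<bar>c\<bar>*(K*norm (x - y) powr \<alpha>) + K'*norm (x - y) powr \<alpha>" by linarith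
   then show "\<bar>pderivs bs ?h x - pderivs bs ?h y\<bar> <= (\<bar>c\<bar>*K + K')*norm (x - y) powr \<alpha>"
    unfolding p[OF bs order_refl xy(1)] p[OF bs order_refl xy(2)] by (simp add: algebra_simps)
  qed
 qed
qed

lemma pderivs_zero: "pderivs bs (%x. 0) = (%x. 0)"
 by (induction bs) auto

lemma holder_space_zero: "(%x. 0) \<in> holder_space k \<alpha> U"
 unfolding holder_space_def by (auto simp: pderivs_zero intro!: exI[of _ "0::real"] exI[of _ "%x. 0"])

lemma holder_space_cmult:
 assumes "open U" "f \<in> holder_space k \<alpha> U"
 shows "(%x. c*f x) \<in> holder_space k \<alpha> U"
 using holder_space_lin[OF assms holder_space_zero, of c] by simp

lemma holder_space_diff:
 assumes "open U" "f \<in> holder_space k \<alpha> U" "g \<in> holder_space k \<alpha> U"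
 shows "(%x. f x - g x) \<in> holder_space k \<alpha> U"
 using holder_space_lin[OF assms(1,3,2), of "- 1"] by simp

lemma holder_pderivs_diff:
 assumes "open U" "f \<in> holder_space k \<alpha> U" "g \<in> holder_space k \<alpha> U" "bs \<in> multi_indices j" "j <= k" "x \<in> U"
 shows "pderivs bs (%x. f x - g x) x = pderivs bs f x - pderivs bs g x"
 using pderivs_lin[OF assms(1) holder_space_Ck[OF assms(3) order_refl] holder_space_Ck[OF assms(2) order_refl], of bs x "- 1"] assms(4-6)
 by (simp add: multi_indices_def)

lemma holder_pderivs_cmult:
 assumes "open U" "f \<in> holder_space k \<alpha> U" "bs \<in> multi_indices j" "j <= k" "x \<in> U"
 shows "pderivs bs (%x. c*f x) x = c*pderivs bs f x"
 using pderivs_lin[OF assms(1) holder_space_Ck[OF assms(2) order_refl] Ck_on_const[of k U 0], of bs x c] assms(3-5)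
 by (simp add: multi_indices_def pderivs_zero)

lemma holder_norm_cmult_le:
 fixes f :: "'a::euclidean_space => real"
 assumes U: "open U" "U ~= {}" and f: "f \<in> holder_space k \<alpha> U"
 shows "holder_norm k \<alpha> U (%x. t*f x) <= \<bar>t\<bar>*holder_norm k \<alpha> U f"
proof -
 note p = holder_pderivs_cmult[OF U(1) f, of _ _ _ t]
 obtain x0 where x0: "x0 \<in> U" using U(2) by blast
 have ne: "\<exists>bs. bs \<in> (multi_indices j :: 'a list set)" for j using multi_indices_nonempty[of j] by blast
 have 1: "Sup {\<bar>pderivs bs (%x. t*f x) x\<bar> | bs x. bs \<in> multi_indices j \<and> x \<in> U} \<le>
   \<bar>t\<bar>*Sup {\<bar>pderivs bs f x\<bar> | bs x. bs \<in> multi_indices j \<and> x \<in> U}" if j: "j <= k" for j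
 proof (rule cSup_least)
  show "{\<bar>pderivs bs (%x. t*f x) x\<bar> | bs x. bs \<in> multi_indices j \<and> x \<in> U} ~= {}" using ne x0 by blast
  fix z assume "z \<in> {\<bar>pderivs bs (%x. t*f x) x\<bar> | bs x. bs \<in> multi_indices j \<and> x \<in> U}"
  then obtain bs x where z: "z = \<bar>pderivs bs (%x. t*f x) x\<bar>" "bs \<in> multi_indices j" "x \<in> U" by blast
  obtain K where "\<forall>bs\<in>multi_indices j. \<forall>x\<in>U. \<bar>pderivs bs f x\<bar> <= K" using holder_space_bound[OF f j] by blast
  then have "bdd_above {\<bar>pderivs bs f x\<bar> | bs x. bs \<in> multi_indices j \<and> x \<in> U}" by (intro bdd_aboveI[of _ K]) auto
  then have "\<bar>pderivs bs f x\<bar> <= Sup {\<bar>pderivs bs f x\<bar> | bs x. bs \<in> multi_indices j \<and> x \<in> U}"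
   using z by (intro cSup_upper) auto
  then show "z <= \<bar>t\<bar>*Sup {\<bar>pderivs bs f x\<bar> | bs x. bs \<in> multi_indices j \<and> x \<in> U}"
   unfolding z(1) p[OF z(2) j z(3)] abs_mult by (rule mult_left_mono) simp
 qed
 let ?Q = "%f. {\<bar>pderivs bs f x - pderivs bs f y\<bar>/norm (x - y) powr \<alpha> | bs x y. bs \<in> multi_indices k \<and> x \<in> U \<and> y \<in> U \<and> x ~= y}"
 have 2: "Sup (?Q (%x. t*f x)) <= \<bar>t\<bar>*Sup (?Q f)"
 proof (rule cSup_least)
  obtain e where e: "0 < e" "ball x0 e \<subseteq> U" using U(1) x0 openE by blast
  obtain b :: 'a where b: "b \<in> Basis" using nonempty_Basis by blast
  have "x0 + (e/2) *\<^sub>R b \<in> U" using e b by (intro subsetD[OF e(2)]) (simp add: dist_norm)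
  moreover have "x0 + (e/2) *\<^sub>R b ~= x0" using e b by auto
  ultimately have "\<exists>y\<in>U. x0 ~= y" by metis
  then show "?Q (%x. t*f x) ~= {}" using ne[of k] x0 by blast
  fix z assume "z \<in> ?Q (%x. t*f x)"
  then obtain bs x y where z: "z = \<bar>pderivs bs (%x. t*f x) x - pderivs bs (%x. t*f x) y\<bar>/norm (x - y) powr \<alpha>"
   "bs \<in> multi_indices k" "x \<in> U" "y \<in> U" "x ~= y" by blast
  obtain K where "\<forall>bs\<in>multi_indices k. \<forall>x\<in>U. \<forall>y\<in>U. x ~= y --> \<bar>pderivs bs f x - pderivs bs f y\<bar>/norm (x - y) powr \<alpha> <= K"
   using holder_space_quotient_bound[OF f] by blast
  then have "bdd_above (?Q f)" by (intro bdd_aboveI[of _ K]) auto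
  then have "\<bar>pderivs bs f x - pderivs bs f y\<bar>/norm (x - y) powr \<alpha> <= Sup (?Q f)"
   using z by (intro cSup_upper) auto
  then have "\<bar>t\<bar>*(\<bar>pderivs bs f x - pderivs bs f y\<bar>/norm (x - y) powr \<alpha>) <= \<bar>t\<bar>*Sup (?Q f)" by (rule mult_left_mono) simp
  then show "z <= \<bar>t\<bar>*Sup (?Q f)"
   unfolding z(1) p[OF z(2) order_refl z(3)] p[OF z(2) order_refl z(4)] right_diff_distrib[symmetric] abs_mult by simp
 qed
 show ?thesis
  unfolding holder_norm_def distrib_left sum_distrib_left by (intro add_mono sum_mono 1 2) simp
qed

lemma holder_norm_nonneg:
 assumes "open U" "U ~= {}" "f \<in> holder_space k \<alpha> U"
 shows "0 <= holder_norm k \<alpha> U f"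
 using holder_norm_ge_pderivs[OF assms, of 0 "[]"] assms(2) by force

lemma bdry_holder_norm_le:
 assumes U: "open U" "U ~= {}" and f: "f \<in> holder_space k \<alpha> U" "!!x. x \<in> frontier U ==> f x = \<eta> x"
 shows "bdry_holder_norm k \<alpha> U \<eta> <= holder_norm k \<alpha> U f" "0 <= bdry_holder_norm k \<alpha> U \<eta>"
proof -
 let ?S = "{holder_norm k \<alpha> U f | f. f \<in> holder_space k \<alpha> U \<and> (\<forall>x\<in>frontier U. f x = \<eta> x)}"
 have "bdd_below ?S" using holder_norm_nonneg[OF U] by (intro bdd_belowI[of _ 0]) auto
 then show "bdry_holder_norm k \<alpha> U \<eta> <= holder_norm k \<alpha> U f"
  unfolding bdry_holder_norm_def using f by (intro cInf_lower) auto
 show "0 <= bdry_holder_norm k \<alpha> U \<eta>"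
  unfolding bdry_holder_norm_def using f holder_norm_nonneg[OF U] by (intro cInf_greatest) auto
qed

text \<open>The estimate at t = 0 itself identifies the value \<open>f 0\<close>, so value and
  derivative of the perturbed quantity are obtained together.\<close>

lemma has_real_derivative_at_0I:
 fixes f :: "real => real"
 assumes "!!e. 0 < e ==> \<exists>r>0. \<forall>t. \<bar>t\<bar> < r --> \<bar>f t - c - t*d\<bar> <= e*\<bar>t\<bar>"
 shows "(f has_real_derivative d) (at 0)" "f 0 = c"
proof -
 obtain r where "0 < r" "\<forall>t. \<bar>t\<bar> < r --> \<bar>f t - c - t*d\<bar> <= 1*\<bar>t\<bar>" using assms[OF zero_less_one] by blast
 then have "\<bar>f 0 - c - 0*d\<bar> <= 1*\<bar>0\<bar>" by (metis abs_zero)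
 then show 0: "f 0 = c" by simp
 show "(f has_real_derivative d) (at 0)"
  unfolding has_field_derivative_def has_derivative_at_alt
 proof (intro conjI allI impI)
  show "bounded_linear ((*) d)" by (rule bounded_linear_mult_right)
  fix e :: real assume "0 < e"
  from assms[OF this] show "\<exists>r>0. \<forall>y. norm (y - 0) < r --> norm (f y - f 0 - d*(y - 0)) <= e*norm (y - 0)"
   unfolding 0 by (simp add: mult.commute)
 qed
qed

section \<open>Linearisation of the Dirichlet problem\<close>

lemma solution_map_solves:
 assumes "local_well_posedness Om m \<alpha> a \<phi> \<Phi> \<delta> V" "\<eta> \<in> bdry_ball (m + 2) \<alpha> Om \<phi> \<delta>"
 shows "solution_map Om a V \<eta> \<in> holder_space (m + 2) \<alpha> Om" "MA_solution Om a \<eta> (solution_map Om a V \<eta>)"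
proof -
 have V: "V \<subseteq> holder_space (m + 2) \<alpha> Om" and "\<exists>u. u \<in> V \<and> MA_solution Om a \<eta> u"
  using assms unfolding local_well_posedness_def by auto
 from someI_ex[OF this(2)] have "solution_map Om a V \<eta> \<in> V \<and> MA_solution Om a \<eta> (solution_map Om a V \<eta>)"
  unfolding solution_map_def .
 then show "solution_map Om a V \<eta> \<in> holder_space (m + 2) \<alpha> Om" "MA_solution Om a \<eta> (solution_map Om a V \<eta>)"
  using V by auto
qed

text \<open>The choice in \<open>solution_map\<close> sees \<eta> only through its values on the
  frontier, so the chosen functions coincide everywhere.\<close>

lemma solution_map_cong:
 assumes "!!x. x \<in> frontier Om ==> \<eta> x = \<eta>' x"
 shows "solution_map Om a V \<eta> = solution_map Om a V \<eta>'"
 using assms by (simp add: solution_map_def MA_solution_def)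

lemma bdry_holder_spaceI:
 "f \<in> holder_space k \<alpha> U ==> (!!x. x \<in> frontier U ==> f x = \<eta> x) ==> \<eta> \<in> bdry_holder_space k \<alpha> U"
 by (auto simp: bdry_holder_space_def)

text \<open>\<open>v\<close> is the first Frechet derivative at \<phi> in direction
  \<open>F\<close>. Convergence in the Hoelder norm is restated as bounds for all derivatives that
  are uniform on \<open>Om\<close>, the form in which the equation, the boundary values and the
  normal derivative can be differentiated.\<close>

lemma solution_map_derivative:
 fixes Om :: "(real^'n) set"
 assumes Om: "open Om" "Om ~= {}" and wp: "local_well_posedness Om m \<alpha> a \<phi> \<Phi> \<delta> V"
  and \<phi>: "\<phi> \<in> bdry_holder_space (m + 2) \<alpha> Om" and F: "F \<in> holder_space (m + 2) \<alpha> Om"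
 shows "\<exists>v\<in>holder_space (m + 2) \<alpha> Om. \<forall>e>0. \<exists>r>0. \<forall>t. \<bar>t\<bar> < r -->
  (%x. \<phi> x + t*F x) \<in> bdry_ball (m + 2) \<alpha> Om \<phi> \<delta> \<and>
  (\<forall>j\<le>m + 2. \<forall>bs\<in>multi_indices j. \<forall>x\<in>Om.
   \<bar>pderivs bs (solution_map Om a V (%x. \<phi> x + t*F x)) x - pderivs bs \<Phi> x - t*pderivs bs v x\<bar> <= e*\<bar>t\<bar>)"
proof -
 define X where "X = bdry_holder_space (m + 2) \<alpha> Om"
 define NX where "NX = bdry_holder_norm (m + 2) \<alpha> Om"
 define Y where "Y = holder_space (m + 2) \<alpha> Om"
 define NY where "NY = holder_norm (m + 2) \<alpha> Om"
 obtain \<rho> where \<rho>: "0 < \<rho>" "\<rho> <= \<delta>"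
  and fr: "frechet_Ck_on X NX Y NY (m + 1) (bdry_ball (m + 2) \<alpha> Om \<phi> \<rho>) (solution_map Om a V)"
  using wp unfolding local_well_posedness_def X_def NX_def Y_def NY_def by (elim conjE exE)
 let ?B = "bdry_ball (m + 2) \<alpha> Om \<phi> \<rho>"
 obtain D where D0: "\<forall>\<eta>\<in>?B. D 0 \<eta> [] = solution_map Om a V \<eta>"
  and Dm: "\<forall>j\<le>m + 1. \<forall>\<eta>\<in>?B. bounded_multilinear X NX Y NY j (D j \<eta>)"
  and Dd: "\<forall>j<m + 1. \<forall>\<eta>\<in>?B. \<forall>\<epsilon>>0. \<exists>r>0. \<forall>h\<in>X. NX h < r \<and> (%x. \<eta> x + h x) \<in> ?B -->
      (\<forall>hs. set hs \<subseteq> X \<and> length hs = j -->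
       NY (%y. D j (%x. \<eta> x + h x) hs y - D j \<eta> hs y - D (Suc j) \<eta> (h # hs) y)
        <= \<epsilon>*NX h*(\<Prod>h'\<leftarrow>hs. NX h'))"
  using fr unfolding frechet_Ck_on_def by (elim conjE exE)
 define H where "H = NY F"
 have H: "0 <= H" unfolding H_def NY_def by (rule holder_norm_nonneg[OF Om F])
 have tF: "(%x. t*F x) \<in> Y" "(%x. t*F x) \<in> X" "NX (%x. t*F x) <= \<bar>t\<bar>*H" "0 <= NX (%x. t*F x)" for t
 proof -
  show Y: "(%x. t*F x) \<in> Y" unfolding Y_def by (rule holder_space_cmult[OF Om(1) F])
  show "(%x. t*F x) \<in> X" unfolding X_def by (rule bdry_holder_spaceI[OF Y[unfolded Y_def] refl])
  have "NX (%x. t*F x) <= NY (%x. t*F x)" "0 <= NX (%x. t*F x)"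
   unfolding NX_def NY_def by (rule bdry_holder_norm_le[OF Om Y[unfolded Y_def]], simp)+
  moreover have "NY (%x. t*F x) <= \<bar>t\<bar>*H" unfolding NY_def H_def by (rule holder_norm_cmult_le[OF Om F])
  ultimately show "NX (%x. t*F x) <= \<bar>t\<bar>*H" "0 <= NX (%x. t*F x)" by auto
 qed
 obtain f where f: "f \<in> Y" "\<forall>x\<in>frontier Om. f x = \<phi> x" using \<phi> by (auto simp: bdry_holder_space_def Y_def)
 have inball: "(%x. \<phi> x + t*F x) \<in> bdry_ball (m + 2) \<alpha> Om \<phi> \<rho>" if t: "\<bar>t\<bar>*H < \<rho>" for t
 proof -
  have "(%x. \<phi> x + t*F x) \<in> bdry_holder_space (m + 2) \<alpha> Om"
   by (rule bdry_holder_spaceI[OF holder_space_lin[OF Om(1) F f(1)[unfolded Y_def], of t]]) (use f(2) in simp)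
  moreover have "bdry_holder_norm (m + 2) \<alpha> Om (%x. \<phi> x + t*F x - \<phi> x) < \<rho>"
   using tF(3)[of t] t by (simp add: NX_def)
  ultimately show ?thesis by (simp add: bdry_ball_def)
 qed
 have ph: "\<phi> \<in> bdry_ball (m + 2) \<alpha> Om \<phi> \<rho>" using inball[of 0] \<rho>(1) by simp
 define T where "T = D 1 \<phi>"
 have T1: "bounded_multilinear X NX Y NY 1 T" using Dm ph by (simp add: T_def)
 then have T1Y: "!!h. h \<in> X ==> T [h] \<in> Y"
  and T1lin: "!!h h' c. h \<in> X ==> h' \<in> X ==> NY (%y. T [%x. c*h x + h' x] y - (c*T [h] y + T [h'] y)) = 0"
  and T1b: "\<exists>K. \<forall>h\<in>X. NY (T [h]) <= K*NX h"
 proof -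
  assume b: "bounded_multilinear X NX Y NY 1 T"
  show "!!h. h \<in> X ==> T [h] \<in> Y" using b by (simp add: bounded_multilinear_def)
  fix h h' c assume "h \<in> X" "h' \<in> X"
  moreover have "\<forall>hs. set hs \<subseteq> X \<and> length hs = 1 -->
    (\<forall>i<1. \<forall>h\<in>X. \<forall>h'\<in>X. \<forall>c. NY (%y. T (hs[i := (%x. c*h x + h' x)]) y - (c*T (hs[i := h]) y + T (hs[i := h']) y)) = 0)"
   using b by (simp add: bounded_multilinear_def)
  from this[rule_format, of "[h]" 0 h h' c] calculation
  show "NY (%y. T [%x. c*h x + h' x] y - (c*T [h] y + T [h'] y)) = 0" by simp
 next
  assume b: "bounded_multilinear X NX Y NY 1 T"
  then obtain K where "\<forall>hs. set hs \<subseteq> X \<and> length hs = 1 --> NY (T hs) <= K*(\<Prod>h\<leftarrow>hs. NX h)"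
   unfolding bounded_multilinear_def by (elim conjE exE)
  from this[rule_format, of "[_]"] have "\<forall>h\<in>X. NY (T [h]) <= K*NX h" by simp
  then show "\<exists>K. \<forall>h\<in>X. NY (T [h]) <= K*NX h" by blast
 qed
 define v where "v = T [F]"
 have FX: "F \<in> X" using tF(2)[of 1] by simp
 have zX: "(%x. 0) \<in> X" "NX (%x. 0) = 0" using tF(2,3,4)[of 0] by auto
 have v: "v \<in> Y" unfolding v_def by (rule T1Y[OF FX])
 have ge: "\<bar>pderivs bs g x\<bar> <= NY g" if "g \<in> Y" "j <= m + 2" "bs \<in> multi_indices j" "x \<in> Om" for bs g x j
  using that unfolding Y_def NY_def by (intro holder_norm_ge_pderivs[OF Om])
 \<comment> \<open>Linearity of the derivative is known only up to norm 0. Write t F as t F + 0; the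
   image of 0 has norm 0 by boundedness, and functions of norm 0 have vanishing derivatives on
   \<open>Om\<close>.\<close>
 have Tt: "pderivs bs (T [%x. t*F x]) x = t*pderivs bs v x" if j: "j <= m + 2" "bs \<in> multi_indices j" "x \<in> Om" for bs x j t
 proof -
  have TZ: "T [%x. 0] \<in> Y" by (rule T1Y[OF zX(1)])
  have Tt: "T [%x. t*F x] \<in> Y" by (rule T1Y[OF tF(2)])
  have w: "(%y. t * v y + T [%x. 0] y) \<in> Y" unfolding Y_def by (rule holder_space_lin[OF Om(1) v[unfolded Y_def] TZ[unfolded Y_def]])
  obtain K where "\<forall>h\<in>X. NY (T [h]) <= K*NX h" using T1b by blast
  from bspec[OF this zX(1)] have "NY (T [%x. 0]) <= 0" by (simp add: zX(2))
  then have 1: "pderivs bs (T [%x. 0]) x = 0" using ge[OF TZ j] by simp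
  have "NY (%y. T [%x. t*F x + 0] y - (t*T [F] y + T [%x. 0] y)) = 0" by (rule T1lin[OF FX zX(1)])
  then have "NY (%y. T [%x. t*F x] y - (t * v y + T [%x. 0] y)) = 0" by (simp add: v_def)
  moreover have "(%y. T [%x. t*F x] y - (t * v y + T [%x. 0] y)) \<in> Y"
   unfolding Y_def by (rule holder_space_diff[OF Om(1) Tt[unfolded Y_def] w[unfolded Y_def]])
  ultimately have "pderivs bs (%y. T [%x. t*F x] y - (t * v y + T [%x. 0] y)) x = 0" using ge[OF _ j] by fastforce
  then have "pderivs bs (T [%x. t*F x]) x = pderivs bs (%y. t * v y + T [%x. 0] y) x"
   using holder_pderivs_diff[OF Om(1) Tt[unfolded Y_def] w[unfolded Y_def] j(2,1,3)] by simp
  also have "\<dots> = t*pderivs bs v x + pderivs bs (T [%x. 0]) x"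
   using v TZ j unfolding Y_def by (intro pderivs_lin[OF Om(1), of "m + 2"]) (auto simp: multi_indices_def intro: holder_space_Ck)
  finally show ?thesis using 1 by simp
 qed
 have \<Phi>eq: "pderivs bs (solution_map Om a V \<phi>) x = pderivs bs \<Phi> x" if "x \<in> Om" for bs x
  using wp closure_subset[of Om] that unfolding local_well_posedness_def by (intro pderivs_cong[OF Om(1)]) auto
 show ?thesis
 proof (intro bexI[of _ v] allI impI)
  show "v \<in> holder_space (m + 2) \<alpha> Om" using v by (simp add: Y_def)
  fix e :: real assume e: "0 < e"
  then have "0 < e/(H + 1)" using H by simp
  from Dd[THEN spec, THEN mp, OF zero_less_Suc[of m, unfolded Suc_eq_plus1], THEN bspec, OF ph, THEN spec, THEN mp, OF this]
  obtain r where r: "0 < r" "\<forall>h\<in>X. NX h < r \<and> (%x. \<phi> x + h x) \<in> ?B --> (\<forall>hs. set hs \<subseteq> X \<and> length hs = 0 -->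
    NY (%y. D 0 (%x. \<phi> x + h x) hs y - D 0 \<phi> hs y - D (Suc 0) \<phi> (h # hs) y) <= e/(H + 1)*NX h*(\<Prod>h'\<leftarrow>hs. NX h'))"
   by (elim exE conjE)
  show "\<exists>r>0. \<forall>t. \<bar>t\<bar> < r --> (%x. \<phi> x + t*F x) \<in> bdry_ball (m + 2) \<alpha> Om \<phi> \<delta> \<and>
   (\<forall>j\<le>m + 2. \<forall>bs\<in>multi_indices j. \<forall>x\<in>Om.
    \<bar>pderivs bs (solution_map Om a V (%x. \<phi> x + t*F x)) x - pderivs bs \<Phi> x - t*pderivs bs v x\<bar> <= e*\<bar>t\<bar>)"
  proof (intro exI[of _ "min r \<rho>/(H + 1)"] conjI allI impI ballI)
   show "0 < min r \<rho>/(H + 1)" using r(1) \<rho>(1) H by simp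
   fix t assume "\<bar>t\<bar> < min r \<rho>/(H + 1)"
   then have "\<bar>t\<bar>*(H + 1) < min r \<rho>" using H by (simp add: pos_less_divide_eq)
   then have t: "\<bar>t\<bar>*H < r" "\<bar>t\<bar>*H < \<rho>" by (auto simp: distrib_left)
   note tb = inball[OF t(2)]
   then show "(%x. \<phi> x + t*F x) \<in> bdry_ball (m + 2) \<alpha> Om \<phi> \<delta>" using \<rho>(2) by (auto simp: bdry_ball_def)
   fix j and bs :: "(real^'n) list" and x assume j: "j <= m + 2" "bs \<in> multi_indices j" "x \<in> Om"
   define u where "u = solution_map Om a V (%x. \<phi> x + t*F x)"
   define u0 where "u0 = solution_map Om a V \<phi>"
   have u: "D 0 (%x. \<phi> x + t*F x) [] = u" "D 0 \<phi> [] = u0"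
    using D0 tb ph by (auto simp: u_def u0_def)
   have "bounded_multilinear X NX Y NY 0 (D 0 \<phi>)" "bounded_multilinear X NX Y NY 0 (D 0 (%x. \<phi> x + t*F x))"
    using Dm tb ph by auto
   then have uY: "u \<in> Y" "u0 \<in> Y" unfolding u[symmetric] bounded_multilinear_def by auto
   have Tt': "T [%x. t*F x] \<in> Y" by (rule T1Y[OF tF(2)])
   have d1: "(%y. u y - u0 y) \<in> Y" unfolding Y_def by (rule holder_space_diff[OF Om(1) uY[unfolded Y_def]])
   have d2: "(%y. u y - u0 y - T [%x. t*F x] y) \<in> Y"
    unfolding Y_def by (rule holder_space_diff[OF Om(1) d1[unfolded Y_def] Tt'[unfolded Y_def]])
   have "NX (%x. t*F x) < r" using tF(3)[of t] t(1) by linarith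
   then have "NY (%y. u y - u0 y - T [%x. t*F x] y) <= e/(H + 1)*NX (%x. t*F x)"
    using r(2)[THEN bspec, OF tF(2), THEN mp, OF conjI[OF _ tb], THEN spec, of "[]"] unfolding T_def u[symmetric] by simp
   also have "\<dots> <= e/(H + 1)*(\<bar>t\<bar>*H)" using tF(3)[of t] e H by (intro mult_left_mono) auto
   also have "\<dots> = (e*\<bar>t\<bar>)*(H/(H + 1))" by simp
   also have "\<dots> <= (e*\<bar>t\<bar>)*1" using e H by (intro mult_left_mono) auto
   finally have "\<bar>pderivs bs (%y. u y - u0 y - T [%x. t*F x] y) x\<bar> <= e*\<bar>t\<bar>" using ge[OF d2 j] by linarith
   then show "\<bar>pderivs bs (solution_map Om a V (%x. \<phi> x + t*F x)) x - pderivs bs \<Phi> x - t*pderivs bs v x\<bar> <= e*\<bar>t\<bar>"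
    using holder_pderivs_diff[OF Om(1) d1[unfolded Y_def] Tt'[unfolded Y_def] j(2,1,3)]
     holder_pderivs_diff[OF Om(1) uY[unfolded Y_def] j(2,1,3)] Tt[OF j] \<Phi>eq[OF j(3), of bs]
    by (simp add: u_def u0_def)
  qed
 qed
qed

lemma partials_of_derivative:
 assumes "(a has_derivative a') (at (x, z, p))"
 shows "a' (0, s, h) = dz a x z p * s + dp a x z p \<bullet> h"
proof -
 interpret bounded_linear a' using assms by (rule has_derivative_bounded_linear)
 have "((%s. (x, s, p)) has_derivative (%h. (0, h, 0))) (at z)" by (auto intro!: derivative_eq_intros)
 from has_derivative_compose[OF this assms]
 have "((%s. a (x, s, p)) has_derivative (%h. a' (0, h, 0))) (at z)" .
 moreover have "(%h. a' (0, h, 0)) = (*) (a' (0, 1, 0))"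
 proof
  fix h show "a' (0, h, 0) = a' (0, 1, 0)*h" using scaleR[of h "(0, 1, 0)"] by simp
 qed
 ultimately have "((%s. a (x, s, p)) has_real_derivative a' (0, 1, 0)) (at z)" by (simp add: has_field_derivative_def)
 then have 1: "dz a x z p = a' (0, 1, 0)" unfolding dz_def by (rule DERIV_imp_deriv)
 have "((%p'. (x, z, p')) has_derivative (%h. (0, 0, h))) (at p)" by (auto intro!: derivative_eq_intros)
 from has_derivative_compose[OF this assms]
 have 2: "((%p'. a (x, z, p')) has_derivative (%h. a' (0, 0, h))) (at p)" .
 then have "((%p'. a (x, z, p')) has_derivative (%h. dp a x z p \<bullet> h)) (at p)"
  unfolding dp_def by (intro has_derivative_grad) (auto simp: differentiable_def)
 from fun_cong[OF has_derivative_unique[OF 2 this], of h] have 3: "a' (0, 0, h) = dp a x z p \<bullet> h" .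
 have "a' (0, s, h) = a' (s *\<^sub>R (0, 1, 0) + (0, 0, h))" by simp
 also have "\<dots> = s*a' (0, 1, 0) + a' (0, 0, h)" unfolding add scaleR by simp
 finally show ?thesis using 1 3 by simp
qed

lemma cl_ext_grad_le:
 assumes Om: "open Om" and h: "u \<in> holder_space (Suc k) \<alpha> Om" "v \<in> holder_space (Suc k) \<alpha> Om" "w \<in> holder_space (Suc k) \<alpha> Om"
  and x0: "x0 \<in> frontier Om" and le: "!!x i. x \<in> Om ==> \<bar>grad u x$i - grad v x$i - t*grad w x$i\<bar> <= e"
 shows "\<bar>normal_deriv Om u x0 - normal_deriv Om v x0 - t*normal_deriv Om w x0\<bar> <= e*(\<Sum>i\<in>UNIV. \<bar>unit_normal Om x0$i\<bar>)"
proof -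
 let ?E = "%u. cl_ext Om (grad u) x0"
 let ?\<nu> = "unit_normal Om x0"
 note T = cl_ext_grad_tendsto[OF Om _ x0]
 have "\<bar>?E u$i - ?E v$i - t*?E w$i\<bar> <= e" for i
 proof (rule tendsto_upperbound[OF _ _ frontier_at_within_nontrivial(1)[OF Om x0]])
  show "((%x. \<bar>grad u x$i - grad v x$i - t*grad w x$i\<bar>) \<longlongrightarrow> \<bar>?E u$i - ?E v$i - t*?E w$i\<bar>) (at x0 within Om)"
   by (intro tendsto_intros T[OF h(1)] T[OF h(2)] T[OF h(3)])
  show "\<forall>\<^sub>F x in at x0 within Om. \<bar>grad u x$i - grad v x$i - t*grad w x$i\<bar> <= e"
   using le by (auto simp: eventually_at_filter)
 qed
 then have le': "\<bar>?E u$i - ?E v$i - t*?E w$i\<bar>*\<bar>?\<nu>$i\<bar> <= e*\<bar>?\<nu>$i\<bar>" for i by (rule mult_right_mono) simp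
 have "normal_deriv Om u x0 - normal_deriv Om v x0 - t*normal_deriv Om w x0 = (?E u - ?E v - t *\<^sub>R ?E w) \<bullet> ?\<nu>"
  by (simp add: normal_deriv_def inner_diff_left)
 also have "\<dots> = (\<Sum>i\<in>UNIV. (?E u$i - ?E v$i - t*?E w$i)*?\<nu>$i)" by (simp add: inner_vec_def)
 finally have eq: "normal_deriv Om u x0 - normal_deriv Om v x0 - t*normal_deriv Om w x0 =
  (\<Sum>i\<in>UNIV. (?E u$i - ?E v$i - t*?E w$i)*?\<nu>$i)" .
 show ?thesis
  unfolding eq sum_distrib_left by (rule order_trans[OF sum_abs sum_mono]) (use le' in \<open>simp add: abs_mult\<close>)
qed

lemma axis_multi_indices:
 "[axis i (1::real)] \<in> multi_indices (Suc 0)" "[axis i (1::real), axis j 1] \<in> multi_indices (Suc (Suc 0))"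
 for i j :: "'n::finite"
 by (auto simp: multi_indices_def Basis_vec_axis)

text \<open>Differentiate det D^2 u = a (x, u, grad u) at t = 0 at each interior point, by Jacobi's
  formula on the left and the chain rule on the right. Boundary values and normal derivatives follow
  from the same estimates, whose uniformity lets them pass to the boundary.\<close>

lemma linearised_solution:
 fixes Om :: "(real^'n) set"
 assumes Om: "open Om" "Om ~= {}" and wp: "local_well_posedness Om m \<alpha> a \<phi> \<Phi> \<delta> V"
  and \<phi>: "\<phi> \<in> bdry_holder_space (m + 2) \<alpha> Om" and F: "F \<in> holder_space (m + 2) \<alpha> Om"
  and \<Phi>: "\<Phi> \<in> holder_space (m + 2) \<alpha> Om" "MA_solution Om a \<phi> \<Phi>"
  and a: "\<forall>x\<in>Om. \<forall>z p. a differentiable at (x, z, p)"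
 shows "\<exists>v\<in>holder_space (m + 2) \<alpha> Om. (\<forall>x\<in>frontier Om. v x = F x) \<and>
  (\<forall>x\<in>Om. lin_tr \<Phi> v x = lin_b a \<Phi> x \<bullet> grad v x + lin_q a \<Phi> x * v x) \<and>
  (\<forall>x\<in>frontier Om. ((%t. normal_deriv Om (solution_map Om a V (%x. \<phi> x + t*F x)) x) has_real_derivative
   normal_deriv Om v x) (at 0)) \<and>
  (\<exists>r>0. \<forall>t. \<bar>t\<bar> < r --> (%x. \<phi> x + t*F x) \<in> bdry_ball (m + 2) \<alpha> Om \<phi> \<delta>)"
proof -
 define u where "u t = solution_map Om a V (%x. \<phi> x + t*F x)" for t
 obtain v where v: "v \<in> holder_space (m + 2) \<alpha> Om"
  and E: "\<forall>e>0. \<exists>r>0. \<forall>t. \<bar>t\<bar> < r --> (%x. \<phi> x + t*F x) \<in> bdry_ball (m + 2) \<alpha> Om \<phi> \<delta> \<and>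
  (\<forall>j\<le>m + 2. \<forall>bs\<in>multi_indices j. \<forall>x\<in>Om. \<bar>pderivs bs (u t) x - pderivs bs \<Phi> x - t*pderivs bs v x\<bar> <= e*\<bar>t\<bar>)"
  using solution_map_derivative[OF Om wp \<phi> F] unfolding u_def by (elim bexE)
 let ?E = "%e t. (\<forall>j\<le>m + 2. \<forall>bs\<in>multi_indices j. \<forall>x\<in>Om. \<bar>pderivs bs (u t) x - pderivs bs \<Phi> x - t*pderivs bs v x\<bar> <= e*\<bar>t\<bar>)"
 define P where "P t \<longleftrightarrow> (%x. \<phi> x + t*F x) \<in> bdry_ball (m + 2) \<alpha> Om \<phi> \<delta> \<and> u t \<in> holder_space (m + 2) \<alpha> Om \<and>
  MA_solution Om a (%x. \<phi> x + t*F x) (u t)" for t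
 have E1: "\<exists>r>0. \<forall>t. \<bar>t\<bar> < r --> P t \<and>
  ?E e t"
  if "0 < e" for e
 proof -
  from E[THEN spec, THEN mp, OF that] obtain r where r: "0 < r" "\<forall>t. \<bar>t\<bar> < r --> (%x. \<phi> x + t*F x) \<in> bdry_ball (m + 2) \<alpha> Om \<phi> \<delta> \<and> ?E e t"
   by (elim exE conjE)
  show ?thesis
  proof (rule exI[of _ r], rule conjI[OF r(1)], intro allI impI)
   fix t assume t: "\<bar>t\<bar> < r"
   note b = r(2)[THEN spec, THEN mp, OF t]
   show "P t \<and> ?E e t"
    unfolding P_def using b solution_map_solves[OF wp b[THEN conjunct1], folded u_def] by simp
  qed
 qed
 have PD: "(%x. \<phi> x + t*F x) \<in> bdry_ball (m + 2) \<alpha> Om \<phi> \<delta>" "u t \<in> holder_space (m + 2) \<alpha> Om" "MA_solution Om a (%x. \<phi> x + t*F x) (u t)" if "P t" for t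
  using that by (auto simp: P_def)
 obtain r1 where r1: "0 < r1" "\<forall>t. \<bar>t\<bar> < r1 --> P t"
  using E1[OF zero_less_one] by (elim exE conjE) (erule that, simp)
 have D: "((%t. pderivs bs (u t) x) has_real_derivative pderivs bs v x) (at 0)" "pderivs bs (u 0) x = pderivs bs \<Phi> x"
  if "bs \<in> multi_indices j" "j <= m + 2" "x \<in> Om" for bs j x
 proof -
  have *: "\<exists>r>0. \<forall>t. \<bar>t\<bar> < r --> \<bar>pderivs bs (u t) x - pderivs bs \<Phi> x - t*pderivs bs v x\<bar> <= e*\<bar>t\<bar>" if e: "0 < e" for e
   using E1[OF e] \<open>bs \<in> _\<close> \<open>j <= _\<close> \<open>x \<in> Om\<close> by (elim exE conjE) (rule exI, rule conjI, assumption, simp)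
  from has_real_derivative_at_0I[OF *]
  show "((%t. pderivs bs (u t) x) has_real_derivative pderivs bs v x) (at 0)" "pderivs bs (u 0) x = pderivs bs \<Phi> x" by auto
 qed
 have fr: "v x = F x" if x: "x \<in> frontier Om" for x
 proof -
  \<comment> \<open>On the frontier the perturbed solution is \<phi> + t F and \<Phi> is \<phi>. The
    interior estimate, extended to the closure by continuity, becomes |t (F - v)| at most e
    |t|.\<close>
  have bnd: "\<bar>F x - v x\<bar> <= e" if e: "0 < e" for e
  proof -
   obtain r where r: "0 < r" "\<forall>t. \<bar>t\<bar> < r --> P t \<and>
    ?E e t"
    using E1[OF e] by (elim exE conjE)
   define t where "t = r/2"
   have t: "0 < t" "\<bar>t\<bar> < r" using r(1) by (auto simp: t_def)
   note R = r(2)[THEN spec, THEN mp, OF t(2)] and PR = PD[OF R[THEN conjunct1]]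
   have c: "continuous_on (closure Om) (u t)" "continuous_on (closure Om) \<Phi>" "continuous_on (closure Om) v"
    using PR(2) \<Phi>(1) v by (simp_all add: holder_space_def)
   have le: "\<forall>y\<in>Om. \<bar>u t y - \<Phi> y - t * v y\<bar> <= e*\<bar>t\<bar>"
    using R[THEN conjunct2, THEN spec, of 0] by simp
   have "\<bar>u t x - \<Phi> x - t * v x\<bar> <= e*\<bar>t\<bar>"
   proof (rule continuous_le_on_closure[of Om "%y. \<bar>u t y - \<Phi> y - t * v y\<bar>"])
    show "continuous_on (closure Om) (%y. \<bar>u t y - \<Phi> y - t * v y\<bar>)" by (intro continuous_intros c)
   qed (use x le in \<open>auto simp: frontier_def\<close>)
   moreover have "u t x = \<phi> x + t*F x" "\<Phi> x = \<phi> x" using PR(3) \<Phi>(2) x by (simp_all add: MA_solution_def)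
   ultimately have "\<bar>t*(F x - v x)\<bar> <= e*\<bar>t\<bar>" by (simp add: right_diff_distrib)
   then show ?thesis using t by (simp add: abs_mult)
  qed
  have "\<bar>F x - v x\<bar> <= 0" by (rule field_le_epsilon, drule bnd, simp)
  then show ?thesis by simp
 qed
 have pde: "lin_tr \<Phi> v x = lin_b a \<Phi> x \<bullet> grad v x + lin_q a \<Phi> x * v x" if x: "x \<in> Om" for x
 proof -
  have h0: "hess (u 0) x = hess \<Phi> x" unfolding vec_eq_iff hess_nth using D(2)[OF axis_multi_indices(2) _ x] by simp
  have g0: "grad (u 0) x = grad \<Phi> x" unfolding vec_eq_iff grad_nth using D(2)[OF axis_multi_indices(1) _ x] by simp
  have u0: "u 0 x = \<Phi> x" using D(2)[of "[]" 0 x] x by simp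
  have "((%t. det (hess (u t) x)) has_real_derivative (\<Sum>i\<in>UNIV. \<Sum>j\<in>UNIV. hess v x$i$j*cof (hess (u 0) x)$i$j)) (at 0)"
   by (rule has_derivative_det) (unfold hess_nth, rule D(1)[OF axis_multi_indices(2) _ x], simp)
  then have 1: "((%t. det (hess (u t) x)) has_real_derivative lin_tr \<Phi> v x) (at 0)"
   by (simp add: h0 lin_tr_def lin_C_def mult.commute)
  obtain a' where a': "(a has_derivative a') (at (x, \<Phi> x, grad \<Phi> x))" using a x unfolding differentiable_def by blast
  have mc: "(*) d = (%h. h*d)" for d :: real by (rule ext) (rule mult.commute)
  have gi: "((%t. grad (u t) x$i) has_derivative (%h. h*grad v x$i)) (at 0)" for i
   using D(1)[OF axis_multi_indices(1) _ x, of i] unfolding has_field_derivative_def mc[of "grad v x$i", symmetric] by (simp add: grad_nth)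
  have "((%t. grad (u t) x) has_derivative (%h. h *\<^sub>R grad v x)) (at 0)"
  proof (rule has_derivative_componentwise_within[THEN iffD2], rule ballI)
   fix b :: "real^'n" assume "b \<in> Basis"
   then obtain i where "b = axis i 1" by (auto simp: Basis_vec_axis)
   then show "((%t. grad (u t) x \<bullet> b) has_derivative (%h. (h *\<^sub>R grad v x) \<bullet> b)) (at 0)" using gi[of i] by (simp add: inner_axis)
  qed
  moreover have "((%t. u t x) has_derivative (%h. h * v x)) (at 0)"
   using D(1)[of "[]" 0 x] x unfolding has_field_derivative_def mc[of "v x", symmetric] by simp
  ultimately have "((%t. (x, u t x, grad (u t) x)) has_derivative (%h. (0, h * v x, h *\<^sub>R grad v x))) (at 0)"
   by (intro has_derivative_Pair has_derivative_const)
  from has_derivative_compose[OF this] a'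
  have "((%t. a (x, u t x, grad (u t) x)) has_derivative (%h. a' (0, h * v x, h *\<^sub>R grad v x))) (at 0)" by (simp add: u0 g0)
  moreover have "(%h. a' (0, h * v x, h *\<^sub>R grad v x)) = (*) (lin_b a \<Phi> x \<bullet> grad v x + lin_q a \<Phi> x * v x)"
   unfolding partials_of_derivative[OF a'] by (auto simp: lin_b_def lin_q_def algebra_simps)
  ultimately have 2: "((%t. a (x, u t x, grad (u t) x)) has_real_derivative lin_b a \<Phi> x \<bullet> grad v x + lin_q a \<Phi> x * v x) (at 0)"
   by (simp add: has_field_derivative_def)
  have "((%t. det (hess (u t) x)) has_real_derivative lin_b a \<Phi> x \<bullet> grad v x + lin_q a \<Phi> x * v x) (at 0)"
  proof (rule has_field_derivative_transform_within[OF 2 r1(1)])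
   fix t :: real assume "dist t 0 < r1"
   then show "a (x, u t x, grad (u t) x) = det (hess (u t) x)" using r1(2) x PD(3)[of t] by (simp add: MA_solution_def)
  qed simp
  from DERIV_unique[OF 1 this] show ?thesis .
 qed
 have nd: "((%t. normal_deriv Om (u t) x) has_real_derivative normal_deriv Om v x) (at 0)" if x: "x \<in> frontier Om" for x
 proof (rule has_real_derivative_at_0I)
  define S where "S = (\<Sum>i\<in>UNIV. \<bar>unit_normal Om x$i\<bar>)"
  have S: "0 <= S" unfolding S_def by (rule sum_nonneg) simp
  fix e :: real assume e: "0 < e"
  then have "0 < e/(S + 1)" using S by simp
  from E1[OF this] obtain r where r: "0 < r" "\<forall>t. \<bar>t\<bar> < r --> P t \<and>
    ?E (e/(S + 1)) t"
   by (elim exE conjE)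
  show "\<exists>r>0. \<forall>t. \<bar>t\<bar> < r --> \<bar>normal_deriv Om (u t) x - normal_deriv Om \<Phi> x - t*normal_deriv Om v x\<bar> <= e*\<bar>t\<bar>"
  proof (rule exI[of _ r], rule conjI[OF r(1)], intro allI impI)
   fix t assume "\<bar>t\<bar> < r"
   note R = r(2)[THEN spec, THEN mp, OF this] and PR = PD[OF R[THEN conjunct1]]
   have "\<bar>normal_deriv Om (u t) x - normal_deriv Om \<Phi> x - t*normal_deriv Om v x\<bar> <= (e/(S + 1)*\<bar>t\<bar>)*S"
   proof (rule cl_ext_grad_le[OF Om(1) _ _ _ x, folded S_def])
    show "u t \<in> holder_space (Suc (Suc m)) \<alpha> Om" "\<Phi> \<in> holder_space (Suc (Suc m)) \<alpha> Om" "v \<in> holder_space (Suc (Suc m)) \<alpha> Om"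
     using PR(2) \<Phi>(1) v by simp_all
    fix y i assume y: "y \<in> Om"
    have "Suc 0 <= m + 2" by simp
    from R[THEN conjunct2, THEN spec, THEN mp, OF this, THEN bspec, OF axis_multi_indices(1), THEN bspec, OF y]
    show "\<bar>grad (u t) y$i - grad \<Phi> y$i - t*grad v y$i\<bar> <= e/(S + 1)*\<bar>t\<bar>" unfolding grad_nth .
   qed
   also have "\<dots> = (e*\<bar>t\<bar>)*(S/(S + 1))" by simp
   also have "\<dots> <= (e*\<bar>t\<bar>)*1" using S e by (intro mult_left_mono) auto
   finally show "\<bar>normal_deriv Om (u t) x - normal_deriv Om \<Phi> x - t*normal_deriv Om v x\<bar> <= e*\<bar>t\<bar>" by simp
  qed
 qed
 show ?thesis
  using v fr pde nd r1 PD(1) unfolding u_def[symmetric] by (intro bexI[OF _ v] conjI) auto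
qed

lemma holder_space_C2b:
 assumes v: "v \<in> holder_space (m + 2) \<alpha> Om"
 shows "\<exists>K. C2b Om K v"
proof -
 obtain K0 where K0: "\<forall>bs\<in>multi_indices 0. \<forall>x\<in>Om. \<bar>pderivs bs v x\<bar> <= K0" using holder_space_bound[OF v, of 0] by auto
 obtain K1 where K1: "0 <= K1" "\<forall>x\<in>Om. norm (grad v x) <= K1" using holder_space_grad_bound[of v "Suc m" \<alpha> Om] v by auto
 obtain K2 where K2: "\<forall>bs\<in>multi_indices (Suc (Suc 0)). \<forall>x\<in>Om. \<bar>pderivs bs v x\<bar> <= K2"
  using holder_space_bound[OF v, of "Suc (Suc 0)"] by auto
 have "C2b Om (\<bar>K0\<bar> + K1 + \<bar>K2\<bar>) v"
  unfolding C2b_def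
 proof (intro conjI ballI allI)
  show "Ck_on (Suc (Suc 0)) Om v" by (rule holder_space_Ck[OF v]) simp
  show "0 <= \<bar>K0\<bar> + K1 + \<bar>K2\<bar>" using K1(1) by simp
  fix x i j assume x: "x \<in> Om"
  have "\<bar>v x\<bar> <= K0" using K0 x by simp
  then show "\<bar>v x\<bar> <= \<bar>K0\<bar> + K1 + \<bar>K2\<bar>" using K1(1) by linarith
  have "norm (grad v x) <= K1" using K1(2) x by blast
  then show "norm (grad v x) <= \<bar>K0\<bar> + K1 + \<bar>K2\<bar>" by linarith
  have "\<bar>hess v x$i$j\<bar> <= K2" unfolding hess_nth using bspec[OF K2 axis_multi_indices(2)] x by blast
  then show "\<bar>hess v x$i$j\<bar> <= \<bar>K0\<bar> + K1 + \<bar>K2\<bar>" using K1(1) by linarith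
 qed
 then show ?thesis ..
qed

lemma nonlinearity_partials:
 fixes a :: "(real^'n) \<times> real \<times> (real^'n) => real" and \<Phi> :: "real^'n => real"
 assumes a: "a \<in> holder_space (Suc k) \<alpha> (Om \<times> UNIV \<times> UNIV)" and \<Phi>: "Ck_on (Suc 0) Om \<Phi>"
 shows "\<forall>x\<in>Om. \<forall>z p. a differentiable at (x, z, p)"
  and "continuous_on Om (lin_b a \<Phi>)" "continuous_on Om (lin_q a \<Phi>)"
  and "\<exists>N. \<forall>x\<in>Om. norm (lin_b a \<Phi> x) <= N" "\<exists>N. \<forall>x\<in>Om. lin_q a \<Phi> x <= N"
proof -
 let ?U = "Om \<times> (UNIV :: real set) \<times> (UNIV :: (real^'n) set)"
 have C1: "Ck_on (Suc 0) ?U a" by (rule holder_space_Ck[OF a]) simp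
 have d: "a differentiable at (x, z, p)" if "x \<in> Om" for x z p using C1 that by (simp add: Ck_on_Suc)
 then show "\<forall>x\<in>Om. \<forall>z p. a differentiable at (x, z, p)" by blast
 have pd: "dz a x z p = pderivs [(0, 1, 0)] a (x, z, p)" "dp a x z p$i = pderivs [(0, 0, axis i 1)] a (x, z, p)"
  if x: "x \<in> Om" for x z p i
 proof -
  obtain a' where a': "(a has_derivative a') (at (x, z, p))" using d[OF x] by (auto simp: differentiable_def)
  show "dz a x z p = pderivs [(0, 1, 0)] a (x, z, p)"
   unfolding pderivs_single[OF a'] using partials_of_derivative[OF a', of 1 0] by simp
  show "dp a x z p$i = pderivs [(0, 0, axis i 1)] a (x, z, p)"
   unfolding pderivs_single[OF a'] using partials_of_derivative[OF a', of 0 "axis i 1"] by (simp add: inner_axis)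
 qed
 have Bz: "(0, 1, 0) \<in> (Basis :: ((real^'n) \<times> real \<times> (real^'n)) set)" by (simp add: Basis_prod_def)
 have Bp: "(0, 0, axis i 1) \<in> (Basis :: ((real^'n) \<times> real \<times> (real^'n)) set)" for i
  unfolding Basis_prod_def by (intro UnI2 imageI) (auto simp: Basis_vec_axis)
 have mi: "[b] \<in> multi_indices (Suc 0)" if "b \<in> Basis" for b :: "(real^'n) \<times> real \<times> (real^'n)"
  using that by (simp add: multi_indices_def)
 have c: "continuous_on ?U (pderivs [b] a)" if "b \<in> Basis" for b
  using C1 that by (simp add: Ck_on_Suc)
 have path: "continuous_on Om (%x. (x, \<Phi> x, grad \<Phi> x))"
  using \<Phi> Ck_on_imp_continuous_on[OF \<Phi>] by (intro continuous_on_Pair continuous_on_id) (auto simp: Ck_on_1)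
 have comp: "continuous_on Om (%x. pderivs [b] a (x, \<Phi> x, grad \<Phi> x))" if "b \<in> Basis" for b
  by (rule continuous_on_compose2[OF c[OF that] path]) auto
 have bi: "lin_b a \<Phi> x = (\<chi> i. pderivs [(0, 0, axis i 1)] a (x, \<Phi> x, grad \<Phi> x))" if "x \<in> Om" for x
  using pd(2)[OF that] by (simp add: lin_b_def vec_eq_iff)
 show "continuous_on Om (lin_q a \<Phi>)"
  using comp[OF Bz] continuous_on_cong[of Om Om "lin_q a \<Phi>"] pd(1) by (simp add: lin_q_def)
 have "continuous_on Om (%x. \<chi> i. pderivs [(0, 0, axis i 1)] a (x, \<Phi> x, grad \<Phi> x))"
  by (intro continuous_on_vec_lambda comp Bp)
 then show "continuous_on Om (lin_b a \<Phi>)" using continuous_on_cong[of Om Om "lin_b a \<Phi>"] bi by simp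
 obtain K where K: "\<forall>bs\<in>multi_indices (Suc 0). \<forall>y\<in>?U. \<bar>pderivs bs a y\<bar> <= K"
  using holder_space_bound[OF a, of "Suc 0"] by auto
 have "\<bar>lin_q a \<Phi> x\<bar> <= K" if x: "x \<in> Om" for x
  unfolding lin_q_def pd(1)[OF x] using K[THEN bspec, OF mi[OF Bz], THEN bspec, of "(x, \<Phi> x, grad \<Phi> x)"] x by simp
 then show "\<exists>N. \<forall>x\<in>Om. lin_q a \<Phi> x <= N" by (intro exI[of _ K]) (auto dest: abs_le_D1)
 have "norm (lin_b a \<Phi> x) <= real CARD('n)*K" if x: "x \<in> Om" for x
 proof -
  have "norm (lin_b a \<Phi> x) <= (\<Sum>i\<in>UNIV. \<bar>lin_b a \<Phi> x$i\<bar>)" by (rule norm_le_l1_cart)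
  also have "\<dots> <= (\<Sum>i\<in>(UNIV :: 'n set). K)"
  proof (rule sum_mono)
   fix i :: 'n
   show "\<bar>lin_b a \<Phi> x$i\<bar> <= K"
    unfolding lin_b_def pd(2)[OF x] using K[THEN bspec, OF mi[OF Bp], THEN bspec, of "(x, \<Phi> x, grad \<Phi> x)"] x by simp
  qed
  finally show ?thesis by simp
 qed
 then show "\<exists>N. \<forall>x\<in>Om. norm (lin_b a \<Phi> x) <= N" by blast
qed

text \<open>\<open>a\<close> is positive but may tend to 0 at infinity. Since \<Phi> and its
  gradient are bounded by \<open>K\<close>, only the values of \<open>a\<close> on a compact set
  occur, and there it attains a positive minimum.\<close>

lemma det_hess_lower_bound:
 fixes a :: "(real^'n) \<times> real \<times> (real^'n) => real" and \<Phi> :: "real^'n => real"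
 assumes Om: "bounded Om" "Om ~= {}" and a: "a \<in> holder_space k \<alpha> (Om \<times> UNIV \<times> UNIV)"
  and pos: "!!x z p. x \<in> closure Om ==> 0 < a (x, z, p)" and \<Phi>: "C2b Om K \<Phi>" "MA_solution Om a \<phi> \<Phi>"
 shows "\<exists>d>0. \<forall>x\<in>Om. d <= det (hess \<Phi> x)"
proof -
 let ?S = "closure Om \<times> cball (0 :: real) K \<times> cball (0 :: real^'n) K"
 have K: "0 <= K" using \<Phi>(1) by (simp add: C2b_def)
 have "continuous_on (closure (Om \<times> (UNIV :: real set) \<times> (UNIV :: (real^'n) set))) a" using a by (simp add: holder_space_def)
 then have c: "continuous_on ?S a" by (rule continuous_on_subset) (auto simp: closure_Times)
 have "compact ?S" using Om(1) by (intro compact_Times) (auto simp: compact_closure)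
 moreover have "?S ~= {}" using Om(2) K by auto
 ultimately obtain y where y: "y \<in> ?S" "\<forall>z\<in>?S. a y <= a z" using continuous_attains_inf[OF _ _ c] by blast
 show ?thesis
 proof (intro exI[of _ "a y"] conjI ballI)
  show "0 < a y" using y(1) pos by (cases y) auto
  fix x assume x: "x \<in> Om"
  then have "(x, \<Phi> x, grad \<Phi> x) \<in> ?S" using C2b_bounds(2,3)[OF \<Phi>(1) x] closure_subset[of Om] by auto
  then show "a y <= det (hess \<Phi> x)" using y(2) \<Phi>(2) x by (simp add: MA_solution_def)
 qed
qed

lemma elliptic_super_linearised:
 fixes a :: "(real^'n) \<times> real \<times> (real^'n) => real" and \<Phi> :: "real^'n => real"
 assumes Om: "open Om" "bounded Om" "Om ~= {}" and a: "a \<in> holder_space (Suc k) \<alpha> (Om \<times> UNIV \<times> UNIV)"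
  and pos: "!!x z p. x \<in> closure Om ==> 0 < a (x, z, p)"
  and \<Phi>: "\<Phi> \<in> holder_space (m + 2) \<beta> Om" "MA_solution Om a \<phi> \<Phi>"
  and c0: "0 < c0" "!!x \<xi>. x \<in> closure Om ==> c0*(norm \<xi>)^2 <= \<xi> \<bullet> (cl_ext Om (hess \<Phi>) x *v \<xi>)"
  and q: "!!x. x \<in> Om ==> 0 <= lin_q a \<Phi> x"
 shows "\<exists>N lam \<psi> g K c. elliptic_super Om (lin_C \<Phi>) (lin_b a \<Phi>) (lin_q a \<Phi>) N lam \<psi> g K c"
proof -
 obtain K where K: "C2b Om K \<Phi>" using holder_space_C2b[OF \<Phi>(1)] by blast
 obtain d where d: "0 < d" "\<forall>x\<in>Om. d <= det (hess \<Phi> x)"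
  using det_hess_lower_bound[OF Om(2,3) a pos K \<Phi>(2)] by blast
 note p = nonlinearity_partials[OF a C2b_Ck(1)[OF K]]
 obtain Nb where Nb: "\<forall>x\<in>Om. norm (lin_b a \<Phi> x) <= Nb" using p(4) by blast
 obtain Nq where Nq: "\<forall>x\<in>Om. lin_q a \<Phi> x <= Nq" using p(5) by blast
 have coer: "c0*(norm \<xi>)^2 <= \<xi> \<bullet> (hess \<Phi> x *v \<xi>)" if "x \<in> Om" for x \<xi>
  using c0(2)[of x \<xi>] that closure_subset[of Om] by (auto simp: cl_ext_def)
 show ?thesis
  by (rule elliptic_super_lin_C[OF Om(1,2) K c0(1) coer d(1) _ p(2) _ p(3)]) (use d Nb Nq q in auto)
qed

section \<open>Comparison of weak with classical solutions\<close>

context elliptic_super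
begin

text \<open>V is the jet of a weak solution, Q that of a smooth approximation, P that of the
  classical solution with the boundary values of Q, and \<theta> approximates their difference. As V
  and P solve the equation, the form of \<theta> is that of the two small remainders, at most 6 N
  times the square root of e; \<open>stability\<close> multiplies this by 3 K4, whence 18 N
  K4.\<close>

lemma weak_solution_approx:
 assumes V: "L2_on Om V" "!!\<xi>. \<xi> \<in> C1c Om ==> form V (jet \<xi>) = 0"
  and P: "L2_on Om P" "!!\<xi>. \<xi> \<in> C1c Om ==> form P (jet \<xi>) = 0"
  and Q: "L2_on Om Q" "L2sq Om (%x. Q x - V x) <= e" and e: "0 < e"
  and \<theta>: "\<theta> \<in> C1c Om" "L2sq Om (%x. P x - Q x - jet \<theta> x) <= e"
 shows "L2sq Om (%x. P x - V x) <= (8 + 2*(18*N*K4)^2)*e"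
proof -
 note L = L2_on_diff(1)[OF Q(1) V(1)] L2_on_diff(1)[OF L2_on_diff(1)[OF P(1) Q(1)] C1c_jet_L2[OF \<theta>(1)]] C1c_jet_L2[OF \<theta>(1)]
 let ?R = "%x. Q x - V x" and ?S = "%x. P x - Q x - jet \<theta> x"
 have sum: "P x - V x = (?R x + ?S x) + jet \<theta> x" for x by simp
 have "nrm \<theta> <= 3*K4*(6*N * sqrt e)"
 proof (rule stability[OF \<theta>(1)])
  show "0 <= 6*N * sqrt e" using N_nonneg e by simp
  fix \<xi> assume \<xi>: "\<xi> \<in> C1c Om"
  note J = C1c_jet_L2[OF \<xi>]
  have n: "0 <= nrm \<xi>" using \<xi> by simp
  have "form P (jet \<xi>) - form V (jet \<xi>) = form (%x. (- 1) *\<^sub>R V x + P x) (jet \<xi>)"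
   using form_lin(1)[OF V(1) P(1) J, of "- 1"] by simp
  also have "(%x. (- 1) *\<^sub>R V x + P x) = (%x. 1 *\<^sub>R (1 *\<^sub>R ?R x + ?S x) + jet \<theta> x)" by (rule ext) simp
  also have "form \<dots> (jet \<xi>) = form (%x. 1 *\<^sub>R ?R x + ?S x) (jet \<xi>) + form (jet \<theta>) (jet \<xi>)"
   using form_lin(1)[OF _ L(3) J, of "%x. 1 *\<^sub>R ?R x + ?S x" 1] L2_on_add(1)[OF L(1,2)] by simp
  also have "form (%x. 1 *\<^sub>R ?R x + ?S x) (jet \<xi>) = form ?R (jet \<xi>) + form ?S (jet \<xi>)"
   using form_lin(1)[OF L(1,2) J, of 1] by simp
  finally have eq: "form (jet \<theta>) (jet \<xi>) = - form ?R (jet \<xi>) - form ?S (jet \<xi>)" using V(2)[OF \<xi>] P(2)[OF \<xi>] by simp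
  have le: "\<bar>form U (jet \<xi>)\<bar> <= 3*N * sqrt e*nrm \<xi>" if U: "L2_on Om U" "L2sq Om U <= e" for U
  proof -
   have "3*N * sqrt (L2sq Om U)*nrm \<xi> <= 3*N * sqrt e*nrm \<xi>"
    using U(2) N_nonneg n by (intro mult_right_mono mult_left_mono) auto
   then show ?thesis using form_le[OF U(1) J] unfolding nrm_jet by linarith
  qed
  have "\<bar>form (jet \<theta>) (jet \<xi>)\<bar> <= 3*N * sqrt e*nrm \<xi> + 3*N * sqrt e*nrm \<xi>"
   unfolding eq using le[OF L(1) Q(2)] le[OF L(2) \<theta>(2)] by linarith
  then show "\<bar>form (jet \<theta>) (jet \<xi>)\<bar> <= 6*N * sqrt e*nrm \<xi>" by simp
 qed
 then have "(nrm \<theta>)^2 <= (3*K4*(6*N * sqrt e))^2" using \<theta>(1) by (intro power_mono) auto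
 then have 1: "L2sq Om (jet \<theta>) <= (18*N*K4)^2*e" using e by (simp add: nrm_jet power_mult_distrib mult_ac)
 have "L2sq Om (%x. P x - V x) <= 2*L2sq Om (%x. ?R x + ?S x) + 2*L2sq Om (jet \<theta>)"
  unfolding sum by (rule L2_on_add(2)[OF L2_on_add(1)[OF L(1,2)] L(3)])
 also have "\<dots> <= 2*(4*e) + 2*((18*N*K4)^2*e)"
  using L2_on_add(2)[OF L(1,2)] Q(2) \<theta>(2) 1 by linarith
 finally show ?thesis by (simp add: algebra_simps)
qed

end

lemma L2sq_cong: "(!!x. x \<in> Om ==> P x = Q x) ==> L2sq Om P = L2sq Om Q"
 unfolding L2sq_def by (intro Bochner_Integration.integral_cong) auto

lemma le_zero_if_le_sqrt:
 assumes "!!e. 0 < e ==> a <= K * sqrt e"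
 shows "a <= (0::real)"
proof (rule tendsto_lowerbound)
 show "((%e. K * sqrt e) \<longlongrightarrow> 0) (at_right 0)" by (auto intro!: tendsto_eq_intros)
 show "\<forall>\<^sub>F e in at_right 0. a <= K * sqrt e" using assms by (auto simp: eventually_at_filter)
qed simp

lemma holder_jet_diff:
 assumes "open Om" "f \<in> holder_space (m + 2) \<alpha> Om" "g \<in> holder_space (m + 2) \<alpha> Om" "x \<in> Om"
 shows "jet (%x. f x - g x) x = jet f x - jet g x" "lin_tr \<Phi> (%x. f x - g x) x = lin_tr \<Phi> f x - lin_tr \<Phi> g x"
proof -
 have "grad (%x. f x - g x) x = grad f x - grad g x"
  unfolding vec_eq_iff vector_minus_component grad_nth
  using holder_pderivs_diff[OF assms(1-3) axis_multi_indices(1) _ assms(4)] by simp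
 then show "jet (%x. f x - g x) x = jet f x - jet g x" by (simp add: jet_def)
 have "hess (%x. f x - g x) x$i$j = hess f x$i$j - hess g x$i$j" for i j
  unfolding hess_nth using holder_pderivs_diff[OF assms(1-3) axis_multi_indices(2) _ assms(4)] by simp
 then show "lin_tr \<Phi> (%x. f x - g x) x = lin_tr \<Phi> f x - lin_tr \<Phi> g x"
  by (simp add: lin_tr_def right_diff_distrib sum_subtractf)
qed

lemma L2_jet_C2b:
 assumes "open Om" "bounded Om" "C2b Om K v"
 shows "L2_on Om (jet v)"
 using C2b_bounds(2,3)[OF assms(3)] by (rule C1_bounded_L2(3)[OF assms(1,2) C2b_Ck(1)[OF assms(3)]])

text \<open>Density in \<open>H1\<close> and continuity of the \<open>L2\<close> pairing. The
  functions \<open>F\<close> are smooth on the whole space and subject to no boundary condition, so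
  \<open>w\<close> is not restricted to \<open>H10\<close>.\<close>

lemma L2_orthogonal_smooth:
 assumes Om: "open Om" "bounded Om" and sh: "!!c. c \<in> closure Om ==> \<exists>r s \<kappa> \<epsilon>\<^sub>0. shiftable Om c r s \<kappa> \<epsilon>\<^sub>0"
  and Z: "L2_on Om Z" "!!F. (!!k. Ck_on k UNIV F) ==> L2_on Om (jet F) \<and> (LINT x|lebesgue_on Om. Z x \<bullet> jet F x) = 0"
  and w: "L2_on Om w" "is_weak_grad Om w G"
 shows "(LINT x|lebesgue_on Om. Z x \<bullet> (w x, G x)) = 0"
proof -
 have W: "L2_on Om (%x. (w x, G x))" using w by (simp add: L2_on_jet_iff is_weak_grad_def)
 have "\<bar>LINT x|lebesgue_on Om. Z x \<bullet> (w x, G x)\<bar> <= 0"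
 proof (rule le_zero_if_le_sqrt)
  fix e :: real assume e: "0 < e"
  obtain F where F: "!!k. Ck_on k UNIV F" "L2sq Om (%x. jet F x - (w x, G x)) <= e"
   using smooth_dense_H1[OF Om sh w e] by metis
  note J = Z(2)[of F, OF F(1)]
  have "(LINT x|lebesgue_on Om. Z x \<bullet> (jet F x - (w x, G x))) = - (LINT x|lebesgue_on Om. Z x \<bullet> (w x, G x))"
   using J L2_on_inner_integrable[OF Z(1) W] L2_on_inner_integrable[OF Z(1) conjunct1[OF J]] by (simp add: inner_diff_right)
  then have "\<bar>LINT x|lebesgue_on Om. Z x \<bullet> (w x, G x)\<bar> <= sqrt (L2sq Om Z) * sqrt (L2sq Om (%x. jet F x - (w x, G x)))"
   using L2_Cauchy_Schwarz[OF Z(1) L2_on_diff(1)[OF conjunct1[OF J] W]] by simp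
  also have "\<dots> <= sqrt (L2sq Om Z) * sqrt e" using F(2) by (intro mult_left_mono) auto
  finally show "\<bar>LINT x|lebesgue_on Om. Z x \<bullet> (w x, G x)\<bar> <= sqrt (L2sq Om Z) * sqrt e" .
 qed
 then show ?thesis by simp
qed

section \<open>Weak solutions in terms of the bilinear form\<close>

context elliptic
begin

lemma form_cong_AE:
 assumes "L2_on Om P" "L2_on Om P'" "L2_on Om Q" "L2_on Om Q'"
  and "AE x in lebesgue_on Om. P x = P' x" "AE x in lebesgue_on Om. Q x = Q' x"
 shows "form P Q = form P' Q'"
 unfolding form_def
proof (rule integral_cong_AE)
 show "(%x. A x (P x) \<bullet> Q x) \<in> borel_measurable (lebesgue_on Om)" "(%x. A x (P' x) \<bullet> Q' x) \<in> borel_measurable (lebesgue_on Om)"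
  using L2_on_inner_integrable[OF L2_A(1)[OF assms(1)] assms(3)] L2_on_inner_integrable[OF L2_A(1)[OF assms(2)] assms(4)] by auto
 show "AE x in lebesgue_on Om. A x (P x) \<bullet> Q x = A x (P' x) \<bullet> Q' x" using assms(5,6) by eventually_elim simp
qed

lemma L2_H1:
 assumes "v \<in> H1 Om"
 shows "L2_on Om (%x. (v x, wgrad Om v x))" "L2_on Om v"
 using assms wgrad_is_weak_grad[OF assms] by (auto simp: L2_on_jet_iff is_weak_grad_def H1_def)

lemma weak_solution_form:
 assumes v: "weak_solution Om C b q v" and \<theta>: "\<theta> \<in> H10 Om" "L2_on Om (jet \<theta>)" "is_weak_grad Om \<theta> (grad \<theta>)"
 shows "form (%x. (v x, wgrad Om v x)) (jet \<theta>) = 0"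
proof -
 have "\<theta> \<in> H1 Om" using \<theta>(1) by (simp add: H10_def)
 note L = L2_H1(1)[OF this] and LV = L2_H1(1)[of v]
 have "(%x. A x (v x, wgrad Om v x) \<bullet> (\<theta> x, wgrad Om \<theta> x)) =
   (%x. (C x *v wgrad Om v x) \<bullet> wgrad Om \<theta> x + (b x \<bullet> wgrad Om v x)*\<theta> x + q x * v x*\<theta> x)"
  by (rule ext) (simp add: A_def algebra_simps)
 then have "form (%x. (v x, wgrad Om v x)) (%x. (\<theta> x, wgrad Om \<theta> x)) = 0"
  using v \<theta>(1) by (simp add: form_def weak_solution_def)
 moreover have "form (%x. (v x, wgrad Om v x)) (%x. (\<theta> x, wgrad Om \<theta> x)) = form (%x. (v x, wgrad Om v x)) (jet \<theta>)"
  using wgrad_AE[OF opn bnd \<theta>(3)] v L \<theta>(2) by (intro form_cong_AE LV) (auto simp: jet_def weak_solution_def)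
 ultimately show ?thesis by simp
qed

text \<open>The symmetry of \<open>C\<close> lets the adjoint equation be read as the same form with
  the solution in the second argument.\<close>

lemma adjoint_weak_solution_form:
 assumes w: "adjoint_weak_solution Om C b q w" and \<theta>: "\<theta> \<in> H10 Om" "L2_on Om (jet \<theta>)" "is_weak_grad Om \<theta> (grad \<theta>)"
  and sym: "!!x G H. x \<in> Om ==> (C x *v G) \<bullet> H = (C x *v H) \<bullet> G"
 shows "form (jet \<theta>) (%x. (w x, wgrad Om w x)) = 0"
proof -
 have "\<theta> \<in> H1 Om" using \<theta>(1) by (simp add: H10_def)
 note L = L2_H1(1)[OF this] and LW = L2_H1(1)[of w]
 have "form (%x. (\<theta> x, wgrad Om \<theta> x)) (%x. (w x, wgrad Om w x)) =
   (LINT x|lebesgue_on Om. (C x *v wgrad Om w x) \<bullet> wgrad Om \<theta> x + w x*(b x \<bullet> wgrad Om \<theta> x) + q x*w x*\<theta> x)"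
  unfolding form_def
 proof (rule Bochner_Integration.integral_cong[OF refl])
  fix x assume "x \<in> space (lebesgue_on Om)"
  then show "A x (\<theta> x, wgrad Om \<theta> x) \<bullet> (w x, wgrad Om w x) =
    (C x *v wgrad Om w x) \<bullet> wgrad Om \<theta> x + w x*(b x \<bullet> wgrad Om \<theta> x) + q x*w x*\<theta> x"
   using sym[of x "wgrad Om \<theta> x" "wgrad Om w x"] by (simp add: A_def algebra_simps)
 qed
 also have "\<dots> = 0" using w \<theta>(1) by (simp add: adjoint_weak_solution_def)
 finally have "form (%x. (\<theta> x, wgrad Om \<theta> x)) (%x. (w x, wgrad Om w x)) = 0" .
 moreover have "form (%x. (\<theta> x, wgrad Om \<theta> x)) (%x. (w x, wgrad Om w x)) = form (jet \<theta>) (%x. (w x, wgrad Om w x))"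
  using wgrad_AE[OF opn bnd \<theta>(3)] w L \<theta>(2) by (intro form_cong_AE LW) (auto simp: jet_def adjoint_weak_solution_def)
 ultimately show ?thesis by simp
qed

end

text \<open>Equality of the data sets yields a partner \<eta>' that agrees with \<eta> only on the
  frontier; \<open>solution_map_cong\<close> shows that it has the same solution.\<close>

lemma normal_deriv_same_cauchy_data:
 assumes eq: "cauchy_data Om m \<alpha> a\<^sub>1 \<phi> \<delta>\<^sub>1 V\<^sub>1 = cauchy_data Om m \<alpha> a\<^sub>2 \<phi> \<delta>\<^sub>2 V\<^sub>2"
  and \<eta>: "\<eta> \<in> bdry_ball (m + 2) \<alpha> Om \<phi> \<delta>\<^sub>1" and x: "x \<in> frontier Om"
 shows "normal_deriv Om (solution_map Om a\<^sub>1 V\<^sub>1 \<eta>) x = normal_deriv Om (solution_map Om a\<^sub>2 V\<^sub>2 \<eta>) x"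
proof -
 let ?r = "%f. restrict f (frontier Om)"
 have "(?r \<eta>, ?r (normal_deriv Om (solution_map Om a\<^sub>1 V\<^sub>1 \<eta>))) \<in> cauchy_data Om m \<alpha> a\<^sub>1 \<phi> \<delta>\<^sub>1 V\<^sub>1"
  unfolding cauchy_data_def by (rule CollectI, rule exI[of _ \<eta>], rule conjI[OF refl \<eta>])
 then obtain \<eta>' where \<eta>': "?r \<eta> = ?r \<eta>'" "?r (normal_deriv Om (solution_map Om a\<^sub>1 V\<^sub>1 \<eta>)) = ?r (normal_deriv Om (solution_map Om a\<^sub>2 V\<^sub>2 \<eta>'))"
  unfolding eq unfolding cauchy_data_def mem_Collect_eq prod.inject by (elim exE conjE)
 have "\<eta>' y = \<eta> y" if "y \<in> frontier Om" for y using fun_cong[OF \<eta>'(1), of y] that by simp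
 then have "solution_map Om a\<^sub>2 V\<^sub>2 \<eta>' = solution_map Om a\<^sub>2 V\<^sub>2 \<eta>" by (rule solution_map_cong)
 then show ?thesis using fun_cong[OF \<eta>'(2), of x] x by simp
qed

text \<open>For small t the two nonlinear solutions with boundary values \<phi> + t F have the same
  normal derivative at each boundary point. These are equal functions of t near 0, so their
  derivatives at 0 agree.\<close>

lemma linearised_pair_exists:
 fixes Om :: "(real^'n) set"
 assumes Om: "open Om" "Om ~= {}" and \<phi>: "\<phi> \<in> bdry_holder_space (m + 2) \<alpha> Om" and F: "F \<in> holder_space (m + 2) \<alpha> Om"
  and \<Phi>: "\<Phi> \<in> holder_space (m + 2) \<alpha> Om" "MA_solution Om a\<^sub>1 \<phi> \<Phi>" "MA_solution Om a\<^sub>2 \<phi> \<Phi>"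
  and wp: "local_well_posedness Om m \<alpha> a\<^sub>1 \<phi> \<Phi> \<delta>\<^sub>1 V\<^sub>1" "local_well_posedness Om m \<alpha> a\<^sub>2 \<phi> \<Phi> \<delta>\<^sub>2 V\<^sub>2"
  and a: "\<forall>x\<in>Om. \<forall>z p. a\<^sub>1 differentiable at (x, z, p)" "\<forall>x\<in>Om. \<forall>z p. a\<^sub>2 differentiable at (x, z, p)"
  and eq: "cauchy_data Om m \<alpha> a\<^sub>1 \<phi> \<delta>\<^sub>1 V\<^sub>1 = cauchy_data Om m \<alpha> a\<^sub>2 \<phi> \<delta>\<^sub>2 V\<^sub>2"
 shows "\<exists>v\<^sub>1\<in>holder_space (m + 2) \<alpha> Om. \<exists>v\<^sub>2\<in>holder_space (m + 2) \<alpha> Om.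
  (\<forall>x\<in>frontier Om. v\<^sub>1 x = F x \<and> v\<^sub>2 x = F x \<and> normal_deriv Om v\<^sub>1 x = normal_deriv Om v\<^sub>2 x) \<and>
  (\<forall>x\<in>Om. lin_tr \<Phi> v\<^sub>1 x = lin_b a\<^sub>1 \<Phi> x \<bullet> grad v\<^sub>1 x + lin_q a\<^sub>1 \<Phi> x * v\<^sub>1 x \<and>
   lin_tr \<Phi> v\<^sub>2 x = lin_b a\<^sub>2 \<Phi> x \<bullet> grad v\<^sub>2 x + lin_q a\<^sub>2 \<Phi> x * v\<^sub>2 x)"
proof -
 obtain v1 where v1: "v1 \<in> holder_space (m + 2) \<alpha> Om" "\<forall>x\<in>frontier Om. v1 x = F x"
  "\<forall>x\<in>Om. lin_tr \<Phi> v1 x = lin_b a\<^sub>1 \<Phi> x \<bullet> grad v1 x + lin_q a\<^sub>1 \<Phi> x * v1 x"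
  "\<forall>x\<in>frontier Om. ((%t. normal_deriv Om (solution_map Om a\<^sub>1 V\<^sub>1 (%x. \<phi> x + t*F x)) x) has_real_derivative normal_deriv Om v1 x) (at 0)"
  and "\<exists>r>0. \<forall>t. \<bar>t\<bar> < r --> (%x. \<phi> x + t*F x) \<in> bdry_ball (m + 2) \<alpha> Om \<phi> \<delta>\<^sub>1"
  using linearised_solution[OF Om wp(1) \<phi> F \<Phi>(1,2) a(1)] by (elim bexE conjE)
 then obtain r where r: "0 < r" "\<forall>t. \<bar>t\<bar> < r --> (%x. \<phi> x + t*F x) \<in> bdry_ball (m + 2) \<alpha> Om \<phi> \<delta>\<^sub>1" by (elim exE conjE)
 obtain v2 where v2: "v2 \<in> holder_space (m + 2) \<alpha> Om" "\<forall>x\<in>frontier Om. v2 x = F x"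
  "\<forall>x\<in>Om. lin_tr \<Phi> v2 x = lin_b a\<^sub>2 \<Phi> x \<bullet> grad v2 x + lin_q a\<^sub>2 \<Phi> x * v2 x"
  "\<forall>x\<in>frontier Om. ((%t. normal_deriv Om (solution_map Om a\<^sub>2 V\<^sub>2 (%x. \<phi> x + t*F x)) x) has_real_derivative normal_deriv Om v2 x) (at 0)"
  using linearised_solution[OF Om wp(2) \<phi> F \<Phi>(1,3) a(2)] by (elim bexE conjE)
 have nd: "normal_deriv Om v1 x = normal_deriv Om v2 x" if x: "x \<in> frontier Om" for x
 proof -
  have "((%t. normal_deriv Om (solution_map Om a\<^sub>2 V\<^sub>2 (%x. \<phi> x + t*F x)) x) has_real_derivative normal_deriv Om v1 x) (at 0)"
  proof (rule has_field_derivative_transform_within[OF bspec[OF v1(4) x] r(1)])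
   fix t :: real assume "dist t 0 < r"
   then have "(%x. \<phi> x + t*F x) \<in> bdry_ball (m + 2) \<alpha> Om \<phi> \<delta>\<^sub>1" using r(2) by simp
   from normal_deriv_same_cauchy_data[OF eq this x]
   show "normal_deriv Om (solution_map Om a\<^sub>1 V\<^sub>1 (%x. \<phi> x + t*F x)) x = normal_deriv Om (solution_map Om a\<^sub>2 V\<^sub>2 (%x. \<phi> x + t*F x)) x" .
  qed simp
  from DERIV_unique[OF this bspec[OF v2(4) x]] show ?thesis .
 qed
 show ?thesis
  using v1(2,3) v2(2,3) nd by (intro bexI[OF _ v1(1)] bexI[OF _ v2(1)] conjI ballI) auto
qed

section \<open>The integral identity\<close>

text \<open>The assumption \<open>pair\<close> is all that remains of the nonlinear problem. The
  first operator carries a supersolution because its weak solutions are the ones to be approximated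
  by classical ones.\<close>

locale linearised_pair =
 E1: elliptic_super Om "lin_C \<Phi>" b\<^sub>1 q\<^sub>1 N\<^sub>1 lam\<^sub>1 \<psi> g K c + E2: elliptic Om "lin_C \<Phi>" b\<^sub>2 q\<^sub>2 N\<^sub>2 lam\<^sub>2
 for Om :: "(real^'n) set" and \<Phi> b\<^sub>1 q\<^sub>1 N\<^sub>1 lam\<^sub>1 \<psi> g K c b\<^sub>2 q\<^sub>2 N\<^sub>2 lam\<^sub>2 +
 fixes m :: nat and \<alpha> :: real
 assumes dom: "bounded_holder_domain (m + 2) \<alpha> Om" and \<alpha>: "0 < \<alpha>" "\<alpha> < 1" and \<Phi>: "\<Phi> \<in> holder_space (m + 2) \<alpha> Om"
  and pair: "!!F. F \<in> holder_space (m + 2) \<alpha> Om ==>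
   \<exists>v\<^sub>1\<in>holder_space (m + 2) \<alpha> Om. \<exists>v\<^sub>2\<in>holder_space (m + 2) \<alpha> Om.
    (\<forall>x\<in>frontier Om. v\<^sub>1 x = F x \<and> v\<^sub>2 x = F x \<and> normal_deriv Om v\<^sub>1 x = normal_deriv Om v\<^sub>2 x) \<and>
    (\<forall>x\<in>Om. lin_tr \<Phi> v\<^sub>1 x = b\<^sub>1 x \<bullet> grad v\<^sub>1 x + q\<^sub>1 x * v\<^sub>1 x \<and>
     lin_tr \<Phi> v\<^sub>2 x = b\<^sub>2 x \<bullet> grad v\<^sub>2 x + q\<^sub>2 x * v\<^sub>2 x)"
begin

lemmas opn = E1.opn and bnd = E1.bnd

abbreviation Y where "Y \<equiv> holder_space (m + 2) \<alpha> Om"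

lemma Suc_Y: "f \<in> Y ==> f \<in> holder_space (Suc (Suc m)) \<alpha> Om" by simp

lemma sh: "x \<in> closure Om ==> \<exists>r s \<kappa> \<epsilon>\<^sub>0. shiftable Om x r s \<kappa> \<epsilon>\<^sub>0"
 using dom by (intro shiftable_holder_domain[of "Suc m" \<alpha>]) auto

lemma smooth_Y: "(!!k. Ck_on k UNIV F) ==> F \<in> Y"
 by (rule smooth_in_holder_space[OF _ bnd \<alpha>])

lemma L2_jet_Y: "f \<in> Y ==> L2_on Om (jet f)"
 using holder_space_C2b[of f m \<alpha> Om] L2_jet_C2b[OF opn bnd] by blast

lemma zero_boundary_Y:
 assumes u: "u \<in> Y" "!!x. x \<in> frontier Om ==> u x = 0"
 shows "u \<in> H10 Om" "is_weak_grad Om u (grad u)" "0 < e ==> \<exists>\<xi>\<in>C1c Om. L2sq Om (%x. jet u x - jet \<xi> x) < e"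
proof -
 obtain K where K: "C2b Om K u" using holder_space_C2b[OF u(1)] by blast
 note B = C2b_bounds(2,3)[OF K]
 have c: "continuous_on (closure Om) u" using u(1) by (simp add: holder_space_def)
 show "u \<in> H10 Om" by (rule zero_boundary_H10[OF opn bnd C2b_Ck(1)[OF K] B c u(2)])
 show "is_weak_grad Om u (grad u)" by (rule C1_bounded_weak_grad[OF opn bnd C2b_Ck(1)[OF K] B])
 show "\<exists>\<xi>\<in>C1c Om. L2sq Om (%x. jet u x - jet \<xi> x) < e" if e: "0 < e"
  using zero_boundary_jet_approx[OF opn bnd C2b_Ck(1)[OF K] B c u(2) e] by metis
qed

text \<open>The principal parts cancel, so on jets this is the left side of the integral identity in
  the uniqueness hypothesis.\<close>

definition gap :: "(real^'n => real \<times> (real^'n)) => (real^'n => real \<times> (real^'n)) => real" where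
 "gap P W = E1.form P W - E2.form P W"

text \<open>The gap splits into the pairing of \<open>W\<close> with the Green integrand of u = v1 -
  v2, minus the second form of \<open>u\<close> against \<open>W\<close>. The first vanishes because
  the gradient of \<open>u\<close> tends to 0 at the boundary, the second because \<open>w\<close>
  solves the adjoint equation and \<open>u\<close> lies in \<open>H10\<close>.\<close>

lemma gap_classical:
 assumes w: "adjoint_weak_solution Om (lin_C \<Phi>) b\<^sub>2 q\<^sub>2 w" and v: "v1 \<in> Y" "v2 \<in> Y"
  and fr: "!!x. x \<in> frontier Om ==> v1 x = v2 x" "!!x. x \<in> frontier Om ==> normal_deriv Om v1 x = normal_deriv Om v2 x"
  and pde: "!!x. x \<in> Om ==> lin_tr \<Phi> v1 x = b\<^sub>1 x \<bullet> grad v1 x + q\<^sub>1 x * v1 x"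
   "!!x. x \<in> Om ==> lin_tr \<Phi> v2 x = b\<^sub>2 x \<bullet> grad v2 x + q\<^sub>2 x * v2 x"
 shows "gap (jet v1) (%x. (w x, wgrad Om w x)) = 0"
proof -
 define W where "W = (%x. (w x, wgrad Om w x))"
 define u where "u = (%x. v1 x - v2 x)"
 have u: "u \<in> Y" unfolding u_def by (rule holder_space_diff[OF opn v])
 have u0: "u x = 0" if "x \<in> frontier Om" for x using fr(1)[OF that] by (simp add: u_def)
 have ju: "jet u x = jet v1 x - jet v2 x" if "x \<in> Om" for x unfolding u_def by (rule holder_jet_diff(1)[OF opn v that])
 obtain K\<Phi> where K\<Phi>: "C2b Om K\<Phi> \<Phi>" using holder_space_C2b[OF \<Phi>] by blast
 obtain Ku where Ku: "C2b Om Ku u" using holder_space_C2b[OF u] by blast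
 have gu: "((%x. grad u x) \<longlongrightarrow> 0) (at x0 within Om)" if x0: "x0 \<in> frontier Om" for x0
 proof -
  have "\<bar>normal_deriv Om v1 x0 - normal_deriv Om v2 x0 - 1*normal_deriv Om u x0\<bar> <= 0*(\<Sum>i\<in>UNIV. \<bar>unit_normal Om x0$i\<bar>)"
   by (rule cl_ext_grad_le[OF opn Suc_Y[OF v(1)] Suc_Y[OF v(2)] Suc_Y[OF u] x0]) (use ju in \<open>simp add: jet_def\<close>)
  then have "normal_deriv Om u x0 = 0" using fr(2)[OF x0] by simp
  then have "cl_ext Om (grad u) x0 = 0"
   using zero_Cauchy_data[of "Suc m" \<alpha> Om u x0] dom u u0 x0 by simp
  then show ?thesis using cl_ext_grad_tendsto[OF opn Suc_Y[OF u] x0] by simp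
 qed
 have w1: "w \<in> H1 Om" using w by (simp add: adjoint_weak_solution_def)
 note LW = E1.L2_H1(1)[OF w1, folded W_def]
 have A2: "E2.form (jet u) W = 0"
  unfolding W_def by (rule E2.adjoint_weak_solution_form[OF w zero_boundary_Y(1)[OF u u0] L2_jet_Y[OF u] zero_boundary_Y(2)[OF u u0]
   lin_C_inner_commute[OF opn K\<Phi>]])
 \<comment> \<open>The value component is \<open>lin_tr \<Phi> u\<close> by the two equations and
   the vector component is C grad u, so pairing \<open>Z\<close> with a jet gives the integrand of
   \<open>Green\<close>. Subtracting the second operator applied to \<open>u\<close> leaves the
   difference of the two operators applied to \<open>v1\<close>.\<close>
 define Z where "Z x = (fst (E1.A x (jet v1 x)) - fst (E2.A x (jet v2 x)), snd (E1.A x (jet u x)))" for x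
 note LA = L2_on_fst_snd[OF E1.L2_A(1)[OF L2_jet_Y[OF v(1)]]] L2_on_fst_snd[OF E2.L2_A(1)[OF L2_jet_Y[OF v(2)]]]
  L2_on_fst_snd[OF E1.L2_A(1)[OF L2_jet_Y[OF u]]]
 have LZ: "L2_on Om Z"
  unfolding Z_def by (rule L2_on_jet_iff(1)[THEN iffD2, OF conjI[OF L2_on_diff(1)[OF LA(1,3)] LA(6)]])
 have Z0: "L2_on Om (jet F) \<and> (LINT x|lebesgue_on Om. Z x \<bullet> jet F x) = 0" if F: "!!k. Ck_on k UNIV F" for F
 proof
  note FY = smooth_Y[OF F]
  show "L2_on Om (jet F)" by (rule L2_jet_Y[OF FY])
  obtain KF where KF: "C2b Om KF F" using holder_space_C2b[OF FY] by blast
  have "(LINT x|lebesgue_on Om. Z x \<bullet> jet F x) = (LINT x|lebesgue_on Om. (lin_C \<Phi> x *v grad u x) \<bullet> grad F x + lin_tr \<Phi> u x*F x)"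
  proof (rule Bochner_Integration.integral_cong[OF refl])
   fix x assume "x \<in> space (lebesgue_on Om)"
   then have x: "x \<in> Om" by simp
   have "lin_tr \<Phi> u x = lin_tr \<Phi> v1 x - lin_tr \<Phi> v2 x" unfolding u_def by (rule holder_jet_diff(2)[OF opn v x])
   then show "Z x \<bullet> jet F x = (lin_C \<Phi> x *v grad u x) \<bullet> grad F x + lin_tr \<Phi> u x*F x"
    by (simp add: Z_def E1.A_def E2.A_def jet_def pde[OF x])
  qed
  also have "\<dots> = 0"
  proof (rule Green[OF opn bnd K\<Phi> Ku C2b_Ck(1)[OF KF] C2b_bounds(2,3)[OF KF]])
   fix x0 i assume x0: "x0 \<in> frontier Om"
   have "isCont F x0" using Ck_on_imp_continuous_on[OF F[of 0]] by (simp add: continuous_on_eq_continuous_at)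
   then have "(F \<longlongrightarrow> F x0) (at x0 within Om)" by (simp add: continuous_at_imp_continuous_at_within continuous_within[symmetric])
   from tendsto_mult[OF this tendsto_vec_nth[OF gu[OF x0], of i]]
   show "((%x. F x*grad u x$i) \<longlongrightarrow> 0) (at x0 within Om)" by simp
  qed
  finally show "(LINT x|lebesgue_on Om. Z x \<bullet> jet F x) = 0" .
 qed
 have ZW: "(LINT x|lebesgue_on Om. Z x \<bullet> W x) = 0"
  unfolding W_def by (rule L2_orthogonal_smooth[OF opn bnd sh LZ Z0 E1.L2_H1(2)[OF w1] wgrad_is_weak_grad[OF w1]])
 have "gap (jet v1) W = (LINT x|lebesgue_on Om. E1.A x (jet v1 x) \<bullet> W x - E2.A x (jet v1 x) \<bullet> W x)"
  unfolding gap_def E1.form_def E2.form_def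
  by (rule Bochner_Integration.integral_diff[symmetric])
   (intro L2_on_inner_integrable[OF _ LW] E1.L2_A(1) E2.L2_A(1) L2_jet_Y[OF v(1)])+
 also have "\<dots> = (LINT x|lebesgue_on Om. Z x \<bullet> W x - E2.A x (jet u x) \<bullet> W x)"
 proof (rule Bochner_Integration.integral_cong[OF refl])
  fix x assume "x \<in> space (lebesgue_on Om)"
  then have "E2.A x (jet u x) = E2.A x (jet v1 x) - E2.A x (jet v2 x)" using ju by (simp add: E2.A_diff)
  then have "Z x - E2.A x (jet u x) = E1.A x (jet v1 x) - E2.A x (jet v1 x)"
   by (simp add: Z_def E1.A_def E2.A_def prod_eq_iff)
  then show "E1.A x (jet v1 x) \<bullet> W x - E2.A x (jet v1 x) \<bullet> W x = Z x \<bullet> W x - E2.A x (jet u x) \<bullet> W x"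
   unfolding inner_diff_left[symmetric] by simp
 qed
 also have "\<dots> = (LINT x|lebesgue_on Om. Z x \<bullet> W x) - E2.form (jet u) W"
  unfolding E2.form_def by (rule Bochner_Integration.integral_diff)
   (intro L2_on_inner_integrable[OF _ LW] LZ E2.L2_A(1) L2_jet_Y[OF u])+
 finally show ?thesis using ZW A2 by (simp add: W_def)
qed

text \<open>The smooth \<open>F\<close> close to \<open>v\<close> supplies the boundary values. The
  multiple of \<open>e\<close> does not depend on \<open>v\<close>, so letting \<open>e\<close> tend
  to 0 reaches every weak solution.\<close>

lemma classical_approx:
 assumes v: "weak_solution Om (lin_C \<Phi>) b\<^sub>1 q\<^sub>1 v" and e: "0 < e"
 shows "\<exists>v1\<in>Y. \<exists>v2\<in>Y. L2sq Om (%x. jet v1 x - (v x, wgrad Om v x)) <= (8 + 2*(18*N\<^sub>1*E1.K4)^2)*e \<and>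
  (\<forall>x\<in>frontier Om. v1 x = v2 x \<and> normal_deriv Om v1 x = normal_deriv Om v2 x) \<and>
  (\<forall>x\<in>Om. lin_tr \<Phi> v1 x = b\<^sub>1 x \<bullet> grad v1 x + q\<^sub>1 x * v1 x \<and> lin_tr \<Phi> v2 x = b\<^sub>2 x \<bullet> grad v2 x + q\<^sub>2 x * v2 x)"
proof -
 have v1: "v \<in> H1 Om" using v by (simp add: weak_solution_def)
 obtain F where F: "!!k. Ck_on k UNIV F" "L2sq Om (%x. jet F x - (v x, wgrad Om v x)) <= e"
  using smooth_dense_H1[OF opn bnd sh E1.L2_H1(2)[OF v1] wgrad_is_weak_grad[OF v1] e] by metis
 note FY = smooth_Y[OF F(1)]
 obtain v1 v2 where Y: "v1 \<in> Y" "v2 \<in> Y"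
  and fr: "\<forall>x\<in>frontier Om. v1 x = F x \<and> v2 x = F x \<and> normal_deriv Om v1 x = normal_deriv Om v2 x"
  and pde: "\<forall>x\<in>Om. lin_tr \<Phi> v1 x = b\<^sub>1 x \<bullet> grad v1 x + q\<^sub>1 x * v1 x \<and> lin_tr \<Phi> v2 x = b\<^sub>2 x \<bullet> grad v2 x + q\<^sub>2 x * v2 x"
  using pair[OF FY] by (elim bexE conjE)
 have \<theta>: "(%x. v1 x - F x) \<in> Y" by (rule holder_space_diff[OF opn Y(1) FY])
 have "\<exists>\<xi>\<in>C1c Om. L2sq Om (%x. jet (%x. v1 x - F x) x - jet \<xi> x) < e"
  by (rule zero_boundary_Y(3)[OF \<theta> _ e]) (use fr in simp)
 then obtain \<xi> where \<xi>: "\<xi> \<in> C1c Om" "L2sq Om (%x. jet (%x. v1 x - F x) x - jet \<xi> x) < e" by (elim bexE)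
 have "L2sq Om (%x. jet (%x. v1 x - F x) x - jet \<xi> x) = L2sq Om (%x. jet v1 x - jet F x - jet \<xi> x)"
  by (rule L2sq_cong) (simp add: holder_jet_diff(1)[OF opn Y(1) FY])
 then have \<xi>2: "L2sq Om (%x. jet v1 x - jet F x - jet \<xi> x) <= e" using \<xi>(2) by simp
 obtain K\<Phi> where K\<Phi>: "C2b Om K\<Phi> \<Phi>" using holder_space_C2b[OF \<Phi>] by blast
 obtain K1 where K1: "C2b Om K1 v1" using holder_space_C2b[OF Y(1)] by blast
 have "L2sq Om (%x. jet v1 x - (v x, wgrad Om v x)) <= (8 + 2*(18*N\<^sub>1*E1.K4)^2)*e"
 proof (rule E1.weak_solution_approx[OF E1.L2_H1(1)[OF v1] _ L2_jet_Y[OF Y(1)] _ L2_jet_Y[OF FY] F(2) e \<xi>(1) \<xi>2])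
  fix \<rho> assume \<rho>: "\<rho> \<in> C1c Om"
  show "E1.form (%x. (v x, wgrad Om v x)) (jet \<rho>) = 0"
   by (rule E1.weak_solution_form[OF v C1c_H10(1)[OF opn bnd \<rho>] E1.C1c_jet_L2[OF \<rho>] C1c_H10(2)[OF opn bnd \<rho>]])
  have "E1.form (jet v1) (jet \<rho>) = (LINT x|lebesgue_on Om. (lin_C \<Phi> x *v grad v1 x) \<bullet> grad \<rho> x + lin_tr \<Phi> v1 x*\<rho> x)"
   unfolding E1.form_def by (rule Bochner_Integration.integral_cong[OF refl]) (use pde in \<open>simp add: E1.A_def jet_def\<close>)
  then show "E1.form (jet v1) (jet \<rho>) = 0" using Green_C1c[OF opn bnd K\<Phi> K1 \<rho>] by simp
 qed
 then show ?thesis using Y fr pde by (intro bexI[OF _ Y(1)] bexI[OF _ Y(2)] conjI) auto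
qed

lemma gap_weak:
 assumes v: "weak_solution Om (lin_C \<Phi>) b\<^sub>1 q\<^sub>1 v" and w: "adjoint_weak_solution Om (lin_C \<Phi>) b\<^sub>2 q\<^sub>2 w"
 shows "gap (%x. (v x, wgrad Om v x)) (%x. (w x, wgrad Om w x)) = 0"
proof -
 define V where "V = (%x. (v x, wgrad Om v x))"
 define W where "W = (%x. (w x, wgrad Om w x))"
 have LV: "L2_on Om V" unfolding V_def using v by (intro E1.L2_H1) (simp add: weak_solution_def)
 have LW: "L2_on Om W" unfolding W_def using w by (intro E1.L2_H1) (simp add: adjoint_weak_solution_def)
 define M where "M = (3*N\<^sub>1 + 3*N\<^sub>2) * sqrt (L2sq Om W)"
 define D where "D = 8 + 2*(18*N\<^sub>1*E1.K4)^2"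
 have M: "0 <= M" using E1.N_nonneg E2.N_nonneg by (simp add: M_def)
 have "\<bar>gap V W\<bar> <= 0"
 proof (rule le_zero_if_le_sqrt)
  fix e :: real assume e: "0 < e"
  obtain v1 v2 where Y: "v1 \<in> Y" "v2 \<in> Y" and le0: "L2sq Om (%x. jet v1 x - (v x, wgrad Om v x)) <= D*e"
   and fr: "\<forall>x\<in>frontier Om. v1 x = v2 x \<and> normal_deriv Om v1 x = normal_deriv Om v2 x"
   and pde: "\<forall>x\<in>Om. lin_tr \<Phi> v1 x = b\<^sub>1 x \<bullet> grad v1 x + q\<^sub>1 x * v1 x \<and> lin_tr \<Phi> v2 x = b\<^sub>2 x \<bullet> grad v2 x + q\<^sub>2 x * v2 x"
   using classical_approx[OF v e, folded D_def] by (elim bexE conjE)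
  have le: "L2sq Om (%x. jet v1 x - V x) <= D*e" using le0 by (simp add: V_def)
  note LJ = L2_jet_Y[OF Y(1)]
  note LD = L2_on_diff(1)[OF LJ LV]
  have "gap (jet v1) W = 0" unfolding W_def by (rule gap_classical[OF w Y]) (use fr pde in auto)
  moreover have "(%x. (- 1) *\<^sub>R V x + jet v1 x) = (%x. jet v1 x - V x)" by (rule ext) simp
  ultimately have "gap V W = - gap (%x. jet v1 x - V x) W"
   using E1.form_lin(1)[OF LV LJ LW, of "- 1"] E2.form_lin(1)[OF LV LJ LW, of "- 1"] by (simp add: gap_def)
  then have "\<bar>gap V W\<bar> <= \<bar>E1.form (%x. jet v1 x - V x) W\<bar> + \<bar>E2.form (%x. jet v1 x - V x) W\<bar>" by (simp add: gap_def)
  also have "\<dots> <= 3*N\<^sub>1 * sqrt (L2sq Om (%x. jet v1 x - V x)) * sqrt (L2sq Om W) +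
    3*N\<^sub>2 * sqrt (L2sq Om (%x. jet v1 x - V x)) * sqrt (L2sq Om W)"
   by (rule add_mono[OF E1.form_le[OF LD LW] E2.form_le[OF LD LW]])
  also have "\<dots> = M * sqrt (L2sq Om (%x. jet v1 x - V x))" by (simp add: M_def algebra_simps)
  also have "\<dots> <= M * sqrt (D*e)" using le M by (intro mult_left_mono) auto
  also have "\<dots> = (M * sqrt D) * sqrt e" by (simp add: real_sqrt_mult)
  finally show "\<bar>gap V W\<bar> <= (M * sqrt D) * sqrt e" .
 qed
 then show ?thesis by (simp add: V_def W_def)
qed

lemma integral_identity:
 assumes v: "weak_solution Om (lin_C \<Phi>) b\<^sub>1 q\<^sub>1 v" and w: "adjoint_weak_solution Om (lin_C \<Phi>) b\<^sub>2 q\<^sub>2 w"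
 shows "(LINT x|lebesgue_on Om. ((b\<^sub>1 x - b\<^sub>2 x) \<bullet> wgrad Om v x)*w x) + (LINT x|lebesgue_on Om. (q\<^sub>1 x - q\<^sub>2 x) * v x*w x) = 0"
proof -
 define W where "W = (%x. (w x, wgrad Om w x))"
 have v1: "v \<in> H1 Om" using v by (simp add: weak_solution_def)
 have w1: "w \<in> H1 Om" using w by (simp add: adjoint_weak_solution_def)
 note LW = E1.L2_H1(1)[OF w1, folded W_def]
 have L0: "L2_on Om (%x. 0 :: 'c::euclidean_space)" by (simp add: L2_on_def)
 \<comment> \<open>The identity is a sum of two integrals, so the jet is split into its gradient and
   its value; each part alone is square integrable, though in general neither is the jet of a
   function.\<close>
 have Lg: "L2_on Om (%x. (0 :: real, wgrad Om v x))" and Lv: "L2_on Om (%x. (v x, 0 :: real^'n))"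
  using E1.L2_H1[OF v1] by (simp_all add: L2_on_jet_iff L0)
 have G: "gap P W = (LINT x|lebesgue_on Om. E1.A x (P x) \<bullet> W x - E2.A x (P x) \<bullet> W x)" if P: "L2_on Om P" for P
  unfolding gap_def E1.form_def E2.form_def
  by (rule Bochner_Integration.integral_diff[symmetric]) (intro L2_on_inner_integrable[OF _ LW] E1.L2_A(1) E2.L2_A(1) P)+
 have "gap (%x. (0, wgrad Om v x)) W = (LINT x|lebesgue_on Om. ((b\<^sub>1 x - b\<^sub>2 x) \<bullet> wgrad Om v x)*w x)"
  unfolding G[OF Lg] by (simp add: E1.A_def E2.A_def W_def inner_diff_left left_diff_distrib)
 moreover have "gap (%x. (v x, 0)) W = (LINT x|lebesgue_on Om. (q\<^sub>1 x - q\<^sub>2 x) * v x*w x)"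
  unfolding G[OF Lv] by (simp add: E1.A_def E2.A_def W_def left_diff_distrib)
 moreover have "gap (%x. (v x, wgrad Om v x)) W = gap (%x. (0, wgrad Om v x)) W + gap (%x. (v x, 0)) W"
  using E1.form_lin(1)[OF Lg Lv LW, of 1] E2.form_lin(1)[OF Lg Lv LW, of 1] by (simp add: gap_def)
 ultimately show ?thesis using gap_weak[OF v w] by (simp add: W_def)
qed

end

theorem theorem7p4:
  fixes \<Omega> :: "(real ^ 'n) set" and m :: nat and \<alpha> c\<^sub>0 \<delta>\<^sub>1 \<delta>\<^sub>2 :: real
    and a\<^sub>1 a\<^sub>2 :: "(real ^ 'n) \<times> real \<times> (real ^ 'n) \<Rightarrow> real"
    and \<phi> \<Phi> :: "real ^ 'n \<Rightarrow> real"
    and V\<^sub>1 V\<^sub>2 :: "(real ^ 'n \<Rightarrow> real) set"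
  assumes alpha: "0 < \<alpha>" "\<alpha> < 1"
    and domain: "bounded_holder_domain (m + 2) \<alpha> \<Omega>"
    and a_regular: "a\<^sub>1 \<in> holder_space (2 * m + 1) \<alpha> (\<Omega> \<times> UNIV \<times> UNIV)"
      "a\<^sub>2 \<in> holder_space (2 * m + 1) \<alpha> (\<Omega> \<times> UNIV \<times> UNIV)"
    and a_pos: "\<And>x z p. x \<in> closure \<Omega> \<Longrightarrow> 0 < a\<^sub>1 (x, z, p)"
      "\<And>x z p. x \<in> closure \<Omega> \<Longrightarrow> 0 < a\<^sub>2 (x, z, p)"
    and phi: "\<phi> \<in> bdry_holder_space (m + 2) \<alpha> \<Omega>"
    and Phi: "\<Phi> \<in> holder_space (m + 2) \<alpha> \<Omega>"
    and Phi_convex: "strictly_convex_in \<Omega> \<Phi>"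
    and c0: "0 < c\<^sub>0"
      "\<And>x \<xi>. x \<in> closure \<Omega> \<Longrightarrow> c\<^sub>0 * (norm \<xi>)\<^sup>2 \<le> \<xi> \<bullet> (cl_ext \<Omega> (hess \<Phi>) x *v \<xi>)"
    and Phi_sol: "MA_solution \<Omega> a\<^sub>1 \<phi> \<Phi>" "MA_solution \<Omega> a\<^sub>2 \<phi> \<Phi>"
    and a_bdry: "\<And>x. x \<in> frontier \<Omega> \<Longrightarrow>
      a\<^sub>1 (x, \<phi> x, cl_ext \<Omega> (grad \<Phi>) x) = a\<^sub>2 (x, \<phi> x, cl_ext \<Omega> (grad \<Phi>) x)"
    and q_nonneg: "\<And>x. x \<in> \<Omega> \<Longrightarrow> 0 \<le> lin_q a\<^sub>1 \<Phi> x" "\<And>x. x \<in> \<Omega> \<Longrightarrow> 0 \<le> lin_q a\<^sub>2 \<Phi> x"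
    and linear_uniqueness:
      "(\<forall>v w. weak_solution \<Omega> (lin_C \<Phi>) (lin_b a\<^sub>1 \<Phi>) (lin_q a\<^sub>1 \<Phi>) v \<and>
          adjoint_weak_solution \<Omega> (lin_C \<Phi>) (lin_b a\<^sub>2 \<Phi>) (lin_q a\<^sub>2 \<Phi>) w \<longrightarrow>
          (LINT x|lebesgue_on \<Omega>. ((lin_b a\<^sub>1 \<Phi> x - lin_b a\<^sub>2 \<Phi> x) \<bullet> wgrad \<Omega> v x) * w x) +
          (LINT x|lebesgue_on \<Omega>. (lin_q a\<^sub>1 \<Phi> x - lin_q a\<^sub>2 \<Phi> x) * v x * w x) = 0)
       \<Longrightarrow> (\<forall>x\<in>\<Omega>. lin_b a\<^sub>1 \<Phi> x = lin_b a\<^sub>2 \<Phi> x \<and> lin_q a\<^sub>1 \<Phi> x = lin_q a\<^sub>2 \<Phi> x)"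
    and well_posed: "local_well_posedness \<Omega> m \<alpha> a\<^sub>1 \<phi> \<Phi> \<delta>\<^sub>1 V\<^sub>1"
      "local_well_posedness \<Omega> m \<alpha> a\<^sub>2 \<phi> \<Phi> \<delta>\<^sub>2 V\<^sub>2"
    and same_data: "cauchy_data \<Omega> m \<alpha> a\<^sub>1 \<phi> \<delta>\<^sub>1 V\<^sub>1 = cauchy_data \<Omega> m \<alpha> a\<^sub>2 \<phi> \<delta>\<^sub>2 V\<^sub>2"
  shows "\<forall>x\<in>\<Omega>. dp a\<^sub>1 x (\<Phi> x) (grad \<Phi> x) = dp a\<^sub>2 x (\<Phi> x) (grad \<Phi> x) \<and>
               dz a\<^sub>1 x (\<Phi> x) (grad \<Phi> x) = dz a\<^sub>2 x (\<Phi> x) (grad \<Phi> x)"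
proof -
 have \<Omega>: "open \<Omega>" "bounded \<Omega>" "\<Omega> ~= {}" using domain by (auto simp: bounded_holder_domain_def)
 have a: "a\<^sub>1 \<in> holder_space (Suc (2*m)) \<alpha> (\<Omega> \<times> UNIV \<times> UNIV)" "a\<^sub>2 \<in> holder_space (Suc (2*m)) \<alpha> (\<Omega> \<times> UNIV \<times> UNIV)"
  using a_regular by simp_all
 have \<Phi>1: "Ck_on (Suc 0) \<Omega> \<Phi>" by (rule holder_space_Ck[OF Phi]) simp
 have "\<exists>N lam \<psi> g K c. elliptic_super \<Omega> (lin_C \<Phi>) (lin_b a\<^sub>1 \<Phi>) (lin_q a\<^sub>1 \<Phi>) N lam \<psi> g K c"
  by (rule elliptic_super_linearised[OF \<Omega> a(1) a_pos(1) Phi Phi_sol(1) c0 q_nonneg(1)])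
 then obtain N1 lam1 \<psi>1 g1 K1 c1 where E1: "elliptic_super \<Omega> (lin_C \<Phi>) (lin_b a\<^sub>1 \<Phi>) (lin_q a\<^sub>1 \<Phi>) N1 lam1 \<psi>1 g1 K1 c1"
  by (elim exE)
 have "\<exists>N lam \<psi> g K c. elliptic_super \<Omega> (lin_C \<Phi>) (lin_b a\<^sub>2 \<Phi>) (lin_q a\<^sub>2 \<Phi>) N lam \<psi> g K c"
  by (rule elliptic_super_linearised[OF \<Omega> a(2) a_pos(2) Phi Phi_sol(2) c0 q_nonneg(2)])
 then obtain N2 lam2 \<psi>2 g2 K2 c2 where E2: "elliptic_super \<Omega> (lin_C \<Phi>) (lin_b a\<^sub>2 \<Phi>) (lin_q a\<^sub>2 \<Phi>) N2 lam2 \<psi>2 g2 K2 c2"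
  by (elim exE)
 interpret linearised_pair \<Omega> \<Phi> "lin_b a\<^sub>1 \<Phi>" "lin_q a\<^sub>1 \<Phi>" N1 lam1 \<psi>1 g1 K1 c1 "lin_b a\<^sub>2 \<Phi>" "lin_q a\<^sub>2 \<Phi>" N2 lam2 m \<alpha>
 proof (rule linearised_pair.intro[OF E1 elliptic_super.axioms(1)[OF E2]], unfold_locales)
  fix F assume F: "F \<in> holder_space (m + 2) \<alpha> \<Omega>"
  from linearised_pair_exists[OF \<Omega>(1,3) phi F Phi Phi_sol well_posed nonlinearity_partials(1)[OF a(1) \<Phi>1]
    nonlinearity_partials(1)[OF a(2) \<Phi>1] same_data]
  show "\<exists>v\<^sub>1\<in>holder_space (m + 2) \<alpha> \<Omega>. \<exists>v\<^sub>2\<in>holder_space (m + 2) \<alpha> \<Omega>.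
    (\<forall>x\<in>frontier \<Omega>. v\<^sub>1 x = F x \<and> v\<^sub>2 x = F x \<and> normal_deriv \<Omega> v\<^sub>1 x = normal_deriv \<Omega> v\<^sub>2 x) \<and>
    (\<forall>x\<in>\<Omega>. lin_tr \<Phi> v\<^sub>1 x = lin_b a\<^sub>1 \<Phi> x \<bullet> grad v\<^sub>1 x + lin_q a\<^sub>1 \<Phi> x * v\<^sub>1 x \<and>
     lin_tr \<Phi> v\<^sub>2 x = lin_b a\<^sub>2 \<Phi> x \<bullet> grad v\<^sub>2 x + lin_q a\<^sub>2 \<Phi> x * v\<^sub>2 x)" .
 qed (fact domain alpha Phi)+
 have "\<forall>x\<in>\<Omega>. lin_b a\<^sub>1 \<Phi> x = lin_b a\<^sub>2 \<Phi> x \<and> lin_q a\<^sub>1 \<Phi> x = lin_q a\<^sub>2 \<Phi> x"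
  by (rule linear_uniqueness) (use integral_identity in blast)
 then show ?thesis by (simp add: lin_b_def lin_q_def)
qed

end
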